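(* Let $\sigma_1,\sigma_2,\sigma_3>0$ and $c\in\mathbb R^d$. Let $\omega_3=\omega_1+\omega_2$. Assume that one of the following conditions holds: (A) $1\le d\le 5$ and $(\omega_1,\omega_2)\in\Omega_c$. (B) $3\le d\le 5$, $(\omega_1,\omega_2)\in\partial\Omega_c$, and $(\omega_i,\omega_j)\ne(\frac{\sigma_i}{4}|c|^2,\frac{\sigma_j}{4}|c|^2)$ for any $1\le i<j\le 3$. (C) $d=5$, $c\ne0$, $(\omega_1,\omega_2)\in\partial\Omega_c$, $(\omega_i,\omega_j)=(\frac{\sigma_i}{4}|c|^2,\frac{\sigma_j}{4}|c|^2)$ for some $1\le i<j\le3$, and $(\omega_1,\omega_2,\omega_3)\ne(\frac{\sigma_1}{4}|c|^2,\frac{\sigma_2}{4}|c|^2,\frac{\sigma_3}{4}|c|^2)$. Then $\widetilde{\mathcal G}_{\omega_1,\omega_2,c}=\widetilde{\mathcal M}_{\omega_1,\omega_2,c}\neq\emptyset$ (and also $\mathcal G_{\omega_1,\omega_2,c}=\mathcal M_{\omega_1,\omega_2,c}\ne\emptyset$). That is, there exists at least one ground state solution.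
   Context: All functions are complex-valued on $\mathbb R^d$; $(f,g)_{L^2}=\int f\overline g\,dx$. Put $F_1(U)=-\overline{u_2}u_3$, $F_2(U)=-\overline{u_1}u_3$, $F_3(U)=-u_1u_2$ for $U=(u_1,u_2,u_3)$. $\Omega_c=\{(\omega_1,\omega_2)\in\mathbb R^2:\ \omega_1>\frac{\sigma_1}{4}|c|^2,\ \omega_2>\frac{\sigma_2}{4}|c|^2,\ \omega_1+\omega_2>\frac{\sigma_3}{4}|c|^2\}$, with boundary $\partial\Omega_c$. Put $\omega_3=\omega_1+\omega_2$ and $\gamma_j=\omega_j-\frac{\sigma_j}{4}|c|^2$ ($\ge 0$ here). Spaces: $\widetilde X_{\omega_1,\omega_2,c}=\widetilde X_1\times\widetilde X_2\times\widetilde X_3$ with $\widetilde X_j=H^1(\mathbb R^d)$ if $\gamma_j>0$ and $\widetilde X_j=\dot H^1(\mathbb R^d)$ if $\gamma_j=0$ (the homogeneous Sobolev space; it only occurs for $d\ge3$, realized as functions in $L^{2d/(d-2)}$ with gradient in $L^2$), and norm $\|\Psi\|_{\widetilde X_{\omega_1,\omega_2,c}}^2=\sum_{j=1}^3\big(\frac1{\sigma_j}\|\nabla\psi_j\|_{L^2}^2+\gamma_j\|\psi_j\|_{L^2}^2\big)$ (a term with $\gamma_j=0$ is absent). With $(\Lambda_c\Psi)(x)=(e^{i\frac{\sigma_1}{2}c\cdot x}\psi_1,e^{i\frac{\sigma_2}{2}c\cdot x}\psi_2,e^{i\frac{\sigma_3}{2}c\cdot x}\psi_3)$, put $X_{\omega_1,\omega_2,c}=\Lambda_c\widetilde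 X_{\omega_1,\omega_2,c}$, $\|\Phi\|_{X_{\omega_1,\omega_2,c}}=\|\Lambda_{-c}\Phi\|_{\widetilde X_{\omega_1,\omega_2,c}}$. Functionals: $N_c(\Psi)=-\mathrm{Re}(e^{i\frac{\sigma_1+\sigma_2-\sigma_3}{2}c\cdot x}\psi_1\psi_2,\psi_3)_{L^2}$, $\widetilde S_{\omega_1,\omega_2,c}(\Psi)=\frac12\|\Psi\|^2_{\widetilde X_{\omega_1,\omega_2,c}}+N_c(\Psi)$, $\widetilde K_{\omega_1,\omega_2,c}(\Psi)=\|\Psi\|^2_{\widetilde X_{\omega_1,\omega_2,c}}+3N_c(\Psi)$; and $S_{\omega_1,\omega_2,c}(\Phi)=\widetilde S_{\omega_1,\omega_2,c}(\Lambda_{-c}\Phi)$, $K_{\omega_1,\omega_2,c}(\Phi)=\widetilde K_{\omega_1,\omega_2,c}(\Lambda_{-c}\Phi)$ for $\Phi\in X_{\omega_1,\omega_2,c}$. Weak solutions: $\Psi\in\widetilde X_{\omega_1,\omega_2,c}$ is a weak solution of $-\frac1{\sigma_j}\Delta\psi_j+\gamma_j\psi_j=-G_{j,c}(\Psi)$ ($j=1,2,3$), where $G_{j,c}(\Psi)=e^{-i\frac{\sigma_j}{2}c\cdot x}F_j(\Lambda_c\Psi)$, written $\widetilde S'_{\omega_1,\omega_2,c}(\Psi)=0$, if $\frac1{\sigma_j}(\nabla\psi_j,\nabla\theta_j)_{L^2}+(\gamma_j\psi_j+G_{j,c}(\Psi),\theta_j)_{L^2}=0$ for all $\Theta\in\widetilde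 X_{\omega_1,\omega_2,c}$, $j=1,2,3$. Likewise $\Phi\in X_{\omega_1,\omega_2,c}$ is a weak solution of $-\frac1{\sigma_j}\Delta\varphi_j+\omega_j\varphi_j+i(c\cdot\nabla)\varphi_j=-F_j(\Phi)$, written $S'_{\omega_1,\omega_2,c}(\Phi)=0$, if $\frac1{\sigma_j}(\nabla(e^{-i\frac{\sigma_j}2c\cdot x}\varphi_j),\nabla(e^{-i\frac{\sigma_j}2c\cdot x}\theta_j))_{L^2}+(\gamma_j\varphi_j+F_j(\Phi),\theta_j)_{L^2}=0$ for all $\Theta\in X_{\omega_1,\omega_2,c}$, $j=1,2,3$. Sets: $\widetilde{\mathcal E}_{\omega_1,\omega_2,c}=\{\Psi\in\widetilde X_{\omega_1,\omega_2,c}:\Psi\ne0,\ \widetilde S'_{\omega_1,\omega_2,c}(\Psi)=0\}$; the set of ground states is $\widetilde{\mathcal G}_{\omega_1,\omega_2,c}=\{\Psi\in\widetilde{\mathcal E}_{\omega_1,\omega_2,c}:\widetilde S_{\omega_1,\omega_2,c}(\Psi)\le\widetilde S_{\omega_1,\omega_2,c}(\Theta)\ \forall\Theta\in\widetilde{\mathcal E}_{\omega_1,\omega_2,c}\}$; $\widetilde{\mathfrak m}_{\omega_1,\omega_2,c}=\inf\{\widetilde S_{\omega_1,\omega_2,c}(\Psi):\Psi\in\widetilde X_{\omega_1,\omega_2,c},\Psi\ne0,\widetilde K_{\omega_1,\omega_2,c}(\Psi)=0\}$; $\widetilde{\mathcal M}_{\omega_1,\omega_2,c}=\{\Psi\in\widetilde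 X_{\omega_1,\omega_2,c}:\Psi\ne0,\widetilde S_{\omega_1,\omega_2,c}(\Psi)=\widetilde{\mathfrak m}_{\omega_1,\omega_2,c},\widetilde K_{\omega_1,\omega_2,c}(\Psi)=0\}$. The sets $\mathcal G_{\omega_1,\omega_2,c}$, $\mathcal M_{\omega_1,\omega_2,c}$ are defined identically without tildes (using $X_{\omega_1,\omega_2,c},S_{\omega_1,\omega_2,c},K_{\omega_1,\omega_2,c}$). *)

theory Defs
  imports "HOL-Analysis.Analysis"
begin

text \<open>
  Elements of the function spaces below are Borel measurable representatives, not classes modulo
  almost everywhere equality. All spaces and solution sets are closed under changing a function
  to another Borel function on a null set, and \<open>\<Psi> \<noteq> 0\<close> is read as ``not almost everywhere zero''.
  Triples are indexed by the three-element type \<open>3\<close>, in which \<open>3 = 0\<close>; its elements are \<open>1, 2, 3\<close>.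
\<close>

definition partial_deriv :: "'d::finite \<Rightarrow> (real^'d \<Rightarrow> complex) \<Rightarrow> real^'d \<Rightarrow> complex" where
  "partial_deriv k f x = frechet_derivative f (at x) (axis k 1)"

primrec C_k :: "nat \<Rightarrow> (real^'d::finite \<Rightarrow> complex) \<Rightarrow> bool" where
  "C_k 0 f \<longleftrightarrow> continuous_on UNIV f"
| "C_k (Suc n) f \<longleftrightarrow> (\<forall>x. f differentiable (at x)) \<and> (\<forall>k. C_k n (partial_deriv k f))"

definition test_functions :: "(real^'d::finite \<Rightarrow> complex) set" where
  "test_functions = {f. (\<forall>n. C_k n f) \<and> (\<exists>K. compact K \<and> (\<forall>x. x \<notin> K \<longrightarrow> f x = 0))}"

definition locally_integrable :: "(real^'d::finite \<Rightarrow> complex) \<Rightarrow> bool" where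
  "locally_integrable f \<longleftrightarrow> (\<forall>K. compact K \<longrightarrow> set_integrable lborel K f)"

definition has_weak_grad :: "(real^'d::finite \<Rightarrow> complex) \<Rightarrow> (real^'d \<Rightarrow> complex^'d) \<Rightarrow> bool" where
  "has_weak_grad f D \<longleftrightarrow> locally_integrable f \<and>
     (\<forall>k. locally_integrable (\<lambda>x. D x $ k) \<and>
       (\<forall>\<phi>\<in>test_functions.
          (\<integral>x. f x * partial_deriv k \<phi> x \<partial>lborel) = - (\<integral>x. D x $ k * \<phi> x \<partial>lborel)))"

text \<open>The weak gradient is unique only up to null sets; it is used below only under integrals.\<close>

definition weak_grad :: "(real^'d::finite \<Rightarrow> complex) \<Rightarrow> real^'d \<Rightarrow> complex^'d" where
  "weak_grad f = (SOME D. has_weak_grad f D)"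

definition Lp :: "real \<Rightarrow> (real^'d::finite \<Rightarrow> complex) set" where
  "Lp p = {f \<in> borel_measurable lborel. integrable lborel (\<lambda>x. cmod (f x) powr p)}"

definition grad_in_L2 :: "(real^'d::finite \<Rightarrow> complex) \<Rightarrow> bool" where
  "grad_in_L2 f \<longleftrightarrow> (\<exists>D. has_weak_grad f D \<and> (\<forall>k. (\<lambda>x. D x $ k) \<in> Lp 2))"

definition H1 :: "(real^'d::finite \<Rightarrow> complex) set" where
  "H1 = {f \<in> Lp 2. grad_in_L2 f}"

text \<open>Only meaningful for dimension at least 3.\<close>

definition H1_hom :: "(real^'d::finite \<Rightarrow> complex) set" where
  "H1_hom = {f \<in> Lp (2 * real CARD('d) / (real CARD('d) - 2)). grad_in_L2 f}"

definition L2_inner :: "(real^'d::finite \<Rightarrow> complex) \<Rightarrow> (real^'d \<Rightarrow> complex) \<Rightarrow> complex" where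
  "L2_inner f g = (\<integral>x. f x * cnj (g x) \<partial>lborel)"

definition L2_normsq :: "(real^'d::finite \<Rightarrow> complex) \<Rightarrow> real" where
  "L2_normsq f = (\<integral>x. (cmod (f x))\<^sup>2 \<partial>lborel)"

definition grad_inner :: "(real^'d::finite \<Rightarrow> complex) \<Rightarrow> (real^'d \<Rightarrow> complex) \<Rightarrow> complex" where
  "grad_inner f g = (\<Sum>k\<in>UNIV. L2_inner (\<lambda>x. weak_grad f x $ k) (\<lambda>x. weak_grad g x $ k))"

definition grad_normsq :: "(real^'d::finite \<Rightarrow> complex) \<Rightarrow> real" where
  "grad_normsq f = (\<Sum>k\<in>UNIV. L2_normsq (\<lambda>x. weak_grad f x $ k))"

definition freq :: "real \<times> real \<Rightarrow> real^3" where
  "freq \<omega> = vector [fst \<omega>, snd \<omega>, fst \<omega> + snd \<omega>]"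

definition crit :: "real^3 \<Rightarrow> real^'d::finite \<Rightarrow> real^3" where
  "crit \<sigma> c = (\<chi> j. \<sigma> $ j / 4 * (norm c)\<^sup>2)"

definition gam :: "real^3 \<Rightarrow> real^'d::finite \<Rightarrow> real \<times> real \<Rightarrow> 3 \<Rightarrow> real" where
  "gam \<sigma> c \<omega> j = freq \<omega> $ j - crit \<sigma> c $ j"

definition Omega :: "real^3 \<Rightarrow> real^'d::finite \<Rightarrow> (real \<times> real) set" where
  "Omega \<sigma> c = {(\<omega>\<^sub>1, \<omega>\<^sub>2). \<omega>\<^sub>1 > \<sigma> $ 1 / 4 * (norm c)\<^sup>2 \<and> \<omega>\<^sub>2 > \<sigma> $ 2 / 4 * (norm c)\<^sup>2 \<and>
     \<omega>\<^sub>1 + \<omega>\<^sub>2 > \<sigma> $ 3 / 4 * (norm c)\<^sup>2}"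

definition F :: "complex^3 \<Rightarrow> complex^3" where
  "F U = vector [- (cnj (U $ 2) * U $ 3), - (cnj (U $ 1) * U $ 3), - (U $ 1 * U $ 2)]"

definition Lam :: "real^3 \<Rightarrow> real^'d::finite \<Rightarrow> (real^'d \<Rightarrow> complex^3) \<Rightarrow> real^'d \<Rightarrow> complex^3" where
  "Lam \<sigma> c \<Psi> x = (\<chi> j. cis (\<sigma> $ j / 2 * (c \<bullet> x)) * \<Psi> x $ j)"

definition nonzero :: "(real^'d::finite \<Rightarrow> complex^3) \<Rightarrow> bool" where
  "nonzero \<Psi> \<longleftrightarrow> \<not> (AE x in lborel. \<Psi> x = 0)"

definition X_til :: "real^3 \<Rightarrow> real^'d::finite \<Rightarrow> real \<times> real \<Rightarrow> (real^'d \<Rightarrow> complex^3) set" where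
  "X_til \<sigma> c \<omega> = {\<Psi>. \<forall>j. (\<lambda>x. \<Psi> x $ j) \<in> (if gam \<sigma> c \<omega> j > 0 then H1 else H1_hom)}"

text \<open>For \<open>gam \<sigma> c \<omega> j = 0\<close> the second term is \<open>0\<close> even if the component is not square integrable.\<close>

definition normsq_X_til :: "real^3 \<Rightarrow> real^'d::finite \<Rightarrow> real \<times> real \<Rightarrow> (real^'d \<Rightarrow> complex^3) \<Rightarrow> real" where
  "normsq_X_til \<sigma> c \<omega> \<Psi> =
     (\<Sum>j\<in>UNIV. 1 / \<sigma> $ j * grad_normsq (\<lambda>x. \<Psi> x $ j) + gam \<sigma> c \<omega> j * L2_normsq (\<lambda>x. \<Psi> x $ j))"

definition N_c :: "real^3 \<Rightarrow> real^'d::finite \<Rightarrow> (real^'d \<Rightarrow> complex^3) \<Rightarrow> real" where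
  "N_c \<sigma> c \<Psi> = - Re (L2_inner
     (\<lambda>x. cis ((\<sigma> $ 1 + \<sigma> $ 2 - \<sigma> $ 3) / 2 * (c \<bullet> x)) * \<Psi> x $ 1 * \<Psi> x $ 2) (\<lambda>x. \<Psi> x $ 3))"

definition S_til :: "real^3 \<Rightarrow> real^'d::finite \<Rightarrow> real \<times> real \<Rightarrow> (real^'d \<Rightarrow> complex^3) \<Rightarrow> real" where
  "S_til \<sigma> c \<omega> \<Psi> = 1 / 2 * normsq_X_til \<sigma> c \<omega> \<Psi> + N_c \<sigma> c \<Psi>"

definition K_til :: "real^3 \<Rightarrow> real^'d::finite \<Rightarrow> real \<times> real \<Rightarrow> (real^'d \<Rightarrow> complex^3) \<Rightarrow> real" where
  "K_til \<sigma> c \<omega> \<Psi> = normsq_X_til \<sigma> c \<omega> \<Psi> + 3 * N_c \<sigma> c \<Psi>"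

definition G_nl :: "real^3 \<Rightarrow> real^'d::finite \<Rightarrow> (real^'d \<Rightarrow> complex^3) \<Rightarrow> real^'d \<Rightarrow> complex^3" where
  "G_nl \<sigma> c \<Psi> x = (\<chi> j. cis (- (\<sigma> $ j / 2 * (c \<bullet> x))) * F (Lam \<sigma> c \<Psi> x) $ j)"

definition weak_sol_til :: "real^3 \<Rightarrow> real^'d::finite \<Rightarrow> real \<times> real \<Rightarrow> (real^'d \<Rightarrow> complex^3) \<Rightarrow> bool" where
  "weak_sol_til \<sigma> c \<omega> \<Psi> \<longleftrightarrow> (\<forall>\<Theta>\<in>X_til \<sigma> c \<omega>. \<forall>j.
     complex_of_real (1 / \<sigma> $ j) * grad_inner (\<lambda>x. \<Psi> x $ j) (\<lambda>x. \<Theta> x $ j)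
     + L2_inner (\<lambda>x. complex_of_real (gam \<sigma> c \<omega> j) * \<Psi> x $ j + G_nl \<sigma> c \<Psi> x $ j) (\<lambda>x. \<Theta> x $ j) = 0)"

definition E_til :: "real^3 \<Rightarrow> real^'d::finite \<Rightarrow> real \<times> real \<Rightarrow> (real^'d \<Rightarrow> complex^3) set" where
  "E_til \<sigma> c \<omega> = {\<Psi> \<in> X_til \<sigma> c \<omega>. nonzero \<Psi> \<and> weak_sol_til \<sigma> c \<omega> \<Psi>}"

definition G_til :: "real^3 \<Rightarrow> real^'d::finite \<Rightarrow> real \<times> real \<Rightarrow> (real^'d \<Rightarrow> complex^3) set" where
  "G_til \<sigma> c \<omega> = {\<Psi> \<in> E_til \<sigma> c \<omega>. \<forall>\<Theta>\<in>E_til \<sigma> c \<omega>. S_til \<sigma> c \<omega> \<Psi> \<le> S_til \<sigma> c \<omega> \<Theta>}"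

definition m_til :: "real^3 \<Rightarrow> real^'d::finite \<Rightarrow> real \<times> real \<Rightarrow> real" where
  "m_til \<sigma> c \<omega> = Inf (S_til \<sigma> c \<omega> ` {\<Psi> \<in> X_til \<sigma> c \<omega>. nonzero \<Psi> \<and> K_til \<sigma> c \<omega> \<Psi> = 0})"

definition M_til :: "real^3 \<Rightarrow> real^'d::finite \<Rightarrow> real \<times> real \<Rightarrow> (real^'d \<Rightarrow> complex^3) set" where
  "M_til \<sigma> c \<omega> =
     {\<Psi> \<in> X_til \<sigma> c \<omega>. nonzero \<Psi> \<and> S_til \<sigma> c \<omega> \<Psi> = m_til \<sigma> c \<omega> \<and> K_til \<sigma> c \<omega> \<Psi> = 0}"

definition X_c :: "real^3 \<Rightarrow> real^'d::finite \<Rightarrow> real \<times> real \<Rightarrow> (real^'d \<Rightarrow> complex^3) set" where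
  "X_c \<sigma> c \<omega> = Lam \<sigma> c ` X_til \<sigma> c \<omega>"

definition S_c :: "real^3 \<Rightarrow> real^'d::finite \<Rightarrow> real \<times> real \<Rightarrow> (real^'d \<Rightarrow> complex^3) \<Rightarrow> real" where
  "S_c \<sigma> c \<omega> \<Phi> = S_til \<sigma> c \<omega> (Lam \<sigma> (- c) \<Phi>)"

definition K_c :: "real^3 \<Rightarrow> real^'d::finite \<Rightarrow> real \<times> real \<Rightarrow> (real^'d \<Rightarrow> complex^3) \<Rightarrow> real" where
  "K_c \<sigma> c \<omega> \<Phi> = K_til \<sigma> c \<omega> (Lam \<sigma> (- c) \<Phi>)"

definition weak_sol_c :: "real^3 \<Rightarrow> real^'d::finite \<Rightarrow> real \<times> real \<Rightarrow> (real^'d \<Rightarrow> complex^3) \<Rightarrow> bool" where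
  "weak_sol_c \<sigma> c \<omega> \<Phi> \<longleftrightarrow> (\<forall>\<Theta>\<in>X_c \<sigma> c \<omega>. \<forall>j.
     complex_of_real (1 / \<sigma> $ j) *
       grad_inner (\<lambda>x. cis (- (\<sigma> $ j / 2 * (c \<bullet> x))) * \<Phi> x $ j)
                  (\<lambda>x. cis (- (\<sigma> $ j / 2 * (c \<bullet> x))) * \<Theta> x $ j)
     + L2_inner (\<lambda>x. complex_of_real (gam \<sigma> c \<omega> j) * \<Phi> x $ j + F (\<Phi> x) $ j) (\<lambda>x. \<Theta> x $ j) = 0)"

definition E_c :: "real^3 \<Rightarrow> real^'d::finite \<Rightarrow> real \<times> real \<Rightarrow> (real^'d \<Rightarrow> complex^3) set" where
  "E_c \<sigma> c \<omega> = {\<Phi> \<in> X_c \<sigma> c \<omega>. nonzero \<Phi> \<and> weak_sol_c \<sigma> c \<omega> \<Phi>}"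

definition G_c :: "real^3 \<Rightarrow> real^'d::finite \<Rightarrow> real \<times> real \<Rightarrow> (real^'d \<Rightarrow> complex^3) set" where
  "G_c \<sigma> c \<omega> = {\<Phi> \<in> E_c \<sigma> c \<omega>. \<forall>\<Theta>\<in>E_c \<sigma> c \<omega>. S_c \<sigma> c \<omega> \<Phi> \<le> S_c \<sigma> c \<omega> \<Theta>}"

definition m_c :: "real^3 \<Rightarrow> real^'d::finite \<Rightarrow> real \<times> real \<Rightarrow> real" where
  "m_c \<sigma> c \<omega> = Inf (S_c \<sigma> c \<omega> ` {\<Phi> \<in> X_c \<sigma> c \<omega>. nonzero \<Phi> \<and> K_c \<sigma> c \<omega> \<Phi> = 0})"

definition M_c :: "real^3 \<Rightarrow> real^'d::finite \<Rightarrow> real \<times> real \<Rightarrow> (real^'d \<Rightarrow> complex^3) set" where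
  "M_c \<sigma> c \<omega> =
     {\<Phi> \<in> X_c \<sigma> c \<omega>. nonzero \<Phi> \<and> S_c \<sigma> c \<omega> \<Phi> = m_c \<sigma> c \<omega> \<and> K_c \<sigma> c \<omega> \<Phi> = 0}"

end

(*
  On X the quadratic form H = ||.||^2 and the trilinear term N satisfy N^2 <= C H^3, with the sharp
  inequality 54 m N^2 <= H^3, where m is the Nehari infimum. The exponents p_1, p_2, p_3 in the
  trilinear Hoelder inequality are chosen Hoelder-conjugate, with p_j critical exactly when gamma_j = 0.
  At least one gamma_j is positive, hence at least one p_j is subcritical; a minimising sequence
  therefore cannot vanish, and after translations (which preserve H and N once the third component is
  multiplied by a phase) it has a nonzero local limit. Both H and N split along this limit as in the
  Brezis-Lieb lemma, and strict concavity in the sharp inequality forces the remainder to carry no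
  energy, so the limit is a minimiser. As an extremal of the sharp inequality it solves the equations;
  conversely every solution satisfies K = 0.

  For the Sobolev estimates a function is compared with its averages over nested boxes whose sides are
  halved one coordinate at a time. One halving changes the average by a difference quotient, which the
  weak gradient controls. Summing the geometric series gives the subcritical bounds and local
  compactness; truncating it with a maximal function gives the critical bound.
*)

theory Submission
  imports Defs "HOL-Computational_Algebra.Polynomial" "HOL-Library.Diagonal_Subsequence" "HOL-Real_Asymp.Real_Asymp"
begin

section \<open>Smooth cut-off functions\<close>

text \<open>The cubic term asks for exponents with 1/p_1 + 1/p_2 + 1/p_3 = 1, each above 2 and, for
  d at least 3, none beyond 2d/(d-2). For d < 6 the value 3 is strictly subcritical, and this slack
  lets a component with zero gamma take the critical exponent while another one stays subcritical. A
  critical component has no compactness in its own L^p, because of dilations. The splitting of N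
  survives since every mixed term holds one fixed factor and one factor that tends to zero locally;
  truncating the fixed factor reduces the matter to local L^2, where all components converge. The
  constants stem from the constraint: there N = -H/3 and S = H/6, so a minimiser has H = 6m and N =
  -2m, and rescaling to the constraint gives H^3/(9 N^2) \<ge> 6m. With x = H/(6m) and y = -N/(2m)
  taken at the local limit, the inequality for limit and remainder reads y^2 \<le> x^3 and (1-y)^2
  \<le> (1-x)^3; once 0 < x \<le> 1, only x = y = 1 remains. Box averages replace convolutions
  because they form a martingale, whose maximal inequality is elementary.\<close>

definition flat :: "real poly \<Rightarrow> real \<Rightarrow> real" where
  "flat p t = (if t > 0 then poly p (1 / t) * exp (- (1 / t)) else 0)"

lemma poly_div_exp_tendsto_0: "((\<lambda>x. poly p x / exp x) \<longlongrightarrow> 0) at_top" for p :: "real poly"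
proof -
  have "((\<lambda>x. \<Sum>i\<le>degree p. coeff p i * (x ^ i / exp x)) \<longlongrightarrow> (\<Sum>i\<le>degree p. coeff p i * 0)) at_top"
    by (intro tendsto_intros tendsto_power_div_exp_0)
  then show ?thesis
    by (simp add: poly_altdef sum_divide_distrib)
qed

text \<open>The functions p(1/t) exp(-1/t) are closed under differentiation: the derivative is t^-2
  (p - p')(1/t) exp(-1/t), and \<open>[:0, 0, 1:]\<close> supplies the factor t^-2. Smoothness of
  every order then follows by induction with p arbitrary.\<close>

lemma flat_has_derivative:
  "(flat p has_real_derivative flat ([:0, 0, 1:] * (p - pderiv p)) t) (at t)"
proof -
  consider "t > 0" | "t < 0" | "t = 0" by linarith
  then show ?thesis
  proof cases
    case 1
    have "((\<lambda>t. poly p (1 / t) * exp (- (1 / t))) has_real_derivative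
        flat ([:0, 0, 1:] * (p - pderiv p)) t) (at t)"
      using 1 by (auto intro!: derivative_eq_intros DERIV_chain2[OF poly_DERIV]
          simp: flat_def field_simps power2_eq_square)
    then show ?thesis
      by (rule DERIV_cong_ev[THEN iffD1, rotated -1])
        (use 1 eventually_nhds_in_open[of "{0<..}" t] in \<open>auto elim!: eventually_mono simp: flat_def\<close>)
  next
    case 2
    have "((\<lambda>t. 0) has_real_derivative flat ([:0, 0, 1:] * (p - pderiv p)) t) (at t)"
      using 2 by (simp add: flat_def)
    then show ?thesis
      by (rule DERIV_cong_ev[THEN iffD1, rotated -1])
        (use 2 eventually_nhds_in_open[of "{..<0}" t] in \<open>auto elim!: eventually_mono simp: flat_def\<close>)
  next
    case 3
    have "((\<lambda>h. flat p h / h) \<longlongrightarrow> 0) (at_right 0)"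
    proof (rule Lim_transform_eventually)
      \<comment> \<open>Dividing by h multiplies the polynomial in 1/h by its variable, so the
        difference quotient at 0 is again a polynomial over an exponential.\<close>
      show "((\<lambda>h. poly (pCons 0 p) (inverse h) / exp (inverse h)) \<longlongrightarrow> 0) (at_right (0::real))"
        by (rule filterlim_compose[OF poly_div_exp_tendsto_0 filterlim_inverse_at_top_right])
      show "\<forall>\<^sub>F h in at_right 0. poly (pCons 0 p) (inverse h) / exp (inverse h) = flat p h / h"
        using eventually_at_right_less[of "0::real"]
        by eventually_elim (auto simp: flat_def exp_minus field_simps)
    qed
    moreover have "((\<lambda>h. flat p h / h) \<longlongrightarrow> 0) (at_left 0)"
      by (rule Lim_transform_eventually[OF tendsto_const])
        (auto simp: eventually_at_left_field flat_def intro!: exI[of _ "-1"])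
    ultimately have "((\<lambda>h. flat p h / h) \<longlongrightarrow> 0) (at 0)"
      by (simp add: filterlim_split_at)
    then show ?thesis
      using 3 by (simp add: DERIV_def flat_def)
  qed
qed

section \<open>Calculus of k times continuously differentiable functions\<close>

lemma partial_deriv_eq: "(f has_derivative f') (at x) \<Longrightarrow> partial_deriv k f x = f' (axis k 1)"
  unfolding partial_deriv_def by (metis frechet_derivative_at)

lemma C_k_Suc_imp: "C_k (Suc n) f \<Longrightarrow> C_k n f"
proof (induction n arbitrary: f)
  case 0
  then show ?case
    by (auto intro!: continuous_at_imp_continuous_on differentiable_imp_continuous_within)
qed auto

lemma C_k_continuous: "C_k n f \<Longrightarrow> continuous_on UNIV f"
  by (induction n) (use C_k_Suc_imp in force)+

lemma C_k_const: "C_k n (\<lambda>x. c)"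
proof (induction n arbitrary: c)
  case (Suc n)
  have "partial_deriv k (\<lambda>x::real^'a. c) = (\<lambda>x. 0)" for k
    by (rule ext, rule trans[OF partial_deriv_eq[OF has_derivative_const]]) simp
  then show ?case using Suc by simp
qed simp

lemma partial_deriv_add:
  assumes "f differentiable (at x)" "g differentiable (at x)"
  shows "partial_deriv k (\<lambda>x. f x + g x) x = partial_deriv k f x + partial_deriv k g x"
  using assms unfolding frechet_derivative_works
  by (subst partial_deriv_eq[OF has_derivative_add]) (auto simp: partial_deriv_def)

lemma C_k_add: "C_k n f \<Longrightarrow> C_k n g \<Longrightarrow> C_k n (\<lambda>x. f x + g x)"
proof (induction n arbitrary: f g)
  case (Suc n)
  have "partial_deriv k (\<lambda>x. f x + g x) = (\<lambda>x. partial_deriv k f x + partial_deriv k g x)" for k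
    using Suc.prems by (auto intro!: ext partial_deriv_add)
  then show ?case using Suc by simp
qed (auto intro: continuous_on_add)

lemma partial_deriv_mult:
  assumes "f differentiable (at x)" "g differentiable (at x)"
  shows "partial_deriv k (\<lambda>x. f x * g x) x = f x * partial_deriv k g x + partial_deriv k f x * g x"
  using assms unfolding frechet_derivative_works
  by (subst partial_deriv_eq[OF has_derivative_mult]) (auto simp: partial_deriv_def)

lemma C_k_mult: "C_k n f \<Longrightarrow> C_k n g \<Longrightarrow> C_k n (\<lambda>x. f x * g x)"
proof (induction n arbitrary: f g)
  case (Suc n)
  have "partial_deriv k (\<lambda>x. f x * g x) = (\<lambda>x. f x * partial_deriv k g x + partial_deriv k f x * g x)" for k
    using Suc.prems by (auto intro!: ext partial_deriv_mult)
  moreover have "C_k n f" "C_k n g"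
    using Suc.prems by (auto intro!: C_k_Suc_imp simp del: C_k.simps)
  ultimately show ?case using Suc by (auto intro!: C_k_add)
qed (auto intro: continuous_on_mult)

lemma C_k_prod: "(\<And>i. i \<in> I \<Longrightarrow> C_k n (f i)) \<Longrightarrow> C_k n (\<lambda>x. \<Prod>i\<in>I. f i x)"
  by (induction I rule: infinite_finite_induct) (auto intro: C_k_mult C_k_const)

lemma coord_has_derivative:
  fixes x :: "real^'d::finite"
  assumes "(h has_real_derivative h') (at (x $ i))"
  shows "((\<lambda>x. complex_of_real (h (x $ i))) has_derivative (\<lambda>v. complex_of_real (h' * v $ i))) (at x)"
proof -
  have 1: "((\<lambda>x::real^'d. x $ i) has_derivative (\<lambda>v. v $ i)) (at x)"
    by (intro bounded_linear_imp_has_derivative bounded_linear_vec_nth)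
  have "(h has_derivative (*) h') (at (x $ i))"
    using assms by (simp add: has_field_derivative_def)
  from has_derivative_compose[OF 1 this] show ?thesis
    by (rule bounded_linear.has_derivative[OF bounded_linear_of_real])
qed

lemma partial_deriv_coord:
  fixes x :: "real^'d::finite"
  assumes "(h has_real_derivative h') (at (x $ i))"
  shows "partial_deriv k (\<lambda>x. complex_of_real (h (x $ i))) x = (if k = i then of_real h' else 0)"
  by (subst partial_deriv_eq[OF coord_has_derivative[OF assms]]) (auto simp: axis_def)

lemma C_k_coord:
  fixes i :: "'d::finite"
  assumes "\<And>t. (h has_real_derivative h' t) (at t)"
    and "C_k n (\<lambda>x::real^'d. complex_of_real (h' (x $ i)))"
  shows "C_k (Suc n) (\<lambda>x::real^'d. complex_of_real (h (x $ i)))"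
proof -
  have "partial_deriv k (\<lambda>x::real^'d. complex_of_real (h (x $ i)))
      = (if k = i then (\<lambda>x. complex_of_real (h' (x $ i))) else (\<lambda>x. 0))" for k
    by (auto intro!: ext simp: partial_deriv_coord[OF assms(1)])
  then show ?thesis
    using assms(2) coord_has_derivative[OF assms(1)] by (auto simp: C_k_const differentiable_def)
qed

lemma C_k_flat:
  fixes i :: "'d::finite"
  shows "C_k n (\<lambda>x::real^'d. complex_of_real (flat p (\<alpha> * x $ i + \<beta>)))"
proof (induction n arbitrary: p)
  case 0
  have "isCont (flat p) t" for t
    using flat_has_derivative DERIV_isCont by blast
  then have "continuous_on UNIV (flat p)"
    by (simp add: continuous_on_eq_continuous_at)
  then have "continuous_on UNIV (\<lambda>x::real^'d. flat p (\<alpha> * x $ i + \<beta>))"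
    by (rule continuous_on_compose2) (auto intro!: continuous_intros)
  then show ?case by (auto intro!: continuous_intros)
next
  case (Suc n)
  let ?q = "[:0, 0, 1:] * (p - pderiv p)"
  have "((\<lambda>t. flat p (\<alpha> * t + \<beta>)) has_real_derivative flat ?q (\<alpha> * t + \<beta>) * \<alpha>) (at t)" for t
    by (rule DERIV_chain2[OF flat_has_derivative]) (auto intro!: derivative_eq_intros)
  moreover have "C_k n (\<lambda>x::real^'d. complex_of_real (flat ?q (\<alpha> * x $ i + \<beta>)) * complex_of_real \<alpha>)"
    by (intro C_k_mult C_k_const Suc)
  ultimately show ?case
    by (intro C_k_coord[where h = "\<lambda>t. flat p (\<alpha> * t + \<beta>)"]) auto
qed

text \<open>Smooth approximations from below of the indicator of an open interval. Growing m
  sharpens the edges while the support stays in the closed interval, so one dominating function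
  serves for all m.\<close>

definition cut :: "nat \<Rightarrow> real \<Rightarrow> real \<Rightarrow> real \<Rightarrow> real" where
  "cut m a b t = flat 1 (real m * (t - a)) * flat 1 (real m * (b - t))"

lemma flat_1_bounds: "0 \<le> flat 1 t" "flat 1 t \<le> 1"
  by (auto simp: flat_def)

lemma cut_bounds: "0 \<le> cut m a b t" "cut m a b t \<le> 1"
  unfolding cut_def using flat_1_bounds by (auto intro!: mult_nonneg_nonneg mult_le_one)

lemma cut_eq_0: "t \<le> a \<or> b \<le> t \<Longrightarrow> cut m a b t = 0"
  by (auto simp: cut_def flat_def zero_less_mult_iff)

lemma cut_pos: "m > 0 \<Longrightarrow> a < t \<Longrightarrow> t < b \<Longrightarrow> cut m a b t > 0"
  by (auto simp: cut_def flat_def)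

lemma flat_1_tendsto: "(\<lambda>m. flat 1 (real m * s)) \<longlonglongrightarrow> (if s > 0 then 1 else 0)"
proof (cases "s > 0")
  case True
  have "(\<lambda>m. exp (- (1 / (real m * s)))) \<longlonglongrightarrow> 1"
    using True by real_asymp
  moreover have "\<forall>\<^sub>F m in sequentially. exp (- (1 / (real m * s))) = flat 1 (real m * s)"
    using eventually_gt_at_top[of 0] by eventually_elim (use True in \<open>auto simp: flat_def\<close>)
  ultimately show ?thesis
    using True by (simp add: Lim_transform_eventually)
next
  case False
  then have "flat 1 (real m * s) = 0" for m
    by (auto simp: flat_def zero_less_mult_iff)
  then show ?thesis using False by simp
qed

lemma cut_tendsto: "(\<lambda>m. cut m a b t) \<longlonglongrightarrow> (if a < t \<and> t < b then 1 else 0)"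
proof -
  have "(\<lambda>m. cut m a b t) \<longlonglongrightarrow> (if t - a > 0 then 1 else 0) * (if b - t > 0 then 1 else 0)"
    unfolding cut_def by (intro tendsto_mult flat_1_tendsto)
  then show ?thesis by (auto split: if_splits)
qed

lemma C_k_cut: "C_k n (\<lambda>x. complex_of_real (cut m a b (x $ i)))"
proof -
  have "real m * (t - a) = real m * t + (- real m * a)" "real m * (b - t) = - real m * t + real m * b" for t
    by (auto simp: algebra_simps)
  then show ?thesis
    unfolding cut_def of_real_mult by (simp only:) (intro C_k_mult C_k_flat)
qed

lemma continuous_cut: "continuous_on A (cut m a b)"
proof -
  have "continuous_on UNIV (flat 1)"
    by (intro continuous_at_imp_continuous_on ballI DERIV_isCont[OF flat_has_derivative])
  then show ?thesis
    unfolding cut_def by (auto intro!: continuous_intros continuous_on_compose2[of UNIV "flat 1"])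
qed

lemma cut_reflect: "cut m a b (s - t) = cut m (s - b) (s - a) t"
  by (simp add: cut_def algebra_simps)

text \<open>The tent is an antiderivative of a function that is odd about the midpoint, hence
  symmetric about it. It therefore vanishes beyond b because it vanishes before a, and its size has
  to be estimated on the left half only, by the mean value theorem.\<close>

lemma tent_exists:
  assumes "a < b"
  obtains \<tau> where "\<And>t. (\<tau> has_real_derivative (cut m a ((a + b) / 2) t - cut m ((a + b) / 2) b t)) (at t)"
    "\<And>t. t \<le> a \<or> b \<le> t \<Longrightarrow> \<tau> t = 0" "\<And>t. \<bar>\<tau> t\<bar> \<le> (b - a) / 2"
proof -
  define c where "c = (a + b) / 2"
  define g where "g t = cut m a c t - cut m c b t" for t
  have c: "a < c" "c < b" "a + b - c = c" "c * 2 = a + b"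
    using assms by (auto simp: c_def field_simps)
  have "isCont g t" for t
    unfolding g_def
    by (intro continuous_intros) (use continuous_cut[of UNIV] in \<open>auto simp: continuous_on_eq_continuous_at\<close>)
  then have "\<exists>F. \<forall>x. -\<infinity> < ereal x \<longrightarrow> ereal x < \<infinity> \<longrightarrow> (F has_vector_derivative g x) (at x)"
    by (intro einterval_antiderivative) auto
  then obtain F where F: "\<And>x. (F has_real_derivative g x) (at x)"
    by (auto simp: has_real_derivative_iff_has_vector_derivative)
  define \<tau> where "\<tau> t = F t - F a" for t
  have d: "(\<tau> has_real_derivative g t) (at t)" for t
    unfolding \<tau>_def using F by (auto intro!: derivative_eq_intros)
  \<comment> \<open>The difference between \<tau> and its reflection has zero derivative; the
    constant is read off at the midpoint \<open>c\<close>, which the reflection fixes.\<close>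
  have refl: "\<tau> (a + b - t) = \<tau> t" for t
  proof -
    have "((\<lambda>t. \<tau> (a + b - t) - \<tau> t) has_real_derivative 0) (at t)" for t
    proof -
      have "((\<lambda>t. \<tau> (a + b - t)) has_real_derivative g (a + b - t) * (-1)) (at t)"
        by (rule DERIV_chain2[OF d]) (auto intro!: derivative_eq_intros)
      moreover have "g (a + b - t) = - g t"
        unfolding g_def cut_reflect c(3) by simp
      ultimately show ?thesis
        using DERIV_diff[OF _ d[of t]] by fastforce
    qed
    then have "\<tau> (a + b - t) - \<tau> t = \<tau> (a + b - c) - \<tau> c"
      using DERIV_isconst_all by blast
    then show ?thesis using c by simp
  qed
  have left: "\<tau> t = 0" if "t \<le> a" for t
  proof (cases "t = a")
    case False
    then have "t < a" using that by simp
    then obtain z where "t < z" "z < a" "\<tau> a - \<tau> t = (a - t) * g z"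
      using MVT2[of t a \<tau> g] d by blast
    then show ?thesis using c by (simp add: \<tau>_def g_def cut_eq_0)
  qed (simp add: \<tau>_def)
  have mid: "\<bar>\<tau> t\<bar> \<le> (b - a) / 2" if "t \<le> c" for t
  proof (cases "t \<le> a")
    case False
    then have "a < t" by simp
    then obtain z where z: "a < z" "z < t" "\<tau> t - \<tau> a = (t - a) * g z"
      using MVT2[of a t \<tau> g] d by blast
    then have "\<bar>g z\<bar> \<le> 1"
      using cut_bounds[of m a c z] that by (simp add: g_def cut_eq_0)
    then have "\<bar>(t - a) * g z\<bar> \<le> (c - a) * 1"
      unfolding abs_mult using z that by (intro mult_mono) auto
    then have "\<bar>\<tau> t\<bar> \<le> c - a"
      using z(3) left[of a] by simp
    also have "c - a = (b - a) / 2"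
      by (simp add: c_def field_simps)
    finally show ?thesis .
  qed (use assms left in auto)
  show thesis
  proof
    show "(\<tau> has_real_derivative (cut m a ((a + b) / 2) t - cut m ((a + b) / 2) b t)) (at t)" for t
      using d[of t] by (simp add: g_def c_def)
    show "\<tau> t = 0" if "t \<le> a \<or> b \<le> t" for t
      using that left[of t] left[of "a + b - t"] refl[of t] by auto
    show "\<bar>\<tau> t\<bar> \<le> (b - a) / 2" for t
    proof (cases "t \<le> c")
      case False
      then show ?thesis using mid[of "a + b - t"] refl[of t] c by simp
    qed (rule mid)
  qed
qed

section \<open>Local integrability and products with test functions\<close>

lemma locally_integrable_borel:
  assumes "locally_integrable f"
  shows "f \<in> borel_measurable borel"
proof (rule borel_measurable_LIMSEQ_metric)
  show "(\<lambda>x. indicator (cball 0 (real n)) x *\<^sub>R f x) \<in> borel_measurable borel" for n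
    using assms borel_measurable_integrable[of lborel "\<lambda>x. indicator (cball 0 (real n)) x *\<^sub>R f x"]
    unfolding locally_integrable_def set_integrable_def by simp
  show "(\<lambda>n. indicator (cball 0 (real n)) x *\<^sub>R f x) \<longlonglongrightarrow> f x" for x
  proof (rule tendsto_eventually)
    show "\<forall>\<^sub>F n in sequentially. indicator (cball 0 (real n)) x *\<^sub>R f x = f x"
      using eventually_ge_at_top[of "nat \<lceil>norm x\<rceil>"]
      by eventually_elim (auto simp: indicator_def dist_norm)
  qed
qed

lemma locally_integrable_norm:
  "locally_integrable f \<Longrightarrow> compact K \<Longrightarrow> integrable lborel (\<lambda>x. cmod (indicator K x *\<^sub>R f x))"
  unfolding locally_integrable_def set_integrable_def by (intro integrable_norm) simp

lemma locally_integrable_mult_bounded: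
  assumes "locally_integrable f" "compact K" "\<phi> \<in> borel_measurable borel"
    and "\<And>x. cmod (\<phi> x) \<le> M" "\<And>x. x \<notin> K \<Longrightarrow> \<phi> x = 0"
  shows "integrable lborel (\<lambda>x. f x * \<phi> x)"
proof (rule Bochner_Integration.integrable_bound)
  show "integrable lborel (\<lambda>x. M * cmod (indicator K x *\<^sub>R f x))"
    by (intro integrable_mult_right locally_integrable_norm assms)
  show "(\<lambda>x. f x * \<phi> x) \<in> borel_measurable lborel"
    using assms(3) locally_integrable_borel[OF assms(1)] by simp
  have "cmod (f x) * cmod (\<phi> x) \<le> cmod (f x) * M" for x
    using assms(4) by (intro mult_left_mono) auto
  then show "AE x in lborel. norm (f x * \<phi> x) \<le> norm (M * cmod (indicator K x *\<^sub>R f x))"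
    using assms(4) order_trans[OF norm_ge_zero assms(4)]
    by (intro AE_I2) (auto simp: norm_mult indicator_def assms(5) mult.commute)
qed

lemma locally_integrable_mult_indicator:
  assumes "locally_integrable f" "compact K" "S \<subseteq> K" "S \<in> sets borel"
  shows "integrable lborel (\<lambda>x. f x * indicator S x)"
proof (rule locally_integrable_mult_bounded[OF assms(1,2), where M = 1])
  show "indicator S \<in> borel_measurable borel"
    using assms(4) by measurable
qed (use assms(3) in \<open>auto simp: indicator_def\<close>)

lemma continuous_compact_support_bounded:
  fixes \<phi> :: "'a::topological_space \<Rightarrow> complex"
  assumes "continuous_on UNIV \<phi>" "compact K" "\<And>x. x \<notin> K \<Longrightarrow> \<phi> x = 0"
  obtains M where "M \<ge> 0" "\<And>x. cmod (\<phi> x) \<le> M"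
proof -
  have "bounded (\<phi> ` K)"
    using assms by (intro compact_imp_bounded compact_continuous_image) (auto intro: continuous_on_subset)
  then obtain M where "\<forall>x\<in>K. cmod (\<phi> x) \<le> M"
    by (auto simp: bounded_iff)
  then have "cmod (\<phi> x) \<le> max M 0" for x
    using assms(3) by (cases "x \<in> K") (auto simp: le_max_iff_disj)
  then show thesis by (intro that[of "max M 0"]) auto
qed

lemma locally_integrable_mult_test:
  assumes "locally_integrable f" "continuous_on UNIV \<phi>" "compact K" "\<And>x. x \<notin> K \<Longrightarrow> \<phi> x = 0"
  shows "integrable lborel (\<lambda>x. f x * \<phi> x)"
proof -
  obtain M where "\<And>x. cmod (\<phi> x) \<le> M"
    using continuous_compact_support_bounded[OF assms(2-4)] by blast
  with assms show ?thesis
    by (intro locally_integrable_mult_bounded[of f K \<phi> M] borel_measurable_continuous_onI)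
qed

lemma partial_deriv_support:
  assumes "closed K" "\<And>x. x \<notin> K \<Longrightarrow> \<phi> x = 0" "x \<notin> K"
  shows "partial_deriv k \<phi> x = 0"
proof -
  have "(\<phi> has_derivative (\<lambda>_. 0)) (at x)"
    by (rule has_derivative_transform_within_open[of "\<lambda>_. 0" _ _ _ "- K"])
      (use assms in auto)
  then show ?thesis by (simp add: partial_deriv_eq)
qed

lemma test_function_C_k: "\<phi> \<in> test_functions \<Longrightarrow> C_k n \<phi>"
  by (simp add: test_functions_def)

lemma test_function_support:
  assumes "\<phi> \<in> test_functions"
  obtains K where "compact K" "\<And>x. x \<notin> K \<Longrightarrow> \<phi> x = 0" "\<And>k x. x \<notin> K \<Longrightarrow> partial_deriv k \<phi> x = 0"
proof -
  obtain K where "compact K" "\<And>x. x \<notin> K \<Longrightarrow> \<phi> x = 0"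
    using assms unfolding test_functions_def by blast
  with partial_deriv_support[OF compact_imp_closed, of K \<phi>] show thesis
    by (intro that[of K]) auto
qed

lemma test_function_integrable:
  assumes "\<phi> \<in> test_functions" "locally_integrable f"
  shows "integrable lborel (\<lambda>x. f x * \<phi> x)" "integrable lborel (\<lambda>x. f x * partial_deriv k \<phi> x)"
proof -
  obtain K where "compact K" "\<And>x. x \<notin> K \<Longrightarrow> \<phi> x = 0" "\<And>k x. x \<notin> K \<Longrightarrow> partial_deriv k \<phi> x = 0"
    using test_function_support[OF assms(1)] by blast
  moreover have "continuous_on UNIV \<phi>" "continuous_on UNIV (partial_deriv k \<phi>)"
    using test_function_C_k[OF assms(1), of 0] test_function_C_k[OF assms(1), of 1] by auto
  ultimately show "integrable lborel (\<lambda>x. f x * \<phi> x)" "integrable lborel (\<lambda>x. f x * partial_deriv k \<phi> x)"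
    by (auto intro!: locally_integrable_mult_test[OF assms(2)])
qed

text \<open>Meant for factors depending on coordinates other than k: they are constant in direction
  k, so that in the product with a tent only the tent is differentiated.\<close>

lemma partial_deriv_prod_0:
  assumes "\<And>i. i \<in> I \<Longrightarrow> f i differentiable (at x) \<and> partial_deriv k (f i) x = 0"
  shows "(\<lambda>x. \<Prod>i\<in>I. f i x) differentiable (at x) \<and> partial_deriv k (\<lambda>x. \<Prod>i\<in>I. f i x) x = 0"
  using assms
proof (induction I rule: infinite_finite_induct)
  case (insert i I)
  then show ?case by (auto simp: partial_deriv_mult intro!: differentiable_mult)
qed (auto simp: partial_deriv_eq[OF has_derivative_const])

lemma cut_test_function:
  fixes a b :: "real^'d::finite"
  shows "(\<lambda>x. \<Prod>i\<in>UNIV. complex_of_real (cut m (a $ i) (b $ i) (x $ i))) \<in> test_functions"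
proof -
  have "(\<Prod>i\<in>UNIV. complex_of_real (cut m (a $ i) (b $ i) (x $ i))) = 0" if x: "x \<notin> cbox a b" for x
  proof -
    obtain i where "x $ i < a $ i \<or> b $ i < x $ i"
      using x unfolding mem_box_cart by (auto simp: not_le)
    then show ?thesis by (intro prod_zero) (auto intro!: exI[of _ i] cut_eq_0)
  qed
  then show ?thesis
    unfolding test_functions_def by (auto intro!: C_k_prod C_k_cut exI[of _ "cbox a b"])
qed

lemma cut_has_derivative: "\<exists>h'. (cut m a b has_real_derivative h') (at t)"
proof -
  have "((\<lambda>t. flat 1 (real m * (t - a))) has_real_derivative flat ([:0, 0, 1:] * (1 - pderiv 1)) (real m * (t - a)) * real m) (at t)"
    "((\<lambda>t. flat 1 (real m * (b - t))) has_real_derivative flat ([:0, 0, 1:] * (1 - pderiv 1)) (real m * (b - t)) * (- real m)) (at t)"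
    by (rule DERIV_chain2[OF flat_has_derivative], (auto intro!: derivative_eq_intros)[])+
  from DERIV_mult[OF this] show ?thesis
    unfolding cut_def by blast
qed

lemma cut_prod_tendsto:
  fixes a b x :: "real^'d::finite"
  shows "(\<lambda>m. \<Prod>i\<in>I. complex_of_real (cut m (a $ i) (b $ i) (x $ i)))
    \<longlonglongrightarrow> (\<Prod>i\<in>I. if a $ i < x $ i \<and> x $ i < b $ i then 1 else 0)"
proof (intro tendsto_prod)
  fix i
  show "(\<lambda>m. complex_of_real (cut m (a $ i) (b $ i) (x $ i))) \<longlonglongrightarrow> (if a $ i < x $ i \<and> x $ i < b $ i then 1 else 0)"
    using tendsto_of_real[OF cut_tendsto[of "a $ i" "b $ i" "x $ i"], where 'a = complex]
    by (auto split: if_splits)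
qed

lemma cut_prod_bound: "cmod (\<Prod>i\<in>I. complex_of_real (cut m (a i) (b i) (x i))) \<le> 1"
  unfolding prod_norm[symmetric] using cut_bounds by (intro prod_le_1) auto

lemma prod_if_01:
  "finite I \<Longrightarrow> (\<Prod>i\<in>I. if P i then 1 else 0) = (if \<forall>i\<in>I. P i then 1 else 0 :: complex)"
  by (induction I rule: finite_induct) auto

lemma set_integral_eq_mult:
  "(LINT x:A|M. f x) = (\<integral>x. f x * indicator A x \<partial>M)" for f :: "'a \<Rightarrow> complex"
  unfolding set_lebesgue_integral_def
  by (intro Bochner_Integration.integral_cong) (auto simp: indicator_def)

text \<open>Products of cut-offs converge to the indicator of the open box and are dominated by that
  of the closed one. This is the first half of the uniqueness of weak derivatives; passing from
  boxes to points is the second.\<close>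

lemma zero_on_boxes:
  fixes f :: "real^'d::finite \<Rightarrow> complex"
  assumes f: "locally_integrable f" and "\<And>\<phi>. \<phi> \<in> test_functions \<Longrightarrow> (\<integral>x. f x * \<phi> x \<partial>lborel) = 0"
  shows "(LINT x:box a b|lborel. f x) = 0"
proof -
  define \<Phi> where "\<Phi> m x = (\<Prod>i\<in>UNIV. complex_of_real (cut m (a $ i) (b $ i) (x $ i)))" for m x
  have [measurable]: "f \<in> borel_measurable borel" by (rule locally_integrable_borel[OF f])
  have [measurable]: "\<Phi> m \<in> borel_measurable borel" for m
    using test_function_C_k[OF cut_test_function, of 0 m a b]
    by (intro borel_measurable_continuous_onI) (simp add: \<Phi>_def)
  have "(\<lambda>m. \<integral>x. f x * \<Phi> m x \<partial>lborel) \<longlonglongrightarrow> (\<integral>x. f x * indicator (box a b) x \<partial>lborel)"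
  proof (rule integral_dominated_convergence[where w = "\<lambda>x. cmod (indicator (cbox a b) x *\<^sub>R f x)"])
    show "integrable lborel (\<lambda>x. cmod (indicator (cbox a b) x *\<^sub>R f x))"
      by (intro locally_integrable_norm f compact_cbox)
    have "(\<lambda>m. f x * \<Phi> m x) \<longlonglongrightarrow> f x * indicator (box a b) x" for x
    proof (rule tendsto_mult_left)
      have "(\<Prod>i\<in>UNIV. if a $ i < x $ i \<and> x $ i < b $ i then 1 else 0) = (indicator (box a b) x :: complex)"
        by (simp add: prod_if_01 indicator_def mem_box_cart)
      then show "(\<lambda>m. \<Phi> m x) \<longlonglongrightarrow> indicator (box a b) x"
        unfolding \<Phi>_def using cut_prod_tendsto[where I = UNIV and a = a and b = b and x = x] by simp
    qed
    then show "AE x in lborel. (\<lambda>m. f x * \<Phi> m x) \<longlonglongrightarrow> f x * indicator (box a b) x" by simp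
    have "\<Phi> m x = 0" if "x \<notin> cbox a b" for m x
    proof -
      have "\<exists>i. x $ i < a $ i \<or> b $ i < x $ i"
        using that unfolding mem_box_cart by (meson not_le)
      then obtain i where "x $ i < a $ i \<or> b $ i < x $ i" ..
      then show ?thesis unfolding \<Phi>_def by (intro prod_zero) (auto intro!: exI[of _ i] cut_eq_0)
    qed
    moreover have "cmod (\<Phi> m x) \<le> 1" for m x
      by (simp only: \<Phi>_def cut_prod_bound)
    ultimately show "AE x in lborel. norm (f x * \<Phi> m x) \<le> cmod (indicator (cbox a b) x *\<^sub>R f x)" for m
      by (intro AE_I2) (auto simp: indicator_def norm_mult mult_left_le)
  qed measurable
  moreover have "(\<integral>x. f x * \<Phi> m x \<partial>lborel) = 0" for m
    using assms(2)[OF cut_test_function[of m a b]] by (simp add: \<Phi>_def)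
  ultimately show ?thesis
    by (simp add: set_integral_eq_mult LIMSEQ_const_iff)
qed

text \<open>The weak derivative in direction \<open>k\<close> is tested with a tent in the coordinate \<open>k\<close> times cut-offs in
  the other coordinates; the derivative of the tent tends to \<open>1\<close> and \<open>-1\<close> on the two halves.\<close>

lemma half_difference:
  fixes f :: "real^'d::finite \<Rightarrow> complex"
  assumes D: "has_weak_grad f D" and ab: "a $ k < b $ k"
  defines "c \<equiv> (a $ k + b $ k) / 2"
  shows "cmod ((LINT x:box a b \<inter> {x. x $ k < c}|lborel. f x) - (LINT x:box a b \<inter> {x. c < x $ k}|lborel. f x))
    \<le> (b $ k - a $ k) / 2 * (LINT x:box a b|lborel. cmod (D x $ k))"
proof -
  have f: "locally_integrable f" and Dk: "locally_integrable (\<lambda>x. D x $ k)"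
    using D by (auto simp: has_weak_grad_def)
  have [measurable]: "f \<in> borel_measurable borel" "(\<lambda>x. D x $ k) \<in> borel_measurable borel"
    by (rule locally_integrable_borel, fact)+
  have "\<forall>m. \<exists>\<tau>. (\<forall>t. (\<tau> has_real_derivative (cut m (a $ k) c t - cut m c (b $ k) t)) (at t))
    \<and> (\<forall>t. t \<le> a $ k \<or> b $ k \<le> t \<longrightarrow> \<tau> t = 0) \<and> (\<forall>t. \<bar>\<tau> t\<bar> \<le> (b $ k - a $ k) / 2)"
    unfolding c_def using tent_exists[OF ab] by metis
  then obtain \<tau> where \<tau>: "\<And>m t. (\<tau> m has_real_derivative (cut m (a $ k) c t - cut m c (b $ k) t)) (at t)"
    "\<And>m t. t \<le> a $ k \<or> b $ k \<le> t \<Longrightarrow> \<tau> m t = 0" "\<And>m t. \<bar>\<tau> m t\<bar> \<le> (b $ k - a $ k) / 2"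
    by metis
  define P where "P m x = (\<Prod>i\<in>UNIV - {k}. complex_of_real (cut m (a $ i) (b $ i) (x $ i)))"
    for m and x :: "real^'d"
  define \<Phi> where "\<Phi> m x = complex_of_real (\<tau> m (x $ k)) * P m x" for m and x :: "real^'d"
  define \<Phi>' where "\<Phi>' m x = complex_of_real (cut m (a $ k) c (x $ k) - cut m c (b $ k) (x $ k)) * P m x"
    for m and x :: "real^'d"
  have Ple: "cmod (P m x) \<le> 1" for m x
    by (simp only: P_def cut_prod_bound)
  have CP: "C_k n (P m)" for n m
    unfolding P_def by (intro C_k_prod C_k_cut)
  have C\<tau>: "C_k (Suc n) (\<lambda>x::real^'d. complex_of_real (\<tau> m (x $ k)))" for n m
  proof (rule C_k_coord[OF \<tau>(1)])
    have "C_k n (\<lambda>x::real^'d. complex_of_real (cut m (a $ k) c (x $ k)) + (-1) * complex_of_real (cut m c (b $ k) (x $ k)))"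
      by (intro C_k_add C_k_mult C_k_const C_k_cut)
    then show "C_k n (\<lambda>x::real^'d. complex_of_real (cut m (a $ k) c (x $ k) - cut m c (b $ k) (x $ k)))"
      by simp
  qed
  have C\<Phi>: "C_k n (\<Phi> m)" for n m
    unfolding \<Phi>_def by (intro C_k_mult CP C_k_Suc_imp[OF C\<tau>])
  have out: "\<Phi> m x = 0" if "x \<notin> box a b" for m x
  proof -
    have "\<exists>i. x $ i \<le> a $ i \<or> b $ i \<le> x $ i"
      using that unfolding mem_box_cart by (meson not_less)
    then obtain i where i: "x $ i \<le> a $ i \<or> b $ i \<le> x $ i" ..
    show ?thesis
    proof (cases "i = k")
      case False
      then have "P m x = 0"
        unfolding P_def using i by (intro prod_zero) (auto intro!: bexI[of _ i] cut_eq_0)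
      then show ?thesis by (simp add: \<Phi>_def)
    qed (use i \<tau>(2) in \<open>auto simp: \<Phi>_def\<close>)
  qed
  have out': "\<Phi> m x = 0" if "x \<notin> cbox a b" for m x
    using that out box_subset_cbox[of a b] by blast
  then have test: "\<Phi> m \<in> test_functions" for m
    unfolding test_functions_def using C\<Phi> by (auto intro!: exI[of _ "cbox a b"])
  have pd: "partial_deriv k (\<Phi> m) = \<Phi>' m" for m
  proof
    fix x
    have "complex_of_real \<circ> cut m (a $ i) (b $ i) \<circ> (\<lambda>x. x $ i) differentiable at x
        \<and> partial_deriv k (\<lambda>x::real^'d. complex_of_real (cut m (a $ i) (b $ i) (x $ i))) x = 0" if "i \<noteq> k" for i
    proof -
      obtain h' where "(cut m (a $ i) (b $ i) has_real_derivative h') (at (x $ i))"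
        using cut_has_derivative by blast
      with partial_deriv_coord[OF this] coord_has_derivative[OF this] that show ?thesis
        unfolding differentiable_def o_def by auto
    qed
    then have P0: "P m differentiable at x \<and> partial_deriv k (P m) x = 0"
      unfolding P_def by (intro partial_deriv_prod_0) (auto simp: o_def)
    have "(\<lambda>x::real^'d. complex_of_real (\<tau> m (x $ k))) differentiable at x"
      using C\<tau>[of 0 m] by auto
    from partial_deriv_mult[OF this conjunct1[OF P0], of k] P0
    show "partial_deriv k (\<Phi> m) x = \<Phi>' m x"
      unfolding \<Phi>_def[abs_def] \<Phi>'_def by (simp add: partial_deriv_coord[OF \<tau>(1)])
  qed
  have [measurable]: "\<Phi> m \<in> borel_measurable borel" "\<Phi>' m \<in> borel_measurable borel" for m
    using C\<Phi>[of 0 m] C\<Phi>[of 1 m] unfolding pd[of m, symmetric]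
    by (auto intro!: borel_measurable_continuous_onI)
  define L where "L = box a b \<inter> {x. x $ k < c}"
  define R where "R = box a b \<inter> {x. c < x $ k}"
  have [measurable]: "L \<in> sets borel" "R \<in> sets borel"
    unfolding L_def R_def by (auto intro!: sets.Int borel_open open_Collect_less continuous_intros)
  have "(\<lambda>m. \<integral>x. f x * \<Phi>' m x \<partial>lborel) \<longlonglongrightarrow> (\<integral>x. f x * (indicator L x - indicator R x) \<partial>lborel)"
  proof (rule integral_dominated_convergence[where w = "\<lambda>x. cmod (indicator (cbox a b) x *\<^sub>R f x)"])
    show "integrable lborel (\<lambda>x. cmod (indicator (cbox a b) x *\<^sub>R f x))"
      by (intro locally_integrable_norm f compact_cbox)
    have "(\<lambda>m. f x * \<Phi>' m x) \<longlonglongrightarrow> f x * (indicator L x - indicator R x)" for x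
    proof (intro tendsto_mult_left)
      have "(\<lambda>m. \<Phi>' m x) \<longlonglongrightarrow> of_real ((if a $ k < x $ k \<and> x $ k < c then 1 else 0)
          - (if c < x $ k \<and> x $ k < b $ k then 1 else 0))
          * (\<Prod>i\<in>UNIV - {k}. if a $ i < x $ i \<and> x $ i < b $ i then 1 else 0)"
        unfolding \<Phi>'_def P_def by (intro tendsto_mult cut_prod_tendsto tendsto_of_real tendsto_diff cut_tendsto)
      moreover have "of_real ((if a $ k < x $ k \<and> x $ k < c then 1 else 0)
          - (if c < x $ k \<and> x $ k < b $ k then 1 else 0))
          * (\<Prod>i\<in>UNIV - {k}. if a $ i < x $ i \<and> x $ i < b $ i then 1 else 0)
          = (indicator L x - indicator R x :: complex)"
      proof -
        have "a $ k < c" "c < b $ k" using ab by (auto simp: c_def)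
        moreover have "x \<in> box a b \<longleftrightarrow> a $ k < x $ k \<and> x $ k < b $ k \<and> (\<forall>i\<in>UNIV - {k}. a $ i < x $ i \<and> x $ i < b $ i)"
          by (auto simp: mem_box_cart)
        ultimately show ?thesis
          by (auto simp: prod_if_01 L_def R_def indicator_def)
      qed
      ultimately show "(\<lambda>m. \<Phi>' m x) \<longlonglongrightarrow> indicator L x - indicator R x"
        by simp
    qed
    then show "AE x in lborel. (\<lambda>m. f x * \<Phi>' m x) \<longlonglongrightarrow> f x * (indicator L x - indicator R x)" by simp
    have "\<Phi>' m x = 0" if "x \<notin> cbox a b" for m x
      using partial_deriv_support[of "cbox a b" "\<Phi> m" x k] out' that closed_cbox[of a b] by (simp add: pd)
    moreover have "cmod (\<Phi>' m x) \<le> 1" for m x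
    proof -
      have "\<bar>cut m (a $ k) c (x $ k) - cut m c (b $ k) (x $ k)\<bar> \<le> 1"
        using cut_bounds[of m "a $ k" c "x $ k"] cut_bounds[of m c "b $ k" "x $ k"] by (auto simp: abs_le_iff)
      with Ple[of m x] show ?thesis
        unfolding \<Phi>'_def norm_mult norm_of_real by (simp add: mult_le_one)
    qed
    ultimately show "AE x in lborel. norm (f x * \<Phi>' m x) \<le> cmod (indicator (cbox a b) x *\<^sub>R f x)" for m
      by (intro AE_I2) (auto simp: indicator_def norm_mult mult_left_le)
  qed measurable
  \<comment> \<open>Moving the derivative over to f leaves the tent itself, which is at most half
    the side length and lives on the box; this is the origin of the factor in the claim.\<close>
  moreover have "cmod (\<integral>x. f x * \<Phi>' m x \<partial>lborel) \<le> (b $ k - a $ k) / 2 * (LINT x:box a b|lborel. cmod (D x $ k))" for m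
  proof -
    have "(\<integral>x. f x * \<Phi>' m x \<partial>lborel) = - (\<integral>x. D x $ k * \<Phi> m x \<partial>lborel)"
      using D test[of m] unfolding has_weak_grad_def pd[of m, symmetric] by blast
    moreover have "cmod (\<integral>x. D x $ k * \<Phi> m x \<partial>lborel)
        \<le> (\<integral>x. (b $ k - a $ k) / 2 * (indicator (box a b) x *\<^sub>R cmod (D x $ k)) \<partial>lborel)"
    proof (rule Bochner_Integration.integral_norm_bound_integral)
      show "integrable lborel (\<lambda>x. D x $ k * \<Phi> m x)"
        by (rule test_function_integrable(1)[OF test Dk])
      have "set_integrable lborel (cbox a b) (\<lambda>x. D x $ k)"
        using Dk by (auto simp: locally_integrable_def)
      then have "set_integrable lborel (box a b) (\<lambda>x. D x $ k)"
        by (rule set_integrable_subset) (auto simp: box_subset_cbox)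
      then have "set_integrable lborel (box a b) (\<lambda>x. cmod (D x $ k))"
        by (rule set_integrable_norm)
      then show "integrable lborel (\<lambda>x. (b $ k - a $ k) / 2 * (indicator (box a b) x *\<^sub>R cmod (D x $ k)))"
        unfolding set_integrable_def by (rule integrable_mult_right)
      fix x
      show "norm (D x $ k * \<Phi> m x) \<le> (b $ k - a $ k) / 2 * (indicator (box a b) x *\<^sub>R cmod (D x $ k))"
      proof (cases "x \<in> box a b")
        case True
        have "\<bar>\<tau> m (x $ k)\<bar> * cmod (P m x) \<le> (b $ k - a $ k) / 2 * 1"
          by (rule mult_mono) (use \<tau>(3)[of m "x $ k"] Ple[of m x] ab in simp_all)
        then have "cmod (\<Phi> m x) \<le> (b $ k - a $ k) / 2"
          by (simp add: \<Phi>_def norm_mult)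
        then show ?thesis
          using True mult_left_mono[of "cmod (\<Phi> m x)" "(b $ k - a $ k) / 2" "cmod (D x $ k)"]
          by (simp add: norm_mult mult.commute)
      qed (simp add: out)
    qed
    ultimately show ?thesis by (simp add: set_lebesgue_integral_def)
  qed
  ultimately have "cmod (\<integral>x. f x * (indicator L x - indicator R x) \<partial>lborel)
      \<le> (b $ k - a $ k) / 2 * (LINT x:box a b|lborel. cmod (D x $ k))"
    using Lim_bounded[OF tendsto_norm, of "\<lambda>m. \<integral>x. f x * \<Phi>' m x \<partial>lborel"] by blast
  moreover have "(\<integral>x. f x * (indicator L x - indicator R x) \<partial>lborel)
      = (\<integral>x. f x * indicator L x \<partial>lborel) - (\<integral>x. f x * indicator R x \<partial>lborel)"
  proof -
    have "L \<subseteq> cbox a b" "R \<subseteq> cbox a b"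
      using box_subset_cbox[of a b] by (auto simp: L_def R_def)
    then have "integrable lborel (\<lambda>x. f x * indicator L x)" "integrable lborel (\<lambda>x. f x * indicator R x)"
      by (auto intro!: locally_integrable_mult_indicator[OF f compact_cbox[of a b]])
    then show ?thesis by (simp add: right_diff_distrib)
  qed
  ultimately show ?thesis
    unfolding set_integral_eq_mult[where f = f] L_def[symmetric] R_def[symmetric] by simp
qed

section \<open>Weak gradients\<close>

lemma lborel_shift:
  fixes f :: "'a::euclidean_space \<Rightarrow> 'b::{banach, second_countable_topology}"
  assumes [measurable]: "f \<in> borel_measurable borel"
  shows "integrable lborel (\<lambda>x. f (x + y)) \<longleftrightarrow> integrable lborel f"
    and "(\<integral>x. f (x + y) \<partial>lborel) = (\<integral>x. f x \<partial>lborel)"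
proof -
  have "integrable (distr lborel borel ((+) y)) f \<longleftrightarrow> integrable lborel (\<lambda>x. f (y + x))"
    by (rule integrable_distr_eq) auto
  then show "integrable lborel (\<lambda>x. f (x + y)) \<longleftrightarrow> integrable lborel f"
    by (simp add: lborel_distr_plus add.commute)
  have "integral\<^sup>L (distr lborel borel ((+) y)) f = (\<integral>x. f (y + x) \<partial>lborel)"
    by (rule integral_distr) auto
  then show "(\<integral>x. f (x + y) \<partial>lborel) = (\<integral>x. f x \<partial>lborel)"
    by (simp add: lborel_distr_plus add.commute)
qed

text \<open>By translation invariance the difference quotients have integral zero, and they converge
  to the partial derivative boundedly with common compact support. No iterated integration is
  involved.\<close>

lemma integral_partial_deriv_eq_0:
  fixes f :: "real^'d::finite \<Rightarrow> complex"
  assumes C: "C_k 1 f" and K: "compact K" "\<And>x. x \<notin> K \<Longrightarrow> f x = 0"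
  shows "(\<integral>x. partial_deriv k f x \<partial>lborel) = 0"
proof -
  let ?e = "axis k 1 :: real^'d"
  have df: "f differentiable (at x)" and cont: "continuous_on UNIV (partial_deriv k f)" for x
    using C by auto
  have cf: "continuous_on UNIV f"
    using C_k_continuous[OF C] .
  have [measurable]: "f \<in> borel_measurable borel" "partial_deriv k f \<in> borel_measurable borel"
    using cf cont by (auto intro: borel_measurable_continuous_onI)
  obtain M where M: "M \<ge> 0" "\<And>x. cmod (partial_deriv k f x) \<le> M"
    using continuous_compact_support_bounded[OF cont K(1) partial_deriv_support[OF compact_imp_closed[OF K(1)] K(2)]]
    by blast
  have line: "((\<lambda>t. f (x + t *\<^sub>R ?e)) has_vector_derivative partial_deriv k f (x + t *\<^sub>R ?e)) (at t)" for x t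
  proof -
    have "((\<lambda>t. x + t *\<^sub>R ?e) has_derivative (\<lambda>s. s *\<^sub>R ?e)) (at t)"
      by (auto intro!: derivative_eq_intros)
    moreover have d: "(f has_derivative frechet_derivative f (at (x + t *\<^sub>R ?e))) (at (x + t *\<^sub>R ?e))"
      using df frechet_derivative_works by blast
    ultimately have "((\<lambda>t. f (x + t *\<^sub>R ?e)) has_derivative (\<lambda>s. frechet_derivative f (at (x + t *\<^sub>R ?e)) (s *\<^sub>R ?e))) (at t)"
      by (rule has_derivative_compose)
    then show ?thesis
      unfolding has_vector_derivative_def partial_deriv_def
      using linear_scale[OF has_derivative_linear[OF d]] by simp
  qed
  define h where "h m = 1 / real (Suc m)" for m
  have h: "h m > 0" "h m \<le> 1" for m by (auto simp: h_def)
  have h0: "filterlim h (at 0) sequentially"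
    unfolding filterlim_at
  proof
    show "\<forall>\<^sub>F m in sequentially. h m \<in> UNIV \<and> h m \<noteq> 0"
      using h(1) by (simp add: less_imp_neq[symmetric])
    show "h \<longlonglongrightarrow> 0"
      using LIMSEQ_inverse_real_of_nat unfolding h_def inverse_eq_divide .
  qed
  define g where "g m x = (f (x + h m *\<^sub>R ?e) - f x) /\<^sub>R h m" for m x
  obtain R where R: "\<And>x. x \<in> K \<Longrightarrow> norm x \<le> R"
    using compact_imp_bounded[OF K(1)] by (auto simp: bounded_iff)
  \<comment> \<open>The steps \<open>h m\<close> are at most 1, so the quotient can only be nonzero
    within distance 1 of the support, whence the radius R + 1.\<close>
  have "(\<lambda>m. \<integral>x. g m x \<partial>lborel) \<longlonglongrightarrow> (\<integral>x. partial_deriv k f x \<partial>lborel)"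
  proof (rule integral_dominated_convergence[where w = "\<lambda>x. indicator (cball 0 (R + 1)) x *\<^sub>R M"])
    show "integrable lborel (\<lambda>x::real^'d. indicator (cball 0 (R + 1)) x *\<^sub>R M)"
      by (rule borel_integrable_compact) (auto intro: continuous_intros)
    have "(\<lambda>m. g m x) \<longlonglongrightarrow> partial_deriv k f x" for x
    proof -
      have "((\<lambda>t. (f (x + t *\<^sub>R ?e) - f x - t *\<^sub>R partial_deriv k f x) /\<^sub>R \<bar>t\<bar>) \<longlongrightarrow> 0) (at 0)"
        using line[of x 0] unfolding has_vector_derivative_def has_derivative_at_within by simp
      from filterlim_compose[OF this h0]
      have "(\<lambda>m. g m x - partial_deriv k f x) \<longlonglongrightarrow> 0"
      proof (rule Lim_transform_eventually[OF _ always_eventually[OF allI]])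
        fix m
        show "(f (x + h m *\<^sub>R ?e) - f x - h m *\<^sub>R partial_deriv k f x) /\<^sub>R \<bar>h m\<bar> = g m x - partial_deriv k f x"
          using h(1)[of m] unfolding g_def by (simp add: scaleR_diff_right)
      qed
      then show ?thesis by (simp add: LIM_zero_iff)
    qed
    then show "AE x in lborel. (\<lambda>m. g m x) \<longlonglongrightarrow> partial_deriv k f x" by simp
    have "norm (g m x) \<le> M" for m x
    proof -
      have "norm (f (x + h m *\<^sub>R ?e) - f (x + 0 *\<^sub>R ?e)) \<le> M * norm (h m - 0)"
      proof (rule differentiable_bound[where S = UNIV and f = "\<lambda>t. f (x + t *\<^sub>R ?e)"
            and f' = "\<lambda>t s. s *\<^sub>R partial_deriv k f (x + t *\<^sub>R ?e)"])
        show "((\<lambda>t. f (x + t *\<^sub>R ?e)) has_derivative (\<lambda>s. s *\<^sub>R partial_deriv k f (x + t *\<^sub>R ?e))) (at t within UNIV)" for t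
          using line[of x t] by (simp add: has_vector_derivative_def)
        show "onorm (\<lambda>s. s *\<^sub>R partial_deriv k f (x + t *\<^sub>R ?e)) \<le> M" for t
          by (rule onorm_le) (use M(2)[of "x + t *\<^sub>R ?e"] in \<open>simp add: mult.commute[of M] mult_left_mono\<close>)
      qed auto
      then show ?thesis
        using h(1)[of m] unfolding g_def norm_scaleR by (simp add: field_simps)
    qed
    moreover have "g m x = 0" if "x \<notin> cball 0 (R + 1)" for m x
    proof -
      have "norm x > R + 1" using that by (simp add: dist_norm)
      moreover have "norm x \<le> norm (x + h m *\<^sub>R ?e) + h m"
        using norm_triangle_ineq4[of "x + h m *\<^sub>R ?e" "h m *\<^sub>R ?e"] h(1)[of m] by (simp add: norm_axis_1)
      ultimately have "norm x > R" "norm (x + h m *\<^sub>R ?e) > R"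
        using h(2)[of m] h(1)[of m] by auto
      then have "x \<notin> K" "x + h m *\<^sub>R ?e \<notin> K"
        using R by force+
      then show ?thesis by (simp add: g_def K(2))
    qed
    ultimately show "AE x in lborel. norm (g m x) \<le> indicator (cball 0 (R + 1)) x *\<^sub>R M" for m
      by (intro AE_I2) (auto simp: indicator_def)
  qed (auto simp: g_def)
  moreover have "(\<integral>x. g m x \<partial>lborel) = 0" for m
  proof -
    have "integrable lborel (\<lambda>x. indicator K x *\<^sub>R f x)"
      by (rule borel_integrable_compact[OF K(1)]) (rule continuous_on_subset[OF cf], simp)
    moreover have "(\<lambda>x. indicator K x *\<^sub>R f x) = f"
      using K(2) by (auto simp: indicator_def fun_eq_iff)
    ultimately have "integrable lborel f" by simp
    then show ?thesis
      unfolding g_def by (simp add: lborel_shift)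
  qed
  ultimately show ?thesis by (simp add: LIMSEQ_const_iff)
qed

lemma locally_integrable_continuous: "continuous_on UNIV f \<Longrightarrow> locally_integrable f"
  unfolding locally_integrable_def set_integrable_def
  by (auto intro!: borel_integrable_compact intro: continuous_on_subset)

text \<open>The product with another test function has compact support, so its derivative integrates
  to zero and the product rule becomes integration by parts. The result puts test functions into the
  energy spaces.\<close>

lemma has_weak_grad_test:
  assumes f: "f \<in> test_functions"
  shows "has_weak_grad f (\<lambda>x. \<chi> k. partial_deriv k f x)"
proof -
  have C: "C_k n f" for n by (rule test_function_C_k[OF f])
  have cont: "continuous_on UNIV f" "continuous_on UNIV (partial_deriv k f)" for k
    using C[of 0] C[of 1] by auto
  have "(\<integral>x. f x * partial_deriv k \<phi> x \<partial>lborel) = - (\<integral>x. partial_deriv k f x * \<phi> x \<partial>lborel)"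
    if \<phi>: "\<phi> \<in> test_functions" for \<phi> k
  proof -
    obtain K where K: "compact K" "\<And>x. x \<notin> K \<Longrightarrow> f x = 0"
      by (rule test_function_support[OF f], rule that)
    have "(\<integral>x. partial_deriv k (\<lambda>x. f x * \<phi> x) x \<partial>lborel) = 0"
      by (rule integral_partial_deriv_eq_0[OF C_k_mult[OF C test_function_C_k[OF \<phi>]] K(1)]) (simp add: K)
    moreover have "partial_deriv k (\<lambda>x. f x * \<phi> x) x = f x * partial_deriv k \<phi> x + partial_deriv k f x * \<phi> x" for x
      using C[of 1] test_function_C_k[OF \<phi>, of 1] by (intro partial_deriv_mult) auto
    moreover have "integrable lborel (\<lambda>x. f x * partial_deriv k \<phi> x)" "integrable lborel (\<lambda>x. partial_deriv k f x * \<phi> x)"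
      using test_function_integrable[OF \<phi> locally_integrable_continuous] cont by auto
    ultimately show ?thesis by (simp add: eq_neg_iff_add_eq_0)
  qed
  then show ?thesis
    using cont by (auto simp: has_weak_grad_def locally_integrable_continuous)
qed

text \<open>Both sides choose from the same set of derivatives, because differentiability at the two
  points is equivalent. The identity therefore holds also where f is not differentiable.\<close>

lemma partial_deriv_shift: "partial_deriv k (\<lambda>x. f (x + y)) x = partial_deriv k f (x + y)"
proof -
  have shift: "((\<lambda>x. g (x + z)) has_derivative g') (at x)"
    if "(g has_derivative g') (at (x + z))" for g :: "real^'a \<Rightarrow> complex" and g' x z
  proof -
    have "((\<lambda>x. x + z) has_derivative (\<lambda>v. v)) (at x)"
      by (auto intro!: derivative_eq_intros)
    from has_derivative_compose[OF this, of g g'] that show ?thesis by simp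
  qed
  have "((\<lambda>x. f (x + y)) has_derivative f') (at x) \<longleftrightarrow> (f has_derivative f') (at (x + y))" for f'
    using shift[of f f' x y] shift[of "\<lambda>x. f (x + y)" f' "x + y" "- y"] by auto
  then show ?thesis by (simp add: partial_deriv_def frechet_derivative_def)
qed

lemma locally_integrable_shift:
  fixes y :: "real^'d::finite"
  assumes "locally_integrable f"
  shows "locally_integrable (\<lambda>x. f (x + y))"
  unfolding locally_integrable_def
proof (intro allI impI)
  fix K :: "(real^'d) set" assume K: "compact K"
  let ?K = "(\<lambda>x. x + y) ` K"
  have "compact ?K"
    by (intro compact_continuous_image continuous_intros K)
  then have "integrable lborel (\<lambda>x. indicator ?K x *\<^sub>R f x)" and [measurable]: "?K \<in> sets borel"
    using assms by (auto simp: locally_integrable_def set_integrable_def compact_imp_closed)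
  moreover have [measurable]: "f \<in> borel_measurable borel"
    by (rule locally_integrable_borel[OF assms])
  ultimately have "integrable lborel (\<lambda>x. indicator ?K (x + y) *\<^sub>R f (x + y))"
    using lborel_shift(1)[of "\<lambda>x. indicator ?K x *\<^sub>R f x" y] by simp
  moreover have "indicator ?K (x + y) = (indicator K x :: real)" for x
    by (auto simp: indicator_def)
  ultimately show "set_integrable lborel K (\<lambda>x. f (x + y))"
    by (simp add: set_integrable_def)
qed

lemma locally_integrable_add:
  "locally_integrable f \<Longrightarrow> locally_integrable g \<Longrightarrow> locally_integrable (\<lambda>x. f x + g x)"
  by (auto simp: locally_integrable_def)

lemma locally_integrable_cmult: "locally_integrable f \<Longrightarrow> locally_integrable (\<lambda>x. a * f x)"
  by (auto simp: locally_integrable_def)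

lemma has_weak_grad_add:
  assumes "has_weak_grad f D" "has_weak_grad g E"
  shows "has_weak_grad (\<lambda>x. f x + g x) (\<lambda>x. D x + E x)"
  unfolding has_weak_grad_def
proof (intro conjI allI ballI)
  fix k and \<phi> :: "real^'a \<Rightarrow> complex"
  assume \<phi>: "\<phi> \<in> test_functions"
  note test_function_integrable[OF \<phi>]
  with assms \<phi> show "(\<integral>x. (f x + g x) * partial_deriv k \<phi> x \<partial>lborel) = - (\<integral>x. (D x + E x) $ k * \<phi> x \<partial>lborel)"
    unfolding has_weak_grad_def by (simp add: distrib_right)
qed (use assms in \<open>auto simp: has_weak_grad_def intro: locally_integrable_add\<close>)

lemma has_weak_grad_cmult:
  assumes "has_weak_grad f D"
  shows "has_weak_grad (\<lambda>x. a * f x) (\<lambda>x. a *s D x)"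
  unfolding has_weak_grad_def
proof (intro conjI allI ballI)
  fix k and \<phi> :: "real^'a \<Rightarrow> complex"
  assume \<phi>: "\<phi> \<in> test_functions"
  with assms show "(\<integral>x. a * f x * partial_deriv k \<phi> x \<partial>lborel) = - (\<integral>x. (a *s D x) $ k * \<phi> x \<partial>lborel)"
    unfolding has_weak_grad_def by (simp add: mult.assoc)
qed (use assms in \<open>auto simp: has_weak_grad_def intro: locally_integrable_cmult\<close>)

lemma C_k_shift: "C_k n f \<Longrightarrow> C_k n (\<lambda>x. f (x + y))"
proof (induction n arbitrary: f)
  case 0
  then show ?case by (auto intro!: continuous_on_compose2[of UNIV f] continuous_intros)
next
  case (Suc n)
  have "(\<lambda>x. f (x + y)) differentiable (at x)" for x
  proof -
    have "(f has_derivative frechet_derivative f (at (x + y))) (at (x + y))"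
      using Suc.prems frechet_derivative_works by auto
    moreover have "((\<lambda>x. x + y) has_derivative (\<lambda>v. v)) (at x)"
      by (auto intro!: derivative_eq_intros)
    ultimately show ?thesis
      using has_derivative_compose unfolding differentiable_def by blast
  qed
  moreover have "partial_deriv k (\<lambda>x. f (x + y)) = (\<lambda>x. partial_deriv k f (x + y))" for k
    by (auto simp: partial_deriv_shift)
  ultimately show ?case using Suc by simp
qed

lemma test_functions_shift:
  assumes "\<phi> \<in> test_functions"
  shows "(\<lambda>x. \<phi> (x + y)) \<in> test_functions"
proof -
  obtain K where K: "compact K" "\<And>x. x \<notin> K \<Longrightarrow> \<phi> x = 0"
    by (rule test_function_support[OF assms], rule that)
  have "compact ((\<lambda>x. x - y) ` K)"
    by (intro compact_continuous_image continuous_intros K)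
  moreover have "\<phi> (x + y) = 0" if "x \<notin> (\<lambda>x. x - y) ` K" for x
    using that K(2)[of "x + y"] by (metis add_diff_cancel imageI)
  ultimately show ?thesis
    using C_k_shift[OF test_function_C_k[OF assms]] unfolding test_functions_def by blast
qed

lemma has_weak_grad_shift:
  fixes y :: "real^'d::finite"
  assumes D: "has_weak_grad f D"
  shows "has_weak_grad (\<lambda>x. f (x + y)) (\<lambda>x. D (x + y))"
  unfolding has_weak_grad_def
proof (intro conjI allI ballI)
  fix k and \<phi> :: "real^'d \<Rightarrow> complex"
  assume \<phi>: "\<phi> \<in> test_functions"
  define \<psi> where "\<psi> x = \<phi> (x + (- y))" for x
  have \<psi>: "\<psi> \<in> test_functions"
    unfolding \<psi>_def by (rule test_functions_shift[OF \<phi>])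
  have li: "locally_integrable f" "locally_integrable (\<lambda>x. D x $ k)"
    using D by (auto simp: has_weak_grad_def)
  have [measurable]: "(\<lambda>x. f x * partial_deriv k \<psi> x) \<in> borel_measurable borel"
    "(\<lambda>x. D x $ k * \<psi> x) \<in> borel_measurable borel"
    using borel_measurable_integrable[OF test_function_integrable(2)[OF \<psi> li(1), of k]]
      borel_measurable_integrable[OF test_function_integrable(1)[OF \<psi> li(2)]]
    by simp_all
  have "(\<integral>x. f (x + y) * partial_deriv k \<psi> (x + y) \<partial>lborel) = - (\<integral>x. D (x + y) $ k * \<psi> (x + y) \<partial>lborel)"
    using D \<psi> lborel_shift(2)[of "\<lambda>x. f x * partial_deriv k \<psi> x" y] lborel_shift(2)[of "\<lambda>x. D x $ k * \<psi> x" y]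
    by (simp add: has_weak_grad_def)
  moreover have "partial_deriv k \<psi> (x + y) = partial_deriv k \<phi> x" for x
    unfolding \<psi>_def by (subst partial_deriv_shift) simp
  ultimately show "(\<integral>x. f (x + y) * partial_deriv k \<phi> x \<partial>lborel) = - (\<integral>x. D (x + y) $ k * \<phi> x \<partial>lborel)"
    by (simp add: \<psi>_def)
qed (use D locally_integrable_shift in \<open>auto simp: has_weak_grad_def\<close>)

section \<open>Boxes\<close>

text \<open>An arbitrary but fixed enumeration of the coordinates; it settles only the order in
  which the directions are halved.\<close>

definition idx :: "'d::finite \<Rightarrow> nat" where
  "idx = (SOME f. bij_betw f UNIV {0..<CARD('d)})"

lemma idx_bij: "bij_betw (idx :: 'd::finite \<Rightarrow> nat) UNIV {0..<CARD('d)}"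
  unfolding idx_def
  by (rule someI_ex[of "\<lambda>f. bij_betw f UNIV {0..<CARD('d)}"], rule ex_bij_betw_finite_nat) simp

lemma idx_less: "idx (k :: 'd::finite) < CARD('d)"
  using bij_betwE[OF idx_bij, rule_format, of k] by simp

text \<open>Raising the level \<open>n\<close> by one halves the box in the single direction \<open>dir n\<close>, cyclically, so that a box of
  level \<open>n\<close> has volume \<open>2 powr - n\<close> in every dimension.\<close>

definition lev :: "int \<Rightarrow> 'd::finite \<Rightarrow> int" where
  "lev n k = (n + int (idx k)) div int CARD('d)"

text \<open>The coordinate k for which n + 1 + \<open>idx k\<close> is a multiple of d: there, and
  only there, the floor in \<open>lev\<close> jumps between n and n + 1.\<close>

definition dir :: "int \<Rightarrow> 'd::finite" where
  "dir n = inv_into UNIV idx (nat ((- (n + 1)) mod int CARD('d)))"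

lemma idx_dir: "int (idx (dir n :: 'd::finite)) = (- (n + 1)) mod int CARD('d)"
proof -
  let ?j = "nat ((- (n + 1)) mod int CARD('d))"
  have "0 \<le> (- (n + 1)) mod int CARD('d)" "(- (n + 1)) mod int CARD('d) < int CARD('d)"
    by (simp_all add: zero_less_card_finite)
  then have "?j \<in> range (idx :: 'd \<Rightarrow> nat)"
    using bij_betw_imp_surj_on[OF idx_bij[where 'd = 'd]] by (auto simp: nat_less_iff)
  then have "idx (dir n :: 'd) = ?j"
    unfolding dir_def by (rule f_inv_into_f)
  then show ?thesis by simp
qed

lemma div_add_one:
  fixes m d :: int
  assumes "d > 0"
  shows "(m + 1) div d = m div d + (if d dvd m + 1 then 1 else 0)"
proof (cases "d dvd m + 1")
  case True
  then obtain q where q: "m + 1 = d * q" ..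
  have "m div d = q - 1"
    by (rule int_div_pos_eq[of m d "q - 1" "d - 1"]) (use q assms in \<open>auto simp: algebra_simps\<close>)
  then show ?thesis using q assms by simp
next
  case False
  have "m mod d < d - 1"
  proof (rule ccontr)
    assume "\<not> ?thesis"
    then have "m mod d = d - 1" using assms pos_mod_bound[of d m] by linarith
    then have "m + 1 = d * (m div d) + d"
      using mult_div_mod_eq[of d m] by linarith
    then have "m + 1 = d * (m div d + 1)" by (simp add: algebra_simps)
    then show False using False by (metis dvd_triv_left)
  qed
  then have "(m + 1) div d = m div d"
    by (intro int_div_pos_eq[of _ _ _ "m mod d + 1"]) (use assms pos_mod_sign[of d m] in auto)
  then show ?thesis using False by simp
qed

lemma lev_Suc: "lev (n + 1) k = lev n k + (if k = dir n then 1 else 0)"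
proof -
  let ?d = "int CARD('a)"
  have "?d dvd n + int (idx k) + 1 \<longleftrightarrow> k = dir n"
  proof
    assume "?d dvd n + int (idx k) + 1"
    then have "?d dvd int (idx k) - (- (n + 1))" by (simp add: algebra_simps)
    then have "int (idx k) mod ?d = (- (n + 1)) mod ?d" by (simp add: mod_eq_dvd_iff)
    then have "idx k = idx (dir n :: 'a)"
      using idx_dir[of n, where 'd = 'a] idx_less[of k] by simp
    then show "k = dir n"
      using idx_bij[where 'd = 'a] by (auto simp: bij_betw_def inj_on_def)
  next
    assume "k = dir n"
    then have "int (idx k) mod ?d = (- (n + 1)) mod ?d"
      using idx_dir[of n, where 'd = 'a] by simp
    then have "?d dvd int (idx k) - (- (n + 1))" by (simp add: mod_eq_dvd_iff)
    then show "?d dvd n + int (idx k) + 1" by (simp add: algebra_simps)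
  qed
  then show ?thesis
    using div_add_one[of ?d "n + int (idx k)"] by (simp add: lev_def algebra_simps zero_less_card_finite)
qed

text \<open>At n = 0 all levels are 0, and each step raises exactly one of them; the induction runs
  in both directions since coarse boxes have negative level. This is what fixes the volume of a
  box.\<close>

lemma sum_lev: "(\<Sum>k\<in>UNIV. lev n (k :: 'd::finite)) = n"
proof (induction n rule: int_induct[of _ 0])
  case base
  have "int (idx k) div int CARD('d) = 0" for k :: 'd
    using idx_less[of k] by (intro div_pos_pos_trivial) auto
  then show ?case by (simp add: lev_def)
next
  case (step1 i)
  then show ?case by (simp add: lev_Suc sum.distrib)
next
  case (step2 i)
  then show ?case using lev_Suc[of "i - 1", where 'a = 'd] by (simp add: sum.distrib)
qed

definition side :: "int \<Rightarrow> 'd::finite \<Rightarrow> real" where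
  "side n k = 2 powr (- real_of_int (lev n k))"

lemma side_pos [simp]: "side n k > 0"
  by (simp add: side_def)

lemma side_Suc: "side (n + 1) k = (if k = dir n then side n k / 2 else side n k)"
  by (simp add: side_def lev_Suc powr_diff powr_minus_divide)

text \<open>The integer division lags behind n/d by less than one, so a side exceeds the ideal
  length of a cube of the same volume by less than one halving, hence the factor 2.\<close>

lemma side_le: "side n (k :: 'd::finite) \<le> 2 * 2 powr (- real_of_int n / real CARD('d))"
proof -
  let ?d = "int CARD('d)"
  have d: "?d > 0" by (simp add: zero_less_card_finite)
  have "n + int (idx k) < ?d * (lev n k + 1)"
    using mult_div_mod_eq[of ?d "n + int (idx k)"] pos_mod_bound[OF d, of "n + int (idx k)"]
    unfolding lev_def distrib_left by linarith
  then have "n < ?d * (lev n k + 1)" by simp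
  then have "real_of_int n < real_of_int (?d * (lev n k + 1))"
    by (simp only: of_int_less_iff)
  then have "real_of_int n / real CARD('d) < real_of_int (lev n k) + 1"
    using d by (simp add: field_simps)
  then have "side n k \<le> 2 powr (1 + (- real_of_int n / real CARD('d)))"
    unfolding side_def by (intro powr_mono) auto
  also have "\<dots> = 2 * 2 powr (- real_of_int n / real CARD('d))"
    by (subst powr_add) simp
  finally show ?thesis .
qed

lemma prod_side: "(\<Prod>k\<in>UNIV. side n (k :: 'd::finite)) = 2 powr (- real_of_int n)"
proof -
  have "(\<Prod>k\<in>UNIV. side n (k :: 'd)) = 2 powr (\<Sum>k\<in>UNIV. - real_of_int (lev n (k :: 'd)))"
    by (simp add: side_def powr_sum)
  also have "(\<Sum>k\<in>UNIV. - real_of_int (lev n (k :: 'd))) = - real_of_int n"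
    unfolding sum_negf of_int_sum[symmetric] sum_lev ..
  finally show ?thesis .
qed

text \<open>The half-open grid box of level n that contains x, indexed by the point rather than by
  the grid position. Equality of floors is an equivalence relation, so two boxes of one level
  coincide or are disjoint.\<close>

definition Bx :: "int \<Rightarrow> real^'d::finite \<Rightarrow> (real^'d) set" where
  "Bx n x = {y. \<forall>k. \<lfloor>y $ k / side n k\<rfloor> = \<lfloor>x $ k / side n k\<rfloor>}"

definition lo :: "int \<Rightarrow> real^'d::finite \<Rightarrow> real^'d" where
  "lo n x = (\<chi> k. side n k * of_int \<lfloor>x $ k / side n k\<rfloor>)"

definition hi :: "int \<Rightarrow> real^'d::finite \<Rightarrow> real^'d" where
  "hi n x = (\<chi> k. lo n x $ k + side n k)"

lemma Bx_refl [simp]: "x \<in> Bx n x"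
  by (simp add: Bx_def)

lemma Bx_sym: "y \<in> Bx n x \<longleftrightarrow> x \<in> Bx n y"
  by (auto simp: Bx_def)

lemma Bx_eq: "y \<in> Bx n x \<Longrightarrow> Bx n y = Bx n x"
  by (auto simp: Bx_def)

lemma Bx_iff: "y \<in> Bx n x \<longleftrightarrow> (\<forall>k. lo n x $ k \<le> y $ k \<and> y $ k < hi n x $ k)"
proof -
  have "\<lfloor>t / s\<rfloor> = j \<longleftrightarrow> s * of_int j \<le> t \<and> t < s * of_int j + s" if "s > 0" for s t :: real and j
    using that by (simp add: floor_eq_iff field_simps)
  then show ?thesis by (simp add: Bx_def lo_def hi_def)
qed

lemma box_subset_Bx: "box (lo n x) (hi n x) \<subseteq> Bx n x"
  by (auto simp: Bx_iff mem_box_cart less_imp_le)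

lemma Bx_subset_cbox: "Bx n x \<subseteq> cbox (lo n x) (hi n x)"
  by (auto simp: Bx_iff mem_box_cart less_imp_le)

lemma sets_Bx [measurable, simp]: "Bx n x \<in> sets borel"
proof -
  have "Bx n x = (\<Inter>k. {y. lo n x $ k \<le> y $ k} \<inter> {y. y $ k < hi n x $ k})"
    by (auto simp: Bx_iff)
  also have "\<dots> \<in> sets borel"
    by (intro sets.countable_INT'' sets.Int borel_closed borel_open closed_Collect_le open_Collect_less continuous_intros) auto
  finally show ?thesis .
qed

text \<open>Joint measurability is what Tonelli needs for the averaging kernel. Equality of the
  integer floors is rewritten as two inequalities between real numbers, to which the measurability
  of the real-valued floor applies.\<close>

lemma measurable_mem_Bx [measurable]:
  "Measurable.pred (borel \<Otimes>\<^sub>M borel) (\<lambda>p. snd p \<in> Bx n (fst p))"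
proof -
  have [measurable]: "(\<lambda>x::real^'a. x $ k) \<in> borel_measurable borel" for k
    by (intro borel_measurable_continuous_onI continuous_intros)
  have "(\<lambda>p::(real^'a) \<times> (real^'a). snd p \<in> Bx n (fst p)) = (\<lambda>p.
      (\<forall>k\<in>UNIV. real_of_int \<lfloor>snd p $ k / side n k\<rfloor> \<le> real_of_int \<lfloor>fst p $ k / side n k\<rfloor>
        \<and> real_of_int \<lfloor>fst p $ k / side n k\<rfloor> \<le> real_of_int \<lfloor>snd p $ k / side n k\<rfloor>))"
    unfolding of_int_le_iff order.eq_iff[symmetric] by (simp add: Bx_def)
  also have "Measurable.pred (borel \<Otimes>\<^sub>M borel) \<dots>"
  proof (rule pred_intros_finite(3)[OF finite])
    fix k :: 'a

    have "(\<lambda>p::(real^'a) \<times> (real^'a). snd p $ k / side n k) \<in> borel_measurable (borel \<Otimes>\<^sub>M borel)"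
      "(\<lambda>p::(real^'a) \<times> (real^'a). fst p $ k / side n k) \<in> borel_measurable (borel \<Otimes>\<^sub>M borel)"
      by measurable
    from this[THEN measurable_compose[OF _ borel_measurable_real_floor]]
    show "Measurable.pred (borel \<Otimes>\<^sub>M borel) (\<lambda>p::(real^'a) \<times> (real^'a).
        real_of_int \<lfloor>snd p $ k / side n k\<rfloor> \<le> real_of_int \<lfloor>fst p $ k / side n k\<rfloor>
        \<and> real_of_int \<lfloor>fst p $ k / side n k\<rfloor> \<le> real_of_int \<lfloor>snd p $ k / side n k\<rfloor>)"
      by measurable
  qed
  finally show ?thesis .
qed

lemma AE_coord_neq: "AE y in lborel. (y :: real^'d::finite) $ k \<noteq> c"
proof -
  have "axis k 1 \<in> (Basis :: (real^'d) set)" by (auto simp: Basis_vec_def)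
  from AE_lborel_inner_neq[OF this, of c] show ?thesis
    by (simp add: inner_axis)
qed

text \<open>The weak gradient is tested on open boxes, while the grid consists of half-open ones;
  the two differ only in finitely many hyperplanes.\<close>

lemma AE_box_Bx: "AE y in lborel. y \<in> box (lo n x) (hi n x) \<longleftrightarrow> y \<in> Bx n x"
proof -
  have "AE y in lborel. \<forall>k\<in>UNIV. y $ k \<noteq> lo n x $ k"
    by (intro AE_finite_allI) (auto intro: AE_coord_neq)
  then show ?thesis
  proof eventually_elim
    case (elim y)
    have "lo n x $ k \<le> y $ k \<longleftrightarrow> lo n x $ k < y $ k" for k
      using elim by (metis UNIV_I less_le)
    then show ?case by (simp add: Bx_iff mem_box_cart)
  qed
qed

lemma emeasure_Bx:
  fixes x :: "real^'d::finite"
  shows "emeasure lborel (Bx n x) = ennreal (2 powr (- real_of_int n))"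
proof -
  have "emeasure lborel (Bx n x) = emeasure lborel (box (lo n x) (hi n x))"
    using AE_box_Bx[of n x] by (intro emeasure_eq_AE) (auto elim!: eventually_mono)
  also have "\<dots> = ennreal (\<Prod>b\<in>Basis. (hi n x - lo n x) \<bullet> b)"
    by (rule emeasure_lborel_box) (auto simp: Basis_vec_def inner_axis hi_def less_imp_le)
  also have "(\<Prod>b\<in>Basis. (hi n x - lo n x) \<bullet> b) = (\<Prod>k\<in>UNIV. side n (k :: 'd))"
    unfolding Basis_vec_def
    by (subst prod.reindex_bij_betw[of "\<lambda>k. axis k 1" UNIV, symmetric])
      (auto simp: hi_def inner_axis bij_betw_def inj_on_def axis_eq_axis)
  finally show ?thesis by (simp add: prod_side)
qed

lemma measure_Bx: "measure lborel (Bx n x) = 2 powr (- real_of_int n)"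
  by (simp add: measure_def emeasure_Bx)

lemma floor_half: "\<lfloor>t / 2\<rfloor> = \<lfloor>t\<rfloor> div 2" for t :: real
  using floor_divide_real_eq_div[of 2 t] by simp

text \<open>Halving a side makes the old floor the integer half of the new one, so the finer floors
  determine the coarser ones.\<close>

lemma Bx_Suc_subset:
  fixes x :: "real^'d::finite"
  shows "Bx (n + 1) x \<subseteq> Bx n x"
proof
  fix y assume y: "y \<in> Bx (n + 1) x"
  have *: "\<lfloor>z $ k / side n k\<rfloor> = (if k = dir n then \<lfloor>z $ k / side (n + 1) k\<rfloor> div 2 else \<lfloor>z $ k / side (n + 1) k\<rfloor>)"
    for z :: "real^'d" and k
    unfolding side_Suc by (simp add: floor_half[symmetric])
  have "\<lfloor>y $ k / side n k\<rfloor> = \<lfloor>x $ k / side n k\<rfloor>" for k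
    using y unfolding Bx_def *[of y k] *[of x k] by simp
  then show "y \<in> Bx n x" by (simp add: Bx_def)
qed

lemma Bx_mono: "n \<le> m \<Longrightarrow> Bx m x \<subseteq> Bx n x"
proof (induction m rule: int_ge_induct)
  case (step i)
  then show ?case using Bx_Suc_subset by blast
qed simp

text \<open>Inside a box of level n the refined floor in direction \<open>dir n\<close> takes just
  two values, 2j and 2j + 1. Floors are closed on the left, so the midpoint goes to the right
  half.\<close>

lemma Bx_Suc_eq:
  fixes n and x :: "real^'d::finite"
  defines "c \<equiv> (lo n x $ dir n + hi n x $ dir n) / 2"
  shows "Bx (n + 1) x = (if x $ dir n < c then Bx n x \<inter> {y. y $ dir n < c} else Bx n x \<inter> {y. c \<le> y $ dir n})"
proof -
  define s where "s = side n (dir n :: 'd)"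
  define j where "j = \<lfloor>x $ dir n / s\<rfloor>"
  have s: "s > 0" by (simp add: s_def)
  have c: "c = s * (of_int j + 1 / 2)"
    by (simp add: c_def lo_def hi_def s_def j_def field_simps)
  have half: "\<lfloor>y $ dir n / (s / 2)\<rfloor> = (if y $ dir n < c then 2 * j else 2 * j + 1)"
    if "\<lfloor>y $ dir n / s\<rfloor> = j" for y :: "real^'d"
  proof -
    have "of_int j \<le> y $ dir n / s" "y $ dir n / s < of_int j + 1"
      using that by linarith+
    then have "s * of_int j \<le> y $ dir n" "y $ dir n < s * (of_int j + 1)"
      using s by (simp_all add: field_simps)
    then show ?thesis
      using s c by (auto simp: floor_eq_iff field_simps)
  qed
  have *: "y \<in> Bx (n + 1) x \<longleftrightarrow> y \<in> Bx n x \<and> \<lfloor>y $ dir n / (s / 2)\<rfloor> = \<lfloor>x $ dir n / (s / 2)\<rfloor>" for y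
  proof
    assume "y \<in> Bx (n + 1) x"
    moreover from this have "\<lfloor>y $ (dir n :: 'd) / side (n + 1) (dir n :: 'd)\<rfloor> = \<lfloor>x $ dir n / side (n + 1) (dir n :: 'd)\<rfloor>"
      unfolding Bx_def by blast
    ultimately show "y \<in> Bx n x \<and> \<lfloor>y $ dir n / (s / 2)\<rfloor> = \<lfloor>x $ dir n / (s / 2)\<rfloor>"
      using Bx_Suc_subset by (auto simp: side_Suc s_def)
  next
    assume "y \<in> Bx n x \<and> \<lfloor>y $ dir n / (s / 2)\<rfloor> = \<lfloor>x $ dir n / (s / 2)\<rfloor>"
    then show "y \<in> Bx (n + 1) x"
      by (auto simp: Bx_def side_Suc s_def)
  qed
  have x: "\<lfloor>x $ dir n / (s / 2)\<rfloor> = (if x $ dir n < c then 2 * j else 2 * j + 1)"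
    by (rule half) (simp add: j_def)
  have y: "\<lfloor>y $ dir n / (s / 2)\<rfloor> = (if y $ dir n < c then 2 * j else 2 * j + 1)" if "y \<in> Bx n x" for y
    using that by (intro half) (simp add: j_def s_def Bx_def)
  have **: "y \<in> Bx (n + 1) x \<longleftrightarrow> y \<in> Bx n x \<and> (y $ dir n < c \<longleftrightarrow> x $ dir n < c)" for y
  proof (cases "y \<in> Bx n x")
    case True
    then show ?thesis unfolding * x y[OF True] by simp
  qed (simp add: *)
  show ?thesis
    by (rule set_eqI, cases "x $ dir n < c") (simp_all add: ** not_less)
qed

lemma Bx_dist:
  fixes x y :: "real^'d::finite"
  assumes "y \<in> Bx n x"
  shows "dist y x \<le> real CARD('d) * (2 * 2 powr (- real_of_int n / real CARD('d)))"
proof -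
  have "\<bar>(y - x) $ k\<bar> \<le> 2 * 2 powr (- real_of_int n / real CARD('d))" for k
  proof -
    have "\<bar>y $ k - x $ k\<bar> \<le> side n k"
    proof -
      have "lo n x $ k \<le> y $ k" "y $ k < lo n x $ k + side n k"
        "lo n x $ k \<le> x $ k" "x $ k < lo n x $ k + side n k"
        using assms Bx_refl[of x n] unfolding Bx_iff hi_def by simp_all
      then show ?thesis by linarith
    qed
    then show ?thesis using side_le[of n k] by simp
  qed
  then have "(\<Sum>k\<in>UNIV. \<bar>(y - x) $ k\<bar>) \<le> (\<Sum>k\<in>(UNIV::'d set). 2 * 2 powr (- real_of_int n / real CARD('d)))"
    by (intro sum_mono) auto
  then show ?thesis
    using norm_le_l1_cart[of "y - x"] by (simp add: dist_norm)
qed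

lemma Bx_in_open:
  fixes x :: "real^'d::finite"
  assumes "open U" "x \<in> U"
  obtains n :: nat where "Bx (int n) x \<subseteq> U"
proof -
  obtain e where e: "e > 0" "ball x e \<subseteq> U"
    using assms open_contains_ball by blast
  have "0 < real CARD('d)" by (simp add: zero_less_card_finite)
  then have "(\<lambda>n. real CARD('d) * (2 * 2 powr (- real n / real CARD('d)))) \<longlonglongrightarrow> 0"
    by real_asymp
  then have "\<forall>\<^sub>F n in sequentially. real CARD('d) * (2 * 2 powr (- real n / real CARD('d))) < e"
    using e(1) by (rule order_tendstoD)
  then obtain n where n: "real CARD('d) * (2 * 2 powr (- real n / real CARD('d))) < e"
    by (auto simp: eventually_sequentially)
  have "y \<in> ball x e" if "y \<in> Bx (int n) x" for y
    using Bx_dist[OF that] n by (simp add: dist_commute)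
  then show thesis using e(2) that[of n] by blast
qed



section \<open>Functions are determined by their integrals over dyadic boxes\<close>

lemma locally_integrable_Bx:
  assumes "locally_integrable f"
  shows "set_integrable lborel (Bx n x) f"
proof (rule set_integrable_subset)
  show "set_integrable lborel (cbox (lo n x) (hi n x)) f"
    using assms by (simp add: locally_integrable_def)
qed (auto simp: Bx_subset_cbox)

text \<open>Including the empty set makes the family stable under intersection, as two boxes are
  nested or disjoint. Nonnegative levels suffice to reach every open set.\<close>

definition dyadic :: "(real^'d::finite) set set" where
  "dyadic = insert {} (\<Union>n::nat. range (Bx (int n)))"

lemma countable_dyadic: "countable (dyadic :: (real^'d::finite) set set)"
proof -
  have "range (Bx n) \<subseteq> range (\<lambda>v::'d \<Rightarrow> int. {y. \<forall>k. \<lfloor>y $ k / side n k\<rfloor> = v k})" for n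
    by (auto simp: Bx_def)
  then have "countable (range (Bx n :: real^'d \<Rightarrow> (real^'d) set))" for n
    by (rule countable_subset) simp
  then show ?thesis by (simp add: dyadic_def)
qed

lemma Int_stable_dyadic: "Int_stable dyadic"
proof (rule Int_stableI)
  fix A B :: "(real^'a) set" assume AB: "A \<in> dyadic" "B \<in> dyadic"
  show "A \<inter> B \<in> dyadic"
  proof (cases "A \<inter> B = {}")
    case False
    then obtain z where z: "z \<in> A" "z \<in> B" by blast
    then obtain n m :: nat where "A = Bx (int n) z" "B = Bx (int m) z"
      using AB unfolding dyadic_def by (auto dest: Bx_eq)
    moreover have "Bx (int n) z \<inter> Bx (int m) z = Bx (int (max n m)) z"
      using Bx_mono[of "int n" "int m" z] Bx_mono[of "int m" "int n" z] by (cases "n \<le> m") (auto simp: max_def)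
    ultimately show ?thesis by (auto simp: dyadic_def)
  qed (simp add: dyadic_def)
qed

text \<open>An open set is the union of the dyadic boxes it contains, and there are only countably
  many of those.\<close>

lemma sigma_sets_dyadic: "sets (borel :: (real^'d::finite) measure) = sigma_sets UNIV dyadic"
proof
  have "dyadic \<subseteq> sets (borel :: (real^'d) measure)"
    by (auto simp: dyadic_def)
  then show "sigma_sets UNIV dyadic \<subseteq> sets (borel :: (real^'d) measure)"
    using sets.sigma_sets_subset[of dyadic borel] by simp
  have "U \<in> sigma_sets UNIV dyadic" if "open U" for U :: "(real^'d) set"
  proof -
    have "U = \<Union>{B \<in> dyadic. B \<subseteq> U}"
    proof
      show "U \<subseteq> \<Union>{B \<in> dyadic. B \<subseteq> U}"
      proof
        fix x assume "x \<in> U"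
        then obtain n :: nat where "Bx (int n) x \<subseteq> U" using Bx_in_open \<open>open U\<close> by blast
        then show "x \<in> \<Union>{B \<in> dyadic. B \<subseteq> U}"
          by (intro UnionI[of "Bx (int n) x"]) (auto simp: dyadic_def)
      qed
    qed auto
    moreover have "countable {B \<in> dyadic. B \<subseteq> U}"
      by (rule countable_subset[OF _ countable_dyadic]) auto
    ultimately show ?thesis
      using sigma_sets_UNION[of "{B \<in> dyadic. B \<subseteq> U}" UNIV dyadic] by auto
  qed
  then show "sets (borel :: (real^'d) measure) \<subseteq> sigma_sets UNIV dyadic"
    by (simp add: borel_def) (rule sigma_sets_mono, auto)
qed

text \<open>The positive and the negative part of g are densities of two measures that agree on an
  intersection-stable generator and are finite on the unit boxes covering the space. The measures
  coincide, hence so do their densities.\<close>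

lemma real_zero_AE:
  fixes g :: "real^'d::finite \<Rightarrow> real"
  assumes [measurable]: "g \<in> borel_measurable borel"
    and int: "\<And>n x. set_integrable lborel (Bx n x) g"
    and zero: "\<And>n x. (LINT y:Bx n x|lborel. g y) = 0"
  shows "AE x in lborel. g x = 0"
proof -
  have finite: "emeasure (density lborel (\<lambda>x. ennreal (h x))) (Bx n x) = ennreal (LINT y:Bx n x|lborel. max 0 (h y))"
    if [measurable]: "h \<in> borel_measurable borel" and h: "set_integrable lborel (Bx n x) h" for h n x
  proof -
    have "emeasure (density lborel (\<lambda>x. ennreal (h x))) (Bx n x)
        = (\<integral>\<^sup>+y. ennreal (indicator (Bx n x) y *\<^sub>R max 0 (h y)) \<partial>lborel)"
      by (subst emeasure_density) (auto intro!: nn_integral_cong simp: indicator_def max_def ennreal_neg)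
    also have "\<dots> = ennreal (LINT y:Bx n x|lborel. max 0 (h y))"
      unfolding set_lebesgue_integral_def
    proof (rule nn_integral_eq_integral)
      show "integrable lborel (\<lambda>y. indicator (Bx n x) y *\<^sub>R max 0 (h y))"
        by (rule Bochner_Integration.integrable_bound[OF h[unfolded set_integrable_def]])
          (auto simp: indicator_def)
    qed simp
    finally show ?thesis .
  qed
  have neg: "set_integrable lborel (Bx n x) (\<lambda>x. - g x)" for n x
    using int[of n x] by (simp add: set_integrable_def)
  have "density lborel (\<lambda>x. ennreal (g x)) = density lborel (\<lambda>x. ennreal (- g x))"
  proof (rule measure_eqI_generator_eq_countable[where \<Omega> = UNIV and E = dyadic and A = "range (Bx 0)"])
    show "Int_stable dyadic" by (rule Int_stable_dyadic)
    show "sets (density lborel (\<lambda>x. ennreal (g x))) = sigma_sets UNIV dyadic"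
      "sets (density lborel (\<lambda>x. ennreal (- g x))) = sigma_sets UNIV dyadic"
      by (simp_all add: sigma_sets_dyadic)
    show "range (Bx 0) \<subseteq> (dyadic :: (real^'d) set set)"
      by (auto simp: dyadic_def intro!: UN_I[of 0])
    then show "countable (range (Bx 0 :: real^'d \<Rightarrow> _))"
      by (rule countable_subset[OF _ countable_dyadic])
    show "\<Union> (range (Bx 0)) = (UNIV :: (real^'d) set)"
      using Bx_refl by blast
    show "emeasure (density lborel (\<lambda>x. ennreal (g x))) a \<noteq> \<infinity>" if "a \<in> range (Bx 0)" for a
      using that finite[OF assms(1) int] by auto
    show "emeasure (density lborel (\<lambda>x. ennreal (g x))) X = emeasure (density lborel (\<lambda>x. ennreal (- g x))) X"
      if X: "X \<in> dyadic" for X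
    proof -
      consider "X = {}" | n x where "X = Bx n x"
        using X by (auto simp: dyadic_def)
      then show ?thesis
      proof cases
        case (2 n x)
        have "set_integrable lborel (Bx n x) (\<lambda>y. max 0 (h y))" if "set_integrable lborel (Bx n x) h" 
          "h \<in> borel_measurable borel" for h :: "real^'d \<Rightarrow> real"
          unfolding set_integrable_def
          by (rule Bochner_Integration.integrable_bound[OF that(1)[unfolded set_integrable_def]])
             (use that(2) in \<open>auto simp: indicator_def\<close>)
        from this[OF int] this[OF neg]
        have "(LINT y:Bx n x|lborel. max 0 (g y)) - (LINT y:Bx n x|lborel. max 0 (- g y))
            = (LINT y:Bx n x|lborel. max 0 (g y) - max 0 (- g y))"
          by (intro set_integral_diff(2)[symmetric]) auto
        also have "(\<lambda>y. max 0 (g y) - max 0 (- g y)) = g"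
          by (auto simp: max_def)
        finally show ?thesis
          using zero[of n x] finite[OF assms(1) int] finite[OF _ neg] by (simp add: 2)
      qed simp
    qed
  qed simp
  then have "AE x in lborel. ennreal (g x) = ennreal (- g x)"
    by (subst (asm) sigma_finite_measure.density_unique_iff[OF sigma_finite_lborel]) simp_all
  \<comment> \<open>Conversion to \<open>ennreal\<close> cuts negative values off to 0, so for
    nonzero g x exactly one side would be positive.\<close>
  then show ?thesis
    by eventually_elim (metis ennreal_eq_0_iff ennreal_neg le_cases neg_0_le_iff_le neg_le_0_iff_le order_antisym)
qed

lemma dyadic_zero_AE:
  fixes f :: "real^'d::finite \<Rightarrow> complex"
  assumes f: "locally_integrable f" and zero: "\<And>n x. (LINT y:Bx n x|lborel. f y) = 0"
  shows "AE x in lborel. f x = 0"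
proof -
  have [measurable]: "f \<in> borel_measurable borel" by (rule locally_integrable_borel[OF f])
  have int: "integrable lborel (\<lambda>y. indicator (Bx n x) y *\<^sub>R f y)" for n x
    using locally_integrable_Bx[OF f] by (simp add: set_integrable_def)
  have "AE x in lborel. Re (f x) = 0"
  proof (rule real_zero_AE)
    show "set_integrable lborel (Bx n x) (\<lambda>x. Re (f x))" for n x
      using integrable_Re[OF int] by (simp add: set_integrable_def)
    show "(LINT y:Bx n x|lborel. Re (f y)) = 0" for n x
      using integral_Re[OF int[of n x]] zero[of n x] by (simp add: set_lebesgue_integral_def)
  qed simp
  moreover have "AE x in lborel. Im (f x) = 0"
  proof (rule real_zero_AE)
    show "set_integrable lborel (Bx n x) (\<lambda>x. Im (f x))" for n x
      using integrable_Im[OF int] by (simp add: set_integrable_def)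
    show "(LINT y:Bx n x|lborel. Im (f y)) = 0" for n x
      using integral_Im[OF int[of n x]] zero[of n x] by (simp add: set_lebesgue_integral_def)
  qed simp
  ultimately show ?thesis
    by eventually_elim (simp add: complex_eq_iff)
qed

text \<open>The fundamental lemma of the calculus of variations: test functions give boxes, boxes
  give almost every point.\<close>

lemma weak_zero_AE:
  fixes f :: "real^'d::finite \<Rightarrow> complex"
  assumes f: "locally_integrable f" and "\<And>\<phi>. \<phi> \<in> test_functions \<Longrightarrow> (\<integral>x. f x * \<phi> x \<partial>lborel) = 0"
  shows "AE x in lborel. f x = 0"
proof (rule dyadic_zero_AE[OF f])
  fix n and x :: "real^'d"
  have [measurable]: "f \<in> borel_measurable borel" by (rule locally_integrable_borel[OF f])
  have "(LINT y:Bx n x|lborel. f y) = (LINT y:box (lo n x) (hi n x)|lborel. f y)"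
    unfolding set_lebesgue_integral_def
    by (rule integral_cong_AE) (use AE_box_Bx[of n x] in \<open>auto elim!: eventually_mono simp: indicator_def\<close>)
  then show "(LINT y:Bx n x|lborel. f y) = 0"
    using zero_on_boxes[OF assms] by simp
qed

text \<open>Since \<open>weak_grad\<close> is an arbitrary choice, this is what allows it to be
  exchanged for any gradient at hand, also after a change of the function on a null set.\<close>

lemma weak_grad_unique:
  fixes f :: "real^'d::finite \<Rightarrow> complex"
  assumes D: "has_weak_grad f D" and E: "has_weak_grad g E" and fg: "AE x in lborel. f x = g x"
  shows "AE x in lborel. D x = E x"
proof -
  have "AE x in lborel. D x $ k - E x $ k = 0" for k
  proof (rule weak_zero_AE)
    have li: "locally_integrable (\<lambda>x. D x $ k)" "locally_integrable (\<lambda>x. - 1 * E x $ k)"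
      using D E by (auto simp: has_weak_grad_def intro!: locally_integrable_cmult[of _ "- 1", simplified])
    from locally_integrable_add[OF this]
    show "locally_integrable (\<lambda>x. D x $ k - E x $ k)" by simp
    have [measurable]: "f \<in> borel_measurable borel" "g \<in> borel_measurable borel"
      using D E locally_integrable_borel by (auto simp: has_weak_grad_def)
    fix \<phi> :: "real^'d \<Rightarrow> complex" assume \<phi>: "\<phi> \<in> test_functions"
    have [measurable]: "partial_deriv k \<phi> \<in> borel_measurable borel"
      using test_function_C_k[OF \<phi>, of 1] by (auto intro!: borel_measurable_continuous_onI)
    have "(\<integral>x. f x * partial_deriv k \<phi> x \<partial>lborel) = (\<integral>x. g x * partial_deriv k \<phi> x \<partial>lborel)"
      by (rule integral_cong_AE) (use fg in auto)
    then have "(\<integral>x. D x $ k * \<phi> x \<partial>lborel) = (\<integral>x. E x $ k * \<phi> x \<partial>lborel)"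
      using D E \<phi> by (simp add: has_weak_grad_def)
    moreover have "integrable lborel (\<lambda>x. D x $ k * \<phi> x)" "integrable lborel (\<lambda>x. E x $ k * \<phi> x)"
      using D E test_function_integrable(1)[OF \<phi>] by (auto simp: has_weak_grad_def)
    ultimately show "(\<integral>x. (D x $ k - E x $ k) * \<phi> x \<partial>lborel) = 0"
      by (simp add: left_diff_distrib)
  qed
  then have "AE x in lborel. \<forall>k\<in>UNIV. D x $ k - E x $ k = 0"
    by (intro AE_finite_allI) auto
  then show ?thesis by (simp add: vec_eq_iff)
qed

section \<open>Averages over boxes and the maximal function\<close>

text \<open>The factor is the reciprocal volume of the box, so this is the conditional expectation
  on the grid of level n; the levels in increasing order form a martingale.\<close>

definition av :: "int \<Rightarrow> (real^'d::finite \<Rightarrow> 'b) \<Rightarrow> real^'d \<Rightarrow> 'b::{banach, second_countable_topology}" where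
  "av n f x = (2 powr real_of_int n) *\<^sub>R (LINT y:Bx n x|lborel. f y)"

lemma av_cong_Bx: "y \<in> Bx n x \<Longrightarrow> av n f y = av n f x"
  by (simp add: av_def Bx_eq)

lemma measurable_indicator_Bx [measurable]:
  fixes n :: int
  shows "(\<lambda>(x :: real^'d::finite, y). indicator (Bx n x) y :: 'b::{zero_neq_one, topological_space}) \<in> borel_measurable (borel \<Otimes>\<^sub>M borel)"
proof -
  have "(\<lambda>p::(real^'d) \<times> (real^'d). if snd p \<in> Bx n (fst p) then 1 else 0 :: 'b) \<in> borel_measurable (borel \<Otimes>\<^sub>M borel)"
    by measurable
  moreover have "(\<lambda>(x :: real^'d, y). indicator (Bx n x) y :: 'b) = (\<lambda>p. if snd p \<in> Bx n (fst p) then 1 else 0)"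
    by (auto simp: indicator_def fun_eq_iff)
  ultimately show ?thesis by simp
qed

lemma av_measurable [measurable]:
  assumes [measurable]: "f \<in> borel_measurable borel"
  shows "av n f \<in> borel_measurable borel"
proof -
  have "(\<lambda>x. \<integral>y. indicator (Bx n x) y *\<^sub>R f y \<partial>lborel) \<in> borel_measurable borel"
  proof (rule lborel.borel_measurable_lebesgue_integral)
    have "(\<lambda>p. indicat_real (Bx n (fst p)) (snd p) *\<^sub>R f (snd p)) \<in> borel_measurable (borel \<Otimes>\<^sub>M borel)"
      using measurable_indicator_Bx[of n, where 'b = real] by (simp add: case_prod_beta')
    then show "(\<lambda>(x, y). indicat_real (Bx n x) y *\<^sub>R f y) \<in> borel_measurable (borel \<Otimes>\<^sub>M lborel)"
      by (simp add: case_prod_beta')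
  qed
  then show ?thesis
    unfolding av_def[abs_def] set_lebesgue_integral_def by simp
qed

lemma av_diff:
  assumes "set_integrable lborel (Bx n x) f" "set_integrable lborel (Bx n x) g"
  shows "av n (\<lambda>y. f y - g y) x = av n f x - av n g x"
  using set_integral_diff(2)[OF assms] by (simp add: av_def scaleR_diff_right)

lemma av_norm_le: "norm (av n f x) \<le> av n (\<lambda>y. norm (f y)) x"
proof -
  have "norm (\<integral>y. indicat_real (Bx n x) y *\<^sub>R f y \<partial>lborel) \<le> (\<integral>y. norm (indicat_real (Bx n x) y *\<^sub>R f y) \<partial>lborel)"
    by (rule integral_norm_bound)
  then show ?thesis
    by (simp add: av_def set_lebesgue_integral_def mult_left_mono)
qed

lemma av_mono:
  assumes "set_integrable lborel (Bx n x) f" "set_integrable lborel (Bx n x) g" "\<And>y. f y \<le> (g y :: real)"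
  shows "av n f x \<le> av n g x"
  unfolding av_def real_scaleR_def
  by (intro mult_left_mono set_integral_mono assms) auto

lemma av_nonneg: "(\<And>y. 0 \<le> f y) \<Longrightarrow> 0 \<le> (av n f x :: real)"
  unfolding av_def set_lebesgue_integral_def by (intro scaleR_nonneg_nonneg integral_nonneg_AE) auto

lemma set_integrable_const_Bx: "set_integrable lborel (Bx n x) (\<lambda>y. c :: real)"
  unfolding set_integrable_def using emeasure_Bx[of n x]
  by (intro integrable_scaleR_left) (simp add: less_top[symmetric])

lemma av_const: "av n (\<lambda>y. c :: real) x = c"
  by (simp add: av_def set_lebesgue_integral_def measure_Bx powr_minus)

lemma set_integrable_Bx_integrable:
  fixes g :: "real^'d::finite \<Rightarrow> real"
  assumes "integrable lborel g"
  shows "set_integrable lborel (Bx n x) g"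
  unfolding set_integrable_def using assms by (intro integrable_mult_indicator) auto

lemma av_le_integral:
  fixes g :: "real^'d::finite \<Rightarrow> real"
  assumes "integrable lborel g" "\<And>y. 0 \<le> g y"
  shows "av n g x \<le> 2 powr real_of_int n * (\<integral>y. g y \<partial>lborel)"
proof -
  have "(LINT y:Bx n x|lborel. g y) \<le> (\<integral>y. g y \<partial>lborel)"
    unfolding set_lebesgue_integral_def
    using assms set_integrable_Bx_integrable[OF assms(1), of n x]
    by (intro integral_mono) (auto simp: indicator_def set_integrable_def)
  then show ?thesis by (simp add: av_def mult_left_mono)
qed

lemma set_integrable_square_Bx:
  assumes [measurable]: "g \<in> borel_measurable borel" and "integrable lborel (\<lambda>y. (g y)\<^sup>2)"
  shows "set_integrable lborel (Bx n x) (g :: _ \<Rightarrow> real)"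
  unfolding set_integrable_def
proof (rule Bochner_Integration.integrable_bound)
  show "integrable lborel (\<lambda>y. (g y)\<^sup>2 + indicator (Bx n x) y *\<^sub>R 1)"
    using set_integrable_const_Bx[of n x 1] assms(2) by (simp add: set_integrable_def)
  have "\<bar>t\<bar> \<le> t\<^sup>2 + 1" for t :: real
    using zero_le_power2[of "\<bar>t\<bar> - 1"] by (auto simp: power2_eq_square algebra_simps abs_if split: if_splits)
  then show "AE y in lborel. norm (indicator (Bx n x) y *\<^sub>R g y) \<le> norm ((g y)\<^sup>2 + indicator (Bx n x) y *\<^sub>R 1)"
    by (intro AE_I2) (auto simp: indicator_def)
qed auto

text \<open>Jensen's inequality for the square: average the pointwise bound m g \<le> g^2/2 + m^2/2
  with m the average of g itself.\<close>

lemma av_square: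
  fixes g :: "real^'d::finite \<Rightarrow> real"
  assumes "g \<in> borel_measurable borel" "integrable lborel (\<lambda>y. (g y)\<^sup>2)"
  shows "(av n g x)\<^sup>2 \<le> av n (\<lambda>y. (g y)\<^sup>2) x"
proof -
  define m where "m = av n g x"
  have g: "set_integrable lborel (Bx n x) g" "set_integrable lborel (Bx n x) (\<lambda>y. (g y)\<^sup>2)"
    using set_integrable_square_Bx[OF assms] set_integrable_Bx_integrable[OF assms(2)] by auto
  have "m * av n g x \<le> av n (\<lambda>y. (g y)\<^sup>2 / 2 + m\<^sup>2 / 2) x"
  proof -
    have "m * av n g x = av n (\<lambda>y. m * g y) x"
      by (simp add: av_def)
    also have "\<dots> \<le> av n (\<lambda>y. (g y)\<^sup>2 / 2 + m\<^sup>2 / 2) x"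
    proof (rule av_mono)
      show "m * g y \<le> (g y)\<^sup>2 / 2 + m\<^sup>2 / 2" for y
        using zero_le_power2[of "g y - m"] by (simp add: power2_eq_square algebra_simps)
    qed (use g set_integrable_const_Bx in \<open>auto intro!: set_integral_add(1) set_integrable_divide\<close>)
    finally show ?thesis .
  qed
  also have "\<dots> = av n (\<lambda>y. (g y)\<^sup>2) x / 2 + m\<^sup>2 / 2"
  proof -
    have "(LINT y:Bx n x|lborel. (g y)\<^sup>2 / 2 + m\<^sup>2 / 2) = (LINT y:Bx n x|lborel. (g y)\<^sup>2 / 2) + (LINT y:Bx n x|lborel. m\<^sup>2 / 2)"
      by (rule set_integral_add(2)) (use g set_integrable_const_Bx in \<open>auto intro!: set_integrable_divide\<close>)
    then show ?thesis
      using av_const[of n "m\<^sup>2 / 2" x] by (simp add: av_def distrib_left)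
  qed
  finally show ?thesis by (simp add: m_def power2_eq_square)
qed

text \<open>The averaging kernel \<open>2\<^sup>n 1\<^bsub>Bx n x\<^esub>(y)\<close> is symmetric, so averaging is self-adjoint by Tonelli.\<close>

lemma nn_integral_av:
  fixes g :: "real^'d::finite \<Rightarrow> real"
  assumes [measurable]: "\<phi> \<in> borel_measurable borel" "g \<in> borel_measurable borel"
    and g: "\<And>y. 0 \<le> g y" "\<And>x. set_integrable lborel (Bx n x) g"
    and \<phi>: "\<And>x y. y \<in> Bx n x \<Longrightarrow> \<phi> y = \<phi> x"
  shows "(\<integral>\<^sup>+x. \<phi> x * ennreal (av n g x) \<partial>lborel) = (\<integral>\<^sup>+x. \<phi> x * ennreal (g x) \<partial>lborel)"
proof -
  have [measurable]: "(\<lambda>p::(real^'d) \<times> (real^'d). indicator (Bx n (fst p)) (snd p) :: ennreal) \<in> borel_measurable (borel \<Otimes>\<^sub>M borel)"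
    using measurable_indicator_Bx[of n, where 'b = ennreal and 'd = 'd] by (simp add: case_prod_beta')
  define k where "k x y = ennreal (2 powr real_of_int n) * indicator (Bx n x) y" for x y :: "real^'d"
  have "(\<lambda>p. k (fst p) (snd p)) \<in> borel_measurable (borel \<Otimes>\<^sub>M borel)"
    unfolding k_def by measurable
  then have [measurable]: "case_prod k \<in> borel_measurable (borel \<Otimes>\<^sub>M borel)"
    by (simp add: case_prod_beta')
  have av: "ennreal (av n g x) = (\<integral>\<^sup>+y. k x y * ennreal (g y) \<partial>lborel)" for x
  proof -
    have "(\<integral>\<^sup>+y. ennreal (indicator (Bx n x) y *\<^sub>R g y) \<partial>lborel) = ennreal (LINT y:Bx n x|lborel. g y)"
      unfolding set_lebesgue_integral_def
      by (rule nn_integral_eq_integral) (use g in \<open>auto simp: set_integrable_def\<close>)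
    then have "ennreal (av n g x) = ennreal (2 powr real_of_int n) * (\<integral>\<^sup>+y. ennreal (indicator (Bx n x) y *\<^sub>R g y) \<partial>lborel)"
      by (simp add: av_def ennreal_mult')
    also have "\<dots> = (\<integral>\<^sup>+y. ennreal (2 powr real_of_int n) * ennreal (indicator (Bx n x) y *\<^sub>R g y) \<partial>lborel)"
      by (rule nn_integral_cmult[symmetric]) simp
    also have "\<dots> = (\<integral>\<^sup>+y. k x y * ennreal (g y) \<partial>lborel)"
      by (intro nn_integral_cong) (auto simp: k_def indicator_def)
    finally show ?thesis .
  qed
  have "(\<integral>\<^sup>+x. \<phi> x * ennreal (av n g x) \<partial>lborel) = (\<integral>\<^sup>+x. (\<integral>\<^sup>+y. \<phi> x * (k x y * ennreal (g y)) \<partial>lborel) \<partial>lborel)"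
    unfolding av by (intro nn_integral_cong nn_integral_cmult[symmetric]) measurable
  also have "\<dots> = (\<integral>\<^sup>+y. (\<integral>\<^sup>+x. \<phi> x * (k x y * ennreal (g y)) \<partial>lborel) \<partial>lborel)"
    by (rule lborel_pair.Fubini') measurable
  also have "\<dots> = (\<integral>\<^sup>+y. (\<integral>\<^sup>+x. \<phi> y * ennreal (g y) * k y x \<partial>lborel) \<partial>lborel)"
  proof (intro nn_integral_cong)
    fix x y :: "real^'d"
    show "\<phi> x * (k x y * ennreal (g y)) = \<phi> y * ennreal (g y) * k y x"
      using \<phi>[of y x] Bx_sym[of x n y] by (cases "y \<in> Bx n x") (auto simp: k_def indicator_def ac_simps)
  qed
  also have "\<dots> = (\<integral>\<^sup>+y. \<phi> y * ennreal (g y) * (\<integral>\<^sup>+x. k y x \<partial>lborel) \<partial>lborel)"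
    by (intro nn_integral_cong nn_integral_cmult) measurable
  moreover have "(\<integral>\<^sup>+x. k y x \<partial>lborel) = 1" for y
    unfolding k_def
    by (subst nn_integral_cmult) (auto simp: emeasure_Bx powr_minus ennreal_mult'[symmetric])
  ultimately show ?thesis by simp
qed

text \<open>The deterministic core of Doob's maximal inequality. The running maximum moves only when
  it equals s, and then the right-hand side gains half the square of the jump. For a martingale the
  left-hand side integrates to zero.\<close>

lemma doob_pathwise:
  fixes s M :: "nat \<Rightarrow> real"
  assumes "M 0 = s 0" "\<And>i. M (Suc i) = max (M i) (s (Suc i))"
  shows "(\<Sum>i<n. M i * (s (Suc i) - s i)) \<le> M n * s n - (M n)\<^sup>2 / 2"
proof (induction n)
  case 0
  then show ?case using assms(1) by (simp add: power2_eq_square)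
next
  case (Suc n)
  have "(\<Sum>i<Suc n. M i * (s (Suc i) - s i)) \<le> M n * s (Suc n) - (M n)\<^sup>2 / 2"
    using Suc by (simp add: algebra_simps)
  also have "\<dots> \<le> M (Suc n) * s (Suc n) - (M (Suc n))\<^sup>2 / 2"
  proof (cases "s (Suc n) \<le> M n")
    case False
    then have M: "M (Suc n) = s (Suc n)" using assms(2)[of n] by simp
    show ?thesis
      unfolding M using zero_le_power2[of "s (Suc n) - M n"] by (simp add: power2_eq_square algebra_simps)
  qed (simp add: assms(2) max_def)
  finally show ?case .
qed

text \<open>Jensen pointwise, then self-adjointness of the averaging tested with the constant
  1.\<close>

lemma av_square_integrable:
  fixes g :: "real^'d::finite \<Rightarrow> real"
  assumes [measurable]: "g \<in> borel_measurable borel" and g: "\<And>y. 0 \<le> g y" "integrable lborel (\<lambda>y. (g y)\<^sup>2)"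
  shows "integrable lborel (\<lambda>x. (av n g x)\<^sup>2)" "(\<integral>x. (av n g x)\<^sup>2 \<partial>lborel) \<le> (\<integral>x. (g x)\<^sup>2 \<partial>lborel)"
proof -
  have "(\<integral>\<^sup>+x. ennreal ((av n g x)\<^sup>2) \<partial>lborel) \<le> (\<integral>\<^sup>+x. 1 * ennreal (av n (\<lambda>y. (g y)\<^sup>2) x) \<partial>lborel)"
    by (intro nn_integral_mono) (simp add: av_square[OF assms(1) g(2)] ennreal_leI)
  also have "\<dots> = (\<integral>\<^sup>+x. 1 * ennreal ((g x)\<^sup>2) \<partial>lborel)"
    by (rule nn_integral_av) (use g set_integrable_Bx_integrable[OF g(2)] in auto)
  finally have le: "(\<integral>\<^sup>+x. ennreal ((av n g x)\<^sup>2) \<partial>lborel) \<le> (\<integral>\<^sup>+x. ennreal ((g x)\<^sup>2) \<partial>lborel)"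
    by simp
  also have eq: "(\<integral>\<^sup>+x. ennreal ((g x)\<^sup>2) \<partial>lborel) = ennreal (\<integral>x. (g x)\<^sup>2 \<partial>lborel)"
    by (rule nn_integral_eq_integral[OF g(2)]) simp
  finally show *: "integrable lborel (\<lambda>x. (av n g x)\<^sup>2)"
    by (intro integrableI_nonneg) (auto simp: le_less_trans)
  have "(\<integral>\<^sup>+x. ennreal ((av n g x)\<^sup>2) \<partial>lborel) = ennreal (\<integral>x. (av n g x)\<^sup>2 \<partial>lborel)"
    by (rule nn_integral_eq_integral[OF *]) simp
  with le eq show "(\<integral>x. (av n g x)\<^sup>2 \<partial>lborel) \<le> (\<integral>x. (g x)\<^sup>2 \<partial>lborel)"
    by (simp add: ennreal_le_iff)
qed

lemma integrable_mult_square: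
  fixes f g :: "'a \<Rightarrow> real"
  assumes [measurable]: "f \<in> borel_measurable M" "g \<in> borel_measurable M"
    and "integrable M (\<lambda>x. (f x)\<^sup>2)" "integrable M (\<lambda>x. (g x)\<^sup>2)"
  shows "integrable M (\<lambda>x. f x * g x)"
proof (rule Bochner_Integration.integrable_bound)
  show "integrable M (\<lambda>x. (f x)\<^sup>2 + (g x)\<^sup>2)" using assms by simp
  have "\<bar>s * t\<bar> \<le> s\<^sup>2 + t\<^sup>2" for s t :: real
  proof -
    have "2 * (\<bar>s\<bar> * \<bar>t\<bar>) \<le> s\<^sup>2 + t\<^sup>2" "0 \<le> \<bar>s\<bar> * \<bar>t\<bar>"
      using sum_squares_bound[of "\<bar>s\<bar>" "\<bar>t\<bar>"] by (simp_all add: mult.assoc)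
    then show ?thesis unfolding abs_mult by linarith
  qed
  then show "AE x in M. norm (f x * g x) \<le> norm ((f x)\<^sup>2 + (g x)\<^sup>2)" by simp
qed measurable

text \<open>The running maximum up to level a + i is constant on boxes of that level, so it is
  orthogonal to all later increments of the averages. Integrating the pathwise inequality then
  bounds the final maximum by the final average, which is at most g in L^2.\<close>

lemma maximal_finite:
  fixes g :: "real^'d::finite \<Rightarrow> real" and a :: int
  assumes [measurable]: "g \<in> borel_measurable borel" and g: "\<And>y. 0 \<le> g y" "integrable lborel (\<lambda>y. (g y)\<^sup>2)"
  obtains M where "M \<in> borel_measurable borel" "\<And>x i. i \<le> n \<Longrightarrow> av (a + int i) g x \<le> M x"
    "\<And>x. \<exists>i\<le>n. M x = av (a + int i) g x"
    "integrable lborel (\<lambda>x. (M x)\<^sup>2)" "(\<integral>x. (M x)\<^sup>2 \<partial>lborel) \<le> 4 * (\<integral>x. (g x)\<^sup>2 \<partial>lborel)"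
proof -
  define s where "s i x = av (a + int i) g x" for i x
  define M where "M i x = rec_nat (s 0 x) (\<lambda>i m. max m (s (Suc i) x)) i" for i x
  have M0: "M 0 x = s 0 x" and MS: "M (Suc i) x = max (M i x) (s (Suc i) x)" for i x
    by (simp_all add: M_def)
  have [measurable]: "s i \<in> borel_measurable borel" for i
    unfolding s_def by measurable
  have [measurable]: "M i \<in> borel_measurable borel" for i
  proof (induction i)
    case 0
    then show ?case using M0 by (simp add: M0[abs_def])
  next
    case (Suc i)
    then show ?case unfolding MS[abs_def] by measurable
  qed
  have s: "0 \<le> s i x" "integrable lborel (\<lambda>x. (s i x)\<^sup>2)" for i x
    unfolding s_def using av_nonneg[of g] g av_square_integrable[OF assms(1) g] by auto
  have M: "0 \<le> M i x \<and> integrable lborel (\<lambda>x. (M i x)\<^sup>2)" for i x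
  proof (induction i)
    case (Suc i)
    have "integrable lborel (\<lambda>x. (M (Suc i) x)\<^sup>2)"
      by (rule Bochner_Integration.integrable_bound[of _ "\<lambda>x. (M i x)\<^sup>2 + (s (Suc i) x)\<^sup>2"])
        (use Suc s in \<open>auto simp: MS max_def\<close>)
    then show ?case using Suc by (simp add: MS le_max_iff_disj)
  qed (use s in \<open>simp_all add: M0[abs_def]\<close>)
  have Ms: "integrable lborel (\<lambda>x. M i x * s j x)" for i j
    by (rule integrable_mult_square) (use M s in auto)
  have Mconst: "M i y = M i x" if "y \<in> Bx (a + int i) x" for i x y
  proof -
    have "M j y = M j x" if "j \<le> i" for j
      using that
    proof (induction j)
      case 0
      then show ?case using Bx_mono[of a "a + int i" x] \<open>y \<in> _\<close> by (auto simp: M0 s_def intro: av_cong_Bx)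
    next
      case (Suc j)
      then have "s (Suc j) y = s (Suc j) x"
        unfolding s_def using Bx_mono[of "a + int (Suc j)" "a + int i" x] \<open>y \<in> _\<close> by (intro av_cong_Bx) auto
      then show ?case using Suc by (simp add: MS)
    qed
    then show ?thesis by simp
  qed
  \<comment> \<open>The right-hand side does not mention j. Taking j = i and j = i + 1 therefore
    shows that the increment integrates to zero against \<open>M i\<close>.\<close>
  have eq: "(\<integral>x. M i x * s j x \<partial>lborel) = enn2real (\<integral>\<^sup>+x. ennreal (M i x) * ennreal (g x) \<partial>lborel)" if "i \<le> j" for i j
  proof -
    have "(\<integral>\<^sup>+x. ennreal (M i x) * ennreal (s j x) \<partial>lborel) = (\<integral>\<^sup>+x. ennreal (M i x) * ennreal (g x) \<partial>lborel)"
      unfolding s_def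
    proof (rule nn_integral_av)
      show "ennreal (M i y) = ennreal (M i x)" if "y \<in> Bx (a + int j) x" for x y
        using Mconst[of y i x] Bx_mono[of "a + int i" "a + int j" x] that \<open>i \<le> j\<close> by auto
    qed (use g set_integrable_square_Bx[OF assms(1) g(2)] in auto)
    moreover have "(\<integral>\<^sup>+x. ennreal (M i x) * ennreal (s j x) \<partial>lborel) = ennreal (\<integral>x. M i x * s j x \<partial>lborel)"
      unfolding ennreal_mult'[symmetric, OF conjunct1[OF M]]
      by (rule nn_integral_eq_integral[OF Ms]) (use M s in auto)
    moreover have "(\<integral>x. M i x * s j x \<partial>lborel) \<ge> 0"
      by (intro integral_nonneg_AE) (use M s in auto)
    ultimately show ?thesis by (metis enn2real_ennreal)
  qed
  have "(\<Sum>i<n. (\<integral>x. M i x * s (Suc i) x \<partial>lborel) - (\<integral>x. M i x * s i x \<partial>lborel)) = 0"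
    by (simp add: eq)
  then have "0 = (\<integral>x. (\<Sum>i<n. M i x * (s (Suc i) x - s i x)) \<partial>lborel)"
    by (simp add: right_diff_distrib Ms)
  also have "\<dots> \<le> (\<integral>x. M n x * s n x - (M n x)\<^sup>2 / 2 \<partial>lborel)"
    by (intro integral_mono doob_pathwise) (use M0 MS M Ms in \<open>auto simp: right_diff_distrib\<close>)
  \<comment> \<open>Completing the square, (s - M/2)^2 \<ge> 0, absorbs the mixed term and leaves a
    quarter of M^2; this is where the constant 4 comes from.\<close>
  also have "\<dots> \<le> (\<integral>x. (s n x)\<^sup>2 - (M n x)\<^sup>2 / 4 \<partial>lborel)"
  proof (rule integral_mono)
    show "M n x * s n x - (M n x)\<^sup>2 / 2 \<le> (s n x)\<^sup>2 - (M n x)\<^sup>2 / 4" for x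
      using zero_le_power2[of "s n x - M n x / 2"] by (simp add: power2_eq_square algebra_simps)
  qed (use M Ms s in auto)
  also have "\<dots> = (\<integral>x. (s n x)\<^sup>2 \<partial>lborel) - (\<integral>x. (M n x)\<^sup>2 \<partial>lborel) / 4"
    using M s by simp
  finally have fin: "(\<integral>x. (M n x)\<^sup>2 \<partial>lborel) \<le> 4 * (\<integral>x. (g x)\<^sup>2 \<partial>lborel)"
    using av_square_integrable(2)[OF assms(1) g, of "a + int n"] by (simp add: s_def)
  have le: "s i x \<le> M j x" if "i \<le> j" for i j x
    using that by (induction j) (auto simp: M0 MS le_Suc_eq)
  have ex: "\<exists>i\<le>j. M j x = s i x" for j x
  proof (induction j)
    case (Suc j)
    then show ?case unfolding MS max_def by (metis le_Suc_eq order_refl)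
  qed (simp add: M0)
  show thesis
    by (rule that[of "M n"]) (use M fin le[where j = n] ex[of n] in \<open>auto simp: s_def\<close>)
qed

text \<open>The bound for finitely many levels has a constant independent of their number, so the
  windows of levels from -N to N can be exhausted by monotone convergence.\<close>

lemma maximal_function:
  fixes g :: "real^'d::finite \<Rightarrow> real"
  assumes [measurable]: "g \<in> borel_measurable borel" and g: "\<And>y. 0 \<le> g y" "integrable lborel (\<lambda>y. (g y)\<^sup>2)"
  obtains G where "G \<in> borel_measurable borel" "\<And>x. 0 \<le> G x" "integrable lborel (\<lambda>x. (G x)\<^sup>2)"
    "(\<integral>x. (G x)\<^sup>2 \<partial>lborel) \<le> 4 * (\<integral>x. (g x)\<^sup>2 \<partial>lborel)" "AE x in lborel. \<forall>i. av i g x \<le> G x"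
proof -
  let ?P = "\<lambda>N M. M \<in> borel_measurable borel \<and> (\<forall>x. \<forall>i\<le>2 * N. av (- int N + int i) g x \<le> M x)
    \<and> (\<forall>x. \<exists>i\<le>2 * N. M x = av (- int N + int i) g x)
    \<and> integrable lborel (\<lambda>x. (M x)\<^sup>2) \<and> (\<integral>x. (M x)\<^sup>2 \<partial>lborel) \<le> 4 * (\<integral>x. (g x)\<^sup>2 \<partial>lborel)"
  have "\<forall>N. \<exists>M. ?P N M"
  proof
    fix N
    show "\<exists>M. ?P N M"
      by (rule maximal_finite[OF assms, of "2 * N" "- int N"]) blast
  qed
  then obtain M where "\<forall>N. ?P N (M N)" by (rule choice[THEN exE])
  then have [measurable]: "\<And>N. M N \<in> borel_measurable borel"
    and le: "\<And>N x i. i \<le> 2 * N \<Longrightarrow> av (- int N + int i) g x \<le> M N x"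
    and ex: "\<And>N x. \<exists>i\<le>2 * N. M N x = av (- int N + int i) g x"
    and int: "\<And>N. integrable lborel (\<lambda>x. (M N x)\<^sup>2)"
    and bound: "\<And>N. (\<integral>x. (M N x)\<^sup>2 \<partial>lborel) \<le> 4 * (\<integral>x. (g x)\<^sup>2 \<partial>lborel)"
    by blast+
  have le': "av i g x \<le> M N x" if "\<bar>i\<bar> \<le> int N" for i N x
  proof -
    have "0 \<le> i + int N" "i \<le> int N" using that by linarith+
    then have "nat (i + int N) \<le> 2 * N" "- int N + int (nat (i + int N)) = i" by simp_all
    then show ?thesis using le[of "nat (i + int N)" N x] by (simp only:)
  qed
  have M0: "0 \<le> M N x" for N x
    using ex[of N x] av_nonneg[of g] g by auto
  have inc: "M N x \<le> M (Suc N) x" for N x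
  proof -
    obtain i where "i \<le> 2 * N" "M N x = av (- int N + int i) g x" using ex by blast
    then show ?thesis using le'[of "- int N + int i" "Suc N" x] by simp
  qed
  \<comment> \<open>The supremum is taken in \<open>ennreal\<close>, where it always exists; the
    integral bound shows afterwards that it is finite almost everywhere.\<close>
  define H where "H x = (SUP N. ennreal ((M N x)\<^sup>2))" for x
  have [measurable]: "H \<in> borel_measurable borel"
    unfolding H_def by measurable
  have "(\<integral>\<^sup>+x. H x \<partial>lborel) = (SUP N. \<integral>\<^sup>+x. ennreal ((M N x)\<^sup>2) \<partial>lborel)"
    unfolding H_def
    by (rule nn_integral_monotone_convergence_SUP)
      (auto intro!: incseq_SucI le_funI ennreal_leI power_mono inc M0)
  also have "\<dots> \<le> ennreal (4 * (\<integral>x. (g x)\<^sup>2 \<partial>lborel))"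
  proof (rule SUP_least)
    fix N
    have "(\<integral>\<^sup>+x. ennreal ((M N x)\<^sup>2) \<partial>lborel) = ennreal (\<integral>x. (M N x)\<^sup>2 \<partial>lborel)"
      by (rule nn_integral_eq_integral[OF int]) simp
    then show "(\<integral>\<^sup>+x. ennreal ((M N x)\<^sup>2) \<partial>lborel) \<le> ennreal (4 * (\<integral>x. (g x)\<^sup>2 \<partial>lborel))"
      using bound by (simp add: ennreal_leI)
  qed
  finally have H: "(\<integral>\<^sup>+x. H x \<partial>lborel) \<le> ennreal (4 * (\<integral>x. (g x)\<^sup>2 \<partial>lborel))" .
  then have fin: "AE x in lborel. H x \<noteq> \<infinity>"
    by (intro nn_integral_PInf_AE) (auto simp: top_unique)
  define G where "G x = sqrt (enn2real (H x))" for x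
  have G2: "(G x)\<^sup>2 = enn2real (H x)" for x
    by (simp add: G_def)
  have eqH: "(\<integral>\<^sup>+x. ennreal ((G x)\<^sup>2) \<partial>lborel) = (\<integral>\<^sup>+x. H x \<partial>lborel)"
    by (rule nn_integral_cong_AE) (use fin in \<open>auto elim!: eventually_mono simp: G2 less_top\<close>)
  have [measurable]: "G \<in> borel_measurable borel"
    unfolding G_def by measurable
  have intG: "integrable lborel (\<lambda>x. (G x)\<^sup>2)"
    by (intro integrableI_nonneg) (use eqH H in \<open>auto simp: le_less_trans\<close>)
  show thesis
  proof
    show "G \<in> borel_measurable borel" by measurable
    show "0 \<le> G x" for x by (simp add: G_def)
    show "integrable lborel (\<lambda>x. (G x)\<^sup>2)" by (rule intG)
    have "ennreal (\<integral>x. (G x)\<^sup>2 \<partial>lborel) = (\<integral>\<^sup>+x. H x \<partial>lborel)"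
      using nn_integral_eq_integral[OF intG] eqH by simp
    with H have "ennreal (\<integral>x. (G x)\<^sup>2 \<partial>lborel) \<le> ennreal (4 * (\<integral>x. (g x)\<^sup>2 \<partial>lborel))"
      by simp
    then show "(\<integral>x. (G x)\<^sup>2 \<partial>lborel) \<le> 4 * (\<integral>x. (g x)\<^sup>2 \<partial>lborel)"
      by (subst (asm) ennreal_le_iff) simp_all
    show "AE x in lborel. \<forall>i. av i g x \<le> G x"
      using fin
    proof eventually_elim
      case (elim x)
      show ?case
      proof
        fix i
        have "ennreal ((M (nat \<bar>i\<bar>) x)\<^sup>2) \<le> H x"
          unfolding H_def by (rule SUP_upper) simp
        then have "(M (nat \<bar>i\<bar>) x)\<^sup>2 \<le> enn2real (H x)"
          using elim by (metis enn2real_ennreal enn2real_mono infinity_ennreal_def less_top zero_le_power2)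
        then have "M (nat \<bar>i\<bar>) x \<le> G x"
          unfolding G_def by (rule real_le_rsqrt)
        then show "av i g x \<le> G x"
          using le'[of i "nat \<bar>i\<bar>" x] by simp
      qed
    qed
  qed
qed

section \<open>Change of the average under one halving, and convergence of averages\<close>

lemma Bx_Suc_AE:
  fixes x :: "real^'d::finite" and n
  defines "c \<equiv> (lo n x $ dir n + hi n x $ dir n) / 2"
    and "B \<equiv> box (lo n x) (hi n x)"
  shows "AE y in lborel. (y \<in> Bx n x \<longleftrightarrow> y \<in> B \<inter> {y. y $ dir n < c} \<or> y \<in> B \<inter> {y. c < y $ dir n})
    \<and> (y \<in> Bx (n + 1) x \<longleftrightarrow> (if x $ dir n < c then y \<in> B \<inter> {y. y $ dir n < c} else y \<in> B \<inter> {y. c < y $ dir n}))"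
  using AE_box_Bx[of n x] AE_coord_neq[of "dir n" c]
proof eventually_elim
  case (elim y)
  show ?case
    using elim unfolding Bx_Suc_eq[of n x] c_def[symmetric] B_def by auto
qed

lemma norm_vec_square: "(norm (v :: complex^'d::finite))\<^sup>2 = (\<Sum>k\<in>UNIV. (cmod (v $ k))\<^sup>2)"
  by (simp add: norm_vec_def L2_set_def sum_nonneg)

text \<open>The average over one half minus the average over the whole is, up to sign, 2^n times the
  difference of the integrals over the two halves. The half-difference estimate contributes half a
  side, which is at most 2^(-n/d).\<close>

lemma av_step:
  fixes u :: "real^'d::finite \<Rightarrow> complex"
  assumes D: "has_weak_grad u D" and nD: "\<And>n x. set_integrable lborel (Bx n x) (\<lambda>y. norm (D y))"
  shows "norm (av (n + 1) u x - av n u x) \<le> 2 powr (- real_of_int n / real CARD('d)) * av n (\<lambda>y. norm (D y)) x"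
proof -
  define c where "c = (lo n x $ dir n + hi n x $ dir n) / 2"
  define B where "B = box (lo n x) (hi n x)"
  define L where "L = B \<inter> {y. y $ dir n < c}"
  define R where "R = B \<inter> {y. c < y $ dir n}"
  note AE = Bx_Suc_AE[of n x, folded c_def B_def, folded L_def R_def]
  have li: "locally_integrable u" "locally_integrable (\<lambda>x. D x $ dir n)"
    using D by (auto simp: has_weak_grad_def)
  have [measurable]: "u \<in> borel_measurable borel" "(\<lambda>x. D x $ dir n) \<in> borel_measurable borel"
    using li locally_integrable_borel by auto
  have BC: "B \<subseteq> cbox (lo n x) (hi n x)" by (simp add: B_def box_subset_cbox)
  have [measurable]: "L \<in> sets borel" "R \<in> sets borel" "B \<in> sets borel"
    unfolding L_def R_def B_def by (auto intro!: sets.Int borel_open open_Collect_less continuous_intros)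
  have intL: "integrable lborel (\<lambda>y. u y * indicator L y)" and intR: "integrable lborel (\<lambda>y. u y * indicator R y)"
    using BC by (auto intro!: locally_integrable_mult_indicator[OF li(1) compact_cbox] simp: L_def R_def)
  have disj: "L \<inter> R = {}" by (auto simp: L_def R_def)
  have "(LINT y:Bx n x|lborel. u y) = (\<integral>y. u y * indicator L y + u y * indicator R y \<partial>lborel)"
    unfolding set_integral_eq_mult
  proof (rule integral_cong_AE)
    show "AE y in lborel. u y * indicator (Bx n x) y = u y * indicator L y + u y * indicator R y"
      using AE by eventually_elim (use disj in \<open>auto simp: indicator_def\<close>)
  qed measurable
  also have "\<dots> = (LINT y:L|lborel. u y) + (LINT y:R|lborel. u y)"
    using intL intR by (simp add: set_integral_eq_mult)
  finally have whole: "(LINT y:Bx n x|lborel. u y) = (LINT y:L|lborel. u y) + (LINT y:R|lborel. u y)" .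
  have half: "(LINT y:Bx (n + 1) x|lborel. u y) = (if x $ dir n < c then (LINT y:L|lborel. u y) else (LINT y:R|lborel. u y))"
  proof (cases "x $ dir n < c")
    case True
    have "(LINT y:Bx (n + 1) x|lborel. u y) = (LINT y:L|lborel. u y)"
      unfolding set_integral_eq_mult
    proof (rule integral_cong_AE)
      show "AE y in lborel. u y * indicator (Bx (n + 1) x) y = u y * indicator L y"
        using AE by eventually_elim (use True in \<open>simp add: indicator_def\<close>)
    qed measurable
    then show ?thesis using True by simp
  next
    case False
    have "(LINT y:Bx (n + 1) x|lborel. u y) = (LINT y:R|lborel. u y)"
      unfolding set_integral_eq_mult
    proof (rule integral_cong_AE)
      show "AE y in lborel. u y * indicator (Bx (n + 1) x) y = u y * indicator R y"
        using AE by eventually_elim (use False in \<open>simp add: indicator_def\<close>)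
    qed measurable
    then show ?thesis using False by simp
  qed
  \<comment> \<open>For x in the left half: 2^(n+1) L - 2^n (L + R) = 2^n (L - R), with L and R the
    two integrals. The right half only changes the sign.\<close>
  have "norm (av (n + 1) u x - av n u x) = 2 powr real_of_int n * cmod ((LINT y:L|lborel. u y) - (LINT y:R|lborel. u y))"
  proof -
    have "av (n + 1) u x - av n u x
        = (2 powr real_of_int n) *\<^sub>R (if x $ dir n < c then (LINT y:L|lborel. u y) - (LINT y:R|lborel. u y)
          else (LINT y:R|lborel. u y) - (LINT y:L|lborel. u y))"
      unfolding av_def whole half by (simp add: powr_add algebra_simps scaleR_conv_of_real)
    then show ?thesis by (simp add: norm_minus_commute)
  qed
  also have "\<dots> \<le> 2 powr real_of_int n * (side n (dir n :: 'd) / 2 * (LINT y:B|lborel. cmod (D y $ dir n)))"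
  proof (rule mult_left_mono)
    have "lo n x $ dir n < hi n x $ dir n" by (simp add: hi_def)
    from half_difference[OF D this]
    show "cmod ((LINT y:L|lborel. u y) - (LINT y:R|lborel. u y)) \<le> side n (dir n :: 'd) / 2 * (LINT y:B|lborel. cmod (D y $ dir n))"
      unfolding L_def R_def B_def c_def by (simp add: hi_def)
  qed simp
  also have "\<dots> \<le> 2 powr real_of_int n * (2 powr (- real_of_int n / real CARD('d)) * (LINT y:Bx n x|lborel. norm (D y)))"
  proof (intro mult_left_mono mult_mono)
    show "side n (dir n :: 'd) / 2 \<le> 2 powr (- real_of_int n / real CARD('d))"
      using side_le[of n "dir n :: 'd"] by simp
    have 1: "set_integrable lborel B (\<lambda>y. cmod (D y $ dir n))"
      using set_integrable_norm[OF set_integrable_subset[of lborel "cbox (lo n x) (hi n x)" "\<lambda>y. D y $ dir n" B]]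
        li(2) BC by (auto simp: locally_integrable_def)
    show "(LINT y:B|lborel. cmod (D y $ dir n)) \<le> (LINT y:Bx n x|lborel. norm (D y))"
      unfolding set_lebesgue_integral_def
    proof (rule integral_mono)
      show "indicat_real B y *\<^sub>R cmod (D y $ dir n) \<le> indicat_real (Bx n x) y *\<^sub>R norm (D y)" for y
        using box_subset_Bx[of n x] by (auto simp: indicator_def B_def Finite_Cartesian_Product.norm_nth_le)
    qed (use 1 nD in \<open>auto simp: set_integrable_def\<close>)
    show "0 \<le> (LINT y:B|lborel. cmod (D y $ dir n))"
      unfolding set_lebesgue_integral_def by (intro integral_nonneg_AE) auto
  qed auto
  finally show ?thesis by (simp add: av_def mult_ac)
qed

text \<open>Finite stretches are estimated in closed form first, because the existence of the limit
  rests on them; the tail bound is then their limit.\<close>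

lemma geometric_tail:
  fixes a :: "nat \<Rightarrow> 'a::banach"
  assumes a: "\<And>n. norm (a (Suc n) - a n) \<le> c * q ^ n" and q: "0 < q" "q < 1" and c: "0 \<le> c"
  shows "\<exists>L. a \<longlonglongrightarrow> L" and "a \<longlonglongrightarrow> L \<Longrightarrow> norm (L - a N) \<le> c * q ^ N / (1 - q)"
proof -
  have step: "norm (a (N + k) - a N) \<le> c * q ^ N * (1 - q ^ k) / (1 - q)" for N k
  proof (induction k)
    case (Suc k)
    have "norm (a (N + Suc k) - a N) \<le> norm (a (Suc (N + k)) - a (N + k)) + norm (a (N + k) - a N)"
      using norm_triangle_ineq[of "a (Suc (N + k)) - a (N + k)" "a (N + k) - a N"] by simp
    also have "\<dots> \<le> c * q ^ (N + k) + c * q ^ N * (1 - q ^ k) / (1 - q)"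
      using a[of "N + k"] Suc by (rule add_mono)
    also have "\<dots> = c * q ^ N * (1 - q ^ Suc k) / (1 - q)"
      using q by (simp add: field_simps power_add)
    finally show ?case .
  qed simp
  have tail: "norm (a (N + k) - a N) \<le> c * q ^ N / (1 - q)" for N k
  proof -
    have "c * q ^ N * (1 - q ^ k) \<le> c * q ^ N * 1"
      using c q by (intro mult_left_mono) auto
    then have "c * q ^ N * (1 - q ^ k) / (1 - q) \<le> c * q ^ N * 1 / (1 - q)"
      using q by (intro divide_right_mono) auto
    then show ?thesis using step[of N k] by simp
  qed
  have "(\<lambda>N. c * q ^ N / (1 - q)) \<longlonglongrightarrow> c * 0 / (1 - q)"
    using q by (intro tendsto_intros LIMSEQ_power_zero) auto
  then have lim: "(\<lambda>N. c * q ^ N / (1 - q)) \<longlonglongrightarrow> 0" by simp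
  have "Cauchy a"
  proof (rule CauchyI')
    fix e :: real assume "e > 0"
    then obtain N where N: "c * q ^ N / (1 - q) < e / 2"
      using order_tendstoD(2)[OF lim, of "e / 2"] by (auto simp: eventually_sequentially)
    have "norm (a m - a n) < e" if mn: "N \<le> m" "m < n" for m n
    proof -
      have "norm (a m - a N) \<le> c * q ^ N / (1 - q)" "norm (a n - a N) \<le> c * q ^ N / (1 - q)"
        using tail[of N "m - N"] tail[of N "n - N"] mn by auto
      moreover have "norm (a m - a n) \<le> norm (a m - a N) + norm (a n - a N)"
        using norm_triangle_ineq4[of "a m - a N" "a n - a N"] by simp
      ultimately show ?thesis using N by linarith
    qed
    then show "\<exists>M. \<forall>m\<ge>M. \<forall>n>m. dist (a m) (a n) < e" unfolding dist_norm by blast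
  qed
  then show "\<exists>L. a \<longlonglongrightarrow> L"
    using Cauchy_convergent convergent_def by blast
  assume L: "a \<longlonglongrightarrow> L"
  have "(\<lambda>k. a (N + k)) \<longlonglongrightarrow> L"
    using LIMSEQ_ignore_initial_segment[OF L, of N] by (simp add: add.commute)
  then have "(\<lambda>k. norm (a (N + k) - a N)) \<longlonglongrightarrow> norm (L - a N)"
    by (intro tendsto_intros)
  then show "norm (L - a N) \<le> c * q ^ N / (1 - q)"
    by (rule Lim_bounded) (use tail in auto)
qed

text \<open>The tower property. The indicator of a coarse box is constant on fine boxes, so
  self-adjointness settles nonnegative functions; the general case is split into positive and
  negative part.\<close>

lemma av_set_integral:
  fixes g :: "real^'d::finite \<Rightarrow> real"
  assumes [measurable]: "g \<in> borel_measurable borel" and g: "\<And>n x. set_integrable lborel (Bx n x) g" and "m \<le> n"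
  shows "set_integrable lborel (Bx m x) (av n g)"
    and "(LINT y:Bx m x|lborel. av n g y) = (LINT y:Bx m x|lborel. g y)"
proof -
  have pos: "set_integrable lborel (Bx m x) (av n h) \<and> (LINT y:Bx m x|lborel. av n h y) = (LINT y:Bx m x|lborel. h y)"
    if [measurable]: "h \<in> borel_measurable borel" and h: "\<And>n x. set_integrable lborel (Bx n x) h" "\<And>x. 0 \<le> h x" for h :: "real^'d \<Rightarrow> real"
  proof -
    have "(\<integral>\<^sup>+y. indicator (Bx m x) y * ennreal (av n h y) \<partial>lborel) = (\<integral>\<^sup>+y. indicator (Bx m x) y * ennreal (h y) \<partial>lborel)"
    proof (rule nn_integral_av)
      show "indicator (Bx m x) z = (indicator (Bx m x) y :: ennreal)" if "z \<in> Bx n y" for y z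
      proof -
        have "z \<in> Bx m y" using Bx_mono[OF \<open>m \<le> n\<close>, of y] that by blast
        then have "z \<in> Bx m x \<longleftrightarrow> y \<in> Bx m x" using Bx_eq Bx_sym by metis
        then show ?thesis by (simp add: indicator_def)
      qed
    qed (use h in auto)
    then have eq: "(\<integral>\<^sup>+y. ennreal (indicator (Bx m x) y *\<^sub>R av n h y) \<partial>lborel) = (\<integral>\<^sup>+y. ennreal (indicator (Bx m x) y *\<^sub>R h y) \<partial>lborel)"
      by (simp add: ennreal_mult' ennreal_indicator)
    have h0: "0 \<le> av n h y" for y by (rule av_nonneg) (rule h)
    have "(\<integral>\<^sup>+y. ennreal (indicator (Bx m x) y *\<^sub>R h y) \<partial>lborel) = ennreal (LINT y:Bx m x|lborel. h y)"
      unfolding set_lebesgue_integral_def by (rule nn_integral_eq_integral) (use h in \<open>auto simp: set_integrable_def\<close>)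
    note eq = eq[unfolded this]
    then have int: "integrable lborel (\<lambda>y. indicator (Bx m x) y *\<^sub>R av n h y)"
      by (intro integrableI_nonneg) (auto simp: h0)
    have "(\<integral>\<^sup>+y. ennreal (indicator (Bx m x) y *\<^sub>R av n h y) \<partial>lborel) = ennreal (LINT y:Bx m x|lborel. av n h y)"
      unfolding set_lebesgue_integral_def by (rule nn_integral_eq_integral[OF int]) (simp add: h0)
    moreover have "0 \<le> (LINT y:Bx m x|lborel. av n h y)" "0 \<le> (LINT y:Bx m x|lborel. h y)"
      unfolding set_lebesgue_integral_def by (intro integral_nonneg_AE; simp add: h h0)+
    ultimately show ?thesis
      using int eq by (simp add: set_integrable_def)
  qed
  have part: "set_integrable lborel (Bx n x) (\<lambda>y. max 0 (h y))"
    if "\<And>n x. set_integrable lborel (Bx n x) h" "h \<in> borel_measurable borel" for h :: "real^'d \<Rightarrow> real" and n x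
    unfolding set_integrable_def
    by (rule Bochner_Integration.integrable_bound[OF that(1)[unfolded set_integrable_def]])
       (use that(2) in \<open>auto simp: indicator_def\<close>)
  have ng: "set_integrable lborel (Bx n x) (\<lambda>y. - g y)" for n x
    using g[of n x] by (simp add: set_integrable_def)
  define p where "p y = max 0 (g y)" for y
  define q where "q y = max 0 (- g y)" for y
  have [measurable]: "p \<in> borel_measurable borel" "q \<in> borel_measurable borel"
    unfolding p_def q_def by measurable
  have pq: "set_integrable lborel (Bx n x) p" "set_integrable lborel (Bx n x) q" for n x
    unfolding p_def q_def using part[OF g] part[OF ng] by auto
  have gpq: "g = (\<lambda>y. p y - q y)" by (auto simp: p_def q_def max_def)
  have avg: "av n g = (\<lambda>y. av n p y - av n q y)"
    unfolding gpq by (intro ext av_diff pq)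
  have P: "set_integrable lborel (Bx m x) (av n p)" "(LINT y:Bx m x|lborel. av n p y) = (LINT y:Bx m x|lborel. p y)"
    and Q: "set_integrable lborel (Bx m x) (av n q)" "(LINT y:Bx m x|lborel. av n q y) = (LINT y:Bx m x|lborel. q y)"
    using pos[of p] pos[of q] pq by (auto simp: p_def q_def)
  show "set_integrable lborel (Bx m x) (av n g)"
    unfolding avg by (rule set_integral_diff(1)[OF P(1) Q(1)])
  show "(LINT y:Bx m x|lborel. av n g y) = (LINT y:Bx m x|lborel. g y)"
    unfolding avg set_integral_diff(2)[OF P(1) Q(1)]
    unfolding gpq set_integral_diff(2)[OF pq] P(2) Q(2) by simp
qed

text \<open>Identifies the limit of the averages without Lebesgue's differentiation theorem. On a
  fixed box the integrals of g and of its finer averages coincide, so the integral of w - g is at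
  most \<epsilon> N times that of G for all large N, hence zero.\<close>

lemma av_limit:
  fixes g :: "real^'d::finite \<Rightarrow> real"
  assumes [measurable]: "g \<in> borel_measurable borel" "w \<in> borel_measurable borel" "G \<in> borel_measurable borel"
    and g: "\<And>n x. set_integrable lborel (Bx n x) g" and G: "\<And>n x. set_integrable lborel (Bx n x) G"
    and \<epsilon>: "\<epsilon> \<longlonglongrightarrow> 0" and w: "AE x in lborel. \<forall>N. \<bar>w x - av (int N) g x\<bar> \<le> \<epsilon> N * G x"
  shows "AE x in lborel. w x = g x"
proof -
  have diff: "set_integrable lborel (Bx m x) (\<lambda>y. w y - av (int N) g y)" for m x N
  proof -
    have "integrable lborel (\<lambda>y. \<epsilon> N * (indicator (Bx m x) y *\<^sub>R G y))"
      using G[of m x] by (simp add: set_integrable_def)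
    then show ?thesis
      unfolding set_integrable_def
    proof (rule Bochner_Integration.integrable_bound)
      show "AE y in lborel. norm (indicat_real (Bx m x) y *\<^sub>R (w y - av (int N) g y)) \<le> norm (\<epsilon> N * (indicat_real (Bx m x) y *\<^sub>R G y))"
        using w by eventually_elim (auto simp: indicator_def intro: order_trans)
    qed measurable
  qed
  have wint: "set_integrable lborel (Bx m x) w" for m x
  proof -
    define N where "N = nat m"
    have "set_integrable lborel (Bx m x) (\<lambda>y. (w y - av (int N) g y) + av (int N) g y)"
      by (rule set_integral_add(1)[OF diff av_set_integral(1)]) (use g in \<open>auto simp: N_def\<close>)
    then show ?thesis by simp
  qed
  have "AE x in lborel. w x - g x = 0"
  proof (rule real_zero_AE)
    show "set_integrable lborel (Bx n x) (\<lambda>x. w x - g x)" for n x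
      by (rule set_integral_diff(1)[OF wint g])
    fix m and x :: "real^'d"
    let ?I = "LINT y:Bx m x|lborel. w y - g y"
    have bound: "\<bar>?I\<bar> \<le> \<epsilon> N * (LINT y:Bx m x|lborel. G y)" if "m \<le> int N" for N
    proof -
      have av: "set_integrable lborel (Bx m x) (av (int N) g)"
        "(LINT y:Bx m x|lborel. av (int N) g y) = (LINT y:Bx m x|lborel. g y)"
        using av_set_integral[OF assms(1) g that] by auto
      have "?I = (LINT y:Bx m x|lborel. w y) - (LINT y:Bx m x|lborel. av (int N) g y)"
        unfolding av by (rule set_integral_diff(2)[OF wint g])
      also have "\<dots> = (LINT y:Bx m x|lborel. w y - av (int N) g y)"
        by (rule set_integral_diff(2)[OF wint av(1), symmetric])
      finally have "\<bar>?I\<bar> = norm (\<integral>y. indicator (Bx m x) y *\<^sub>R (w y - av (int N) g y) \<partial>lborel)"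
        by (simp add: set_lebesgue_integral_def)
      also have "\<dots> \<le> (\<integral>y. norm (indicator (Bx m x) y *\<^sub>R (w y - av (int N) g y)) \<partial>lborel)"
        by (rule integral_norm_bound)
      also have "\<dots> \<le> (\<integral>y. \<epsilon> N * (indicator (Bx m x) y *\<^sub>R G y) \<partial>lborel)"
      proof (rule integral_mono_AE)
        show "AE y in lborel. norm (indicator (Bx m x) y *\<^sub>R (w y - av (int N) g y)) \<le> \<epsilon> N * (indicator (Bx m x) y *\<^sub>R G y)"
          using w by eventually_elim (auto simp: indicator_def)
      qed (use diff[of m x N] G[of m x] in \<open>auto simp: set_integrable_def\<close>)
      finally show ?thesis by (simp add: set_lebesgue_integral_def)
    qed
    have "(\<lambda>N. \<epsilon> N * (LINT y:Bx m x|lborel. G y)) \<longlonglongrightarrow> 0 * (LINT y:Bx m x|lborel. G y)"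
      by (intro tendsto_mult \<epsilon> tendsto_const)
    moreover have "\<forall>\<^sub>F N in sequentially. \<bar>?I\<bar> \<le> \<epsilon> N * (LINT y:Bx m x|lborel. G y)"
      using eventually_ge_at_top[of "nat m"] by eventually_elim (rule bound, simp)
    ultimately have "\<bar>?I\<bar> \<le> 0 * (LINT y:Bx m x|lborel. G y)"
      by (intro tendsto_lowerbound) auto
    then show "?I = 0" by simp
  qed measurable
  then show ?thesis by simp
qed

section \<open>Sobolev inequalities\<close>

text \<open>The gradient is carried along explicitly; \<open>sob_weak_grad\<close> returns to the
  chosen \<open>weak_grad\<close> when the energy is computed.\<close>

definition sob :: "(real^'d::finite \<Rightarrow> complex) \<Rightarrow> (real^'d \<Rightarrow> complex^'d) \<Rightarrow> bool" where
  "sob u D \<longleftrightarrow> has_weak_grad u D \<and> (\<forall>k. (\<lambda>x. D x $ k) \<in> Lp 2)"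

definition dirichlet :: "(real^'d::finite \<Rightarrow> complex^'d) \<Rightarrow> real" where
  "dirichlet D = (\<integral>x. (norm (D x))\<^sup>2 \<partial>lborel)"

lemma dirichlet_nonneg [simp]: "0 \<le> dirichlet D"
  by (simp add: dirichlet_def)

lemma Lp2_iff: "f \<in> Lp 2 \<longleftrightarrow> f \<in> borel_measurable borel \<and> integrable lborel (\<lambda>x. (cmod (f x))\<^sup>2)"
  by (simp add: Lp_def)

lemma sob_borel:
  assumes "sob u D"
  shows "u \<in> borel_measurable borel" "(\<lambda>x. D x $ k) \<in> borel_measurable borel" "(\<lambda>x. norm (D x)) \<in> borel_measurable borel"
    "integrable lborel (\<lambda>x. (norm (D x))\<^sup>2)" "integrable lborel (\<lambda>x. (cmod (D x $ k))\<^sup>2)"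
proof -
  show "u \<in> borel_measurable borel"
    using assms by (simp add: sob_def has_weak_grad_def locally_integrable_borel)
  have [measurable]: "(\<lambda>x. D x $ k) \<in> borel_measurable borel" and int: "integrable lborel (\<lambda>x. (cmod (D x $ k))\<^sup>2)" for k
    using assms by (auto simp: sob_def Lp2_iff)
  then show "(\<lambda>x. D x $ k) \<in> borel_measurable borel" "integrable lborel (\<lambda>x. (cmod (D x $ k))\<^sup>2)" by auto
  show "(\<lambda>x. norm (D x)) \<in> borel_measurable borel"
    unfolding norm_vec_def L2_set_def by measurable
  show "integrable lborel (\<lambda>x. (norm (D x))\<^sup>2)"
    unfolding norm_vec_square by (intro Bochner_Integration.integrable_sum int)
qed

lemma av_complex_parts:
  fixes u :: "real^'d::finite \<Rightarrow> complex"
  assumes "set_integrable lborel (Bx n x) u"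
  shows "av n (\<lambda>y. Re (u y)) x = Re (av n u x)" "av n (\<lambda>y. Im (u y)) x = Im (av n u x)"
  using integral_Re[OF assms[unfolded set_integrable_def]] integral_Im[OF assms[unfolded set_integrable_def]]
  by (simp_all add: av_def set_lebesgue_integral_def)

lemma powr_geometric: "2 powr (- (t + real n) * \<alpha>) = 2 powr (- t * \<alpha>) * (2 powr (- \<alpha>)) ^ n"
proof -
  have "(2 powr (- \<alpha>)) ^ n = 2 powr (- real n * \<alpha>)"
    by (simp add: powr_realpow[symmetric] powr_powr mult.commute)
  then show ?thesis by (simp add: powr_add[symmetric] algebra_simps)
qed

text \<open>The common source of the Sobolev estimates. The increments are 2^(-n/d) times a local
  average of the gradient, and that average has two competing bounds: the maximal function, useful
  on fine levels, and 2^(n/2) times the L^2 norm, useful on coarse levels.\<close>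

lemma sobolev_core:
  fixes u :: "real^'d::finite \<Rightarrow> complex"
  assumes u: "sob u D"
  obtains G where "G \<in> borel_measurable borel" "\<And>x. 0 \<le> G x" "integrable lborel (\<lambda>x. (G x)\<^sup>2)"
    "(\<integral>x. (G x)\<^sup>2 \<partial>lborel) \<le> 4 * dirichlet D"
    "AE x in lborel. (\<lambda>n. av (int n) u x) \<longlonglongrightarrow> u x \<and> (\<exists>h. \<forall>n. 0 \<le> h n \<and> h n \<le> G x
      \<and> h n \<le> 2 powr (real_of_int n / 2) * sqrt (dirichlet D)
      \<and> norm (av (n + 1) u x - av n u x) \<le> 2 powr (- real_of_int n / real CARD('d)) * h n)"
proof -
  note meas [measurable] = sob_borel(1-3)[OF u]
  have wg: "has_weak_grad u D" and li: "locally_integrable u"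
    using u by (auto simp: sob_def has_weak_grad_def)
  let ?g = "\<lambda>x. norm (D x)"
  obtain G where [measurable]: "G \<in> borel_measurable borel" and G: "\<And>x. 0 \<le> G x" "integrable lborel (\<lambda>x. (G x)\<^sup>2)"
    "(\<integral>x. (G x)\<^sup>2 \<partial>lborel) \<le> 4 * (\<integral>x. (?g x)\<^sup>2 \<partial>lborel)" "AE x in lborel. \<forall>i. av i ?g x \<le> G x"
    by (rule maximal_function[of ?g]) (use sob_borel[OF u] in auto)
  define d where "d = real CARD('d)"
  have d: "d > 0" by (simp add: d_def zero_less_card_finite)
  define q :: real where "q = 2 powr (- (1 / d))"
  have q: "0 < q" "q < 1"
    using d powr_less_one[of 2 "- (1 / d)"] by (auto simp: q_def)
  have step: "norm (av (n + 1) u x - av n u x) \<le> 2 powr (- real_of_int n / d) * av n ?g x" for n x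
    unfolding d_def by (rule av_step[OF wg set_integrable_square_Bx]) (use sob_borel[OF u] in auto)
  have tail: "(\<exists>L. (\<lambda>n. av (int n) u x) \<longlonglongrightarrow> L) \<and>
      (\<forall>L N. (\<lambda>n. av (int n) u x) \<longlonglongrightarrow> L \<longrightarrow> norm (L - av (int N) u x) \<le> G x * q ^ N / (1 - q))"
    if "\<forall>i. av i ?g x \<le> G x" for x
  proof -
    have "norm (av (int (Suc n)) u x - av (int n) u x) \<le> G x * q ^ n" for n
    proof -
      have "norm (av (int n + 1) u x - av (int n) u x) \<le> 2 powr (- real_of_int (int n) / d) * G x"
        by (rule order_trans[OF step]) (use that in \<open>auto intro!: mult_left_mono\<close>)
      also have "2 powr (- real_of_int (int n) / d) = q ^ n"
        using powr_geometric[of 0 n "1 / d"] by (simp add: q_def)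
      finally show ?thesis by (simp add: mult.commute add.commute)
    qed
    from geometric_tail[OF this q G(1)] show ?thesis by blast
  qed
  \<comment> \<open>A limit of averages is automatically measurable; it is identified with u
    afterwards, separately for real and imaginary part.\<close>
  define v where "v x = lim (\<lambda>n. av (int n) u x)" for x
  have [measurable]: "v \<in> borel_measurable borel"
    unfolding v_def by measurable
  have conv: "AE x in lborel. (\<lambda>n. av (int n) u x) \<longlonglongrightarrow> v x"
    using G(4)
  proof eventually_elim
    case (elim x)
    then have "convergent (\<lambda>n. av (int n) u x)" using tail[of x] by (auto simp: convergent_def)
    then show ?case by (simp add: v_def convergent_LIMSEQ_iff)
  qed
  define \<epsilon> where "\<epsilon> N = q ^ N / (1 - q)" for N
  have "(\<lambda>N. q ^ N / (1 - q)) \<longlonglongrightarrow> 0 / (1 - q)"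
    using q by (intro tendsto_intros LIMSEQ_power_zero) auto
  then have \<epsilon>: "\<epsilon> \<longlonglongrightarrow> 0" by (simp add: \<epsilon>_def[abs_def])
  have vt: "AE x in lborel. \<forall>N. norm (v x - av (int N) u x) \<le> \<epsilon> N * G x"
    using conv G(4) by eventually_elim (use tail in \<open>auto simp: \<epsilon>_def mult.commute\<close>)
  have intu: "set_integrable lborel (Bx n x) u" for n x
    by (rule locally_integrable_Bx[OF li])
  have intG: "set_integrable lborel (Bx n x) G" for n x
    by (rule set_integrable_square_Bx) (use G in auto)
  have "AE x in lborel. Re (v x) = Re (u x)"
  proof (rule av_limit[OF _ _ _ _ intG \<epsilon>])
    show "set_integrable lborel (Bx n x) (\<lambda>x. Re (u x))" for n x
      using integrable_Re[OF intu[of n x, unfolded set_integrable_def]] by (simp add: set_integrable_def)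
    show "AE x in lborel. \<forall>N. \<bar>Re (v x) - av (int N) (\<lambda>x. Re (u x)) x\<bar> \<le> \<epsilon> N * G x"
      using vt
    proof eventually_elim
      case (elim x)
      have "\<bar>Re (v x - av (int N) u x)\<bar> \<le> \<epsilon> N * G x" for N
        using elim abs_Re_le_cmod order_trans by blast
      then show ?case by (simp add: av_complex_parts[OF intu])
    qed
  qed measurable
  moreover have "AE x in lborel. Im (v x) = Im (u x)"
  proof (rule av_limit[OF _ _ _ _ intG \<epsilon>])
    show "set_integrable lborel (Bx n x) (\<lambda>x. Im (u x))" for n x
      using integrable_Im[OF intu[of n x, unfolded set_integrable_def]] by (simp add: set_integrable_def)
    show "AE x in lborel. \<forall>N. \<bar>Im (v x) - av (int N) (\<lambda>x. Im (u x)) x\<bar> \<le> \<epsilon> N * G x"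
      using vt
    proof eventually_elim
      case (elim x)
      have "\<bar>Im (v x - av (int N) u x)\<bar> \<le> \<epsilon> N * G x" for N
        using elim abs_Im_le_cmod order_trans by blast
      then show ?case by (simp add: av_complex_parts[OF intu])
    qed
  qed measurable
  ultimately have vu: "AE x in lborel. v x = u x"
    by eventually_elim (simp add: complex_eq_iff)
  show thesis
  proof
    show "AE x in lborel. (\<lambda>n. av (int n) u x) \<longlonglongrightarrow> u x \<and> (\<exists>h. \<forall>n. 0 \<le> h n \<and> h n \<le> G x
      \<and> h n \<le> 2 powr (real_of_int n / 2) * sqrt (dirichlet D)
      \<and> norm (av (n + 1) u x - av n u x) \<le> 2 powr (- real_of_int n / real CARD('d)) * h n)"
      using conv vu G(4)
    proof eventually_elim
      case (elim x)
      have "av n ?g x \<le> 2 powr (real_of_int n / 2) * sqrt (dirichlet D)" for n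
      proof (rule power2_le_imp_le)
        have "(av n ?g x)\<^sup>2 \<le> av n (\<lambda>x. (?g x)\<^sup>2) x"
          by (rule av_square) (use sob_borel[OF u] in auto)
        also have "\<dots> \<le> 2 powr real_of_int n * dirichlet D"
          unfolding dirichlet_def by (rule av_le_integral) (use sob_borel[OF u] in auto)
        also have "\<dots> = (2 powr (real_of_int n / 2) * sqrt (dirichlet D))\<^sup>2"
          by (simp add: power_mult_distrib powr_power)
        finally show "(av n ?g x)\<^sup>2 \<le> (2 powr (real_of_int n / 2) * sqrt (dirichlet D))\<^sup>2" .
      qed simp
      moreover have "0 \<le> av n ?g x" for n by (rule av_nonneg) simp
      ultimately show ?case
        using elim step by (auto simp: d_def intro!: exI[of _ "\<lambda>n. av n ?g x"])
    qed
  qed (use G in \<open>auto simp: dirichlet_def\<close>)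
qed

section \<open>Summing the increments of the averages\<close>

lemma le_powr_interpolate:
  fixes m a b t :: real
  assumes "0 \<le> m" "m \<le> a" "m \<le> b" "0 \<le> t" "t \<le> 1"
  shows "m \<le> a powr t * b powr (1 - t)"
proof (cases "m = 0")
  case False
  have "m = m powr t * m powr (1 - t)"
    using assms False by (simp add: powr_add[symmetric])
  also have "\<dots> \<le> a powr t * b powr (1 - t)"
    using assms by (intro mult_mono powr_mono2) auto
  finally show ?thesis .
qed simp

lemma filterlim_av_shift:
  assumes "(\<lambda>n. av (int n) u x) \<longlonglongrightarrow> L"
  shows "(\<lambda>j. av (N + int j) u x) \<longlonglongrightarrow> L"
proof -
  have "filterlim (\<lambda>j. nat (N + int j)) at_top sequentially"
    unfolding filterlim_at_top
  proof
    fix Z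
    show "\<forall>\<^sub>F j in sequentially. Z \<le> nat (N + int j)"
      using eventually_ge_at_top[of "Z + nat \<bar>N\<bar>"] by eventually_elim linarith
  qed
  from filterlim_compose[OF assms this]
  show ?thesis
  proof (rule Lim_transform_eventually)
    show "\<forall>\<^sub>F j in sequentially. av (int (nat (N + int j))) u x = av (N + int j) u x"
      using eventually_ge_at_top[of "nat \<bar>N\<bar>"]
      by eventually_elim (rule arg_cong[where f = "\<lambda>n. av n u x"], linarith)
  qed
qed

lemma up_tail:
  fixes u :: "real^'d::finite \<Rightarrow> complex"
  assumes "(\<lambda>n. av (int n) u x) \<longlonglongrightarrow> u x" "\<alpha> > 0" "c \<ge> 0"
    and "\<And>n. norm (av (n + 1) u x - av n u x) \<le> c * 2 powr (- real_of_int n * \<alpha>)"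
  shows "norm (u x - av N u x) \<le> c * 2 powr (- real_of_int N * \<alpha>) / (1 - 2 powr (- \<alpha>))"
proof -
  have q: "0 < 2 powr (- \<alpha>)" "2 powr (- \<alpha>) < (1::real)"
    using assms(2) powr_less_one[of 2 "- \<alpha>"] by auto
  have "norm (av (N + int (Suc j)) u x - av (N + int j) u x)
      \<le> c * 2 powr (- real_of_int N * \<alpha>) * (2 powr (- \<alpha>)) ^ j" for j
    using assms(4)[of "N + int j"] powr_geometric[of "real_of_int N" j \<alpha>]
    by (simp add: add.assoc add.commute[of 1] mult.assoc)
  from geometric_tail(2)[OF this q _ filterlim_av_shift[OF assms(1)], of 0] assms(3)
  show ?thesis by simp
qed

lemma down_tail:
  fixes u :: "real^'d::finite \<Rightarrow> complex"
  assumes "(\<lambda>j. av (N - int j) u x) \<longlonglongrightarrow> 0" "\<beta> > 0" "c \<ge> 0"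
    and "\<And>n. norm (av (n + 1) u x - av n u x) \<le> c * 2 powr (real_of_int n * \<beta>)"
  shows "norm (av N u x) \<le> c * 2 powr (real_of_int N * \<beta>) / (1 - 2 powr (- \<beta>))"
proof -
  have q: "0 < 2 powr (- \<beta>)" "2 powr (- \<beta>) < (1::real)"
    using assms(2) powr_less_one[of 2 "- \<beta>"] by auto
  have "norm (av (N - int (Suc j)) u x - av (N - int j) u x)
      \<le> c * 2 powr (real_of_int N * \<beta>) * (2 powr (- \<beta>)) ^ j" for j
  proof -
    have "norm (av (N - int (Suc j)) u x - av (N - int j) u x) \<le> c * 2 powr (real_of_int (N - int (Suc j)) * \<beta>)"
      using assms(4)[of "N - int (Suc j)"] by (simp add: norm_minus_commute)
    \<comment> \<open>The exact level is N - j - 1. Rounding it up lets the series start at 2^(N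
      \<beta>) and match the form of the geometric tail.\<close>
    also have "\<dots> \<le> c * 2 powr (real_of_int (N - int j) * \<beta>)"
      using assms(2,3) by (intro mult_left_mono powr_mono mult_right_mono) auto
    also have "2 powr (real_of_int (N - int j) * \<beta>) = 2 powr (real_of_int N * \<beta>) * (2 powr (- \<beta>)) ^ j"
      using powr_geometric[of "- real_of_int N" j \<beta>] by (simp add: algebra_simps)
    finally show ?thesis by simp
  qed
  from geometric_tail(2)[OF this q _ assms(1), of 0] assms(3)
  show ?thesis by simp
qed

text \<open>Interpolating the local average between its two bounds with weight 2/r leaves increments
  of size 2^(-n \<alpha>) with \<alpha> = 1/d - 1/2 + 1/r, which is positive exactly in the
  subcritical range. The r-th power turns the factor G^(2/r) into the integrable G^2.\<close>

lemma lr_estimate: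
  fixes r :: real
  assumes r: "2 \<le> r" "r * (real CARD('d::finite) - 2) < 2 * real CARD('d)"
  obtains \<alpha> C where "\<alpha> > 0" "C \<ge> 0"
    "\<And>(u :: real^'d \<Rightarrow> complex) D N. sob u D \<Longrightarrow>
      integrable lborel (\<lambda>x. cmod (u x - av N u x) powr r)
      \<and> (\<integral>x. cmod (u x - av N u x) powr r \<partial>lborel) \<le> C * 2 powr (- real_of_int N * \<alpha>) * dirichlet D powr (r / 2)"
proof -
  define d where "d = real CARD('d)"
  have d: "d > 0" by (simp add: d_def zero_less_card_finite)
  define \<alpha> where "\<alpha> = 1 / d - 1 / 2 + 1 / r"
  have \<alpha>: "\<alpha> > 0"
  proof -
    have "\<alpha> = (2 * d - r * (d - 2)) / (2 * d * r)"
      using d r by (simp add: \<alpha>_def field_simps)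
    then show ?thesis using r d by (simp add: d_def)
  qed
  define K where "K = 1 / (1 - 2 powr (- \<alpha>))"
  have K: "K > 0" using \<alpha> powr_less_one[of 2 "- \<alpha>"] by (simp add: K_def)
  show thesis
  proof (rule that[of "\<alpha> * r" "4 * K powr r"])
    fix u :: "real^'d \<Rightarrow> complex" and D N
    assume u: "sob u D"
    define A where "A = dirichlet D"
    have [measurable]: "u \<in> borel_measurable borel" by (rule sob_borel(1)[OF u])
    obtain G where [measurable]: "G \<in> borel_measurable borel" and G: "\<And>x. 0 \<le> G x" "integrable lborel (\<lambda>x. (G x)\<^sup>2)"
      "(\<integral>x. (G x)\<^sup>2 \<partial>lborel) \<le> 4 * A"
      and ae: "AE x in lborel. (\<lambda>n. av (int n) u x) \<longlonglongrightarrow> u x \<and> (\<exists>h. \<forall>n. 0 \<le> h n \<and> h n \<le> G x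
        \<and> h n \<le> 2 powr (real_of_int n / 2) * sqrt A
        \<and> norm (av (n + 1) u x - av n u x) \<le> 2 powr (- real_of_int n / real CARD('d)) * h n)"
      using sobolev_core[OF u] unfolding A_def by blast
    define c where "c x = G x powr (2 / r) * sqrt A powr (1 - 2 / r)" for x
    have pw: "AE x in lborel. norm (u x - av N u x) \<le> c x * 2 powr (- real_of_int N * \<alpha>) * K"
      using ae
    proof eventually_elim
      case (elim x)
      then obtain h where h: "\<And>n. 0 \<le> h n" "\<And>n. h n \<le> G x" "\<And>n. h n \<le> 2 powr (real_of_int n / 2) * sqrt A"
        "\<And>n. norm (av (n + 1) u x - av n u x) \<le> 2 powr (- real_of_int n / d) * h n"
        by (auto simp: d_def)
      have "norm (av (n + 1) u x - av n u x) \<le> c x * 2 powr (- real_of_int n * \<alpha>)" for n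
      proof -
        have "h n \<le> G x powr (2 / r) * (2 powr (real_of_int n / 2) * sqrt A) powr (1 - 2 / r)"
          by (rule le_powr_interpolate) (use h r in auto)
        then have "2 powr (- real_of_int n / d) * h n \<le>
            2 powr (- real_of_int n / d) * (G x powr (2 / r) * (2 powr (real_of_int n / 2) * sqrt A) powr (1 - 2 / r))"
          by (intro mult_left_mono) auto
        also have "\<dots> = c x * (2 powr (- real_of_int n / d) * 2 powr (real_of_int n / 2 * (1 - 2 / r)))"
          by (simp add: c_def powr_mult powr_powr)
        also have "2 powr (- real_of_int n / d) * 2 powr (real_of_int n / 2 * (1 - 2 / r)) = 2 powr (- real_of_int n * \<alpha>)"
          unfolding powr_add[symmetric] \<alpha>_def by (simp add: algebra_simps)
        finally show ?thesis using h(4)[of n] by simp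
      qed
      then show ?case
        using up_tail[of u x \<alpha> "c x" N] elim \<alpha> by (simp add: K_def c_def)
    qed
    have cr: "(c x * 2 powr (- real_of_int N * \<alpha>) * K) powr r
        = (K powr r * 2 powr (- real_of_int N * (\<alpha> * r)) * sqrt A powr (r - 2)) * (G x)\<^sup>2" for x
    proof -
      have "(c x * 2 powr (- real_of_int N * \<alpha>) * K) powr r
        = G x powr (2 / r * r) * sqrt A powr ((1 - 2 / r) * r) * 2 powr (- real_of_int N * \<alpha> * r) * K powr r"
        using K by (simp add: c_def powr_mult powr_powr)
      also have "2 / r * r = 2" using r by simp
      also have "(1 - 2 / r) * r = r - 2" using r by (simp add: field_simps)
      finally show ?thesis using G(1)[of x] by (simp add: mult_ac)
    qed
    define E where "E = K powr r * 2 powr (- real_of_int N * (\<alpha> * r)) * sqrt A powr (r - 2)"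
    have le: "AE x in lborel. cmod (u x - av N u x) powr r \<le> E * (G x)\<^sup>2"
      using pw
    proof eventually_elim
      case (elim x)
      then have "cmod (u x - av N u x) powr r \<le> (c x * 2 powr (- real_of_int N * \<alpha>) * K) powr r"
        using r by (intro powr_mono2) auto
      then show ?case unfolding cr E_def .
    qed
    have int: "integrable lborel (\<lambda>x. cmod (u x - av N u x) powr r)"
      by (rule Bochner_Integration.integrable_bound[of _ "\<lambda>x. E * (G x)\<^sup>2"])
        (use G le in \<open>auto elim!: eventually_mono simp: E_def\<close>)
    have "(\<integral>x. cmod (u x - av N u x) powr r \<partial>lborel) \<le> (\<integral>x. E * (G x)\<^sup>2 \<partial>lborel)"
      by (rule integral_mono_AE[OF int _ le]) (use G in auto)
    also have "\<dots> \<le> E * (4 * A)"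
      using G(3) by (simp add: E_def mult_left_mono)
    also have "\<dots> = 4 * K powr r * 2 powr (- real_of_int N * (\<alpha> * r)) * A powr (r / 2)"
    proof -
      have "A * sqrt A powr (r - 2) = A powr (r / 2)"
      proof (cases "A = 0")
        case False
        then have "A > 0" using dirichlet_nonneg[of D] unfolding A_def by linarith
        then have "A * sqrt A powr (r - 2) = A powr 1 * A powr (1 / 2 * (r - 2))"
          by (simp add: powr_half_sqrt[symmetric] powr_powr)
        also have "\<dots> = A powr (r / 2)"
          unfolding powr_add[symmetric] by (simp add: field_simps)
        finally show ?thesis .
      qed simp
      then show ?thesis by (simp add: E_def mult_ac)
    qed
    finally show "integrable lborel (\<lambda>x. cmod (u x - av N u x) powr r)
      \<and> (\<integral>x. cmod (u x - av N u x) powr r \<partial>lborel)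
        \<le> 4 * K powr r * 2 powr (- real_of_int N * (\<alpha> * r)) * dirichlet D powr (r / 2)"
      using int by (simp add: A_def)
  qed (use \<alpha> r in auto)
qed

lemma le_eps_powr:
  fixes t \<epsilon> p :: real
  assumes "0 \<le> t" "0 < \<epsilon>" "1 \<le> p"
  shows "t \<le> \<epsilon> + \<epsilon> powr (1 - p) * t powr p"
proof (cases "t \<le> \<epsilon>")
  case False
  then have "t > 0" using assms by simp
  have "t = t powr (1 - p) * t powr p"
    using \<open>t > 0\<close> by (simp add: powr_add[symmetric])
  also have "\<dots> \<le> \<epsilon> powr (1 - p) * t powr p"
    using False assms by (intro mult_right_mono powr_mono2') auto
  finally show ?thesis using assms by simp
qed (use assms in \<open>simp add: add_increasing2\<close>)

text \<open>Stands in for Hoelder's inequality. For fixed \<epsilon> the second term is small on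
  coarse levels, so averages over growing boxes tend to zero.\<close>

lemma av_Lp_bound:
  fixes u :: "real^'d::finite \<Rightarrow> complex"
  assumes u: "u \<in> Lp p" and p: "1 \<le> p" and \<epsilon>: "\<epsilon> > 0"
  shows "norm (av n u x) \<le> \<epsilon> + \<epsilon> powr (1 - p) * (2 powr real_of_int n * (\<integral>y. cmod (u y) powr p \<partial>lborel))"
proof -
  have [measurable]: "u \<in> borel_measurable borel" and int: "integrable lborel (\<lambda>y. cmod (u y) powr p)"
    using u by (auto simp: Lp_def)
  define h where "h y = \<epsilon> powr (1 - p) * cmod (u y) powr p" for y
  have hint: "integrable lborel h" unfolding h_def using int by simp
  have le: "cmod (u y) \<le> \<epsilon> + h y" for y
    unfolding h_def by (rule le_eps_powr) (use p \<epsilon> in auto)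
  have ih: "set_integrable lborel (Bx n x) (\<lambda>y. \<epsilon> + h y)"
    by (rule set_integral_add(1)[OF set_integrable_const_Bx set_integrable_Bx_integrable[OF hint]])
  have "norm (av n u x) \<le> av n (\<lambda>y. cmod (u y)) x" by (rule av_norm_le)
  also have "\<dots> \<le> av n (\<lambda>y. \<epsilon> + h y) x"
  proof (rule av_mono[OF _ ih le])
    show "set_integrable lborel (Bx n x) (\<lambda>y. cmod (u y))"
      unfolding set_integrable_def
      by (rule Bochner_Integration.integrable_bound[OF ih[unfolded set_integrable_def]])
        (use le order_trans[OF norm_ge_zero le] in \<open>auto simp: indicator_def\<close>)
  qed
  also have "\<dots> = \<epsilon> + av n h x"
    using set_integral_add(2)[OF set_integrable_const_Bx set_integrable_Bx_integrable[OF hint], of n x \<epsilon>]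
      av_const[of n \<epsilon> x] by (simp add: av_def distrib_left)
  also have "av n h x \<le> 2 powr real_of_int n * (\<integral>y. h y \<partial>lborel)"
    by (rule av_le_integral[OF hint]) (simp add: h_def)
  also have "(\<integral>y. h y \<partial>lborel) = \<epsilon> powr (1 - p) * (\<integral>y. cmod (u y) powr p \<partial>lborel)"
    unfolding h_def by simp
  finally show ?thesis by (simp add: mult_ac)
qed

text \<open>At the critical exponent the interpolated increments no longer decay. Instead the series
  is cut: above a level N the maximal function is used, below it the L^2 norm. With N depending on x
  this gives a pointwise bound by G^(2/p), whose p-th power is integrable, in the manner of
  Hedberg.\<close>

lemma sobolev_inequality:
  assumes d: "3 \<le> CARD('d::finite)"
  defines "p \<equiv> 2 * real CARD('d) / (real CARD('d) - 2)"
  obtains C where "C \<ge> 0"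
    "\<And>(u :: real^'d \<Rightarrow> complex) D. sob u D \<Longrightarrow> u \<in> Lp p \<Longrightarrow>
      (\<integral>x. cmod (u x) powr p \<partial>lborel) \<le> C * dirichlet D powr (p / 2)"
proof -
  define d where "d = real CARD('d)"
  have d3: "d \<ge> 3" using d by (simp add: d_def)
  have p1: "1 \<le> p" using d3 by (simp add: p_def d_def[symmetric] field_simps)
  define \<alpha> where "\<alpha> = 1 / d"
  define \<beta> where "\<beta> = 1 / 2 - 1 / d"
  have \<alpha>: "\<alpha> > 0" and \<beta>: "\<beta> > 0" using d3 by (auto simp: \<alpha>_def \<beta>_def field_simps)
  define K1 where "K1 = 1 / (1 - 2 powr (- \<alpha>))"
  define K2 where "K2 = 1 / (1 - 2 powr (- \<beta>))"
  have K: "K1 > 0" "K2 > 0"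
    using \<alpha> \<beta> powr_less_one[of 2 "- \<alpha>"] powr_less_one[of 2 "- \<beta>"] by (simp_all add: K1_def K2_def)
  define K where "K = K1 * 2 powr \<alpha> + K2"
  have K0: "K > 0" using K by (simp add: K_def add_pos_pos)
  show thesis
  proof (rule that[of "4 * K powr p"])
    fix u :: "real^'d \<Rightarrow> complex" and D
    assume u: "sob u D" and up: "u \<in> Lp p"
    define A where "A = dirichlet D"
    have A: "0 \<le> A" by (simp add: A_def)
    have [measurable]: "u \<in> borel_measurable borel" by (rule sob_borel(1)[OF u])
    obtain G where [measurable]: "G \<in> borel_measurable borel" and G: "\<And>x. 0 \<le> G x" "integrable lborel (\<lambda>x. (G x)\<^sup>2)"
      "(\<integral>x. (G x)\<^sup>2 \<partial>lborel) \<le> 4 * A"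
      and ae: "AE x in lborel. (\<lambda>n. av (int n) u x) \<longlonglongrightarrow> u x \<and> (\<exists>h. \<forall>n. 0 \<le> h n \<and> h n \<le> G x
        \<and> h n \<le> 2 powr (real_of_int n / 2) * sqrt A
        \<and> norm (av (n + 1) u x - av n u x) \<le> 2 powr (- real_of_int n / real CARD('d)) * h n)"
      using sobolev_core[OF u] unfolding A_def by blast
    \<comment> \<open>Integrability of the p-th power rules out constants: the coarse half of the
      series starts from 0.\<close>
    have down: "(\<lambda>j. av (N - int j) u x) \<longlonglongrightarrow> 0" for N x
    proof (rule LIMSEQ_I)
      fix e :: real assume e: "e > 0"
      define I where "I = (\<integral>y. cmod (u y) powr p \<partial>lborel)"
      have "(\<lambda>j. (e / 2) powr (1 - p) * (2 powr (real_of_int N - real j) * I)) \<longlonglongrightarrow> 0"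
        by real_asymp
      then have "\<forall>\<^sub>F j in sequentially. (e / 2) powr (1 - p) * (2 powr (real_of_int N - real j) * I) < e / 2"
        by (rule order_tendstoD(2)) (use e in simp)
      then obtain no where no: "\<And>j. j \<ge> no \<Longrightarrow> (e / 2) powr (1 - p) * (2 powr (real_of_int N - real j) * I) < e / 2"
        by (auto simp: eventually_sequentially)
      have "norm (av (N - int j) u x - 0) < e" if "j \<ge> no" for j
        using av_Lp_bound[OF up p1, of "e / 2" "N - int j" x] no[OF that] e by (simp add: I_def)
      then show "\<exists>no. \<forall>j\<ge>no. norm (av (N - int j) u x - 0) < e" by blast
    qed
    have pw: "AE x in lborel. norm (u x) \<le> K * (G x powr (2 / p) * sqrt A powr (2 / d))"
      using ae
    proof eventually_elim
      case (elim x)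
      then obtain h where h: "\<And>n. 0 \<le> h n" "\<And>n. h n \<le> G x" "\<And>n. h n \<le> 2 powr (real_of_int n / 2) * sqrt A"
        "\<And>n. norm (av (n + 1) u x - av n u x) \<le> 2 powr (- real_of_int n / d) * h n"
        by (auto simp: d_def)
      \<comment> \<open>Kept general in the two bounds \<Gamma> and a, so that the degenerate case
        can insert zero for both.\<close>
      have two: "norm (u x) \<le> \<Gamma> * 2 powr (- real_of_int N * \<alpha>) * K1 + a * 2 powr (real_of_int N * \<beta>) * K2"
        if \<Gamma>: "\<And>n. h n \<le> \<Gamma>" and a: "\<And>n. h n \<le> 2 powr (real_of_int n / 2) * a" "0 \<le> a" for \<Gamma> a N
      proof -
        have "norm (av (n + 1) u x - av n u x) \<le> \<Gamma> * 2 powr (- real_of_int n * \<alpha>)" for n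
        proof -
          have "2 powr (- real_of_int n / d) * h n \<le> 2 powr (- real_of_int n / d) * \<Gamma>"
            by (intro mult_left_mono \<Gamma>) simp
          then have "norm (av (n + 1) u x - av n u x) \<le> 2 powr (- real_of_int n / d) * \<Gamma>"
            using h(4)[of n] by linarith
          then show ?thesis by (simp add: \<alpha>_def mult.commute)
        qed
        then have 1: "norm (u x - av N u x) \<le> \<Gamma> * 2 powr (- real_of_int N * \<alpha>) * K1"
          using up_tail[of u x \<alpha> \<Gamma> N] elim \<alpha> h(1)[of 0] \<Gamma>[of 0] by (simp add: K1_def)
        have "norm (av (n + 1) u x - av n u x) \<le> a * 2 powr (real_of_int n * \<beta>)" for n
        proof -
          have "2 powr (- real_of_int n / d) * h n \<le> 2 powr (- real_of_int n / d) * (2 powr (real_of_int n / 2) * a)"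
            by (intro mult_left_mono a) auto
          also have "\<dots> = a * (2 powr (- real_of_int n / d) * 2 powr (real_of_int n / 2))" by simp
          also have "2 powr (- real_of_int n / d) * 2 powr (real_of_int n / 2) = 2 powr (real_of_int n * \<beta>)"
            unfolding powr_add[symmetric] \<beta>_def by (simp add: algebra_simps)
          finally show ?thesis using h(4)[of n] by simp
        qed
        then have 2: "norm (av N u x) \<le> a * 2 powr (real_of_int N * \<beta>) * K2"
          using down_tail[OF down[of N x] \<beta> a(2)] by (simp add: K2_def)
        show ?thesis
          using norm_triangle_sub[of "u x" "av N u x"] 1 2 by linarith
      qed
      show ?case
      proof (cases "G x = 0 \<or> A = 0")
        case True
        then have "h n \<le> 0" for n using h(2)[of n] h(3)[of n] by auto
        then have "norm (u x) \<le> 0" using two[of 0 0 0] by simp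
        then show ?thesis using K0 by simp
      next
        case False
        then have pos: "G x > 0" "sqrt A > 0" using G(1)[of x] A by auto
        define z where "z = G x / sqrt A"
        have z: "z > 0" using pos by (simp add: z_def)
        \<comment> \<open>The level at which the two bounds balance: 2^(N/2) \<open>sqrt A\<close> =
          G x. Rounding costs the factor 2^\<alpha> in K.\<close>
        define N where "N = \<lfloor>2 * log 2 z\<rfloor>"
        have N: "real_of_int N \<le> 2 * log 2 z" "2 * log 2 z < real_of_int N + 1"
          by (simp_all add: N_def)
        have "2 powr (- real_of_int N * \<alpha>) \<le> 2 powr ((1 - 2 * log 2 z) * \<alpha>)"
          using N(2) \<alpha> by (intro powr_mono mult_right_mono) auto
        also have "\<dots> = 2 powr \<alpha> * (2 powr (log 2 z)) powr (- 2 * \<alpha>)"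
          unfolding powr_powr powr_add[symmetric] by (simp add: algebra_simps)
        finally have e1: "2 powr (- real_of_int N * \<alpha>) \<le> 2 powr \<alpha> * z powr (- 2 / d)"
          using z by (simp add: \<alpha>_def)
        have "2 powr (real_of_int N * \<beta>) \<le> 2 powr (2 * log 2 z * \<beta>)"
          using N(1) \<beta> by (intro powr_mono mult_right_mono) auto
        also have "\<dots> = (2 powr (log 2 z)) powr (2 * \<beta>)"
          unfolding powr_powr by (simp add: algebra_simps)
        finally have e2: "2 powr (real_of_int N * \<beta>) \<le> z powr (1 - 2 / d)"
          using z by (simp add: \<beta>_def algebra_simps)
        have "norm (u x) \<le> G x * 2 powr (- real_of_int N * \<alpha>) * K1 + sqrt A * 2 powr (real_of_int N * \<beta>) * K2"
          by (rule two) (use h A in auto)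
        also have "\<dots> \<le> G x * (2 powr \<alpha> * z powr (- 2 / d)) * K1 + sqrt A * z powr (1 - 2 / d) * K2"
          using K pos by (intro add_mono mult_right_mono mult_left_mono e1 e2) auto
        also have "\<dots> = K * (G x powr (1 - 2 / d) * sqrt A powr (2 / d))"
        proof -
          have "G x * z powr (- 2 / d) = G x powr (1 - 2 / d) * sqrt A powr (2 / d)"
            unfolding z_def using pos by (simp add: powr_divide powr_diff powr_minus field_simps)
          moreover have "sqrt A * z powr (1 - 2 / d) = G x powr (1 - 2 / d) * sqrt A powr (2 / d)"
            unfolding z_def using pos by (simp add: powr_divide powr_diff field_simps)
          ultimately show ?thesis by (simp add: K_def algebra_simps)
        qed
        also have "1 - 2 / d = 2 / p" using d3 by (simp add: p_def d_def[symmetric] field_simps)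
        finally show ?thesis .
      qed
    qed
    define E where "E = K powr p * sqrt A powr (2 / d * p)"
    have le: "AE x in lborel. cmod (u x) powr p \<le> E * (G x)\<^sup>2"
      using pw
    proof eventually_elim
      case (elim x)
      then have "cmod (u x) powr p \<le> (K * (G x powr (2 / p) * sqrt A powr (2 / d))) powr p"
        using p1 by (intro powr_mono2) auto
      also have "\<dots> = E * (G x)\<^sup>2"
        using K0 p1 G(1)[of x] by (simp add: powr_mult powr_powr E_def)
      finally show ?case .
    qed
    have "(\<integral>x. cmod (u x) powr p \<partial>lborel) \<le> (\<integral>x. E * (G x)\<^sup>2 \<partial>lborel)"
      by (rule integral_mono_AE[OF _ _ le]) (use G up in \<open>auto simp: Lp_def\<close>)
    also have "\<dots> \<le> E * (4 * A)"
      using G(3) by (simp add: E_def mult_left_mono)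
    also have "\<dots> = 4 * K powr p * A powr (p / 2)"
    proof (cases "A = 0")
      case False
      then have "A > 0" using A by simp
      then have "A * sqrt A powr (2 / d * p) = A powr 1 * A powr (1 / 2 * (2 / d * p))"
        by (simp add: powr_half_sqrt[symmetric] powr_powr)
      also have "\<dots> = A powr (p / 2)"
        unfolding powr_add[symmetric] using d3
        by (intro arg_cong[where f = "(powr) A"]) (simp add: p_def d_def[symmetric] field_simps)
      finally show ?thesis by (simp add: E_def mult_ac)
    qed simp
    finally show "(\<integral>x. cmod (u x) powr p \<partial>lborel) \<le> 4 * K powr p * dirichlet D powr (p / 2)"
      by (simp add: A_def)
  qed simp
qed

section \<open>Completeness\<close>

lemma cmod_add_square_le: "(cmod (a + b))\<^sup>2 \<le> 2 * (cmod a)\<^sup>2 + 2 * (cmod b)\<^sup>2"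
proof -
  have "(cmod (a + b))\<^sup>2 \<le> (cmod a + cmod b)\<^sup>2"
    by (intro power_mono norm_triangle_ineq) auto
  also have "\<dots> \<le> 2 * (cmod a)\<^sup>2 + 2 * (cmod b)\<^sup>2"
    using zero_le_power2[of "cmod a - cmod b"] by (simp add: power2_eq_square algebra_simps)
  finally show ?thesis .
qed

lemma square_integrable_add:
  fixes f g :: "'a \<Rightarrow> complex"
  assumes [measurable]: "f \<in> borel_measurable M" "g \<in> borel_measurable M"
    and "integrable M (\<lambda>x. (cmod (f x))\<^sup>2)" "integrable M (\<lambda>x. (cmod (g x))\<^sup>2)"
  shows "integrable M (\<lambda>x. (cmod (f x + g x))\<^sup>2)"
    and "(\<integral>x. (cmod (f x + g x))\<^sup>2 \<partial>M) \<le> 2 * (\<integral>x. (cmod (f x))\<^sup>2 \<partial>M) + 2 * (\<integral>x. (cmod (g x))\<^sup>2 \<partial>M)"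
proof -
  show int: "integrable M (\<lambda>x. (cmod (f x + g x))\<^sup>2)"
  proof (rule Bochner_Integration.integrable_bound)
    show "integrable M (\<lambda>x. 2 * (cmod (f x))\<^sup>2 + 2 * (cmod (g x))\<^sup>2)" using assms by simp
  qed (use cmod_add_square_le in auto)
  have "(\<integral>x. (cmod (f x + g x))\<^sup>2 \<partial>M) \<le> (\<integral>x. 2 * (cmod (f x))\<^sup>2 + 2 * (cmod (g x))\<^sup>2 \<partial>M)"
    by (rule integral_mono[OF int]) (use assms cmod_add_square_le in auto)
  then show "(\<integral>x. (cmod (f x + g x))\<^sup>2 \<partial>M) \<le> 2 * (\<integral>x. (cmod (f x))\<^sup>2 \<partial>M) + 2 * (\<integral>x. (cmod (g x))\<^sup>2 \<partial>M)"
    using assms by simp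
qed

lemma square_integrable_diff:
  fixes f g :: "'a \<Rightarrow> complex"
  assumes "f \<in> borel_measurable M" "g \<in> borel_measurable M"
    and "integrable M (\<lambda>x. (cmod (f x))\<^sup>2)" "integrable M (\<lambda>x. (cmod (g x))\<^sup>2)"
  shows "integrable M (\<lambda>x. (cmod (f x - g x))\<^sup>2)"
    and "(\<integral>x. (cmod (f x - g x))\<^sup>2 \<partial>M) \<le> 2 * (\<integral>x. (cmod (f x))\<^sup>2 \<partial>M) + 2 * (\<integral>x. (cmod (g x))\<^sup>2 \<partial>M)"
  using square_integrable_add[of f M "\<lambda>x. - g x"] assms by simp_all

text \<open>Riesz--Fischer. Along a subsequence the squared increments integrate to less than 8^-k;
  multiplied by 2^k they still sum to an integrable h. Hence the increments are at most sqrt(h)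
  2^(-k/2) pointwise, and the geometric tail gives both the limit and a dominated error.\<close>

lemma L2_complete:
  fixes f :: "nat \<Rightarrow> 'a \<Rightarrow> complex"
  assumes meas [measurable]: "\<And>n. f n \<in> borel_measurable M"
    and int: "\<And>n. integrable M (\<lambda>x. (cmod (f n x))\<^sup>2)"
    and cauchy: "\<And>e. e > 0 \<Longrightarrow> \<exists>N. \<forall>m\<ge>N. \<forall>n\<ge>N. (\<integral>x. (cmod (f m x - f n x))\<^sup>2 \<partial>M) < e"
  obtains g where "g \<in> borel_measurable M" "integrable M (\<lambda>x. (cmod (g x))\<^sup>2)"
    "(\<lambda>n. \<integral>x. (cmod (f n x - g x))\<^sup>2 \<partial>M) \<longlonglongrightarrow> 0"
proof -
  note dint = square_integrable_diff(1)[OF meas meas int int]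
  have "\<forall>k. \<exists>N. \<forall>m\<ge>N. \<forall>n\<ge>N. (\<integral>x. (cmod (f m x - f n x))\<^sup>2 \<partial>M) < (1 / 8) ^ k"
    using cauchy by simp
  then obtain N where N: "\<And>k m n. N k \<le> m \<Longrightarrow> N k \<le> n \<Longrightarrow> (\<integral>x. (cmod (f m x - f n x))\<^sup>2 \<partial>M) < (1 / 8) ^ k"
    by metis
  \<comment> \<open>Partial sums exceed every single N k and do not decrease, so r k and r (Suc k)
    both lie beyond N k.\<close>
  define r where "r k = (\<Sum>i\<le>k. N i)" for k
  have rN: "N k \<le> r k" "N k \<le> r (Suc k)" for k
    by (auto simp: r_def intro: member_le_sum trans_le_add1)
  define \<Delta> where "\<Delta> k x = cmod (f (r (Suc k)) x - f (r k) x)" for k x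
  have [measurable]: "\<Delta> k \<in> borel_measurable M" for k
    unfolding \<Delta>_def by measurable
  have \<Delta>int: "integrable M (\<lambda>x. (\<Delta> k x)\<^sup>2)" for k
    unfolding \<Delta>_def by (rule dint)
  define H where "H x = (\<Sum>k. ennreal (2 ^ k * (\<Delta> k x)\<^sup>2))" for x
  have [measurable]: "H \<in> borel_measurable M"
    unfolding H_def by measurable
  have "(\<integral>\<^sup>+x. H x \<partial>M) = (\<Sum>k. \<integral>\<^sup>+x. ennreal (2 ^ k * (\<Delta> k x)\<^sup>2) \<partial>M)"
    unfolding H_def by (rule nn_integral_suminf) measurable
  also have "\<dots> \<le> (\<Sum>k. ennreal ((1 / 4) ^ k))"
  proof (rule suminf_le)
    fix k
    have "(\<integral>\<^sup>+x. ennreal (2 ^ k * (\<Delta> k x)\<^sup>2) \<partial>M) = ennreal (\<integral>x. 2 ^ k * (\<Delta> k x)\<^sup>2 \<partial>M)"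
      by (rule nn_integral_eq_integral) (use \<Delta>int in auto)
    also have "(\<integral>x. 2 ^ k * (\<Delta> k x)\<^sup>2 \<partial>M) \<le> 2 ^ k * (1 / 8) ^ k"
      using N[OF rN(2) rN(1), of k] by (simp add: \<Delta>_def less_imp_le)
    also have "2 ^ k * (1 / 8) ^ k = (1 / 4 :: real) ^ k"
      by (simp add: power_mult_distrib[symmetric])
    finally show "(\<integral>\<^sup>+x. ennreal (2 ^ k * (\<Delta> k x)\<^sup>2) \<partial>M) \<le> ennreal ((1 / 4) ^ k)"
      by (simp add: ennreal_leI)
  qed auto
  also have "\<dots> = ennreal (\<Sum>k. (1 / 4) ^ k)"
    by (rule suminf_ennreal2) (auto intro: summable_geometric)
  finally have Hfin: "(\<integral>\<^sup>+x. H x \<partial>M) < \<infinity>"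
    by (simp add: le_less_trans)
  then have ae: "AE x in M. H x \<noteq> \<infinity>"
    by (intro nn_integral_PInf_AE) auto
  define h where "h x = enn2real (H x)" for x
  have [measurable]: "h \<in> borel_measurable M"
    unfolding h_def by measurable
  have hint: "integrable M h"
  proof (rule integrableI_nonneg)
    have "(\<integral>\<^sup>+x. ennreal (h x) \<partial>M) = (\<integral>\<^sup>+x. H x \<partial>M)"
      by (rule nn_integral_cong_AE) (use ae in \<open>auto elim!: eventually_mono simp: h_def less_top\<close>)
    then show "(\<integral>\<^sup>+x. ennreal (h x) \<partial>M) < \<infinity>" using Hfin by simp
  qed (auto simp: h_def)
  define q where "q = sqrt (1 / 2)"
  have q: "0 < q" "q < 1" "q\<^sup>2 = 1 / 2" by (auto simp: q_def real_sqrt_less_iff)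
  define K where "K = 1 / (1 - q)"
  define g where "g x = lim (\<lambda>k. f (r k) x)" for x
  have [measurable]: "g \<in> borel_measurable M"
    unfolding g_def by measurable
  have tail: "AE x in M. \<forall>k. (cmod (f (r k) x - g x))\<^sup>2 \<le> K\<^sup>2 * (1 / 2) ^ k * h x"
    using ae
  proof eventually_elim
    case (elim x)
    have hpos: "0 \<le> h x" by (simp add: h_def)
    have b: "cmod (f (r (Suc k)) x - f (r k) x) \<le> sqrt (h x) * q ^ k" for k
    proof -
      have "(\<Sum>j\<in>{k}. ennreal (2 ^ j * (\<Delta> j x)\<^sup>2)) \<le> H x"
        unfolding H_def by (rule sum_le_suminf) (rule summableI, simp_all)
      then have "ennreal (2 ^ k * (\<Delta> k x)\<^sup>2) \<le> H x"
        by (simp only: sum.insert[OF finite.emptyI] sum.empty finite.emptyI empty_iff not_False_eq_True add_0_right)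
      then have "enn2real (ennreal (2 ^ k * (\<Delta> k x)\<^sup>2)) \<le> h x"
        unfolding h_def by (rule enn2real_mono) (use elim in \<open>auto simp: less_top\<close>)
      then have "2 ^ k * (\<Delta> k x)\<^sup>2 \<le> h x" by simp
      moreover have "(q ^ k)\<^sup>2 = (1 / 2) ^ k"
        unfolding q(3)[symmetric] by (simp add: power_mult[symmetric] mult.commute)
      then have "2 ^ k * (h x * (q ^ k)\<^sup>2) = h x"
        by (simp add: power_divide)
      ultimately have "2 ^ k * (\<Delta> k x)\<^sup>2 \<le> 2 ^ k * (h x * (q ^ k)\<^sup>2)" by (simp only:)
      then have "(\<Delta> k x)\<^sup>2 \<le> h x * (q ^ k)\<^sup>2"
        by (rule mult_left_le_imp_le) simp
      also have "\<dots> = (sqrt (h x) * q ^ k)\<^sup>2"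
        using hpos by (simp only: power_mult_distrib real_sqrt_pow2)
      finally have "\<Delta> k x \<le> sqrt (h x) * q ^ k"
        by (rule power2_le_imp_le) (intro mult_nonneg_nonneg real_sqrt_ge_zero hpos zero_le_power less_imp_le[OF q(1)])
      then show ?thesis by (simp only: \<Delta>_def)
    qed
    have h0: "0 \<le> sqrt (h x)" by (simp add: h_def)
    note tail = geometric_tail[OF b q(1,2) h0]
    have "convergent (\<lambda>k. f (r k) x)"
      unfolding convergent_def by (rule tail(1))
    then have "(\<lambda>k. f (r k) x) \<longlonglongrightarrow> g x"
      by (simp add: g_def convergent_LIMSEQ_iff)
    from tail(2)[OF this] have le: "cmod (g x - f (r k) x) \<le> K * q ^ k * sqrt (h x)" for k
      by (simp add: K_def mult_ac)
    show ?case
    proof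
      fix k
      have "(cmod (f (r k) x - g x))\<^sup>2 \<le> (K * q ^ k * sqrt (h x))\<^sup>2"
        using le[of k] by (intro power_mono) (auto simp: norm_minus_commute)
      also have "\<dots> = K\<^sup>2 * (q\<^sup>2) ^ k * h x"
        by (simp add: power_mult_distrib power_mult[symmetric] mult.commute h_def)
      finally show "(cmod (f (r k) x - g x))\<^sup>2 \<le> K\<^sup>2 * (1 / 2) ^ k * h x" by (simp add: q)
    qed
  qed
  have rint: "integrable M (\<lambda>x. (cmod (f (r k) x - g x))\<^sup>2)" for k
  proof (rule Bochner_Integration.integrable_bound)
    show "integrable M (\<lambda>x. K\<^sup>2 * (1 / 2) ^ k * h x)" using hint by simp
    show "AE x in M. norm ((cmod (f (r k) x - g x))\<^sup>2) \<le> norm (K\<^sup>2 * (1 / 2) ^ k * h x)"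
      using tail by eventually_elim (auto intro: order_trans[OF _ abs_ge_self])
  qed measurable
  have rbound: "(\<integral>x. (cmod (f (r k) x - g x))\<^sup>2 \<partial>M) \<le> K\<^sup>2 * (1 / 2) ^ k * (\<integral>x. h x \<partial>M)" for k
  proof -
    have "(\<integral>x. (cmod (f (r k) x - g x))\<^sup>2 \<partial>M) \<le> (\<integral>x. K\<^sup>2 * (1 / 2) ^ k * h x \<partial>M)"
      by (rule integral_mono_AE[OF rint]) (use hint tail in \<open>auto elim!: eventually_mono\<close>)
    then show ?thesis by simp
  qed
  have gint: "integrable M (\<lambda>x. (cmod (g x))\<^sup>2)"
    using square_integrable_diff(1)[of "f (r 0)" M "\<lambda>x. f (r 0) x - g x", OF _ _ int rint] by simp
  show thesis
  proof
    show "(\<lambda>n. \<integral>x. (cmod (f n x - g x))\<^sup>2 \<partial>M) \<longlonglongrightarrow> 0"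
    proof (rule LIMSEQ_I)
      fix e :: real assume e: "e > 0"
      have "(\<lambda>k. K\<^sup>2 * (1 / 2) ^ k * (\<integral>x. h x \<partial>M)) \<longlonglongrightarrow> K\<^sup>2 * 0 * (\<integral>x. h x \<partial>M)"
        by (intro tendsto_intros LIMSEQ_power_zero) auto
      then have "\<forall>\<^sub>F k in sequentially. K\<^sup>2 * (1 / 2) ^ k * (\<integral>x. h x \<partial>M) < e / 4"
        by (rule order_tendstoD(2)) (use e in simp)
      moreover have "\<forall>\<^sub>F k in sequentially. (1 / 8) ^ k < e / 4"
        by (rule order_tendstoD(2)[OF LIMSEQ_power_zero]) (use e in auto)
      ultimately have "\<forall>\<^sub>F k in sequentially. K\<^sup>2 * (1 / 2) ^ k * (\<integral>x. h x \<partial>M) < e / 4 \<and> (1 / 8) ^ k < e / 4"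
        by (rule eventually_conj)
      then obtain k where k: "K\<^sup>2 * (1 / 2) ^ k * (\<integral>x. h x \<partial>M) < e / 4" "(1 / 8) ^ k < e / 4"
        by (auto simp: eventually_sequentially)
      have "(\<integral>x. (cmod (f n x - g x))\<^sup>2 \<partial>M) < e" if n: "N k \<le> n" for n
      proof -
        have "(\<integral>x. (cmod ((f n x - f (r k) x) + (f (r k) x - g x)))\<^sup>2 \<partial>M)
            \<le> 2 * (\<integral>x. (cmod (f n x - f (r k) x))\<^sup>2 \<partial>M) + 2 * (\<integral>x. (cmod (f (r k) x - g x))\<^sup>2 \<partial>M)"
          by (rule square_integrable_add(2)) (use dint rint in auto)
        then show ?thesis
          using N[OF n rN(1)] rbound[of k] k by simp
      qed
      then show "\<exists>n0. \<forall>n\<ge>n0. norm ((\<integral>x. (cmod (f n x - g x))\<^sup>2 \<partial>M) - 0) < e"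
        by auto
    qed
  qed (use gint in auto)
qed

text \<open>Convergence in \<open>L\<^sup>2\<close> on compact sets is metrised by a single integrable positive weight.\<close>

lemma weight_exists:
  "\<exists>w :: 'a::euclidean_space \<Rightarrow> real. w \<in> borel_measurable borel \<and> (\<forall>x. 0 < w x \<and> w x \<le> 1) \<and> integrable lborel w
    \<and> (\<forall>K. compact K \<longrightarrow> (\<exists>c>0. \<forall>x\<in>K. c \<le> w x))"
proof -
  define m where "m i = measure lborel (cball (0::'a) (real i))" for i :: nat
  \<comment> \<open>The denominator keeps both the values and the integrals of the i-th summand
    below 2^-(i+1), so that the weight is bounded by 1 and integrable at once.\<close>
  define c where "c i = (1 / 2) ^ Suc i / (1 + m i)" for i
  have m: "0 \<le> m i" for i by (simp add: m_def)
  have c: "0 < c i" "c i \<le> (1 / 2) ^ Suc i" "c i * m i \<le> (1 / 2) ^ Suc i" for i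
  proof -
    have a: "0 < (1 / 2 :: real) ^ Suc i" by simp
    show "0 < c i" unfolding c_def using a m[of i] by (intro divide_pos_pos) auto
    have "(1 / 2) ^ Suc i / (1 + m i) \<le> (1 / 2) ^ Suc i / 1"
      using a m[of i] by (intro divide_left_mono) auto
    then show "c i \<le> (1 / 2) ^ Suc i" by (simp add: c_def)
    have "m i / (1 + m i) \<le> 1" using m[of i] by simp
    from mult_left_mono[OF this less_imp_le[OF a]]
    show "c i * m i \<le> (1 / 2) ^ Suc i" by (simp add: c_def)
  qed
  have geo: "(\<lambda>i. (1 / 2 :: real) ^ Suc i) sums 1" by (rule power_half_series)
  define f where "f i x = c i * indicator (cball (0::'a) (real i)) x" for i x
  have f: "0 \<le> f i x" "f i x \<le> (1 / 2) ^ Suc i" for i x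
    using c(1)[of i] c(2)[of i] by (auto simp: f_def indicator_def)
  have sf: "summable (\<lambda>i. f i x)" for x
    by (rule summable_comparison_test'[OF sums_summable[OF geo]]) (use f in auto)
  define w where "w x = (\<Sum>i. f i x)" for x
  have fle: "f i x \<le> w x" for i x
    unfolding w_def using sum_le_suminf[OF sf, of "{i}"] f by simp
  have lower: "\<exists>c>0. \<forall>x\<in>K. c \<le> w x" if K: "compact K" for K
  proof -
    obtain B where B: "\<And>x. x \<in> K \<Longrightarrow> norm x \<le> B"
      using compact_imp_bounded[OF K] by (auto simp: bounded_iff)
    define i where "i = nat \<lceil>B\<rceil>"
    have "c i \<le> w x" if "x \<in> K" for x
    proof -
      have "x \<in> cball 0 (real i)" using B[OF that] by (simp add: i_def) linarith
      then show ?thesis using fle[of i x] by (simp add: f_def)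
    qed
    then show ?thesis using c(1) by blast
  qed
  have [measurable]: "cball (0::'a) s \<in> sets borel" for s
    by (intro borel_closed closed_cball)
  have [measurable]: "f i \<in> borel_measurable borel" for i
    unfolding f_def by measurable
  have "w \<in> borel_measurable borel" unfolding w_def by measurable
  moreover have "integrable lborel w"
    unfolding w_def
  proof (rule integrable_suminf)
    show i: "integrable lborel (f i)" for i
      unfolding f_def by (intro integrable_mult_right integrable_real_indicator) (auto simp: emeasure_bounded_finite[OF bounded_cball, simplified])
    show "AE x in lborel. summable (\<lambda>i. norm (f i x))" using sf f by simp
    show "summable (\<lambda>i. \<integral>x. norm (f i x) \<partial>lborel)"
    proof (rule summable_comparison_test'[OF sums_summable[OF geo]])
      show "norm (\<integral>x. norm (f i x) \<partial>lborel) \<le> (1 / 2) ^ Suc i" for i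
      proof -
        have "(\<integral>x. norm (f i x) \<partial>lborel) = (\<integral>x. f i x \<partial>lborel)"
          using f by simp
        also have "\<dots> = c i * m i" by (simp add: f_def m_def)
        finally show ?thesis using c(3)[of i] m[of i] less_imp_le[OF c(1)[of i]] by simp
      qed
    qed
  qed
  moreover have "0 < w x \<and> w x \<le> 1" for x
  proof
    obtain c' where "c' > 0" "\<forall>y\<in>{x}. c' \<le> w y" using lower[of "{x}"] by auto
    then show "0 < w x" by auto
    show "w x \<le> 1"
      unfolding w_def using suminf_le[OF f(2) sf sums_summable[OF geo]] sums_unique[OF geo] by simp
  qed
  ultimately show ?thesis using lower by blast
qed

definition wt :: "'a::euclidean_space \<Rightarrow> real" where
  "wt = (SOME w. w \<in> borel_measurable borel \<and> (\<forall>x. 0 < w x \<and> w x \<le> 1) \<and> integrable lborel w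
    \<and> (\<forall>K. compact K \<longrightarrow> (\<exists>c>0. \<forall>x\<in>K. c \<le> w x)))"

lemma
  shows wt_measurable [measurable]: "(wt :: 'a::euclidean_space \<Rightarrow> real) \<in> borel_measurable borel"
    and wt_pos: "0 < wt (x :: 'a)" and wt_le: "wt x \<le> 1" and wt_int: "integrable lborel (wt :: 'a \<Rightarrow> real)"
    and wt_lower: "compact (K :: 'a set) \<Longrightarrow> \<exists>c>0. \<forall>x\<in>K. c \<le> wt x"
  using someI_ex[OF weight_exists] unfolding wt_def[symmetric] by auto

section \<open>The weighted L^2 space\<close>

definition nw :: "(real^'d::finite \<Rightarrow> complex) \<Rightarrow> real" where
  "nw f = (\<integral>x. wt x * (cmod (f x))\<^sup>2 \<partial>lborel)"

definition L2w :: "(real^'d::finite \<Rightarrow> complex) set" where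
  "L2w = {f \<in> borel_measurable borel. integrable lborel (\<lambda>x. wt x * (cmod (f x))\<^sup>2)}"

lemma L2wD: "f \<in> L2w \<Longrightarrow> f \<in> borel_measurable borel" "f \<in> L2w \<Longrightarrow> integrable lborel (\<lambda>x. wt x * (cmod (f x))\<^sup>2)"
  by (auto simp: L2w_def)

lemma nw_nonneg: "0 \<le> nw f"
  unfolding nw_def by (intro integral_nonneg_AE) (auto simp: wt_pos less_imp_le)

lemma cmod_sqrt_wt: "(cmod (complex_of_real (sqrt (wt x)) * z))\<^sup>2 = wt x * (cmod z)\<^sup>2"
  by (simp add: norm_mult power_mult_distrib wt_pos less_imp_le)

lemma L2w_add:
  assumes f: "f \<in> L2w" "g \<in> L2w"
  shows "(\<lambda>x. f x + g x) \<in> L2w" "nw (\<lambda>x. f x + g x) \<le> 2 * nw f + 2 * nw g"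
proof -
  note m [measurable] = L2wD(1)[OF f(1)] L2wD(1)[OF f(2)]
  have "(\<lambda>x. complex_of_real (sqrt (wt x)) * f x) \<in> borel_measurable lborel"
    "(\<lambda>x. complex_of_real (sqrt (wt x)) * g x) \<in> borel_measurable lborel" by measurable
  note add = square_integrable_add[OF this, unfolded cmod_sqrt_wt distrib_left[symmetric], OF L2wD(2)[OF f(1)] L2wD(2)[OF f(2)]]
  show "(\<lambda>x. f x + g x) \<in> L2w" using add(1) by (simp add: L2w_def)
  show "nw (\<lambda>x. f x + g x) \<le> 2 * nw f + 2 * nw g"
    using add(2) unfolding nw_def by simp
qed

lemma L2w_cmult:
  assumes "f \<in> L2w"
  shows "(\<lambda>x. a * f x) \<in> L2w" "nw (\<lambda>x. a * f x) = (cmod a)\<^sup>2 * nw f"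
proof -
  have "(\<lambda>x. wt x * (cmod (a * f x))\<^sup>2) = (\<lambda>x. (cmod a)\<^sup>2 * (wt x * (cmod (f x))\<^sup>2))"
    by (simp add: norm_mult power_mult_distrib mult_ac)
  then show "(\<lambda>x. a * f x) \<in> L2w" "nw (\<lambda>x. a * f x) = (cmod a)\<^sup>2 * nw f"
    using assms by (auto simp: L2w_def nw_def)
qed

lemma L2w_diff:
  assumes "f \<in> L2w" "g \<in> L2w"
  shows "(\<lambda>x. f x - g x) \<in> L2w" "nw (\<lambda>x. f x - g x) \<le> 2 * nw f + 2 * nw g"
  using L2w_add[OF assms(1) L2w_cmult(1)[OF assms(2), of "- 1"]] L2w_cmult(2)[OF assms(2), of "- 1"] by simp_all

lemma nw_zero:
  assumes "f \<in> L2w" "nw f = 0"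
  shows "AE x in lborel. f x = 0"
proof -
  have "AE x in lborel. wt x * (cmod (f x))\<^sup>2 = 0"
    using assms unfolding nw_def by (subst (asm) integral_nonneg_eq_0_iff_AE) (auto simp: L2w_def wt_pos less_imp_le)
  then show ?thesis
    by eventually_elim (metis mult_eq_0_iff norm_eq_zero order_less_irrefl power_eq_0_iff wt_pos)
qed

text \<open>Multiplication by the square root of the positive weight is an isometry onto ordinary
  L^2 and can be undone.\<close>

lemma L2w_complete:
  fixes f :: "nat \<Rightarrow> real^'d::finite \<Rightarrow> complex"
  assumes f: "\<And>n. f n \<in> L2w" and cauchy: "\<And>e. e > 0 \<Longrightarrow> \<exists>N. \<forall>m\<ge>N. \<forall>n\<ge>N. nw (\<lambda>x. f m x - f n x) < e"
  obtains g where "g \<in> L2w" "(\<lambda>n. nw (\<lambda>x. f n x - g x)) \<longlonglongrightarrow> 0"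
proof -
  let ?s = "\<lambda>x::real^'d. complex_of_real (sqrt (wt x))"
  have m [measurable]: "f n \<in> borel_measurable borel" for n by (rule L2wD(1)[OF f])
  obtain h where h: "h \<in> borel_measurable lborel" "integrable lborel (\<lambda>x. (cmod (h x))\<^sup>2)"
    "(\<lambda>n. \<integral>x. (cmod (?s x * f n x - h x))\<^sup>2 \<partial>lborel) \<longlonglongrightarrow> 0"
  proof (rule L2_complete[of "\<lambda>n x. ?s x * f n x" lborel])
    show "\<exists>N. \<forall>m\<ge>N. \<forall>n\<ge>N. (\<integral>x. (cmod (?s x * f m x - ?s x * f n x))\<^sup>2 \<partial>lborel) < e" if "e > 0" for e
      using cauchy[OF that] unfolding right_diff_distrib[symmetric] cmod_sqrt_wt nw_def .
  qed (use L2wD(2)[OF f] in \<open>auto simp: cmod_sqrt_wt\<close>)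
  define g where "g x = h x / ?s x" for x
  have hg: "h x = ?s x * g x" for x
    using wt_pos[of x] by (simp add: g_def)
  have [measurable]: "g \<in> borel_measurable borel"
    unfolding g_def using h(1) by simp
  show thesis
  proof
    show "g \<in> L2w"
      using h(2) by (simp add: hg cmod_sqrt_wt L2w_def)
    show "(\<lambda>n. nw (\<lambda>x. f n x - g x)) \<longlonglongrightarrow> 0"
      using h(3) unfolding hg right_diff_distrib[symmetric] cmod_sqrt_wt nw_def .
  qed
qed

lemma L2w_L1:
  assumes f: "f \<in> L2w"
  shows "integrable lborel (\<lambda>x. wt x * cmod (f x))"
    and "(\<integral>x. wt x * cmod (f x) \<partial>lborel)\<^sup>2 \<le> (\<integral>x. wt x \<partial>(lborel :: (real^'d::finite) measure)) * nw (f :: real^'d \<Rightarrow> complex)"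
proof -
  have [measurable]: "f \<in> borel_measurable borel" by (rule L2wD(1)[OF f])
  have bound: "wt x * cmod (f x) \<le> wt x + wt x * (cmod (f x))\<^sup>2" for x
  proof -
    have "cmod (f x) \<le> 1 + (cmod (f x))\<^sup>2"
    proof -
      have "2 * cmod (f x) \<le> 1 + (cmod (f x))\<^sup>2"
        using zero_le_power2[of "cmod (f x) - 1"] by (simp add: power2_diff)
      then show ?thesis using norm_ge_zero[of "f x"] by linarith
    qed
    from mult_left_mono[OF this, of "wt x"] show ?thesis
      using wt_pos[of x] by (simp add: distrib_left less_imp_le)
  qed
  show int: "integrable lborel (\<lambda>x. wt x * cmod (f x))"
    by (rule Bochner_Integration.integrable_bound[of _ "\<lambda>x. wt x + wt x * (cmod (f x))\<^sup>2"])
      (use order_trans[OF bound abs_ge_self] wt_int L2wD(2)[OF f] in \<open>auto simp: abs_mult abs_of_pos[OF wt_pos]\<close>)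
  define W where "W = (\<integral>x. wt x \<partial>(lborel :: (real^'d) measure))"
  define I where "I = (\<integral>x. wt x * cmod (f x) \<partial>lborel)"
  have W: "0 \<le> W" unfolding W_def by (intro integral_nonneg_AE) (auto simp: wt_pos less_imp_le)
  \<comment> \<open>Cauchy--Schwarz for the finite measure with density \<open>wt\<close>: expanding
    the square gives W (W \<open>nw f\<close> - I^2), and W is positive.\<close>
  have "0 \<le> (\<integral>x. wt x * (W * cmod (f x) - I)\<^sup>2 \<partial>lborel)"
    by (intro integral_nonneg_AE) (auto simp: wt_pos less_imp_le)
  also have "\<dots> = (\<integral>x. W\<^sup>2 * (wt x * (cmod (f x))\<^sup>2) - 2 * W * I * (wt x * cmod (f x)) + I\<^sup>2 * wt x \<partial>lborel)"
    by (rule Bochner_Integration.integral_cong) (auto simp: power2_eq_square algebra_simps)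
  also have "\<dots> = W\<^sup>2 * nw f - 2 * W * I * I + I\<^sup>2 * W"
  proof -
    have i: "integrable lborel (\<lambda>x. W\<^sup>2 * (wt x * (cmod (f x))\<^sup>2))"
      "integrable lborel (\<lambda>x. 2 * W * I * (wt x * cmod (f x)))" "integrable lborel (\<lambda>x. I\<^sup>2 * wt (x :: real^'d))"
      using int wt_int L2wD(2)[OF f] by (intro integrable_mult_right; simp)+
    show ?thesis
      unfolding Bochner_Integration.integral_add[OF Bochner_Integration.integrable_diff[OF i(1,2)] i(3)]
        Bochner_Integration.integral_diff[OF i(1,2)] integral_mult_right_zero
      by (simp only: nw_def I_def W_def)
  qed
  also have "\<dots> = W * (W * nw f - I\<^sup>2)"
    by (simp add: power2_eq_square algebra_simps)
  finally have *: "0 \<le> W * (W * nw f - I\<^sup>2)" .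
  have "W \<noteq> 0"
  proof
    assume "W = 0"
    then have "AE x in lborel. wt (x :: real^'d) = 0"
      unfolding W_def by (subst (asm) integral_nonneg_eq_0_iff_AE) (auto simp: wt_pos less_imp_le wt_int)
    then have "AE x in (lborel :: (real^'d) measure). False"
      by eventually_elim (use wt_pos less_irrefl in metis)
    then show False by (simp add: eventually_False ae_filter_eq_bot_iff emeasure_lborel_UNIV)
  qed
  then show "(\<integral>x. wt x * cmod (f x) \<partial>lborel)\<^sup>2 \<le> (\<integral>x. wt x \<partial>(lborel :: (real^'d) measure)) * nw f"
    using * W unfolding W_def[symmetric] I_def[symmetric] by (simp add: zero_le_mult_iff)
qed

lemma L2w_mult:
  assumes f: "f \<in> L2w" and [measurable]: "\<phi> \<in> borel_measurable borel" and \<phi>: "\<And>x. cmod (\<phi> x) \<le> B * wt x"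
  shows "integrable lborel (\<lambda>x. f x * \<phi> x)"
    and "cmod (\<integral>x. f x * \<phi> x \<partial>lborel) \<le> B * sqrt ((\<integral>x. wt x \<partial>(lborel :: (real^'d::finite) measure)) * nw (f :: real^'d \<Rightarrow> complex))"
proof -
  have [measurable]: "f \<in> borel_measurable borel" by (rule L2wD(1)[OF f])
  have "0 \<le> B * wt (0 :: real^'d)" using \<phi>[of 0] norm_ge_zero order_trans by blast
  then have B: "0 \<le> B" using wt_pos[of "0 :: real^'d"] by (simp add: zero_le_mult_iff)
  have le: "cmod (f x * \<phi> x) \<le> B * (wt x * cmod (f x))" for x
    using mult_left_mono[OF \<phi>[of x], of "cmod (f x)"] by (simp add: norm_mult mult_ac)
  show int: "integrable lborel (\<lambda>x. f x * \<phi> x)"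
    by (rule Bochner_Integration.integrable_bound[of _ "\<lambda>x. B * (wt x * cmod (f x))"])
      (use L2w_L1(1)[OF f] le in \<open>auto intro!: order_trans[OF _ abs_ge_self]\<close>)
  have "cmod (\<integral>x. f x * \<phi> x \<partial>lborel) \<le> (\<integral>x. B * (wt x * cmod (f x)) \<partial>lborel)"
    by (rule Bochner_Integration.integral_norm_bound_integral[OF int _ le]) (use L2w_L1(1)[OF f] in simp)
  also have "\<dots> = B * (\<integral>x. wt x * cmod (f x) \<partial>lborel)" by simp
  also have "\<dots> \<le> B * sqrt ((\<integral>x. wt x \<partial>(lborel :: (real^'d) measure)) * nw f)"
    by (intro mult_left_mono real_le_rsqrt L2w_L1(2)[OF f] B)
  finally show "cmod (\<integral>x. f x * \<phi> x \<partial>lborel) \<le> B * sqrt ((\<integral>x. wt x \<partial>(lborel :: (real^'d) measure)) * nw f)" .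
qed

text \<open>Bounded functions of compact support are dominated by a multiple of the weight. Local
  convergence hence passes both to box averages and to the identity defining a weak
  gradient.\<close>

lemma L2w_test_tendsto:
  fixes f :: "nat \<Rightarrow> real^'d::finite \<Rightarrow> complex"
  assumes f: "\<And>n. f n \<in> L2w" "g \<in> L2w" "(\<lambda>n. nw (\<lambda>x. f n x - g x)) \<longlonglongrightarrow> 0"
    and \<phi>: "\<phi> \<in> borel_measurable borel" "\<And>x. cmod (\<phi> x) \<le> B * wt x"
  shows "(\<lambda>n. \<integral>x. f n x * \<phi> x \<partial>lborel) \<longlonglongrightarrow> (\<integral>x. g x * \<phi> x \<partial>lborel)"
proof -
  let ?W = "\<integral>x. wt x \<partial>(lborel :: (real^'d) measure)"
  have "(\<lambda>n. B * sqrt (?W * nw (\<lambda>x. f n x - g x))) \<longlonglongrightarrow> B * sqrt (?W * 0)"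
    by (intro tendsto_intros f)
  then have lim: "(\<lambda>n. B * sqrt (?W * nw (\<lambda>x. f n x - g x))) \<longlonglongrightarrow> 0" by simp
  have "(\<integral>x. f n x * \<phi> x \<partial>lborel) - (\<integral>x. g x * \<phi> x \<partial>lborel) = (\<integral>x. (f n x - g x) * \<phi> x \<partial>lborel)" for n
    using L2w_mult(1)[OF f(1) \<phi>] L2w_mult(1)[OF f(2) \<phi>] by (simp add: left_diff_distrib)
  then have "norm ((\<integral>x. f n x * \<phi> x \<partial>lborel) - (\<integral>x. g x * \<phi> x \<partial>lborel)) \<le> B * sqrt (?W * nw (\<lambda>x. f n x - g x))" for n
    using L2w_mult(2)[OF L2w_diff(1)[OF f(1,2)] \<phi>] by simp
  then have "(\<lambda>n. (\<integral>x. f n x * \<phi> x \<partial>lborel) - (\<integral>x. g x * \<phi> x \<partial>lborel)) \<longlonglongrightarrow> 0"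
    using lim by (rule Lim_null_comparison[OF always_eventually[OF allI]])
  then show ?thesis by (simp add: LIM_zero_iff)
qed

lemma bounded_le_wt:
  fixes \<phi> :: "real^'d::finite \<Rightarrow> complex"
  assumes "compact K" "\<And>x. x \<notin> K \<Longrightarrow> \<phi> x = 0" "\<And>x. cmod (\<phi> x) \<le> M"
  shows "\<exists>B. \<forall>x. cmod (\<phi> x) \<le> B * wt x"
proof -
  obtain c where c: "c > 0" "\<And>x. x \<in> K \<Longrightarrow> c \<le> wt x" using wt_lower[OF assms(1)] by auto
  have M: "0 \<le> M" using assms(3) norm_ge_zero order_trans by blast
  have "cmod (\<phi> x) \<le> M / c * wt x" for x
  proof (cases "x \<in> K")
    case True
    have "M * 1 \<le> M * (wt x / c)" using M c(2)[OF True] c(1) by (intro mult_left_mono) auto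
    then show ?thesis using assms(3)[of x] by simp
  next
    case False
    then show ?thesis using assms(2)[of x] M c(1) wt_pos[of x] by simp
  qed
  then show ?thesis by blast
qed

lemma indicator_le_wt:
  assumes "compact K" "S \<subseteq> K"
  shows "\<exists>B. \<forall>x::real^'d::finite. cmod (indicator S x) \<le> B * wt x"
proof -
  have "indicator S x = (0 :: complex)" if "x \<notin> K" for x
    using that assms(2) by (auto simp: indicator_def)
  moreover have "cmod (indicator S x) \<le> 1" for x
    by (simp add: indicator_def)
  ultimately show ?thesis
    by (intro bounded_le_wt[OF assms(1), of "indicator S" 1]) auto
qed

lemma L2w_locally_integrable: "f \<in> L2w \<Longrightarrow> locally_integrable f" for f :: "real^'d::finite \<Rightarrow> complex"
  unfolding locally_integrable_def
proof (intro allI impI)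
  fix K :: "(real^'d) set" assume f: "f \<in> L2w" and K: "compact K"
  have [measurable]: "K \<in> sets borel" using K by (simp add: compact_imp_closed)
  obtain B where "\<And>x. cmod (indicator K x) \<le> B * wt x"
    using indicator_le_wt[OF K order.refl] by blast
  from L2w_mult(1)[OF f _ this] have "integrable lborel (\<lambda>x. f x * indicator K x)" by simp
  moreover have "f x * indicator K x = indicat_real K x *\<^sub>R f x" for x by (simp add: indicator_def)
  ultimately show "set_integrable lborel K f" by (simp add: set_integrable_def)
qed

lemma L2w_av_tendsto:
  fixes f :: "nat \<Rightarrow> real^'d::finite \<Rightarrow> complex"
  assumes f: "\<And>n. f n \<in> L2w" "g \<in> L2w" "(\<lambda>n. nw (\<lambda>x. f n x - g x)) \<longlonglongrightarrow> 0"
  shows "(\<lambda>n. av N (f n) x) \<longlonglongrightarrow> av N g x"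
proof -
  obtain B where B: "\<And>y. cmod (indicator (Bx N x) y) \<le> B * wt y"
    using indicator_le_wt[OF compact_cbox Bx_subset_cbox] by blast
  have "(\<lambda>n. \<integral>y. f n y * indicator (Bx N x) y \<partial>lborel) \<longlonglongrightarrow> (\<integral>y. g y * indicator (Bx N x) y \<partial>lborel)"
    by (rule L2w_test_tendsto[OF f _ B]) simp
  then show ?thesis
    unfolding av_def set_integral_eq_mult by (intro tendsto_intros)
qed

lemma Lp2_L2w:
  assumes "f \<in> Lp 2"
  shows "f \<in> L2w" "nw f \<le> (\<integral>x. (cmod (f x))\<^sup>2 \<partial>lborel)"
proof -
  have [measurable]: "f \<in> borel_measurable borel" and int: "integrable lborel (\<lambda>x. (cmod (f x))\<^sup>2)"
    using assms by (auto simp: Lp2_iff)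
  have le: "wt x * (cmod (f x))\<^sup>2 \<le> (cmod (f x))\<^sup>2" for x
    using mult_right_mono[OF wt_le[of x], of "(cmod (f x))\<^sup>2"] by simp
  have i: "integrable lborel (\<lambda>x. wt x * (cmod (f x))\<^sup>2)"
    by (rule Bochner_Integration.integrable_bound[OF int]) (use le in \<open>auto simp: abs_mult abs_of_pos[OF wt_pos]\<close>)
  then show "f \<in> L2w" by (simp add: L2w_def)
  show "nw f \<le> (\<integral>x. (cmod (f x))\<^sup>2 \<partial>lborel)"
    unfolding nw_def by (rule integral_mono[OF i int le])
qed

text \<open>Both sides of the integration by parts are pairings with continuous functions of compact
  support, so they are continuous for \<open>nw\<close>. The L^2 convergence of the gradients is
  needed for their limit to remain square integrable.\<close>

lemma weak_grad_limit:
  fixes V :: "nat \<Rightarrow> real^'d::finite \<Rightarrow> complex"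
  assumes V: "\<And>n. V n \<in> L2w" "u \<in> L2w" "(\<lambda>n. nw (\<lambda>x. V n x - u x)) \<longlonglongrightarrow> 0"
    and E: "\<And>n. sob (V n) (E n)"
    and D: "\<And>k. (\<lambda>x. D x $ k) \<in> Lp 2" "\<And>k. (\<lambda>n. \<integral>x. (cmod (E n x $ k - D x $ k))\<^sup>2 \<partial>lborel) \<longlonglongrightarrow> 0"
  shows "sob u D"
  unfolding sob_def has_weak_grad_def
proof (intro conjI allI ballI)
  show "locally_integrable u" by (rule L2w_locally_integrable[OF V(2)])
  show li: "locally_integrable (\<lambda>x. D x $ k)" "(\<lambda>x. D x $ k) \<in> Lp 2" for k
    using D(1) L2w_locally_integrable Lp2_L2w by blast+
  fix k and \<phi> :: "real^'d \<Rightarrow> complex" assume \<phi>: "\<phi> \<in> test_functions"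
  obtain K where K: "compact K" "\<And>x. x \<notin> K \<Longrightarrow> \<phi> x = 0" "\<And>x. x \<notin> K \<Longrightarrow> partial_deriv k \<phi> x = 0"
    by (rule test_function_support[OF \<phi>], rule that)
  have C: "continuous_on UNIV \<phi>" "continuous_on UNIV (partial_deriv k \<phi>)"
    using test_function_C_k[OF \<phi>, of 0] test_function_C_k[OF \<phi>, of 1] by auto
  obtain M1 where M1: "\<And>x. cmod (\<phi> x) \<le> M1"
    using continuous_compact_support_bounded[OF C(1) K(1,2)] by blast
  obtain M2 where M2: "\<And>x. cmod (partial_deriv k \<phi> x) \<le> M2"
    using continuous_compact_support_bounded[OF C(2) K(1,3)] by blast
  obtain B1 where B1: "\<And>x. cmod (\<phi> x) \<le> B1 * wt x" using bounded_le_wt[of K \<phi> M1, OF K(1,2) M1] by blast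
  obtain B2 where B2: "\<And>x. cmod (partial_deriv k \<phi> x) \<le> B2 * wt x" using bounded_le_wt[of K "partial_deriv k \<phi>" M2, OF K(1,3) M2] by blast
  have 1: "(\<lambda>n. \<integral>x. V n x * partial_deriv k \<phi> x \<partial>lborel) \<longlonglongrightarrow> (\<integral>x. u x * partial_deriv k \<phi> x \<partial>lborel)"
    by (rule L2w_test_tendsto[OF V _ B2]) (rule borel_measurable_continuous_onI[OF C(2)])
  have E2: "(\<lambda>x. E n x $ k) \<in> Lp 2" for n using E by (simp add: sob_def)
  have diff: "(\<lambda>x. E n x $ k - D x $ k) \<in> Lp 2" for n
    using E2[of n] D(1)[of k] square_integrable_diff(1)[of "\<lambda>x. E n x $ k" lborel "\<lambda>x. D x $ k"] by (auto simp: Lp2_iff)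
  have "(\<lambda>n. nw (\<lambda>x. E n x $ k - D x $ k)) \<longlonglongrightarrow> 0"
    by (rule tendsto_sandwich[OF _ _ tendsto_const D(2)[of k]]) (auto simp: nw_nonneg Lp2_L2w(2)[OF diff])
  then have "(\<lambda>n. \<integral>x. E n x $ k * \<phi> x \<partial>lborel) \<longlonglongrightarrow> (\<integral>x. D x $ k * \<phi> x \<partial>lborel)"
    by (intro L2w_test_tendsto[OF _ _ _ borel_measurable_continuous_onI[OF C(1)] B1] Lp2_L2w E2 D(1))
  then have "(\<lambda>n. - (\<integral>x. E n x $ k * \<phi> x \<partial>lborel)) \<longlonglongrightarrow> - (\<integral>x. D x $ k * \<phi> x \<partial>lborel)"
    by (rule tendsto_minus)
  moreover have "- (\<integral>x. E n x $ k * \<phi> x \<partial>lborel) = (\<integral>x. V n x * partial_deriv k \<phi> x \<partial>lborel)" for n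
    using E[of n] \<phi> by (simp add: sob_def has_weak_grad_def)
  ultimately show "(\<integral>x. u x * partial_deriv k \<phi> x \<partial>lborel) = - (\<integral>x. D x $ k * \<phi> x \<partial>lborel)"
    using 1 LIMSEQ_unique by auto
qed

section \<open>The component spaces\<close>

definition Xs :: "real \<Rightarrow> (real^'d::finite \<Rightarrow> complex) set" where
  "Xs \<gamma> = (if \<gamma> > 0 then H1 else H1_hom)"

definition hs :: "real \<Rightarrow> real \<Rightarrow> (real^'d::finite \<Rightarrow> complex) \<Rightarrow> real" where
  "hs s \<gamma> u = s * grad_normsq u + \<gamma> * L2_normsq u"

text \<open>The real polar form of \<open>hs\<close>. Variations carry a real parameter; the
  imaginary direction enters by multiplying the test function by the imaginary unit.\<close>

definition bs :: "real \<Rightarrow> real \<Rightarrow> (real^'d::finite \<Rightarrow> complex) \<Rightarrow> (real^'d \<Rightarrow> complex) \<Rightarrow> real" where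
  "bs s \<gamma> u v = s * Re (grad_inner u v) + \<gamma> * Re (L2_inner u v)"

text \<open>Strictness of 2 < p yields the positive power p - 2 that turns small averages into a
  small L^p integral. With \<gamma> = 0 there is no choice: the gradient alone controls just the
  Sobolev exponent.\<close>

definition adm :: "'d::finite itself \<Rightarrow> real \<Rightarrow> real \<Rightarrow> bool" where
  "adm _ \<gamma> p \<longleftrightarrow> 2 < p \<and> 0 \<le> \<gamma> \<and> (if \<gamma> > 0 then p * (real CARD('d) - 2) < 2 * real CARD('d)
    else 3 \<le> CARD('d) \<and> p = 2 * real CARD('d) / (real CARD('d) - 2))"

lemma Lp_borel: "f \<in> Lp p \<Longrightarrow> f \<in> borel_measurable borel"
  and Lp_int: "f \<in> Lp p \<Longrightarrow> integrable lborel (\<lambda>x. cmod (f x) powr p)"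
  by (auto simp: Lp_def)

lemma add_powr_le:
  fixes a b p :: real
  assumes "0 \<le> a" "0 \<le> b" "0 \<le> p"
  shows "(a + b) powr p \<le> 2 powr p * (a powr p + b powr p)"
proof -
  have "(a + b) powr p \<le> (2 * max a b) powr p"
    using assms by (intro powr_mono2) auto
  also have "\<dots> = 2 powr p * max a b powr p"
    using assms by (simp add: powr_mult)
  also have "\<dots> \<le> 2 powr p * (a powr p + b powr p)"
    by (intro mult_left_mono) (auto simp: max_def)
  finally show ?thesis .
qed

lemma cmod_add_powr_le: "0 \<le> p \<Longrightarrow> cmod (a + b) powr p \<le> 2 powr p * (cmod a powr p + cmod b powr p)"
  by (rule order_trans[OF powr_mono2[OF _ _ norm_triangle_ineq] add_powr_le]) auto

lemma Lp_add:
  assumes "f \<in> Lp p" "g \<in> Lp p" "0 \<le> p"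
  shows "(\<lambda>x. f x + g x) \<in> Lp p"
    and "(\<integral>x. cmod (f x + g x) powr p \<partial>lborel)
      \<le> 2 powr p * ((\<integral>x. cmod (f x) powr p \<partial>lborel) + (\<integral>x. cmod (g x) powr p \<partial>lborel))"
proof -
  have [measurable]: "f \<in> borel_measurable borel" "g \<in> borel_measurable borel"
    using assms by (auto intro: Lp_borel)
  have i: "integrable lborel (\<lambda>x. 2 powr p * (cmod (f x) powr p + cmod (g x) powr p))"
    using assms by (intro integrable_mult_right Bochner_Integration.integrable_add Lp_int)
  have int: "integrable lborel (\<lambda>x. cmod (f x + g x) powr p)"
    by (rule Bochner_Integration.integrable_bound[OF i])
      (use cmod_add_powr_le[OF assms(3)] in \<open>auto intro!: order_trans[OF _ abs_ge_self]\<close>)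
  then show "(\<lambda>x. f x + g x) \<in> Lp p" by (simp add: Lp_def)
  have "(\<integral>x. cmod (f x + g x) powr p \<partial>lborel) \<le> (\<integral>x. 2 powr p * (cmod (f x) powr p + cmod (g x) powr p) \<partial>lborel)"
    by (rule integral_mono[OF int i]) (rule cmod_add_powr_le[OF assms(3)])
  then show "(\<integral>x. cmod (f x + g x) powr p \<partial>lborel)
      \<le> 2 powr p * ((\<integral>x. cmod (f x) powr p \<partial>lborel) + (\<integral>x. cmod (g x) powr p \<partial>lborel))"
    using assms by (simp add: Lp_int)
qed

lemma Lp_cmult:
  assumes "f \<in> Lp p"
  shows "(\<lambda>x. a * f x) \<in> Lp p"
  using assms by (auto simp: Lp_def norm_mult powr_mult)

lemma sob_add: "sob u D \<Longrightarrow> sob v E \<Longrightarrow> sob (\<lambda>x. u x + v x) (\<lambda>x. D x + E x)"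
  unfolding sob_def using has_weak_grad_add[of u D v E] Lp_add(1)[of _ 2] by auto

lemma sob_cmult: "sob u D \<Longrightarrow> sob (\<lambda>x. a * u x) (\<lambda>x. a *s D x)"
  unfolding sob_def using has_weak_grad_cmult[of u D a] Lp_cmult[of _ 2 a] by auto

text \<open>Measurability and square integrability of the chosen gradient are inherited from the
  given one by uniqueness almost everywhere.\<close>

lemma sob_weak_grad:
  assumes u: "sob u D"
  shows "sob u (weak_grad u)" "AE x in lborel. weak_grad u x = D x"
proof -
  have D: "has_weak_grad u D" using u by (simp add: sob_def)
  have wg: "has_weak_grad u (weak_grad u)"
    unfolding weak_grad_def by (rule someI[of "has_weak_grad u", OF D])
  then show ae: "AE x in lborel. weak_grad u x = D x"
    using weak_grad_unique D by blast
  have "(\<lambda>x. weak_grad u x $ k) \<in> Lp 2" for k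
  proof -
    have [measurable]: "(\<lambda>x. weak_grad u x $ k) \<in> borel_measurable borel" "(\<lambda>x. D x $ k) \<in> borel_measurable borel"
      using wg D by (auto simp: has_weak_grad_def locally_integrable_borel)
    have "integrable lborel (\<lambda>x. (cmod (weak_grad u x $ k))\<^sup>2) \<longleftrightarrow> integrable lborel (\<lambda>x. (cmod (D x $ k))\<^sup>2)"
      by (rule integrable_cong_AE) (use ae in \<open>auto elim!: eventually_mono\<close>)
    then show ?thesis using sob_borel(5)[OF u] by (simp add: Lp2_iff)
  qed
  then show "sob u (weak_grad u)" using wg by (simp add: sob_def)
qed

lemma grad_normsq_eq:
  assumes u: "sob u D"
  shows "grad_normsq u = dirichlet D"
proof -
  note w = sob_weak_grad[OF u]
  have [measurable]: "(\<lambda>x. norm (D x)) \<in> borel_measurable borel" "(\<lambda>x. norm (weak_grad u x)) \<in> borel_measurable borel"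
    using sob_borel(3)[OF u] sob_borel(3)[OF w(1)] by auto
  have "grad_normsq u = (\<integral>x. (\<Sum>k\<in>UNIV. (cmod (weak_grad u x $ k))\<^sup>2) \<partial>lborel)"
    unfolding grad_normsq_def L2_normsq_def
    by (rule Bochner_Integration.integral_sum[symmetric]) (rule sob_borel(5)[OF w(1)])
  also have "\<dots> = (\<integral>x. (norm (weak_grad u x))\<^sup>2 \<partial>lborel)" by (simp add: norm_vec_square)
  also have "\<dots> = dirichlet D"
    unfolding dirichlet_def by (rule integral_cong_AE) (use w(2) in \<open>auto elim!: eventually_mono\<close>)
  finally show ?thesis .
qed

lemma L2_normsq_nonneg: "0 \<le> L2_normsq f"
  by (simp add: L2_normsq_def)

lemma grad_normsq_nonneg: "0 \<le> grad_normsq u"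
  unfolding grad_normsq_def by (intro sum_nonneg L2_normsq_nonneg)

lemma hs_nonneg: "0 \<le> s \<Longrightarrow> 0 \<le> \<gamma> \<Longrightarrow> 0 \<le> hs s \<gamma> u"
  unfolding hs_def by (intro add_nonneg_nonneg mult_nonneg_nonneg L2_normsq_nonneg grad_normsq_nonneg)

text \<open>The exponent that defines the space, as opposed to the exponent p of \<open>adm\<close>,
  which is the one used in the trilinear estimate. They agree only for \<gamma> = 0.\<close>

definition qexp :: "'d::finite itself \<Rightarrow> real \<Rightarrow> real" where
  "qexp _ \<gamma> = (if \<gamma> > 0 then 2 else 2 * real CARD('d) / (real CARD('d) - 2))"

lemma Xs_iff: "u \<in> Xs \<gamma> \<longleftrightarrow> u \<in> Lp (qexp TYPE('d) \<gamma>) \<and> (\<exists>D. sob u D)" for u :: "real^'d::finite \<Rightarrow> complex"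
  by (auto simp: Xs_def H1_def H1_hom_def qexp_def grad_in_L2_def sob_def)

lemma Xs_sob: "u \<in> Xs \<gamma> \<Longrightarrow> sob u (weak_grad u)"
  using Xs_iff sob_weak_grad by blast

lemma qexp_ge: "adm TYPE('d::finite) \<gamma> p \<Longrightarrow> 2 \<le> qexp TYPE('d) \<gamma>"
  by (auto simp: adm_def qexp_def split: if_splits)

lemma Xs_add: "adm TYPE('d::finite) \<gamma> p \<Longrightarrow> u \<in> Xs \<gamma> \<Longrightarrow> v \<in> Xs \<gamma> \<Longrightarrow> (\<lambda>x. u x + v x) \<in> Xs \<gamma>"
  for u v :: "real^'d \<Rightarrow> complex"
  unfolding Xs_iff using Lp_add(1)[of u _ v] sob_add[of u _ v] qexp_ge[of \<gamma> p, where 'd = 'd] by force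

lemma Xs_cmult: "u \<in> Xs \<gamma> \<Longrightarrow> (\<lambda>x. a * u x) \<in> Xs \<gamma>"
  unfolding Xs_iff using Lp_cmult[of u _ a] sob_cmult[of u _ a] by blast

lemma Xs_diff: "adm TYPE('d::finite) \<gamma> p \<Longrightarrow> u \<in> Xs \<gamma> \<Longrightarrow> v \<in> Xs \<gamma> \<Longrightarrow> (\<lambda>x. u x - v x) \<in> Xs \<gamma>"
  for u v :: "real^'d \<Rightarrow> complex"
  using Xs_add[of \<gamma> p u "\<lambda>x. - 1 * v x"] Xs_cmult[of v \<gamma> "- 1"] by simp

lemma Xs_borel: "u \<in> Xs \<gamma> \<Longrightarrow> u \<in> borel_measurable borel"
  by (auto simp: Xs_iff intro: Lp_borel)

section \<open>The energy as a quadratic form\<close>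

lemma borel_measurable_cnj [measurable (raw)]:
  "f \<in> borel_measurable M \<Longrightarrow> (\<lambda>x. cnj (f x)) \<in> borel_measurable M"
  by (rule borel_measurable_continuous_on[of cnj]) (auto intro: continuous_intros)

lemma Lp2_mult_integrable:
  assumes "f \<in> Lp 2" "g \<in> Lp 2"
  shows "integrable lborel (\<lambda>x. f x * cnj (g x))"
proof (rule Bochner_Integration.integrable_bound)
  show "integrable lborel (\<lambda>x. cmod (f x) * cmod (g x))"
    by (rule integrable_mult_square) (use assms in \<open>auto simp: Lp2_iff\<close>)
qed (use assms in \<open>auto simp: Lp2_iff norm_mult\<close>)

lemma cmod_add_real_square:
  "(cmod (a + of_real t * b))\<^sup>2 = (cmod a)\<^sup>2 + 2 * t * Re (a * cnj b) + t\<^sup>2 * (cmod b)\<^sup>2"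
  unfolding cmod_power2 by (simp add: power2_eq_square algebra_simps)

lemma L2_expand:
  assumes "f \<in> Lp 2" "g \<in> Lp 2"
  shows "L2_normsq (\<lambda>x. f x + of_real t * g x) = L2_normsq f + 2 * t * Re (L2_inner f g) + t\<^sup>2 * L2_normsq g"
proof -
  have i: "integrable lborel (\<lambda>x. (cmod (f x))\<^sup>2)" "integrable lborel (\<lambda>x. (cmod (g x))\<^sup>2)"
    using assms by (auto simp: Lp2_iff)
  note m = Lp2_mult_integrable[OF assms]
  have j: "integrable lborel (\<lambda>x. 2 * t * Re (f x * cnj (g x)))" "integrable lborel (\<lambda>x. t\<^sup>2 * (cmod (g x))\<^sup>2)"
    using integrable_Re[OF m] i by (intro integrable_mult_right; simp)+
  show ?thesis
    unfolding L2_normsq_def L2_inner_def cmod_add_real_square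
      Bochner_Integration.integral_add[OF Bochner_Integration.integrable_add[OF i(1) j(1)] j(2)]
      Bochner_Integration.integral_add[OF i(1) j(1)]
    using integral_Re[OF m] by simp
qed

lemma L2_normsq_cong_AE:
  assumes "AE x in lborel. f x = g x" "f \<in> borel_measurable borel" "g \<in> borel_measurable borel"
  shows "L2_normsq f = L2_normsq g"
  unfolding L2_normsq_def by (rule integral_cong_AE) (use assms in auto)

lemma grad_expand:
  assumes u: "sob u (weak_grad u)" and v: "sob v (weak_grad v)"
  shows "grad_normsq (\<lambda>x. u x + of_real t * v x) = grad_normsq u + 2 * t * Re (grad_inner u v) + t\<^sup>2 * grad_normsq v"
proof -
  let ?w = "\<lambda>x. u x + of_real t * v x"
  have s: "sob ?w (\<lambda>x. weak_grad u x + complex_of_real t *s weak_grad v x)"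
    by (rule sob_add[OF u sob_cmult[OF v]])
  note w = sob_weak_grad[OF s]
  have "L2_normsq (\<lambda>x. weak_grad ?w x $ k) = L2_normsq (\<lambda>x. weak_grad u x $ k)
      + 2 * t * Re (L2_inner (\<lambda>x. weak_grad u x $ k) (\<lambda>x. weak_grad v x $ k)) + t\<^sup>2 * L2_normsq (\<lambda>x. weak_grad v x $ k)" for k
  proof -
    have "L2_normsq (\<lambda>x. weak_grad ?w x $ k) = L2_normsq (\<lambda>x. weak_grad u x $ k + of_real t * weak_grad v x $ k)"
    proof (rule L2_normsq_cong_AE)
      show "AE x in lborel. weak_grad ?w x $ k = weak_grad u x $ k + of_real t * weak_grad v x $ k"
        using w(2) by eventually_elim simp
    qed (use sob_borel(2)[OF u] sob_borel(2)[OF v] sob_borel(2)[OF w(1)] in auto)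
    then show ?thesis
      using L2_expand[of "\<lambda>x. weak_grad u x $ k" "\<lambda>x. weak_grad v x $ k" t] u v by (simp add: sob_def)
  qed
  then show ?thesis
    by (simp add: grad_normsq_def grad_inner_def sum.distrib sum_distrib_left)
qed

lemma hs_expand:
  fixes u v :: "real^'d::finite \<Rightarrow> complex"
  assumes "0 \<le> \<gamma>" "u \<in> Xs \<gamma>" "v \<in> Xs \<gamma>"
  shows "hs s \<gamma> (\<lambda>x. u x + of_real t * v x) = hs s \<gamma> u + 2 * t * bs s \<gamma> u v + t\<^sup>2 * hs s \<gamma> v"
proof -
  have L: "\<gamma> * L2_normsq (\<lambda>x. u x + of_real t * v x)
      = \<gamma> * (L2_normsq u + 2 * t * Re (L2_inner u v) + t\<^sup>2 * L2_normsq v)"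
  proof (cases "\<gamma> > 0")
    case True
    then have "u \<in> Lp 2" "v \<in> Lp 2" using assms by (auto simp: Xs_iff qexp_def)
    from L2_expand[OF this] show ?thesis by simp
  qed (use assms in simp)
  show ?thesis
    unfolding hs_def bs_def L grad_expand[OF Xs_sob[OF assms(2)] Xs_sob[OF assms(3)]]
    by (simp add: algebra_simps)
qed

lemma hs_zero_fun: "hs s \<gamma> (\<lambda>x::real^'d::finite. 0) = 0"
proof -
  have "sob (\<lambda>x::real^'d. 0) (\<lambda>x. 0)"
    by (auto simp: sob_def has_weak_grad_def Lp_def locally_integrable_def set_integrable_def)
  from grad_normsq_eq[OF this] show ?thesis
    by (simp add: hs_def dirichlet_def L2_normsq_def)
qed

lemma hs_cmult_real:
  assumes "adm TYPE('d::finite) \<gamma> p" "(u :: real^'d \<Rightarrow> complex) \<in> Xs \<gamma>"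
  shows "hs s \<gamma> (\<lambda>x. of_real a * u x) = a\<^sup>2 * hs s \<gamma> u"
proof -
  have z: "(\<lambda>x::real^'d. 0) \<in> Xs \<gamma>" using Xs_cmult[OF assms(2), of 0] by simp
  have g: "0 \<le> \<gamma>" using assms(1) by (simp add: adm_def)
  have e: "hs s \<gamma> (\<lambda>x. of_real t * u x) = 2 * t * bs s \<gamma> (\<lambda>x. 0) u + t\<^sup>2 * hs s \<gamma> u" for t
    using hs_expand[OF g z assms(2), of s t] by (simp add: hs_zero_fun)
  \<comment> \<open>At t = 1 the expansion around the zero function reads hs u = 2 bs 0 u + hs u, so
    the linear term vanishes.\<close>
  from e[of 1] have "bs s \<gamma> (\<lambda>x. 0) u = 0" by simp
  then show ?thesis using e[of a] by simp
qed

text \<open>The parallelogram identity in convex form. Its last term is the uniform convexity behind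
  both the Cauchy property of near-minimisers (t = 1/2) and the splitting of the energy (small
  t).\<close>

lemma hs_interp:
  assumes "adm TYPE('d::finite) \<gamma> p" "(u :: real^'d \<Rightarrow> complex) \<in> Xs \<gamma>" "v \<in> Xs \<gamma>"
  shows "hs s \<gamma> (\<lambda>x. of_real (1 - t) * u x + of_real t * v x)
    = (1 - t) * hs s \<gamma> u + t * hs s \<gamma> v - t * (1 - t) * hs s \<gamma> (\<lambda>x. v x - u x)"
proof -
  have g: "0 \<le> \<gamma>" using assms(1) by (simp add: adm_def)
  have w: "(\<lambda>x. v x - u x) \<in> Xs \<gamma>" by (rule Xs_diff[OF assms(1,3,2)])
  note e = hs_expand[OF g assms(2) w, of s]
  have "(\<lambda>x. of_real (1 - t) * u x + of_real t * v x) = (\<lambda>x. u x + of_real t * (v x - u x))"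
    by (simp add: algebra_simps)
  then have 1: "hs s \<gamma> (\<lambda>x. of_real (1 - t) * u x + of_real t * v x)
      = hs s \<gamma> u + 2 * t * bs s \<gamma> u (\<lambda>x. v x - u x) + t\<^sup>2 * hs s \<gamma> (\<lambda>x. v x - u x)"
    using e[of t] by simp
  have 2: "hs s \<gamma> v = hs s \<gamma> u + 2 * bs s \<gamma> u (\<lambda>x. v x - u x) + hs s \<gamma> (\<lambda>x. v x - u x)"
    using e[of 1] by simp
  show ?thesis unfolding 1 2 by (simp add: power2_eq_square algebra_simps)
qed

text \<open>Convexity applied to u/(1-t) and v/t. Letting t tend to 0 with v negligible recovers the
  energy of u with the sharp factor 1.\<close>

lemma hs_triangle:
  assumes "adm TYPE('d::finite) \<gamma> p" "(u :: real^'d \<Rightarrow> complex) \<in> Xs \<gamma>" "v \<in> Xs \<gamma>" "0 \<le> s" "0 < t" "t < 1"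
  shows "hs s \<gamma> (\<lambda>x. u x + v x) \<le> hs s \<gamma> u / (1 - t) + hs s \<gamma> v / t"
proof -
  let ?u = "\<lambda>x. of_real (1 / (1 - t)) * u x" and ?v = "\<lambda>x. of_real (1 / t) * v x"
  have m: "?u \<in> Xs \<gamma>" "?v \<in> Xs \<gamma>" by (intro Xs_cmult assms)+
  have "(\<lambda>x. u x + v x) = (\<lambda>x. of_real (1 - t) * ?u x + of_real t * ?v x)"
    using assms(5,6) by (simp add: mult.assoc[symmetric] of_real_mult[symmetric] del: of_real_mult)
  then have "hs s \<gamma> (\<lambda>x. u x + v x) = (1 - t) * hs s \<gamma> ?u + t * hs s \<gamma> ?v - t * (1 - t) * hs s \<gamma> (\<lambda>x. ?v x - ?u x)"
    using hs_interp[OF assms(1) m, of s t] by simp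
  also have "\<dots> \<le> (1 - t) * hs s \<gamma> ?u + t * hs s \<gamma> ?v"
    using assms hs_nonneg[of s \<gamma> "\<lambda>x. ?v x - ?u x"] by (simp add: adm_def)
  also have "\<dots> = hs s \<gamma> u / (1 - t) + hs s \<gamma> v / t"
    unfolding hs_cmult_real[OF assms(1,2)] hs_cmult_real[OF assms(1,3)]
    using assms(5,6) by (simp add: power2_eq_square)
  finally show ?thesis .
qed

section \<open>Integrability gained from bounded energy\<close>

lemma dirichlet_le_hs:
  assumes "u \<in> Xs \<gamma>" "0 < s" "0 \<le> \<gamma>"
  shows "dirichlet (weak_grad u) \<le> hs s \<gamma> u / s"
proof -
  have "s * dirichlet (weak_grad u) \<le> hs s \<gamma> u"
    using grad_normsq_eq[OF Xs_sob[OF assms(1)]] L2_normsq_nonneg[of u] assms by (simp add: hs_def)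
  then show ?thesis using assms by (simp add: field_simps)
qed

lemma L2_le_hs:
  assumes "0 < s" "0 < \<gamma>"
  shows "L2_normsq u \<le> hs s \<gamma> u / \<gamma>"
proof -
  have "\<gamma> * L2_normsq u \<le> hs s \<gamma> u"
    using grad_normsq_nonneg[of u] assms by (simp add: hs_def)
  then show ?thesis using assms by (simp add: field_simps)
qed

lemma av_powr_bound:
  fixes u :: "real^'d::finite \<Rightarrow> complex"
  assumes u: "u \<in> Lp 2" and c: "\<And>x. cmod (av N u x) \<le> c" and p: "2 \<le> p"
  shows "av N u \<in> Lp p" "(\<integral>x. cmod (av N u x) powr p \<partial>lborel) \<le> c powr (p - 2) * L2_normsq u"
proof -
  have [measurable]: "u \<in> borel_measurable borel" using u by (rule Lp_borel)
  have u2: "integrable lborel (\<lambda>x. (cmod (u x))\<^sup>2)" using u by (simp add: Lp2_iff)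
  let ?g = "\<lambda>x. cmod (u x)"
  have g: "integrable lborel (\<lambda>x. (av N ?g x)\<^sup>2)" "(\<integral>x. (av N ?g x)\<^sup>2 \<partial>lborel) \<le> L2_normsq u"
    using av_square_integrable[of ?g N] u2 by (auto simp: L2_normsq_def)
  have le: "cmod (av N u x) powr p \<le> c powr (p - 2) * (av N ?g x)\<^sup>2" for x
  proof -
    have "cmod (av N u x) powr p = cmod (av N u x) powr (p - 2) * cmod (av N u x) powr 2"
      unfolding powr_add[symmetric] by simp
    also have "\<dots> \<le> c powr (p - 2) * (av N ?g x) powr 2"
      using p c by (intro mult_mono powr_mono2 av_norm_le) auto
    finally show ?thesis using av_nonneg[of ?g N x] by simp
  qed
  have i: "integrable lborel (\<lambda>x. c powr (p - 2) * (av N ?g x)\<^sup>2)" using g(1) by simp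
  have int: "integrable lborel (\<lambda>x. cmod (av N u x) powr p)"
    by (rule Bochner_Integration.integrable_bound[OF i]) (use le in \<open>auto intro!: order_trans[OF _ abs_ge_self]\<close>)
  then show "av N u \<in> Lp p" by (simp add: Lp_def)
  have "(\<integral>x. cmod (av N u x) powr p \<partial>lborel) \<le> (\<integral>x. c powr (p - 2) * (av N ?g x)\<^sup>2 \<partial>lborel)"
    by (rule integral_mono[OF int i le])
  also have "\<dots> \<le> c powr (p - 2) * L2_normsq u" using g(2) by (simp add: mult_left_mono)
  finally show "(\<integral>x. cmod (av N u x) powr p \<partial>lborel) \<le> c powr (p - 2) * L2_normsq u" .
qed

text \<open>u is its average plus a remainder. The remainder is small for large N whatever u is, and
  the average costs c^(p-2) times the L^2 norm, so small averages at one fine level force a small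
  L^p integral.\<close>

lemma subcritical_bound:
  assumes adm: "adm TYPE('d::finite) \<gamma> p" and s: "0 < s" and \<gamma>: "0 < \<gamma>"
  obtains \<alpha> C where "\<alpha> > 0" "C \<ge> 0"
    "\<And>(u :: real^'d \<Rightarrow> complex) N c M. u \<in> Xs \<gamma> \<Longrightarrow> hs s \<gamma> u \<le> M \<Longrightarrow> (\<And>x. cmod (av N u x) \<le> c) \<Longrightarrow>
      u \<in> Lp p \<and> (\<integral>x. cmod (u x) powr p \<partial>lborel)
        \<le> 2 powr p * (C * 2 powr (- real_of_int N * \<alpha>) * (M / s) powr (p / 2) + c powr (p - 2) * (M / \<gamma>))"
proof -
  have p: "2 \<le> p" "p * (real CARD('d) - 2) < 2 * real CARD('d)" "0 \<le> p"
    using adm \<gamma> by (auto simp: adm_def)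
  obtain \<alpha> C where \<alpha>: "\<alpha> > 0" "C \<ge> 0" and est: "\<And>(u :: real^'d \<Rightarrow> complex) D N. sob u D \<Longrightarrow>
      integrable lborel (\<lambda>x. cmod (u x - av N u x) powr p)
      \<and> (\<integral>x. cmod (u x - av N u x) powr p \<partial>lborel) \<le> C * 2 powr (- real_of_int N * \<alpha>) * dirichlet D powr (p / 2)"
    by (rule lr_estimate[OF p(1,2)]) blast
  show thesis
  proof (rule that[OF \<alpha>])
    fix u :: "real^'d \<Rightarrow> complex" and N c M
    assume u: "u \<in> Xs \<gamma>" and M: "hs s \<gamma> u \<le> M" and c: "\<And>x. cmod (av N u x) \<le> c"
    have u2: "u \<in> Lp 2" using u \<gamma> by (simp add: Xs_iff qexp_def)
    have [measurable]: "u \<in> borel_measurable borel" by (rule Lp_borel[OF u2])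
    note sob = Xs_sob[OF u]
    have A: "dirichlet (weak_grad u) \<le> M / s"
      using dirichlet_le_hs[OF u s] \<gamma> divide_right_mono[OF M, of s] s by auto
    have B: "L2_normsq u \<le> M / \<gamma>"
      using L2_le_hs[OF s \<gamma>, of u] divide_right_mono[OF M, of \<gamma>] \<gamma> by auto
    have d: "(\<lambda>x. u x - av N u x) \<in> Lp p"
      using est[OF sob, of N] by (simp add: Lp_def)
    note P = av_powr_bound[OF u2 c p(1)]
    have "(\<integral>x. cmod ((u x - av N u x) + av N u x) powr p \<partial>lborel)
      \<le> 2 powr p * ((\<integral>x. cmod (u x - av N u x) powr p \<partial>lborel) + (\<integral>x. cmod (av N u x) powr p \<partial>lborel))"
      by (rule Lp_add(2)[OF d P(1) p(3)])
    also have "\<dots> \<le> 2 powr p * (C * 2 powr (- real_of_int N * \<alpha>) * (M / s) powr (p / 2) + c powr (p - 2) * (M / \<gamma>))"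
    proof (intro mult_left_mono add_mono)
      have "C * 2 powr (- real_of_int N * \<alpha>) * dirichlet (weak_grad u) powr (p / 2)
        \<le> C * 2 powr (- real_of_int N * \<alpha>) * (M / s) powr (p / 2)"
        using \<alpha> A p by (intro mult_left_mono powr_mono2) auto
      then show "(\<integral>x. cmod (u x - av N u x) powr p \<partial>lborel) \<le> C * 2 powr (- real_of_int N * \<alpha>) * (M / s) powr (p / 2)"
        using est[OF sob, of N] by linarith
      show "(\<integral>x. cmod (av N u x) powr p \<partial>lborel) \<le> c powr (p - 2) * (M / \<gamma>)"
        by (rule order_trans[OF P(2) mult_left_mono[OF B]]) simp
    qed simp
    finally show "u \<in> Lp p \<and> (\<integral>x. cmod (u x) powr p \<partial>lborel)
        \<le> 2 powr p * (C * 2 powr (- real_of_int N * \<alpha>) * (M / s) powr (p / 2) + c powr (p - 2) * (M / \<gamma>))"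
      using Lp_add(1)[OF d P(1) p(3)] by simp
  qed
qed

text \<open>Only boundedness on energy balls is recorded, which treats the subcritical and the
  critical case alike; homogeneity is restored later by scaling.\<close>

lemma Xs_Lp_bound:
  assumes adm: "adm TYPE('d::finite) \<gamma> p" and s: "0 < s"
  shows "\<exists>C. \<forall>u :: real^'d \<Rightarrow> complex. u \<in> Xs \<gamma> \<longrightarrow> hs s \<gamma> u \<le> M \<longrightarrow>
    u \<in> Lp p \<and> (\<integral>x. cmod (u x) powr p \<partial>lborel) \<le> C"
proof (cases "0 < \<gamma>")
  case True
  obtain \<alpha> C where \<alpha>: "\<alpha> > 0" "C \<ge> 0" and est: "\<And>(u :: real^'d \<Rightarrow> complex) N c M. u \<in> Xs \<gamma> \<Longrightarrow> hs s \<gamma> u \<le> M \<Longrightarrow> (\<And>x. cmod (av N u x) \<le> c) \<Longrightarrow>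
      u \<in> Lp p \<and> (\<integral>x. cmod (u x) powr p \<partial>lborel)
        \<le> 2 powr p * (C * 2 powr (- real_of_int N * \<alpha>) * (M / s) powr (p / 2) + c powr (p - 2) * (M / \<gamma>))"
    by (rule subcritical_bound[OF adm s True]) blast
  \<comment> \<open>Boxes of level 0 have unit volume, so the L^2 norm bounds the averages; 1 is the
    \<epsilon> of \<open>av_Lp_bound\<close>.\<close>
  have "cmod (av 0 u x) \<le> 1 + M / \<gamma>" if "u \<in> Xs \<gamma>" "hs s \<gamma> u \<le> M" for u :: "real^'d \<Rightarrow> complex" and x
  proof -
    have "u \<in> Lp 2" using that True by (simp add: Xs_iff qexp_def)
    from av_Lp_bound[OF this, of 1 0 x] have "cmod (av 0 u x) \<le> 1 + L2_normsq u"
      by (simp add: L2_normsq_def)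
    also have "L2_normsq u \<le> M / \<gamma>"
      using L2_le_hs[OF s True, of u] divide_right_mono[OF that(2), of \<gamma>] True by auto
    finally show ?thesis by simp
  qed
  then show ?thesis using est[of _ M 0 "1 + M / \<gamma>"] by blast
next
  case False
  then have \<gamma>: "\<gamma> = 0" "3 \<le> CARD('d)" "p = 2 * real CARD('d) / (real CARD('d) - 2)" "2 < p"
    using adm by (auto simp: adm_def)
  obtain C where C: "C \<ge> 0" and est: "\<And>(u :: real^'d \<Rightarrow> complex) D. sob u D \<Longrightarrow> u \<in> Lp p \<Longrightarrow>
      (\<integral>x. cmod (u x) powr p \<partial>lborel) \<le> C * dirichlet D powr (p / 2)"
    using sobolev_inequality[OF \<gamma>(2)] unfolding \<gamma>(3)[symmetric] by blast
  have "u \<in> Lp p \<and> (\<integral>x. cmod (u x) powr p \<partial>lborel) \<le> C * (M / s) powr (p / 2)"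
    if "u \<in> Xs \<gamma>" "hs s \<gamma> u \<le> M" for u :: "real^'d \<Rightarrow> complex"
  proof -
    have up: "u \<in> Lp p" using that(1) \<gamma> by (simp add: Xs_iff qexp_def)
    have "dirichlet (weak_grad u) \<le> M / s"
      using dirichlet_le_hs[OF that(1) s] \<gamma> divide_right_mono[OF that(2), of s] s by auto
    then have "C * dirichlet (weak_grad u) powr (p / 2) \<le> C * (M / s) powr (p / 2)"
      using C \<gamma> by (intro mult_left_mono powr_mono2) auto
    then show ?thesis using est[OF Xs_sob[OF that(1)] up] up by linarith
  qed
  then show ?thesis by blast
qed

lemma Xs_Lp: "adm TYPE('d::finite) \<gamma> p \<Longrightarrow> u \<in> Xs \<gamma> \<Longrightarrow> u \<in> Lp p" for u :: "real^'d \<Rightarrow> complex"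
  using Xs_Lp_bound[of \<gamma> p 1 "hs 1 \<gamma> u"] by auto

text \<open>For \<gamma> = 0 a vanishing gradient would leave the constants; the Sobolev inequality,
  through membership in the critical L^p, excludes them.\<close>

lemma hs_zero:
  fixes u :: "real^'d::finite \<Rightarrow> complex"
  assumes adm: "adm TYPE('d) \<gamma> p" and s: "0 < s" and u: "u \<in> Xs \<gamma>" "hs s \<gamma> u = 0"
  shows "AE x in lborel. u x = 0"
proof (cases "0 < \<gamma>")
  case True
  have "u \<in> Lp 2" using u(1) True by (simp add: Xs_iff qexp_def)
  moreover have "L2_normsq u = 0"
    using L2_le_hs[OF s True, of u] u L2_normsq_nonneg[of u] by simp
  ultimately have "AE x in lborel. (cmod (u x))\<^sup>2 = 0"
    unfolding L2_normsq_def by (subst (asm) integral_nonneg_eq_0_iff_AE) (auto simp: Lp2_iff)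
  then show ?thesis by simp
next
  case False
  then have \<gamma>: "\<gamma> = 0" "3 \<le> CARD('d)" "p = 2 * real CARD('d) / (real CARD('d) - 2)" "2 < p"
    using adm by (auto simp: adm_def)
  obtain C where C: "C \<ge> 0" and est: "\<And>(u :: real^'d \<Rightarrow> complex) D. sob u D \<Longrightarrow> u \<in> Lp p \<Longrightarrow>
      (\<integral>x. cmod (u x) powr p \<partial>lborel) \<le> C * dirichlet D powr (p / 2)"
    using sobolev_inequality[OF \<gamma>(2)] unfolding \<gamma>(3)[symmetric] by blast
  have up: "u \<in> Lp p" by (rule Xs_Lp[OF adm u(1)])
  have "dirichlet (weak_grad u) = 0"
    using dirichlet_le_hs[OF u(1) s] u(2) \<gamma>(1) by (intro antisym dirichlet_nonneg) simp
  then have "(\<integral>x. cmod (u x) powr p \<partial>lborel) \<le> 0"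
    using est[OF Xs_sob[OF u(1)] up] by simp
  then have "(\<integral>x. cmod (u x) powr p \<partial>lborel) = 0"
    by (intro antisym integral_nonneg_AE) auto
  then have "AE x in lborel. cmod (u x) powr p = 0"
    by (subst (asm) integral_nonneg_eq_0_iff_AE) (use Lp_int[OF up] in auto)
  then show ?thesis by simp
qed

text \<open>Components with \<gamma> = 0 are in general not square integrable. Since the weight is
  integrable and at most 1, it provides one topology of local convergence for all three
  components.\<close>

lemma Lp_L2w:
  fixes u :: "real^'d::finite \<Rightarrow> complex"
  assumes u: "u \<in> Lp p" and p: "2 \<le> p"
  shows "u \<in> L2w" "nw u \<le> (\<integral>x. wt x \<partial>(lborel :: (real^'d) measure)) + (\<integral>x. cmod (u x) powr p \<partial>lborel)"
proof -
  have [measurable]: "u \<in> borel_measurable borel" using u by (rule Lp_borel)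
  have le: "wt x * (cmod (u x))\<^sup>2 \<le> wt x + cmod (u x) powr p" for x
  proof (cases "cmod (u x) \<le> 1")
    case True
    then have "(cmod (u x))\<^sup>2 \<le> 1" by (simp add: power_le_one)
    then have "wt x * (cmod (u x))\<^sup>2 \<le> wt x * 1" using wt_pos[of x] by (intro mult_left_mono) auto
    then show ?thesis by (simp add: add_increasing2)
  next
    case False
    have "wt x * (cmod (u x))\<^sup>2 \<le> 1 * (cmod (u x))\<^sup>2" using wt_le[of x] by (intro mult_right_mono) auto
    also have "\<dots> = cmod (u x) powr 2" by simp
    also have "\<dots> \<le> cmod (u x) powr p" using False p by (intro powr_mono) auto
    finally show ?thesis using wt_pos[of x] by simp
  qed
  have i: "integrable lborel (\<lambda>x. wt x + cmod (u x) powr p)"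
    by (intro Bochner_Integration.integrable_add wt_int Lp_int[OF u])
  have int: "integrable lborel (\<lambda>x. wt x * (cmod (u x))\<^sup>2)"
    by (rule Bochner_Integration.integrable_bound[OF i])
      (use order_trans[OF le abs_ge_self] in \<open>auto simp: abs_mult abs_of_pos[OF wt_pos]\<close>)
  then show "u \<in> L2w" by (simp add: L2w_def)
  have "nw u \<le> (\<integral>x. wt x + cmod (u x) powr p \<partial>lborel)"
    unfolding nw_def by (rule integral_mono[OF int i le])
  then show "nw u \<le> (\<integral>x. wt x \<partial>(lborel :: (real^'d) measure)) + (\<integral>x. cmod (u x) powr p \<partial>lborel)"
    unfolding Bochner_Integration.integral_add[OF wt_int Lp_int[OF u]] .
qed

lemma Xs_L2w:
  fixes u :: "real^'d::finite \<Rightarrow> complex"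
  assumes "adm TYPE('d) \<gamma> p" "u \<in> Xs \<gamma>"
  shows "u \<in> L2w"
proof -
  have "2 \<le> p" using assms(1) by (simp add: adm_def)
  then show ?thesis using Lp_L2w(1)[OF Xs_Lp[OF assms]] by simp
qed

text \<open>The vanishing lemma of P.-L. Lions: were all averages at level N small, the L^p integral
  would fall below \<delta>. Level and threshold depend on \<delta> and M but not on u.\<close>

lemma nonvanishing:
  assumes adm: "adm TYPE('d::finite) \<gamma> p" and s: "0 < s" and \<gamma>: "0 < \<gamma>" and \<delta>: "0 < \<delta>" and M: "0 < M"
  obtains N :: int and \<epsilon> where "\<epsilon> > 0"
    "\<And>u :: real^'d \<Rightarrow> complex. u \<in> Xs \<gamma> \<Longrightarrow> hs s \<gamma> u \<le> M \<Longrightarrow> \<delta> \<le> (\<integral>x. cmod (u x) powr p \<partial>lborel) \<Longrightarrow>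
      \<exists>x. \<epsilon> < cmod (av N u x)"
proof -
  obtain \<alpha> C where \<alpha>: "\<alpha> > 0" "C \<ge> 0" and est: "\<And>(u :: real^'d \<Rightarrow> complex) N c M. u \<in> Xs \<gamma> \<Longrightarrow> hs s \<gamma> u \<le> M \<Longrightarrow> (\<And>x. cmod (av N u x) \<le> c) \<Longrightarrow>
      u \<in> Lp p \<and> (\<integral>x. cmod (u x) powr p \<partial>lborel)
        \<le> 2 powr p * (C * 2 powr (- real_of_int N * \<alpha>) * (M / s) powr (p / 2) + c powr (p - 2) * (M / \<gamma>))"
    by (rule subcritical_bound[OF adm s \<gamma>]) blast
  have p: "p > 2" using adm by (simp add: adm_def)
  define e where "e = \<delta> / 2 powr p"
  have e: "e > 0" using \<delta> by (simp add: e_def)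
  have "(\<lambda>n. C * 2 powr (- real n * \<alpha>) * (M / s) powr (p / 2)) \<longlonglongrightarrow> 0"
    using \<alpha>(1) by real_asymp
  then have "\<forall>\<^sub>F n in sequentially. C * 2 powr (- real n * \<alpha>) * (M / s) powr (p / 2) < e / 2"
    by (rule order_tendstoD(2)) (use e in simp)
  then obtain n :: nat where n: "C * 2 powr (- real n * \<alpha>) * (M / s) powr (p / 2) < e / 2"
    by (auto simp: eventually_sequentially)
  \<comment> \<open>Solves c^(p-2) M/\<gamma> = e/2; the other half of e is covered by the choice of
    the level.\<close>
  define c where "c = (e / 2 * (\<gamma> / M)) powr (1 / (p - 2))"
  have c: "c > 0" using e M \<gamma> by (simp add: c_def)
  have cp: "c powr (p - 2) * (M / \<gamma>) = e / 2"
    using e M \<gamma> p by (simp add: c_def powr_powr)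
  show thesis
  proof (rule that[OF c, of "int n"])
    fix u :: "real^'d \<Rightarrow> complex"
    assume u: "u \<in> Xs \<gamma>" "hs s \<gamma> u \<le> M" and \<delta>': "\<delta> \<le> (\<integral>x. cmod (u x) powr p \<partial>lborel)"
    show "\<exists>x. c < cmod (av (int n) u x)"
    proof (rule ccontr)
      assume "\<not> ?thesis"
      then have "\<And>x. cmod (av (int n) u x) \<le> c" by (auto simp: not_less)
      from est[OF u this, unfolded cp] have "\<delta> \<le> 2 powr p * (C * 2 powr (- real n * \<alpha>) * (M / s) powr (p / 2) + e / 2)"
        using \<delta>' by simp
      also have "\<dots> < 2 powr p * e" using n by (intro mult_strict_left_mono) auto
      finally show False by (simp add: e_def)
    qed
  qed
qed

lemma nw_tendsto_AE_subseq:
  assumes V: "\<And>n. V n \<in> L2w" "u \<in> L2w" and lim: "(\<lambda>n. nw (\<lambda>x. V n x - u x)) \<longlonglongrightarrow> 0"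
  obtains r :: "nat \<Rightarrow> nat" where "strict_mono r" "AE x in lborel. (\<lambda>n. V (r n) x) \<longlonglongrightarrow> u x"
proof -
  have "\<exists>r::nat\<Rightarrow>nat. strict_mono r \<and> (AE x in lborel. (\<lambda>n. wt x * (cmod (V (r n) x - u x))\<^sup>2) \<longlonglongrightarrow> 0)"
  proof (rule tendsto_L1_AE_subseq)
    show "integrable lborel (\<lambda>x. wt x * (cmod (V n x - u x))\<^sup>2)" for n
      by (rule L2wD(2)[OF L2w_diff(1)[OF V]])
    show "(\<lambda>n. \<integral>x. norm (wt x * (cmod (V n x - u x))\<^sup>2) \<partial>lborel) \<longlonglongrightarrow> 0"
      using lim by (simp add: nw_def abs_mult abs_of_pos[OF wt_pos])
  qed
  then obtain r :: "nat \<Rightarrow> nat" where r: "strict_mono r"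
    and ae: "AE x in lborel. (\<lambda>n. wt x * (cmod (V (r n) x - u x))\<^sup>2) \<longlonglongrightarrow> 0" by blast
  have "AE x in lborel. (\<lambda>n. V (r n) x) \<longlonglongrightarrow> u x"
    using ae
  proof eventually_elim
    case (elim x)
    have "(\<lambda>n. wt x * (cmod (V (r n) x - u x))\<^sup>2 / wt x) \<longlonglongrightarrow> 0 / wt x"
      using wt_pos[of x] by (intro tendsto_divide elim tendsto_const) simp
    then have "(\<lambda>n. (cmod (V (r n) x - u x))\<^sup>2) \<longlonglongrightarrow> 0"
      using wt_pos[of x] by simp
    then have "(\<lambda>n. sqrt ((cmod (V (r n) x - u x))\<^sup>2)) \<longlonglongrightarrow> sqrt 0"
      by (rule tendsto_real_sqrt)
    then have "(\<lambda>n. cmod (V (r n) x - u x)) \<longlonglongrightarrow> 0" by simp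
    then have "(\<lambda>n. V (r n) x - u x) \<longlonglongrightarrow> 0" by (rule tendsto_norm_zero_cancel)
    then show ?case by (rule LIM_zero_cancel)
  qed
  with r show thesis by (rule that)
qed

text \<open>Fatou along a subsequence converging almost everywhere. It keeps the limit in the
  critical L^p, which convergence of gradients alone would not give.\<close>

lemma Lp_limit:
  assumes V: "\<And>n. V n \<in> L2w" "u \<in> L2w" "(\<lambda>n. nw (\<lambda>x. V n x - u x)) \<longlonglongrightarrow> 0"
    and p: "0 < p" and Vp: "\<And>n. V n \<in> Lp p" and C: "\<And>n. (\<integral>x. cmod (V n x) powr p \<partial>lborel) \<le> C"
  shows "u \<in> Lp p"
proof -
  have [measurable]: "u \<in> borel_measurable borel" "\<And>n. V n \<in> borel_measurable borel"
    using V L2wD(1) by auto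
  obtain r :: "nat \<Rightarrow> nat" where r: "strict_mono r" "AE x in lborel. (\<lambda>n. V (r n) x) \<longlonglongrightarrow> u x"
    using nw_tendsto_AE_subseq[OF V] .
  have "(\<integral>\<^sup>+x. ennreal (cmod (u x) powr p) \<partial>lborel) = (\<integral>\<^sup>+x. liminf (\<lambda>n. ennreal (cmod (V (r n) x) powr p)) \<partial>lborel)"
  proof (rule nn_integral_cong_AE)
    show "AE x in lborel. ennreal (cmod (u x) powr p) = liminf (\<lambda>n. ennreal (cmod (V (r n) x) powr p))"
      using r(2)
    proof eventually_elim
      case (elim x)
      have "(\<lambda>n. cmod (V (r n) x) powr p) \<longlonglongrightarrow> cmod (u x) powr p"
        using p by (intro tendsto_powr' tendsto_norm elim tendsto_const) auto
      then have "(\<lambda>n. ennreal (cmod (V (r n) x) powr p)) \<longlonglongrightarrow> ennreal (cmod (u x) powr p)"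
        by (rule tendsto_ennrealI)
      then show ?case by (intro lim_imp_Liminf[symmetric]) auto
    qed
  qed
  also have "\<dots> \<le> liminf (\<lambda>n. \<integral>\<^sup>+x. ennreal (cmod (V (r n) x) powr p) \<partial>lborel)"
    by (rule nn_integral_liminf) measurable
  also have "\<dots> \<le> liminf (\<lambda>n::nat. ennreal C)"
  proof (intro Liminf_mono always_eventually allI)
    fix n
    have "(\<integral>\<^sup>+x. ennreal (cmod (V (r n) x) powr p) \<partial>lborel) = ennreal (\<integral>x. cmod (V (r n) x) powr p \<partial>lborel)"
      by (rule nn_integral_eq_integral[OF Lp_int[OF Vp]]) simp
    then show "(\<integral>\<^sup>+x. ennreal (cmod (V (r n) x) powr p) \<partial>lborel) \<le> ennreal C"
      using C by (simp add: ennreal_leI)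
  qed
  also have "\<dots> = ennreal C" by (simp add: Liminf_const)
  finally have "integrable lborel (\<lambda>x. cmod (u x) powr p)"
    by (intro integrableI_nonneg) (auto simp: le_less_trans)
  then show ?thesis by (simp add: Lp_def)
qed

lemma sob_diff: "sob u D \<Longrightarrow> sob v E \<Longrightarrow> sob (\<lambda>x. u x - v x) (\<lambda>x. D x - E x)"
proof -
  assume "sob u D" "sob v E"
  from sob_add[OF this(1) sob_cmult[OF this(2), of "- 1"]]
  have "sob (\<lambda>x. u x - v x) (\<lambda>x. D x + (- 1) *s E x)" by simp
  moreover have "D x + (- 1) *s E x = D x - E x" for x by (simp add: vec_eq_iff)
  ultimately show ?thesis by simp
qed

lemma dirichlet_sum:
  assumes "sob u D"
  shows "dirichlet D = (\<Sum>k\<in>UNIV. \<integral>x. (cmod (D x $ k))\<^sup>2 \<partial>lborel)"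
  unfolding dirichlet_def norm_vec_square
  by (rule Bochner_Integration.integral_sum) (rule sob_borel(5)[OF assms])

text \<open>The local limit u is known beforehand, so it only has to be matched with the limits of
  the gradients and, for \<gamma> > 0, of the functions in L^2. For \<gamma> = 0 membership in the
  space comes from Fatou.\<close>

lemma Xs_complete:
  fixes V :: "nat \<Rightarrow> real^'d::finite \<Rightarrow> complex"
  assumes adm: "adm TYPE('d) \<gamma> p" and s: "0 < s" and V: "\<And>n. V n \<in> Xs \<gamma>"
    and cauchy: "\<And>e. e > 0 \<Longrightarrow> \<exists>N. \<forall>m\<ge>N. \<forall>n\<ge>N. hs s \<gamma> (\<lambda>x. V m x - V n x) < e"
    and M: "\<And>n. hs s \<gamma> (V n) \<le> M"
    and u: "u \<in> L2w" "(\<lambda>n. nw (\<lambda>x. V n x - u x)) \<longlonglongrightarrow> 0"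
  shows "u \<in> Xs \<gamma>" "(\<lambda>n. hs s \<gamma> (\<lambda>x. V n x - u x)) \<longlonglongrightarrow> 0"
proof -
  have \<gamma>: "0 \<le> \<gamma>" and p2: "2 < p" using adm by (auto simp: adm_def)
  define E where "E n = weak_grad (V n)" for n
  have E: "sob (V n) (E n)" for n unfolding E_def by (rule Xs_sob[OF V])
  have VL: "V n \<in> L2w" for n by (rule Xs_L2w[OF adm V])
  have dE: "grad_normsq (\<lambda>x. V m x - V n x) = (\<Sum>k\<in>UNIV. \<integral>x. (cmod (E m x $ k - E n x $ k))\<^sup>2 \<partial>lborel)" for m n
    using grad_normsq_eq[OF sob_diff[OF E E]] dirichlet_sum[OF sob_diff[OF E E]] by simp
  have "\<exists>g. g \<in> borel_measurable lborel \<and> integrable lborel (\<lambda>x. (cmod (g x))\<^sup>2)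
      \<and> (\<lambda>n. \<integral>x. (cmod (E n x $ k - g x))\<^sup>2 \<partial>lborel) \<longlonglongrightarrow> 0" for k
  proof -
    obtain g where "g \<in> borel_measurable lborel" "integrable lborel (\<lambda>x. (cmod (g x))\<^sup>2)"
      "(\<lambda>n. \<integral>x. (cmod (E n x $ k - g x))\<^sup>2 \<partial>lborel) \<longlonglongrightarrow> 0"
    proof (rule L2_complete[of "\<lambda>n x. E n x $ k" lborel])
      show "\<exists>N. \<forall>m\<ge>N. \<forall>n\<ge>N. (\<integral>x. (cmod (E m x $ k - E n x $ k))\<^sup>2 \<partial>lborel) < e" if e: "e > 0" for e
      proof -
        obtain N where N: "\<And>m n. m \<ge> N \<Longrightarrow> n \<ge> N \<Longrightarrow> hs s \<gamma> (\<lambda>x. V m x - V n x) < s * e"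
          using cauchy[of "s * e"] e s by auto
        have "(\<integral>x. (cmod (E m x $ k - E n x $ k))\<^sup>2 \<partial>lborel) < e" if "m \<ge> N" "n \<ge> N" for m n
        proof -
          have "(\<integral>x. (cmod (E m x $ k - E n x $ k))\<^sup>2 \<partial>lborel) \<le> grad_normsq (\<lambda>x. V m x - V n x)"
            unfolding dE by (rule member_le_sum) auto
          moreover have "s * grad_normsq (\<lambda>x. V m x - V n x) < s * e"
            using N[OF that] mult_nonneg_nonneg[OF \<gamma> L2_normsq_nonneg[of "\<lambda>x. V m x - V n x"]]
            unfolding hs_def by linarith
          ultimately show ?thesis using s by simp
        qed
        then show ?thesis by blast
      qed
    qed (use sob_borel[OF E] in auto)
    then show ?thesis by blast
  qed
  then have "\<forall>k. \<exists>g. g \<in> borel_measurable lborel \<and> integrable lborel (\<lambda>x. (cmod (g x))\<^sup>2)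
      \<and> (\<lambda>n. \<integral>x. (cmod (E n x $ k - g x))\<^sup>2 \<partial>lborel) \<longlonglongrightarrow> 0" ..
  from choice[OF this] obtain g where "\<forall>k. g k \<in> borel_measurable lborel \<and> integrable lborel (\<lambda>x. (cmod (g k x))\<^sup>2)
      \<and> (\<lambda>n. \<integral>x. (cmod (E n x $ k - g k x))\<^sup>2 \<partial>lborel) \<longlonglongrightarrow> 0" ..
  then have g: "\<And>k. g k \<in> borel_measurable lborel" "\<And>k. integrable lborel (\<lambda>x. (cmod (g k x))\<^sup>2)"
    "\<And>k. (\<lambda>n. \<integral>x. (cmod (E n x $ k - g k x))\<^sup>2 \<partial>lborel) \<longlonglongrightarrow> 0" by auto
  define D where "D x = (\<chi> k. g k x)" for x
  have D: "sob u D"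
    by (rule weak_grad_limit[where V = V and E = E]) (use VL u E g in \<open>auto simp: D_def Lp2_iff\<close>)
  have grad: "(\<lambda>n. grad_normsq (\<lambda>x. V n x - u x)) \<longlonglongrightarrow> 0"
  proof -
    have "grad_normsq (\<lambda>x. V n x - u x) = (\<Sum>k\<in>UNIV. \<integral>x. (cmod (E n x $ k - g k x))\<^sup>2 \<partial>lborel)" for n
      using grad_normsq_eq[OF sob_diff[OF E D]] dirichlet_sum[OF sob_diff[OF E D]] by (simp add: D_def)
    moreover have "(\<lambda>n. \<Sum>k\<in>UNIV. \<integral>x. (cmod (E n x $ k - g k x))\<^sup>2 \<partial>lborel) \<longlonglongrightarrow> (\<Sum>k\<in>(UNIV :: 'd set). 0)"
      by (intro tendsto_sum g(3))
    ultimately show ?thesis by simp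
  qed
  show "u \<in> Xs \<gamma>" and "(\<lambda>n. hs s \<gamma> (\<lambda>x. V n x - u x)) \<longlonglongrightarrow> 0"
  proof -
    have "u \<in> Xs \<gamma> \<and> (\<lambda>n. \<gamma> * L2_normsq (\<lambda>x. V n x - u x)) \<longlonglongrightarrow> 0"
    proof (cases "0 < \<gamma>")
      case True
      have V2: "V n \<in> Lp 2" for n using V[of n] True by (simp add: Xs_iff qexp_def)
      obtain v where v: "v \<in> borel_measurable lborel" "integrable lborel (\<lambda>x. (cmod (v x))\<^sup>2)"
        "(\<lambda>n. \<integral>x. (cmod (V n x - v x))\<^sup>2 \<partial>lborel) \<longlonglongrightarrow> 0"
      proof (rule L2_complete[of V lborel])
        show "\<exists>N. \<forall>m\<ge>N. \<forall>n\<ge>N. (\<integral>x. (cmod (V m x - V n x))\<^sup>2 \<partial>lborel) < e" if e: "e > 0" for e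
        proof -
          obtain N where N: "\<And>m n. m \<ge> N \<Longrightarrow> n \<ge> N \<Longrightarrow> hs s \<gamma> (\<lambda>x. V m x - V n x) < \<gamma> * e"
            using cauchy[of "\<gamma> * e"] e True by auto
          have "(\<integral>x. (cmod (V m x - V n x))\<^sup>2 \<partial>lborel) < e" if "m \<ge> N" "n \<ge> N" for m n
          proof -
            have "\<gamma> * L2_normsq (\<lambda>x. V m x - V n x) < \<gamma> * e"
              using N[OF that] mult_nonneg_nonneg[OF less_imp_le[OF s] grad_normsq_nonneg[of "\<lambda>x. V m x - V n x"]]
              unfolding hs_def by linarith
            then show ?thesis using True by (simp add: L2_normsq_def)
          qed
          then show ?thesis by blast
        qed
      qed (use V2 in \<open>auto simp: Lp2_iff\<close>)
      have v2: "v \<in> Lp 2" using v by (simp add: Lp2_iff)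
      have vL: "v \<in> L2w" by (rule Lp2_L2w(1)[OF v2])
      have d2: "(\<lambda>x. V n x - v x) \<in> Lp 2" for n
        using V2[of n] v2 square_integrable_diff(1)[of "V n" lborel v] by (auto simp: Lp2_iff)
      have nv: "(\<lambda>n. nw (\<lambda>x. V n x - v x)) \<longlonglongrightarrow> 0"
        by (rule tendsto_sandwich[OF _ _ tendsto_const v(3)]) (auto simp: nw_nonneg Lp2_L2w(2)[OF d2])
      have "nw (\<lambda>x. v x - u x) \<le> 2 * nw (\<lambda>x. V n x - u x) + 2 * nw (\<lambda>x. V n x - v x)" for n
        using L2w_diff(2)[OF L2w_diff(1)[OF VL u(1), of n] L2w_diff(1)[OF VL vL, of n]] by simp
      moreover have "(\<lambda>n. 2 * nw (\<lambda>x. V n x - u x) + 2 * nw (\<lambda>x. V n x - v x)) \<longlonglongrightarrow> 2 * 0 + 2 * 0"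
        by (intro tendsto_intros u nv)
      ultimately have "nw (\<lambda>x. v x - u x) \<le> 2 * 0 + 2 * 0"
        by (intro tendsto_lowerbound[of _ _ sequentially]) auto
      then have "nw (\<lambda>x. v x - u x) = 0" using nw_nonneg[of "\<lambda>x. v x - u x"] by simp
      from nw_zero[OF L2w_diff(1)[OF vL u(1)] this] have ae: "AE x in lborel. v x = u x" by simp
      have [measurable]: "u \<in> borel_measurable borel" "v \<in> borel_measurable borel" "\<And>n. V n \<in> borel_measurable borel"
        using L2wD(1)[OF u(1)] L2wD(1)[OF vL] L2wD(1)[OF VL] by auto
      have "integrable lborel (\<lambda>x. (cmod (v x))\<^sup>2) \<longleftrightarrow> integrable lborel (\<lambda>x. (cmod (u x))\<^sup>2)"
        by (rule integrable_cong_AE) (use ae in auto)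
      then have "u \<in> Lp 2" using v(2) by (simp add: Lp2_iff)
      then have "u \<in> Xs \<gamma>" using True D by (auto simp: Xs_iff qexp_def)
      moreover have "L2_normsq (\<lambda>x. V n x - u x) = (\<integral>x. (cmod (V n x - v x))\<^sup>2 \<partial>lborel)" for n
        unfolding L2_normsq_def by (rule integral_cong_AE) (use ae in auto)
      then have "(\<lambda>n. \<gamma> * L2_normsq (\<lambda>x. V n x - u x)) \<longlonglongrightarrow> \<gamma> * 0"
        using v(3) by (intro tendsto_mult tendsto_const) simp
      ultimately show ?thesis by simp
    next
      case False
      then have g0: "\<gamma> = 0" and peq: "p = qexp TYPE('d) \<gamma>" using \<gamma> adm by (auto simp: qexp_def adm_def)
      obtain C where "\<And>v :: real^'d \<Rightarrow> complex. v \<in> Xs \<gamma> \<Longrightarrow> hs s \<gamma> v \<le> M \<Longrightarrow>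
          v \<in> Lp p \<and> (\<integral>x. cmod (v x) powr p \<partial>lborel) \<le> C"
        using Xs_Lp_bound[OF adm s] by blast
      then have "V n \<in> Lp p" "(\<integral>x. cmod (V n x) powr p \<partial>lborel) \<le> C" for n using V M by auto
      from Lp_limit[OF VL u _ this] p2 have "u \<in> Lp p" by simp
      then show ?thesis using D g0 peq by (auto simp: Xs_iff)
    qed
    moreover have "(\<lambda>n. s * grad_normsq (\<lambda>x. V n x - u x)) \<longlonglongrightarrow> s * 0"
      by (intro tendsto_mult tendsto_const grad)
    ultimately show "u \<in> Xs \<gamma>" "(\<lambda>n. hs s \<gamma> (\<lambda>x. V n x - u x)) \<longlonglongrightarrow> 0"
      unfolding hs_def using tendsto_add[of "\<lambda>n. s * grad_normsq (\<lambda>x. V n x - u x)" "s * 0" sequentially "\<lambda>n. \<gamma> * L2_normsq (\<lambda>x. V n x - u x)" 0] by simp_all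
  qed
qed

text \<open>Near-minimisers of the energy over the shrinking convex sets of functions close to \<open>u\<close> form a
  Cauchy sequence by the parallelogram identity; this replaces weak compactness.\<close>

lemma hs_lsc:
  fixes f :: "nat \<Rightarrow> real^'d::finite \<Rightarrow> complex"
  assumes adm: "adm TYPE('d) \<gamma> p" and s: "0 < s" and f: "\<And>n. f n \<in> Xs \<gamma>"
    and M: "\<forall>\<^sub>F n in sequentially. hs s \<gamma> (f n) \<le> M"
    and u: "u \<in> L2w" "(\<lambda>n. nw (\<lambda>x. f n x - u x)) \<longlonglongrightarrow> 0"
  shows "u \<in> Xs \<gamma>" "hs s \<gamma> u \<le> M"
proof -
  have \<gamma>: "0 \<le> \<gamma>" using adm by (simp add: adm_def)
  have h0: "0 \<le> hs s \<gamma> v" for v :: "real^'d \<Rightarrow> complex" using hs_nonneg[of s \<gamma> v] s \<gamma> by simp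
  define C where "C n = {v \<in> Xs \<gamma>. nw (\<lambda>x. v x - u x) \<le> 1 / real (Suc n)}" for n
  have ne: "\<exists>v\<in>C n. hs s \<gamma> v \<le> M" for n
  proof -
    have "\<forall>\<^sub>F m in sequentially. nw (\<lambda>x. f m x - u x) < 1 / real (Suc n)"
      by (rule order_tendstoD(2)[OF u(2)]) simp
    with M have "\<forall>\<^sub>F m in sequentially. hs s \<gamma> (f m) \<le> M \<and> nw (\<lambda>x. f m x - u x) < 1 / real (Suc n)"
      by (rule eventually_conj)
    then obtain m where "hs s \<gamma> (f m) \<le> M" "nw (\<lambda>x. f m x - u x) < 1 / real (Suc n)"
      by (auto simp: eventually_sequentially)
    then show ?thesis using f by (intro bexI[of _ "f m"]) (auto simp: C_def)
  qed
  define d where "d n = Inf (hs s \<gamma> ` C n)" for n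
  have bdd: "bdd_below (hs s \<gamma> ` C n)" for n using h0 by (intro bdd_belowI[of _ 0]) auto
  have dle: "d n \<le> hs s \<gamma> v" if "v \<in> C n" for n v
    unfolding d_def using that by (intro cInf_lower bdd) auto
  have Cmono: "C m \<subseteq> C n" if "n \<le> m" for m n
  proof -
    have "1 / real (Suc m) \<le> 1 / real (Suc n)" using that by (intro divide_left_mono) auto
    then show ?thesis by (auto simp: C_def)
  qed
  have dM: "d n \<le> M" for n using ne[of n] dle order_trans by blast
  have "\<exists>v\<in>C n. hs s \<gamma> v < d n + 1 / real (Suc n)" for n
  proof -
    have "hs s \<gamma> ` C n \<noteq> {}" using ne[of n] by auto
    from cInf_lessD[OF this, of "d n + 1 / real (Suc n)"] show ?thesis by (auto simp: d_def)
  qed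
  then obtain V where V: "\<And>n. V n \<in> C n" "\<And>n. hs s \<gamma> (V n) < d n + 1 / real (Suc n)" by metis
  have VX: "V n \<in> Xs \<gamma>" for n using V(1)[of n] by (simp add: C_def)
  have VL: "V n \<in> L2w" for n by (rule Xs_L2w[OF adm VX])
  have dmono: "d n \<le> d m" if "n \<le> m" for m n
    unfolding d_def using ne[of m] Cmono[OF that] by (intro cInf_superset_mono bdd) auto
  \<comment> \<open>\<open>nw\<close> satisfies the triangle inequality only with a factor 2, but
    halving contributes 1/4, so its sublevel sets are closed under midpoints.\<close>
  have mid: "(\<lambda>x. of_real (1 - 1/2) * V n x + of_real (1/2) * V m x) \<in> C n" if "n \<le> m" for m n
  proof -
    let ?a = "\<lambda>x. V n x - u x" and ?b = "\<lambda>x. V m x - u x"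
    have nw: "nw ?a \<le> 1 / real (Suc n)" "nw ?b \<le> 1 / real (Suc n)"
      using V(1)[of n] V(1)[of m] Cmono[OF that] by (auto simp: C_def)
    have "nw (\<lambda>x. 1 / 2 * ?a x + 1 / 2 * ?b x) \<le> 2 * nw (\<lambda>x. 1 / 2 * ?a x) + 2 * nw (\<lambda>x. 1 / 2 * ?b x)"
      by (intro L2w_add L2w_cmult L2w_diff VL u)
    also have "\<dots> = nw ?a / 2 + nw ?b / 2"
    proof -
      have half: "nw (\<lambda>x. 1 / 2 * (V k x - u x)) = nw (\<lambda>x. V k x - u x) / 4" for k
        using L2w_cmult(2)[OF L2w_diff(1)[OF VL u(1)], of "1 / 2" k] by (simp add: power2_eq_square norm_divide)
      show ?thesis unfolding half by simp
    qed
    also have "\<dots> \<le> 1 / real (Suc n)" using nw by simp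
    also have "(\<lambda>x. 1 / 2 * ?a x + 1 / 2 * ?b x) = (\<lambda>x. of_real (1 - 1/2) * V n x + of_real (1/2) * V m x - u x)"
      by (simp add: fun_eq_iff field_simps)
    finally show ?thesis
      unfolding C_def mem_Collect_eq by (intro conjI Xs_add[OF adm] Xs_cmult VX)
  qed
  \<comment> \<open>The midpoint belongs to the larger set and cannot have energy below
    \<open>d n\<close>; the parallelogram identity then bounds the difference by the excess
    energies.\<close>
  have key: "hs s \<gamma> (\<lambda>x. V m x - V n x) \<le> 2 * (d m - d n) + 2 / real (Suc n) + 2 / real (Suc m)" if "n \<le> m" for m n
    using dle[OF mid[OF that]] hs_interp[OF adm VX VX, of s "1/2" n m] V(2)[of n] V(2)[of m] by simp
  have sym: "hs s \<gamma> (\<lambda>x. V m x - V n x) = hs s \<gamma> (\<lambda>x. V n x - V m x)" for m n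
    using hs_cmult_real[OF adm Xs_diff[OF adm VX VX], of s "-1" m n] by simp
  have "incseq d" unfolding incseq_def using dmono by blast
  then obtain L where dL: "d \<longlonglongrightarrow> L" and dleL': "\<forall>n. d n \<le> L"
    by (rule incseq_convergent) (use dM in blast)+
  have dleL: "d n \<le> L" for n using dleL' by blast
  have cauchy: "\<exists>N. \<forall>m\<ge>N. \<forall>n\<ge>N. hs s \<gamma> (\<lambda>x. V m x - V n x) < e" if e: "e > 0" for e
  proof -
    have "(\<lambda>N. 4 / real (Suc N)) \<longlonglongrightarrow> 0" by real_asymp
    then have "(\<lambda>N. 2 * (L - d N) + 4 / real (Suc N)) \<longlonglongrightarrow> 2 * (L - L) + 0"
      by (intro tendsto_add tendsto_mult tendsto_diff tendsto_const dL)
    then have "\<forall>\<^sub>F N in sequentially. 2 * (L - d N) + 4 / real (Suc N) < e"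
      by (rule order_tendstoD(2)) (use e in simp)
    then obtain N where N: "2 * (L - d N) + 4 / real (Suc N) < e" by (auto simp: eventually_sequentially)
    have *: "hs s \<gamma> (\<lambda>x. V m x - V n x) < e" if "N \<le> n" "n \<le> m" for m n
    proof -
      have "2 / real (Suc n) \<le> 2 / real (Suc N)" "2 / real (Suc m) \<le> 2 / real (Suc N)"
        using that by (intro divide_left_mono; simp)+
      moreover have "2 * (d m - d n) \<le> 2 * (L - d N)" by (intro mult_left_mono diff_mono dleL dmono that) simp
      ultimately have "2 * (d m - d n) + 2 / real (Suc n) + 2 / real (Suc m)
          \<le> 2 * (L - d N) + 2 / real (Suc N) + 2 / real (Suc N)"
        by (intro add_mono)
      also have "\<dots> = 2 * (L - d N) + 4 / real (Suc N)" by simp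
      also note N
      finally show ?thesis by (rule le_less_trans[OF key[OF that(2)]])
    qed
    have "hs s \<gamma> (\<lambda>x. V m x - V n x) < e" if "m \<ge> N" "n \<ge> N" for m n
      using *[of n m] *[of m n] that sym[of m n] by (cases "n \<le> m") auto
    then show ?thesis by blast
  qed
  have VM: "hs s \<gamma> (V n) \<le> M + 1 / real (Suc n)" for n using V(2)[of n] dM[of n] by simp
  have VM': "hs s \<gamma> (V n) \<le> M + 1" for n
  proof -
    have "1 / real (Suc n) \<le> 1" by simp
    then show ?thesis using VM[of n] by linarith
  qed
  have "(\<lambda>n. nw (\<lambda>x. V n x - u x)) \<longlonglongrightarrow> 0"
  proof (rule tendsto_sandwich[OF _ _ tendsto_const LIMSEQ_inverse_real_of_nat])
    show "\<forall>\<^sub>F n in sequentially. nw (\<lambda>x. V n x - u x) \<le> inverse (real (Suc n))"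
      using V(1) by (auto simp: C_def inverse_eq_divide)
  qed (simp add: nw_nonneg)
  note comp = Xs_complete[OF adm s VX cauchy VM' u(1) this]
  show uX: "u \<in> Xs \<gamma>" by (rule comp(1))
  \<comment> \<open>First n tends to infinity with t fixed, then t to 0.\<close>
  have le: "(1 - t) * hs s \<gamma> u \<le> M" if t: "0 < t" "t < 1" for t
  proof -
    have "hs s \<gamma> u \<le> (M + 1 / real (Suc n)) / (1 - t) + hs s \<gamma> (\<lambda>x. V n x - u x) / t" for n
    proof -
      have "hs s \<gamma> (\<lambda>x. V n x + (u x - V n x)) \<le> hs s \<gamma> (V n) / (1 - t) + hs s \<gamma> (\<lambda>x. u x - V n x) / t"
        by (rule hs_triangle[OF adm VX Xs_diff[OF adm uX VX] _ t]) (use s in simp)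
      moreover have "hs s \<gamma> (\<lambda>x. u x - V n x) = hs s \<gamma> (\<lambda>x. V n x - u x)"
        using hs_cmult_real[OF adm Xs_diff[OF adm VX uX], of s "-1" n] by simp
      moreover have "hs s \<gamma> (V n) / (1 - t) \<le> (M + 1 / real (Suc n)) / (1 - t)"
        using VM[of n] t by (intro divide_right_mono) auto
      ultimately show ?thesis by simp
    qed
    moreover have "(\<lambda>n. (M + 1 / real (Suc n)) / (1 - t) + hs s \<gamma> (\<lambda>x. V n x - u x) / t) \<longlonglongrightarrow> (M + 0) / (1 - t) + 0 / t"
    proof -
      have "(\<lambda>n. 1 / real (Suc n)) \<longlonglongrightarrow> 0" by real_asymp
      then show ?thesis using t by (intro tendsto_add tendsto_divide tendsto_const comp(2)) auto
    qed
    ultimately have "hs s \<gamma> u \<le> (M + 0) / (1 - t) + 0 / t"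
      by (intro tendsto_lowerbound[of _ _ sequentially]) auto
    then show ?thesis using t by (simp add: field_simps)
  qed
  have "((\<lambda>t. (1 - t) * hs s \<gamma> u) \<longlongrightarrow> (1 - 0) * hs s \<gamma> u) (at_right 0)"
    by (intro tendsto_intros)
  then have "(1 - 0) * hs s \<gamma> u \<le> M"
  proof (rule tendsto_upperbound)
    show "\<forall>\<^sub>F t in at_right 0. (1 - t) * hs s \<gamma> u \<le> M"
      using le by (auto simp: eventually_at_right_field intro!: exI[of _ 1])
  qed simp
  then show "hs s \<gamma> u \<le> M" by simp
qed

text \<open>If the remainder carried too much energy along a subsequence, then (1-t) u + t f_n with
  a small t would still converge to u locally but have energy below that of u, against lower
  semicontinuity.\<close>

lemma hs_split:
  fixes f :: "nat \<Rightarrow> real^'d::finite \<Rightarrow> complex"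
  assumes adm: "adm TYPE('d) \<gamma> p" and s: "0 < s" and f: "\<And>n. f n \<in> Xs \<gamma>"
    and l: "(\<lambda>n. hs s \<gamma> (f n)) \<longlonglongrightarrow> l"
    and u: "u \<in> L2w" "(\<lambda>n. nw (\<lambda>x. f n x - u x)) \<longlonglongrightarrow> 0"
  shows "u \<in> Xs \<gamma>" "e > 0 \<Longrightarrow> \<forall>\<^sub>F n in sequentially. hs s \<gamma> (\<lambda>x. f n x - u x) \<le> l - hs s \<gamma> u + e"
proof -
  have lev: "\<forall>\<^sub>F n in sequentially. hs s \<gamma> (f n) \<le> l + e" if "e > 0" for e
    using order_tendstoD(2)[OF l, of "l + e"] that by (auto elim: eventually_mono)
  show uX: "u \<in> Xs \<gamma>" by (rule hs_lsc(1)[OF adm s f lev[of 1] u]) simp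
  define h where "h = hs s \<gamma> u"
  have hl: "h \<le> l"
  proof (rule field_le_epsilon)
    show "h \<le> l + e" if "e > 0" for e
      unfolding h_def by (rule hs_lsc(2)[OF adm s f lev[OF that] u])
  qed
  assume e: "e > 0"
  show "\<forall>\<^sub>F n in sequentially. hs s \<gamma> (\<lambda>x. f n x - u x) \<le> l - hs s \<gamma> u + e"
  proof (rule ccontr)
    assume "\<not> ?thesis"
    then have "\<exists>\<^sub>F n in sequentially. l - h + e < hs s \<gamma> (\<lambda>x. f n x - u x)"
      by (simp add: frequently_def not_less h_def)
    then have inf: "infinite {n. l - h + e < hs s \<gamma> (\<lambda>x. f n x - u x)}"
      by (simp add: frequently_cofinite[symmetric] cofinite_eq_sequentially)
    define r where "r = enumerate {n. l - h + e < hs s \<gamma> (\<lambda>x. f n x - u x)}"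
    have r: "strict_mono r" "\<And>n. l - h + e < hs s \<gamma> (\<lambda>x. f (r n) x - u x)"
      using strict_mono_enumerate[OF inf] enumerate_in_set[OF inf] by (auto simp: r_def)
    define X where "X = l - h + e"
    \<comment> \<open>Makes t X = e/2: the quadratic loss t e/2 stays below the linear gain 3 t e/4,
      leaving a deficit of t e/4.\<close>
    define t where "t = e / (2 * X)"
    have le: "X > 0" "e \<le> X" using hl e by (auto simp: X_def)
    have t: "0 < t" "t < 1" using e le by (auto simp: t_def field_simps)
    have "t * X = e / 2" using le by (simp add: t_def)
    then have te: "t * (l - h + e) = e / 2" by (simp only: X_def)
    let ?v = "\<lambda>n x. of_real (1 - t) * u x + of_real t * f (r n) x"
    define B where "B = (1 - t) * h + t * (l + e / 4) - t * (1 - t) * (l - h + e)"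
    have "h \<le> B"
      unfolding h_def
    proof (rule hs_lsc(2)[OF adm s _ _ u(1)])
      show "?v n \<in> Xs \<gamma>" for n by (rule Xs_add[OF adm Xs_cmult[OF uX] Xs_cmult[OF f]])
      have "\<forall>\<^sub>F n in sequentially. hs s \<gamma> (f (r n)) \<le> l + e / 4"
        using eventually_subseq[OF r(1) lev[of "e / 4"]] e by simp
      then show "\<forall>\<^sub>F n in sequentially. hs s \<gamma> (?v n) \<le> B"
      proof eventually_elim
        case (elim n)
        have 1: "t * hs s \<gamma> (f (r n)) \<le> t * (l + e / 4)" using elim t by (intro mult_left_mono) auto
        have 2: "t * (1 - t) * (l - h + e) \<le> t * (1 - t) * hs s \<gamma> (\<lambda>x. f (r n) x - u x)"
          using r(2)[of n] t by (intro mult_left_mono) auto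
        show ?case
          unfolding hs_interp[OF adm uX f] B_def h_def[symmetric] by (rule diff_mono[OF add_left_mono[OF 1] 2])
      qed
      have "(\<lambda>n. t\<^sup>2 * nw (\<lambda>x. f (r n) x - u x)) \<longlonglongrightarrow> t\<^sup>2 * 0"
        using LIMSEQ_subseq_LIMSEQ[OF u(2) r(1)] by (intro tendsto_intros) (simp add: o_def)
      moreover have "nw (\<lambda>x. ?v n x - u x) = t\<^sup>2 * nw (\<lambda>x. f (r n) x - u x)" for n
      proof -
        have "(\<lambda>x. ?v n x - u x) = (\<lambda>x. of_real t * (f (r n) x - u x))" by (simp add: algebra_simps)
        then show ?thesis
          using L2w_cmult(2)[OF L2w_diff(1)[OF Xs_L2w[OF adm f] u(1)], of "of_real t"] by simp
      qed
      ultimately show "(\<lambda>n. nw (\<lambda>x. ?v n x - u x)) \<longlonglongrightarrow> 0" by simp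
    qed
    also have "B = h + t * (l - h + e / 4 - (l - h + e)) + t * (t * (l - h + e))"
      by (simp add: B_def algebra_simps)
    also have "\<dots> = h - t * e / 4" unfolding te by (simp add: algebra_simps)
    finally show False using mult_pos_pos[OF t(1) e] by simp
  qed
qed

section \<open>Compactness and trilinear estimates\<close>

text \<open>Averages at a fixed level are bounded and, along a diagonal sequence, converge
  everywhere, hence in the weighted norm. Bounded energy makes the distance from a function to its
  averages small uniformly in the sequence, so the functions themselves are Cauchy.\<close>

lemma rellich:
  fixes f :: "nat \<Rightarrow> real^'d::finite \<Rightarrow> complex"
  assumes adm: "adm TYPE('d) \<gamma> p" and s: "0 < s" and f: "\<And>n. f n \<in> Xs \<gamma>" and M: "\<And>n. hs s \<gamma> (f n) \<le> M"
  obtains r :: "nat \<Rightarrow> nat" and u where "strict_mono r" "u \<in> L2w" "(\<lambda>n. nw (\<lambda>x. f (r n) x - u x)) \<longlonglongrightarrow> 0"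
proof -
  have \<gamma>: "0 \<le> \<gamma>" and p: "1 \<le> p" using adm by (auto simp: adm_def)
  obtain C where C: "\<And>u :: real^'d \<Rightarrow> complex. u \<in> Xs \<gamma> \<Longrightarrow> hs s \<gamma> u \<le> M \<Longrightarrow>
      u \<in> Lp p \<and> (\<integral>x. cmod (u x) powr p \<partial>lborel) \<le> C"
    using Xs_Lp_bound[OF adm s] by blast
  have bound: "cmod (av N (f n) x) \<le> 1 + 2 powr real_of_int N * C" for N n x
  proof -
    have "cmod (av N (f n) x) \<le> 1 + 2 powr real_of_int N * (\<integral>y. cmod (f n y) powr p \<partial>lborel)"
      using av_Lp_bound[of "f n" p 1 N x] C[OF f M, of n] p by simp
    also have "\<dots> \<le> 1 + 2 powr real_of_int N * C"
      using C[OF f M, of n] by (intro add_left_mono mult_left_mono) auto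
    finally show ?thesis .
  qed
  define B where "B = from_nat_into (dyadic :: (real^'d) set set)"
  have Bd: "B i \<in> dyadic" for i
    unfolding B_def by (rule from_nat_into) (auto simp: dyadic_def)
  define I where "I i n = (LINT y:B i|lborel. f n y)" for i n
  have Ib: "bounded (range (I i))" for i
  proof -
    consider "B i = {}" | N x where "B i = Bx (int N) x"
      using Bd[of i] by (auto simp: dyadic_def)
    then show ?thesis
    proof cases
      case 1
      then show ?thesis by (simp add: I_def set_lebesgue_integral_def)
    next
      case (2 N x)
      have "cmod (I i n) \<le> (1 + 2 powr real N * C) / 2 powr real N" for n
        using bound[of "int N" n x] by (simp add: I_def 2 av_def field_simps)
      then show ?thesis by (auto simp: bounded_iff)
    qed
  qed
  \<comment> \<open>Countably many boxes determine all averages of nonnegative level, so one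
    diagonal sequence handles them together.\<close>
  interpret subseqs "\<lambda>i r. convergent (\<lambda>n. I i (r n))"
  proof
    fix i and r :: "nat \<Rightarrow> nat" assume "strict_mono r"
    have "bounded (range (\<lambda>n. I i (r n)))"
      by (rule bounded_subset[OF Ib[of i]]) auto
    then obtain l r' where "strict_mono r'" "((\<lambda>n. I i (r n)) \<circ> r') \<longlonglongrightarrow> l"
      using bounded_imp_convergent_subsequence by blast
    then show "\<exists>r'. strict_mono r' \<and> convergent (\<lambda>n. I i ((r \<circ> r') n))"
      by (auto simp: convergent_def o_def)
  qed
  define r where "r = diagseq"
  have r: "strict_mono r" unfolding r_def by (rule subseq_diagseq)
  have conv: "convergent (\<lambda>n. I i (r n))" for i
  proof -
    \<comment> \<open>The diagonal runs inside the i-th subsequence only from index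
      \<open>Suc i\<close> on; the initial segment is restored afterwards.\<close>
    have "convergent (\<lambda>n. I i ((diagseq \<circ> (+) (Suc i)) n))"
    proof (rule diagseq_holds)
      fix t q :: "nat \<Rightarrow> nat" and n
      assume "strict_mono t" "convergent (\<lambda>m. I n (q m))"
      then show "convergent (\<lambda>m. I n ((q \<circ> t) m))"
        using convergent_subseq_convergent[of "\<lambda>m. I n (q m)" t] by (simp add: o_def)
    qed
    then have "convergent (\<lambda>n. I i (r (n + Suc i)))"
      by (simp add: r_def add.commute)
    then show ?thesis using convergent_ignore_initial_segment[of "\<lambda>n. I i (r n)" "Suc i"] by simp
  qed
  have avconv: "convergent (\<lambda>n. av (int N) (f (r n)) x)" for N x
  proof -
    have "Bx (int N) x \<in> dyadic" by (auto simp: dyadic_def)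
    then obtain i where i: "B i = Bx (int N) x"
      unfolding B_def using from_nat_into_surj[OF countable_dyadic] by blast
    obtain l where "(\<lambda>n. I i (r n)) \<longlonglongrightarrow> l" using conv[of i] by (auto simp: convergent_def)
    then have "(\<lambda>n. (2 powr real N) *\<^sub>R I i (r n)) \<longlonglongrightarrow> (2 powr real N) *\<^sub>R l"
      by (intro tendsto_intros)
    then show ?thesis by (auto simp: convergent_def av_def I_def i)
  qed
  define v where "v n = f (r n)" for n
  have vX: "v n \<in> Xs \<gamma>" for n by (simp add: v_def f)
  have vL: "v n \<in> L2w" for n by (rule Xs_L2w[OF adm vX])
  have vm [measurable]: "v n \<in> borel_measurable borel" for n by (rule L2wD(1)[OF vL])
  have vli: "set_integrable lborel (Bx N x) (v n)" for N x n
    by (rule locally_integrable_Bx[OF L2w_locally_integrable[OF vL]])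
  have avlim: "\<exists>A\<in>L2w. (\<lambda>n. nw (\<lambda>x. av (int N) (v n) x - A x)) \<longlonglongrightarrow> 0 \<and> (\<forall>n. av (int N) (v n) \<in> L2w)" for N
  proof -
    define A where "A x = lim (\<lambda>n. av (int N) (v n) x)" for x
    define K where "K = 1 + 2 powr real N * C"
    have vb: "cmod (av (int N) (v n) x) \<le> K" for n x using bound[of "int N" "r n" x] by (simp add: v_def K_def)
    have lim: "(\<lambda>n. av (int N) (v n) x) \<longlonglongrightarrow> A x" for x
      using avconv[of N x] by (simp add: A_def v_def convergent_LIMSEQ_iff)
    have [measurable]: "A \<in> borel_measurable borel" unfolding A_def by measurable
    have Ab: "cmod (A x) \<le> K" for x
      by (rule Lim_bounded[OF tendsto_norm[OF lim]]) (use vb in auto)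
    have L: "g \<in> L2w" if [measurable]: "g \<in> borel_measurable borel" and g: "\<And>x. cmod (g x) \<le> K" for g :: "real^'d \<Rightarrow> complex"
    proof -
      have "integrable lborel (\<lambda>x. wt x * (cmod (g x))\<^sup>2)"
      proof (rule Bochner_Integration.integrable_bound)
        show "integrable lborel (\<lambda>x::real^'d. wt x * K\<^sup>2)" by (intro integrable_mult_left wt_int)
        have "(cmod (g x))\<^sup>2 \<le> K\<^sup>2" for x using g by (intro power_mono) auto
        then show "AE x in lborel. norm (wt x * (cmod (g x))\<^sup>2) \<le> norm (wt x * K\<^sup>2)"
          by (auto simp: abs_mult intro!: mult_left_mono)
      qed measurable
      then show ?thesis by (simp add: L2w_def)
    qed
    have "(\<lambda>n. \<integral>x. wt x * (cmod (av (int N) (v n) x - A x))\<^sup>2 \<partial>lborel) \<longlonglongrightarrow> (\<integral>x. 0 \<partial>(lborel :: (real^'d) measure))"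
    proof (rule integral_dominated_convergence[where w = "\<lambda>x. wt x * (2 * K)\<^sup>2"])
      show "integrable lborel (\<lambda>x::real^'d. wt x * (2 * K)\<^sup>2)" by (intro integrable_mult_left wt_int)
      have "(\<lambda>n. wt x * (cmod (av (int N) (v n) x - A x))\<^sup>2) \<longlonglongrightarrow> wt x * (cmod (A x - A x))\<^sup>2" for x
        by (intro tendsto_intros lim)
      then show "AE x in lborel. (\<lambda>n. wt x * (cmod (av (int N) (v n) x - A x))\<^sup>2) \<longlonglongrightarrow> 0" by simp
      have "(cmod (av (int N) (v n) x - A x))\<^sup>2 \<le> (2 * K)\<^sup>2" for n x
        using norm_triangle_ineq4[of "av (int N) (v n) x" "A x"] vb[of n x] Ab[of x] by (intro power_mono) auto
      then show "AE x in lborel. norm (wt x * (cmod (av (int N) (v n) x - A x))\<^sup>2) \<le> wt x * (2 * K)\<^sup>2" for n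
        by (auto simp: abs_mult abs_of_pos[OF wt_pos] intro!: mult_left_mono less_imp_le[OF wt_pos])
    qed measurable
    then have "(\<lambda>n. nw (\<lambda>x. av (int N) (v n) x - A x)) \<longlonglongrightarrow> 0" by (simp add: nw_def)
    then show ?thesis using L[of A] Ab L[OF av_measurable[OF vm] vb] by auto
  qed
  \<comment> \<open>The exponent r = 2 is subcritical in every dimension, so the estimate also
    covers components without an L^2 term.\<close>
  have two: "(2::real) \<le> 2" "2 * (real CARD('d) - 2) < 2 * real CARD('d)" by auto
  obtain \<alpha> K where \<alpha>: "\<alpha> > 0" "K \<ge> 0" and est: "\<And>(u :: real^'d \<Rightarrow> complex) D N. sob u D \<Longrightarrow>
      integrable lborel (\<lambda>x. cmod (u x - av N u x) powr 2)
      \<and> (\<integral>x. cmod (u x - av N u x) powr 2 \<partial>lborel) \<le> K * 2 powr (- real_of_int N * \<alpha>) * dirichlet D powr (2 / 2)"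
    by (rule lr_estimate[OF two]) blast
  have cauchy: "\<exists>n0. \<forall>m\<ge>n0. \<forall>n\<ge>n0. nw (\<lambda>x. v m x - v n x) < e" if e: "e > 0" for e
  proof -
    have "(\<lambda>N. K * 2 powr (- real N * \<alpha>) * (4 * M / s)) \<longlonglongrightarrow> 0" using \<alpha>(1) by real_asymp
    then have "\<forall>\<^sub>F N in sequentially. K * 2 powr (- real N * \<alpha>) * (4 * M / s) < e / 8"
      by (rule order_tendstoD(2)) (use e in simp)
    then obtain N :: nat where N: "K * 2 powr (- real N * \<alpha>) * (4 * M / s) < e / 8"
      by (auto simp: eventually_sequentially)
    obtain A where A: "A \<in> L2w" "(\<lambda>n. nw (\<lambda>x. av (int N) (v n) x - A x)) \<longlonglongrightarrow> 0" "\<And>n. av (int N) (v n) \<in> L2w"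
      using avlim[of N] by blast
    have "\<forall>\<^sub>F n in sequentially. nw (\<lambda>x. av (int N) (v n) x - A x) < e / 16"
      by (rule order_tendstoD(2)[OF A(2)]) (use e in simp)
    then obtain n0 where n0: "\<And>n. n \<ge> n0 \<Longrightarrow> nw (\<lambda>x. av (int N) (v n) x - A x) < e / 16"
      by (auto simp: eventually_sequentially)
    have "nw (\<lambda>x. v m x - v n x) < e" if mn: "m \<ge> n0" "n \<ge> n0" for m n
    proof -
      let ?w = "\<lambda>x. v m x - v n x"
      have wX: "?w \<in> Xs \<gamma>" by (rule Xs_diff[OF adm vX vX])
      have "hs s \<gamma> (\<lambda>x. v m x + (- 1) * v n x) \<le> hs s \<gamma> (v m) / (1 - 1/2) + hs s \<gamma> (\<lambda>x. (- 1) * v n x) / (1/2)"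
        by (rule hs_triangle[OF adm vX Xs_cmult[OF vX]]) (use s in auto)
      moreover have "hs s \<gamma> (\<lambda>x. (- 1) * v n x) = hs s \<gamma> (v n)"
        using hs_cmult_real[OF adm vX, of s "- 1" n] by simp
      ultimately have "hs s \<gamma> ?w \<le> 4 * M" using M[of "r m"] M[of "r n"] by (simp add: v_def)
      then have A': "dirichlet (weak_grad ?w) \<le> 4 * M / s"
        using dirichlet_le_hs[OF wX s \<gamma>] divide_right_mono[of "hs s \<gamma> ?w" "4 * M" s] s by simp
      define R where "R x = ?w x - av (int N) ?w x" for x
      note e1 = est[OF Xs_sob[OF wX], of "int N"]
      have [measurable]: "R \<in> borel_measurable borel" unfolding R_def by measurable
      have R2: "R \<in> Lp 2" using e1 by (simp add: Lp_def R_def)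
      have "nw R \<le> (\<integral>x. (cmod (R x))\<^sup>2 \<partial>lborel)" by (rule Lp2_L2w(2)[OF R2])
      also have "\<dots> \<le> K * 2 powr (- real N * \<alpha>) * dirichlet (weak_grad ?w)"
        using e1 by (simp add: R_def)
      also have "\<dots> \<le> K * 2 powr (- real N * \<alpha>) * (4 * M / s)"
        using A' \<alpha> by (intro mult_left_mono) auto
      also note N
      finally have nR: "nw R < e / 8" .
      have aw: "av (int N) ?w = (\<lambda>x. av (int N) (v m) x - av (int N) (v n) x)"
        by (intro ext av_diff vli)
      have "nw (\<lambda>x. (av (int N) (v m) x - A x) - (av (int N) (v n) x - A x))
          \<le> 2 * nw (\<lambda>x. av (int N) (v m) x - A x) + 2 * nw (\<lambda>x. av (int N) (v n) x - A x)"
        by (intro L2w_diff A)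
      then have "nw (av (int N) ?w) \<le> 2 * nw (\<lambda>x. av (int N) (v m) x - A x) + 2 * nw (\<lambda>x. av (int N) (v n) x - A x)"
        by (simp add: aw)
      then have nA: "nw (av (int N) ?w) < 2 * (e / 16) + 2 * (e / 16)" using n0[OF mn(1)] n0[OF mn(2)] by linarith
      have "nw (\<lambda>x. R x + av (int N) ?w x) \<le> 2 * nw R + 2 * nw (av (int N) ?w)"
        by (rule L2w_add(2)[OF Lp2_L2w(1)[OF R2]]) (unfold aw, intro L2w_diff A)
      moreover have "(\<lambda>x. R x + av (int N) ?w x) = ?w" by (simp add: R_def)
      ultimately have "nw ?w \<le> 2 * nw R + 2 * nw (av (int N) ?w)" by simp
      moreover have "2 * a + 2 * b < e" if "a < e / 8" "b < 2 * (e / 16) + 2 * (e / 16)" for a b :: real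
        using that e by linarith
      ultimately show ?thesis using nR nA by (meson order_le_less_trans)
    qed
    then show ?thesis by blast
  qed
  obtain u where "u \<in> L2w" "(\<lambda>n. nw (\<lambda>x. v n x - u x)) \<longlonglongrightarrow> 0"
    using L2w_complete[OF vL cauchy] by blast
  with r show thesis by (intro that[of r u]) (simp_all add: v_def)
qed

section \<open>Trilinear estimates\<close>

lemma young3:
  fixes a b c p q r :: real
  assumes "0 \<le> a" "0 \<le> b" "0 \<le> c" "0 < p" "0 < q" "0 < r" "1 / p + 1 / q + 1 / r = 1"
  shows "a * b * c \<le> a powr p + b powr q + c powr r"
proof (cases "a = 0 \<or> b = 0 \<or> c = 0")
  case False
  \<comment> \<open>Young's inequality with constant 1 by a shortcut: each factor is at most m to
    the reciprocal of its exponent, and the reciprocals add up to 1.\<close>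
  define m where "m = max (a powr p) (max (b powr q) (c powr r))"
  have m: "m > 0" using False assms by (auto simp: m_def less_max_iff_disj)
  have root: "t \<le> m powr (1 / e)" if "0 \<le> t" "0 < e" "t powr e \<le> m" for t e
  proof -
    have "t = (t powr e) powr (1 / e)" using that by (simp add: powr_powr)
    also have "\<dots> \<le> m powr (1 / e)" using that by (intro powr_mono2) auto
    finally show ?thesis .
  qed
  have "a * b * c \<le> m powr (1 / p) * m powr (1 / q) * m powr (1 / r)"
    using assms by (intro mult_mono root) (auto simp: m_def le_max_iff_disj)
  also have "\<dots> = m" using m assms(7) by (simp add: powr_add[symmetric])
  also have "\<dots> \<le> a powr p + b powr q + c powr r"
    by (auto simp: m_def)
  finally show ?thesis .
qed (use assms in auto)

text \<open>The factors \<eta>^-2, \<eta>, \<eta> multiply to 1. Two terms that are merely bounded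
  become small, at the price of a large constant on the first one.\<close>

lemma young3_weighted:
  fixes a b c p q r \<eta> :: real
  assumes "0 \<le> a" "0 \<le> b" "0 \<le> c" "0 < p" "0 < q" "0 < r" "1 / p + 1 / q + 1 / r = 1" "0 < \<eta>"
  shows "a * b * c \<le> \<eta> powr (- 2 * p) * a powr p + \<eta> powr q * b powr q + \<eta> powr r * c powr r"
proof -
  have "a * b * c = (\<eta> powr (- 2) * a) * (\<eta> * b) * (\<eta> * c)"
    using assms(8) by (simp add: powr_minus power2_eq_square field_simps)
  also have "\<dots> \<le> (\<eta> powr (- 2) * a) powr p + (\<eta> * b) powr q + (\<eta> * c) powr r"
    by (rule young3) (use assms in auto)
  finally show ?thesis using assms by (simp add: powr_mult powr_powr)
qed

lemma triple_integrable:
  assumes f: "f \<in> Lp p" and g: "g \<in> Lp q" and h: "h \<in> Lp r"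
    and e: "0 < p" "0 < q" "0 < r" "1 / p + 1 / q + 1 / r = 1"
  shows "integrable lborel (\<lambda>x. cmod (f x) * cmod (g x) * cmod (h x))"
    and "0 < \<eta> \<Longrightarrow> (\<integral>x. cmod (f x) * cmod (g x) * cmod (h x) \<partial>lborel)
      \<le> \<eta> powr (- 2 * p) * (\<integral>x. cmod (f x) powr p \<partial>lborel) + \<eta> powr q * (\<integral>x. cmod (g x) powr q \<partial>lborel)
        + \<eta> powr r * (\<integral>x. cmod (h x) powr r \<partial>lborel)"
proof -
  have [measurable]: "f \<in> borel_measurable borel" "g \<in> borel_measurable borel" "h \<in> borel_measurable borel"
    using f g h Lp_borel by auto
  show int: "integrable lborel (\<lambda>x. cmod (f x) * cmod (g x) * cmod (h x))"
  proof (rule Bochner_Integration.integrable_bound)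
    show "integrable lborel (\<lambda>x. cmod (f x) powr p + cmod (g x) powr q + cmod (h x) powr r)"
      by (intro Bochner_Integration.integrable_add Lp_int f g h)
    show "AE x in lborel. norm (cmod (f x) * cmod (g x) * cmod (h x)) \<le> norm (cmod (f x) powr p + cmod (g x) powr q + cmod (h x) powr r)"
      using young3[OF _ _ _ e] by (intro AE_I2) (auto intro!: order_trans[OF _ abs_ge_self])
  qed measurable
  assume \<eta>: "0 < \<eta>"
  have i: "integrable lborel (\<lambda>x. \<eta> powr (- 2 * p) * cmod (f x) powr p)" "integrable lborel (\<lambda>x. \<eta> powr q * cmod (g x) powr q)"
    "integrable lborel (\<lambda>x. \<eta> powr r * cmod (h x) powr r)"
    by (intro integrable_mult_right Lp_int f g h)+
  have "(\<integral>x. cmod (f x) * cmod (g x) * cmod (h x) \<partial>lborel)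
      \<le> (\<integral>x. \<eta> powr (- 2 * p) * cmod (f x) powr p + \<eta> powr q * cmod (g x) powr q + \<eta> powr r * cmod (h x) powr r \<partial>lborel)"
    by (rule integral_mono[OF int Bochner_Integration.integrable_add[OF Bochner_Integration.integrable_add[OF i(1,2)] i(3)]])
      (rule young3_weighted, use e \<eta> in auto)
  then show "(\<integral>x. cmod (f x) * cmod (g x) * cmod (h x) \<partial>lborel)
      \<le> \<eta> powr (- 2 * p) * (\<integral>x. cmod (f x) powr p \<partial>lborel) + \<eta> powr q * (\<integral>x. cmod (g x) powr q \<partial>lborel)
        + \<eta> powr r * (\<integral>x. cmod (h x) powr r \<partial>lborel)"
    unfolding Bochner_Integration.integral_add[OF Bochner_Integration.integrable_add[OF i(1,2)] i(3)]
      Bochner_Integration.integral_add[OF i(1,2)] integral_mult_right_zero .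
qed

lemma small_powers:
  fixes C q r e :: real
  assumes "0 < q" "0 < r" "0 < e"
  obtains \<eta> where "0 < \<eta>" "\<eta> powr q * C + \<eta> powr r * C < e"
proof -
  have z: "((\<lambda>\<eta>::real. \<eta> powr t) \<longlongrightarrow> 0) (at_right 0)" if "0 < t" for t
    using that by real_asymp
  have "((\<lambda>\<eta>. \<eta> powr q * C + \<eta> powr r * C) \<longlongrightarrow> 0 * C + 0 * C) (at_right 0)"
    by (intro tendsto_add tendsto_mult tendsto_const z assms)
  then have "\<forall>\<^sub>F \<eta> in at_right 0. \<eta> powr q * C + \<eta> powr r * C < e"
    by (rule order_tendstoD(2)) (use assms in simp)
  then have "\<forall>\<^sub>F \<eta> in at_right 0. \<eta> powr q * C + \<eta> powr r * C < e \<and> 0 < \<eta>"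
    using eventually_at_right_less by (rule eventually_conj)
  then show thesis
    using eventually_happens'[OF trivial_limit_at_right_real] that by blast
qed

text \<open>Where the fixed factor is at most a multiple of the weight, local convergence of g
  suffices; the rest of f has a small L^p integral and the other two factors are bounded. The
  choices are made in the order \<eta>, R, \<kappa>, n.\<close>

lemma triple_tendsto_0:
  fixes f :: "real^'d::finite \<Rightarrow> complex"
  assumes f: "f \<in> Lp p" and g: "\<And>n. g n \<in> Lp q" "\<And>n. g n \<in> L2w" and h: "\<And>n. h n \<in> Lp r" "\<And>n. h n \<in> L2w"
    and e: "0 < p" "0 < q" "0 < r" "1 / p + 1 / q + 1 / r = 1"
    and C: "\<And>n. (\<integral>x. cmod (g n x) powr q \<partial>lborel) \<le> C" "\<And>n. (\<integral>x. cmod (h n x) powr r \<partial>lborel) \<le> C"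
      "\<And>n. nw (h n) \<le> C"
    and lim: "(\<lambda>n. nw (g n)) \<longlonglongrightarrow> 0"
  shows "(\<lambda>n. \<integral>x. cmod (f x) * cmod (g n x) * cmod (h n x) \<partial>lborel) \<longlonglongrightarrow> 0"
proof (rule LIMSEQ_I)
  fix \<epsilon> :: real assume \<epsilon>: "\<epsilon> > 0"
  have [measurable]: "f \<in> borel_measurable borel" "\<And>n. g n \<in> borel_measurable borel" "\<And>n. h n \<in> borel_measurable borel"
    using Lp_borel[OF f] Lp_borel[OF g(1)] Lp_borel[OF h(1)] by auto
  have C0: "0 \<le> C" using order_trans[OF nw_nonneg C(3)] .
  obtain \<eta> where \<eta>: "0 < \<eta>" "\<eta> powr q * C + \<eta> powr r * C < \<epsilon> / 4"
    by (rule small_powers[of q r "\<epsilon> / 4"]) (use e \<epsilon> in auto)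
  \<comment> \<open>The part of f that exceeds R times the weight. The weight is positive
    everywhere, so this part vanishes pointwise as R grows.\<close>
  define fR where "fR R x = (if cmod (f x) \<le> real R * wt x then 0 else f x)" for R :: nat and x
  have [measurable]: "fR R \<in> borel_measurable borel" for R unfolding fR_def by measurable
  have "(\<lambda>R. \<integral>x. cmod (fR R x) powr p \<partial>lborel) \<longlonglongrightarrow> (\<integral>x. 0 \<partial>(lborel :: (real^'d) measure))"
  proof (rule integral_dominated_convergence[where w = "\<lambda>x. cmod (f x) powr p"])
    show "integrable lborel (\<lambda>x. cmod (f x) powr p)" by (rule Lp_int[OF f])
    have "(\<lambda>R. cmod (fR R x) powr p) \<longlonglongrightarrow> 0" for x
    proof (rule tendsto_eventually)
      have "\<forall>\<^sub>F R in sequentially. cmod (f x) / wt x \<le> real R"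
        by (rule eventually_sequentiallyI[of "nat \<lceil>cmod (f x) / wt x\<rceil>"]) linarith
      then show "\<forall>\<^sub>F R in sequentially. cmod (fR R x) powr p = 0"
        by eventually_elim (use wt_pos[of x] in \<open>auto simp: fR_def field_simps\<close>)
    qed
    then show "AE x in lborel. (\<lambda>R. cmod (fR R x) powr p) \<longlonglongrightarrow> 0" by simp
    show "AE x in lborel. norm (cmod (fR R x) powr p) \<le> cmod (f x) powr p" for R
      by (auto simp: fR_def)
  qed measurable
  then have "(\<lambda>R. \<eta> powr (- 2 * p) * (\<integral>x. cmod (fR R x) powr p \<partial>lborel)) \<longlonglongrightarrow> \<eta> powr (- 2 * p) * 0"
    by (intro tendsto_mult tendsto_const) simp
  then have "\<forall>\<^sub>F R in sequentially. \<eta> powr (- 2 * p) * (\<integral>x. cmod (fR R x) powr p \<partial>lborel) < \<epsilon> / 4"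
    by (rule order_tendstoD(2)) (use \<epsilon> in simp)
  then obtain R where R: "\<eta> powr (- 2 * p) * (\<integral>x. cmod (fR R x) powr p \<partial>lborel) < \<epsilon> / 4"
    by (auto simp: eventually_sequentially)
  have fRp: "fR R \<in> Lp p"
  proof -
    have "integrable lborel (\<lambda>x. cmod (fR R x) powr p)"
      by (rule Bochner_Integration.integrable_bound[OF Lp_int[OF f]]) (auto simp: fR_def)
    then show ?thesis by (simp add: Lp_def)
  qed
  \<comment> \<open>Splits g h into g^2/\<kappa> + \<kappa> h^2: with this \<kappa> the bounded
    factor h costs at most \<epsilon>/4, and then n is taken large for g. The summands 1 avoid
    division by zero.\<close>
  define \<kappa> where "\<kappa> = \<epsilon> / (4 * (real R + 1) * (C + 1))"
  have \<kappa>: "\<kappa> > 0" using \<epsilon> C0 by (simp add: \<kappa>_def)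
  have \<kappa>C: "real R * (\<kappa> * C) \<le> \<epsilon> / 4"
  proof -
    have "real R * (\<kappa> * C) \<le> (real R + 1) * (\<kappa> * (C + 1))"
      using \<kappa> C0 by (intro mult_mono) auto
    also have "\<dots> = \<epsilon> / 4"
    proof -
      have "a * (\<epsilon> / (4 * a * b) * b) = \<epsilon> / 4" if "a \<noteq> 0" "b \<noteq> 0" for a b :: real
        using that by (simp add: field_simps)
      from this[of "real R + 1" "C + 1"] show ?thesis using C0 unfolding \<kappa>_def by linarith
    qed
    finally show ?thesis .
  qed
  have "(\<lambda>n. real R * (nw (g n) / \<kappa>)) \<longlonglongrightarrow> real R * (0 / \<kappa>)"
    using \<kappa> by (intro tendsto_intros lim) auto
  then have "\<forall>\<^sub>F n in sequentially. real R * (nw (g n) / \<kappa>) < \<epsilon> / 4"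
    by (rule order_tendstoD(2)) (use \<epsilon> in simp)
  then obtain n0 where n0: "\<And>n. n \<ge> n0 \<Longrightarrow> real R * (nw (g n) / \<kappa>) < \<epsilon> / 4"
    by (auto simp: eventually_sequentially)
  have "(\<integral>x. cmod (f x) * cmod (g n x) * cmod (h n x) \<partial>lborel) < \<epsilon>" if n: "n \<ge> n0" for n
  proof -
    have wg: "integrable lborel (\<lambda>x. wt x * (cmod (g n x))\<^sup>2)" "integrable lborel (\<lambda>x. wt x * (cmod (h n x))\<^sup>2)"
      by (intro L2wD(2) g h)+
    note tr = triple_integrable[OF fRp g(1)[of n] h(1)[of n] e]
    have i: "integrable lborel (\<lambda>x. real R * (wt x * (cmod (g n x))\<^sup>2 / \<kappa> + \<kappa> * (wt x * (cmod (h n x))\<^sup>2)))"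
      using wg by simp
    have pw: "cmod (f x) * cmod (g n x) * cmod (h n x) \<le> real R * (wt x * (cmod (g n x))\<^sup>2 / \<kappa> + \<kappa> * (wt x * (cmod (h n x))\<^sup>2))
        + cmod (fR R x) * cmod (g n x) * cmod (h n x)" for x
    proof (cases "cmod (f x) \<le> real R * wt x")
      case True
      have ab: "a * b \<le> a\<^sup>2 / \<kappa> + \<kappa> * b\<^sup>2" if "0 \<le> a" "0 \<le> b" for a b :: real
      proof -
        have "2 * (a * b) \<le> a\<^sup>2 / \<kappa> + \<kappa> * b\<^sup>2"
          using zero_le_power2[of "a / sqrt \<kappa> - sqrt \<kappa> * b"] \<kappa>
          by (simp add: power2_diff power_divide power_mult_distrib)
        then show ?thesis using mult_nonneg_nonneg[OF that] by linarith
      qed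
      have "cmod (f x) * (cmod (g n x) * cmod (h n x)) \<le> real R * wt x * ((cmod (g n x))\<^sup>2 / \<kappa> + \<kappa> * (cmod (h n x))\<^sup>2)"
        using True wt_pos[of x] by (intro mult_mono ab) (auto intro!: add_nonneg_nonneg simp: \<kappa> less_imp_le)
      then show ?thesis using True by (simp add: fR_def algebra_simps)
    next
      case False
      have "0 \<le> real R * (wt x * (cmod (g n x))\<^sup>2 / \<kappa> + \<kappa> * (wt x * (cmod (h n x))\<^sup>2))"
        using \<kappa> wt_pos[of x] by (intro mult_nonneg_nonneg add_nonneg_nonneg divide_nonneg_pos) auto
      then show ?thesis using False by (simp add: fR_def)
    qed
    have "(\<integral>x. cmod (f x) * cmod (g n x) * cmod (h n x) \<partial>lborel)
      \<le> (\<integral>x. real R * (wt x * (cmod (g n x))\<^sup>2 / \<kappa> + \<kappa> * (wt x * (cmod (h n x))\<^sup>2)) + cmod (fR R x) * cmod (g n x) * cmod (h n x) \<partial>lborel)"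
      by (rule integral_mono[OF triple_integrable(1)[OF f g(1) h(1) e] Bochner_Integration.integrable_add[OF i tr(1)] pw])
    also have "\<dots> = real R * (nw (g n) / \<kappa> + \<kappa> * nw (h n)) + (\<integral>x. cmod (fR R x) * cmod (g n x) * cmod (h n x) \<partial>lborel)"
      unfolding Bochner_Integration.integral_add[OF i tr(1)] using wg by (simp add: nw_def)
    also have "\<dots> < \<epsilon>"
    proof -
      have "real R * (\<kappa> * nw (h n)) \<le> real R * (\<kappa> * C)"
        using \<kappa> C(3) by (intro mult_left_mono) auto
      moreover have "\<eta> powr q * (\<integral>x. cmod (g n x) powr q \<partial>lborel) \<le> \<eta> powr q * C"
        "\<eta> powr r * (\<integral>x. cmod (h n x) powr r \<partial>lborel) \<le> \<eta> powr r * C"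
        using C by (intro mult_left_mono; simp)+
      ultimately show ?thesis
        using \<kappa>C n0[OF n] R tr(2)[OF \<eta>(1)] \<eta>(2) unfolding distrib_left by linarith
    qed
    finally show ?thesis .
  qed
  moreover have "0 \<le> (\<integral>x. cmod (f x) * cmod (g n x) * cmod (h n x) \<partial>lborel)" for n
    by (intro integral_nonneg_AE) auto
  ultimately show "\<exists>no. \<forall>n\<ge>no. norm ((\<integral>x. cmod (f x) * cmod (g n x) * cmod (h n x) \<partial>lborel) - 0) < \<epsilon>"
    by auto
qed

section \<open>Translations\<close>

lemma sob_shift:
  fixes y :: "real^'d::finite"
  assumes "sob u D"
  shows "sob (\<lambda>x. u (x + y)) (\<lambda>x. D (x + y))" "dirichlet (\<lambda>x. D (x + y)) = dirichlet D"
proof -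
  have "(\<lambda>x. D (x + y) $ k) \<in> Lp 2" for k
    using sob_borel(2,5)[OF assms, of k] lborel_shift(1)[of "\<lambda>x. (cmod (D x $ k))\<^sup>2" y] by (auto simp: Lp2_iff)
  then show "sob (\<lambda>x. u (x + y)) (\<lambda>x. D (x + y))"
    using assms has_weak_grad_shift by (auto simp: sob_def)
  show "dirichlet (\<lambda>x. D (x + y)) = dirichlet D"
    unfolding dirichlet_def using lborel_shift(2)[of "\<lambda>x. (norm (D x))\<^sup>2" y] sob_borel(3)[OF assms] by simp
qed

lemma Xs_shift:
  fixes y :: "real^'d::finite"
  assumes u: "u \<in> Xs \<gamma>" and a: "cmod a = 1"
  shows "(\<lambda>x. a * u (x + y)) \<in> Xs \<gamma>" "hs s \<gamma> (\<lambda>x. a * u (x + y)) = hs s \<gamma> u"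
proof -
  have [measurable]: "u \<in> borel_measurable borel" by (rule Xs_borel[OF u])
  have sh: "sob (\<lambda>x. a * u (x + y)) (\<lambda>x. a *s weak_grad u (x + y))"
    by (rule sob_cmult[OF sob_shift(1)[OF Xs_sob[OF u]]])
  moreover have "(\<lambda>x. a * u (x + y)) \<in> Lp q" if "u \<in> Lp q" for q
    using that lborel_shift(1)[of "\<lambda>x. cmod (u x) powr q" y] a by (simp add: Lp_def norm_mult)
  ultimately show "(\<lambda>x. a * u (x + y)) \<in> Xs \<gamma>" using u by (auto simp: Xs_iff)
  have "L2_normsq (\<lambda>x. a * u (x + y)) = L2_normsq u"
    unfolding L2_normsq_def using lborel_shift(2)[of "\<lambda>x. (cmod (u x))\<^sup>2" y] a by (simp add: norm_mult)
  moreover have "dirichlet (\<lambda>x. a *s weak_grad u (x + y)) = dirichlet (\<lambda>x. weak_grad u (x + y))"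
    unfolding dirichlet_def norm_vec_square using a by (simp add: norm_mult)
  ultimately show "hs s \<gamma> (\<lambda>x. a * u (x + y)) = hs s \<gamma> u"
    unfolding hs_def grad_normsq_eq[OF sh] grad_normsq_eq[OF Xs_sob[OF u]] using sob_shift(2)[OF Xs_sob[OF u]] by simp
qed

text \<open>The corner of a box is a point of the grid of that level, so translating by it maps
  boxes to boxes; translating by x itself would not.\<close>

lemma av_shift_lo:
  fixes u :: "real^'d::finite \<Rightarrow> complex"
  assumes [measurable]: "u \<in> borel_measurable borel"
  shows "av N (\<lambda>t. a * u (t + lo N x)) 0 = a * av N u x"
proof -
  have "t \<in> Bx N 0 \<longleftrightarrow> t + lo N x \<in> Bx N x" for t
  proof -
    have "\<lfloor>(t + lo N x) $ k / side N k\<rfloor> = \<lfloor>t $ k / side N k\<rfloor> + \<lfloor>x $ k / side N k\<rfloor>" for k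
      using side_pos[of N k] by (simp add: lo_def add_divide_distrib)
    then show ?thesis by (simp add: Bx_def)
  qed
  then have "(LINT t:Bx N 0|lborel. a * u (t + lo N x)) = (\<integral>t. indicat_real (Bx N x) (t + lo N x) *\<^sub>R (a * u (t + lo N x)) \<partial>lborel)"
    unfolding set_lebesgue_integral_def
    by (intro Bochner_Integration.integral_cong) (auto simp: indicator_def)
  also have "\<dots> = (LINT t:Bx N x|lborel. a * u t)"
    unfolding set_lebesgue_integral_def
    by (rule lborel_shift(2)[of "\<lambda>t. indicat_real (Bx N x) t *\<^sub>R (a * u t)"]) measurable
  finally show ?thesis by (simp add: av_def)
qed

section \<open>The constrained minimisation problem\<close>

lemma test_function_Lp:
  fixes \<phi> :: "real^'d::finite \<Rightarrow> complex"
  assumes "continuous_on UNIV \<phi>" "compact K" "\<And>x. x \<notin> K \<Longrightarrow> \<phi> x = 0" and q: "0 < q"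
  shows "\<phi> \<in> Lp q"
proof -
  have [measurable]: "\<phi> \<in> borel_measurable borel" using assms(1) by (rule borel_measurable_continuous_onI)
  obtain M where M: "0 \<le> M" "\<And>x. cmod (\<phi> x) \<le> M" using continuous_compact_support_bounded[OF assms(1-3)] by blast
  have "integrable lborel (\<lambda>x. indicator K x *\<^sub>R (M powr q))"
    using assms(2) by (intro borel_integrable_compact) (auto intro: continuous_intros)
  then have "integrable lborel (\<lambda>x. cmod (\<phi> x) powr q)"
  proof (rule Bochner_Integration.integrable_bound)
    have "cmod (\<phi> x) powr q \<le> M powr q" for x using M q by (intro powr_mono2) auto
    then show "AE x in lborel. norm (cmod (\<phi> x) powr q) \<le> norm (indicat_real K x *\<^sub>R (M powr q))"
      using assms(3) q by (intro AE_I2) (auto simp: indicator_def)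
  qed measurable
  then show ?thesis by (simp add: Lp_def)
qed

lemma test_function_Xs:
  fixes \<phi> :: "real^'d::finite \<Rightarrow> complex"
  assumes adm: "adm TYPE('d) \<gamma> p" and \<phi>: "\<phi> \<in> test_functions"
  shows "\<phi> \<in> Xs \<gamma>"
proof -
  obtain K where K: "compact K" "\<And>x. x \<notin> K \<Longrightarrow> \<phi> x = 0" "\<And>k x. x \<notin> K \<Longrightarrow> partial_deriv k \<phi> x = 0"
    by (rule test_function_support[OF \<phi>], rule that)
  have C: "continuous_on UNIV \<phi>" "continuous_on UNIV (partial_deriv k \<phi>)" for k
    using test_function_C_k[OF \<phi>, of 0] test_function_C_k[OF \<phi>, of 1] by auto
  have "0 < qexp TYPE('d) \<gamma>" using qexp_ge[OF adm] by simp
  from test_function_Lp[OF C(1) K(1,2) this]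
  have 1: "\<phi> \<in> Lp (qexp TYPE('d) \<gamma>)" .
  have "partial_deriv k \<phi> \<in> Lp 2" for k
    by (rule test_function_Lp[OF C(2) K(1,3)]) auto
  then have "sob \<phi> (\<lambda>x. \<chi> k. partial_deriv k \<phi> x)"
    using has_weak_grad_test[OF \<phi>] by (simp add: sob_def)
  with 1 show ?thesis by (auto simp: Xs_iff)
qed

lemma permute_3:
  fixes j :: 3
  obtains k l where "\<And>f :: 3 \<Rightarrow> real. f 1 * f 2 * f 3 = f j * f k * f l" "\<And>f :: 3 \<Rightarrow> real. f 1 + f 2 + f 3 = f j + f k + f l"
proof -
  consider "j = 1" | "j = 2" | "j = 3" using exhaust_3 by blast
  then show thesis
    by cases (use that[of 2 3] that[of 1 3] that[of 1 2] in \<open>auto simp: ac_simps\<close>)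
qed

text \<open>What the cases (A), (B) and (C) have in common. They differ only in the exponents that
  can be supplied for \<open>p\<close>.\<close>

locale triple_setup =
  fixes \<sigma> :: "real^3" and c :: "real^'d::finite" and \<omega> :: "real \<times> real" and p :: "3 \<Rightarrow> real"
  assumes \<sigma>: "\<And>j. \<sigma> $ j > 0"
    and adm: "\<And>j. adm TYPE('d) (gam \<sigma> c \<omega> j) (p j)"
    and pq: "1 / p 1 + 1 / p 2 + 1 / p 3 = 1"
    and pos: "\<exists>j. gam \<sigma> c \<omega> j > 0"
begin

abbreviation \<gamma> :: "3 \<Rightarrow> real" where "\<gamma> \<equiv> gam \<sigma> c \<omega>"
abbreviation X :: "(real^'d \<Rightarrow> complex^3) set" where "X \<equiv> X_til \<sigma> c \<omega>"
abbreviation H :: "(real^'d \<Rightarrow> complex^3) \<Rightarrow> real" where "H \<equiv> normsq_X_til \<sigma> c \<omega>"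
abbreviation N :: "(real^'d \<Rightarrow> complex^3) \<Rightarrow> real" where "N \<equiv> N_c \<sigma> c"
abbreviation hj :: "3 \<Rightarrow> (real^'d \<Rightarrow> complex) \<Rightarrow> real" where "hj j \<equiv> hs (1 / \<sigma> $ j) (\<gamma> j)"

definition th :: "real^'d \<Rightarrow> complex" where
  "th x = cis ((\<sigma> $ 1 + \<sigma> $ 2 - \<sigma> $ 3) / 2 * (c \<bullet> x))"

lemma s_pos: "0 < 1 / \<sigma> $ j" and \<gamma>_nonneg: "0 \<le> \<gamma> j" and p2: "2 < p j" and p0: "0 < p j"
  using \<sigma>[of j] adm[of j] by (auto simp: adm_def)

lemma X_iff: "\<Psi> \<in> X \<longleftrightarrow> (\<forall>j. (\<lambda>x. \<Psi> x $ j) \<in> Xs (\<gamma> j))"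
  by (simp add: X_til_def Xs_def)

lemma XD: "\<Psi> \<in> X \<Longrightarrow> (\<lambda>x. \<Psi> x $ j) \<in> Xs (\<gamma> j)"
  by (simp add: X_iff)

lemma H_sum: "H \<Psi> = (\<Sum>j\<in>UNIV. hj j (\<lambda>x. \<Psi> x $ j))"
  by (simp add: normsq_X_til_def hs_def)

lemma hj_nonneg: "0 \<le> hj j u"
  using hs_nonneg s_pos \<gamma>_nonneg less_imp_le by blast

lemma hj_le_H: "hj j (\<lambda>x. \<Psi> x $ j) \<le> H \<Psi>"
  unfolding H_sum by (rule member_le_sum) (auto simp: hj_nonneg)

lemma H_nonneg: "0 \<le> H \<Psi>"
  unfolding H_sum by (intro sum_nonneg hj_nonneg)

lemma X_diff: "\<Psi> \<in> X \<Longrightarrow> \<Phi> \<in> X \<Longrightarrow> (\<lambda>x. \<Psi> x - \<Phi> x) \<in> X"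
  using Xs_diff[OF adm] by (simp add: X_iff)

lemma X_scale: "\<Psi> \<in> X \<Longrightarrow> (\<lambda>x. a *s \<Psi> x) \<in> X"
  by (auto simp: X_iff intro: Xs_cmult)

lemma H_scale: "\<Psi> \<in> X \<Longrightarrow> H (\<lambda>x. of_real a *s \<Psi> x) = a\<^sup>2 * H \<Psi>"
  unfolding H_sum using hs_cmult_real[OF adm XD] by (simp add: sum_distrib_left)

lemma X_Lp: "\<Psi> \<in> X \<Longrightarrow> (\<lambda>x. \<Psi> x $ j) \<in> Lp (p j)"
  by (rule Xs_Lp[OF adm XD])

lemma X_borel: "\<Psi> \<in> X \<Longrightarrow> (\<lambda>x. \<Psi> x $ j) \<in> borel_measurable borel"
  by (rule Lp_borel[OF X_Lp])

lemma th_norm [simp]: "cmod (th x) = 1"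
  by (simp add: th_def)

lemma th_measurable [measurable]: "th \<in> borel_measurable borel"
  unfolding th_def[abs_def] by (intro borel_measurable_continuous_onI continuous_intros)

lemma N_eq: "N \<Psi> = - Re (\<integral>x. th x * \<Psi> x $ 1 * \<Psi> x $ 2 * cnj (\<Psi> x $ 3) \<partial>lborel)"
  by (simp add: N_c_def L2_inner_def th_def)

lemma triple_int:
  assumes "u \<in> Lp (p 1)" "v \<in> Lp (p 2)" "w \<in> Lp (p 3)"
  shows "integrable lborel (\<lambda>x. th x * u x * v x * cnj (w x))"
    and "cmod (\<integral>x. th x * u x * v x * cnj (w x) \<partial>lborel) \<le> (\<integral>x. cmod (u x) * cmod (v x) * cmod (w x) \<partial>lborel)"
proof -
  have [measurable]: "u \<in> borel_measurable borel" "v \<in> borel_measurable borel" "w \<in> borel_measurable borel"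
    using assms Lp_borel by blast+
  note t = triple_integrable(1)[OF assms p0 p0 p0 pq]
  show i: "integrable lborel (\<lambda>x. th x * u x * v x * cnj (w x))"
    by (rule Bochner_Integration.integrable_bound[OF t]) (auto simp: norm_mult)
  show "cmod (\<integral>x. th x * u x * v x * cnj (w x) \<partial>lborel) \<le> (\<integral>x. cmod (u x) * cmod (v x) * cmod (w x) \<partial>lborel)"
    by (rule Bochner_Integration.integral_norm_bound_integral[OF i t]) (simp add: norm_mult)
qed

lemma N_scale:
  assumes "\<Psi> \<in> X"
  shows "N (\<lambda>x. of_real a *s \<Psi> x) = a ^ 3 * N \<Psi>"
proof -
  have "(\<lambda>x. th x * (of_real a *s \<Psi> x) $ 1 * (of_real a *s \<Psi> x) $ 2 * cnj ((of_real a *s \<Psi> x) $ 3))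
      = (\<lambda>x. of_real (a ^ 3) * (th x * \<Psi> x $ 1 * \<Psi> x $ 2 * cnj (\<Psi> x $ 3)))"
    by (simp add: fun_eq_iff power3_eq_cube)
  then have "(\<integral>x. th x * (of_real a *s \<Psi> x) $ 1 * (of_real a *s \<Psi> x) $ 2 * cnj ((of_real a *s \<Psi> x) $ 3) \<partial>lborel)
      = of_real (a ^ 3) * (\<integral>x. th x * \<Psi> x $ 1 * \<Psi> x $ 2 * cnj (\<Psi> x $ 3) \<partial>lborel)"
    by (simp only: integral_mult_right_zero)
  then show ?thesis unfolding N_eq by (simp del: of_real_power)
qed

lemma N_le_triple:
  assumes "\<Psi> \<in> X" and eq: "\<And>f :: 3 \<Rightarrow> real. f 1 * f 2 * f 3 = f j * f k * f l"
  shows "\<bar>N \<Psi>\<bar> \<le> (\<integral>x. cmod (\<Psi> x $ j) * cmod (\<Psi> x $ k) * cmod (\<Psi> x $ l) \<partial>lborel)"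
proof -
  have "\<bar>N \<Psi>\<bar> \<le> cmod (\<integral>x. th x * \<Psi> x $ 1 * \<Psi> x $ 2 * cnj (\<Psi> x $ 3) \<partial>lborel)"
    unfolding N_eq by (simp add: abs_Re_le_cmod)
  also have "\<dots> \<le> (\<integral>x. cmod (\<Psi> x $ 1) * cmod (\<Psi> x $ 2) * cmod (\<Psi> x $ 3) \<partial>lborel)"
    by (rule triple_int(2)) (intro X_Lp assms)+
  also have "\<dots> = (\<integral>x. cmod (\<Psi> x $ j) * cmod (\<Psi> x $ k) * cmod (\<Psi> x $ l) \<partial>lborel)"
    using eq[of "\<lambda>i. cmod (\<Psi> _ $ i)"] by simp
  finally show ?thesis .
qed

lemma Lp_uniform:
  obtains C where "0 \<le> C" "\<And>j u. u \<in> Xs (\<gamma> j) \<Longrightarrow> hj j u \<le> M \<Longrightarrow> (\<integral>x. cmod (u x) powr p j \<partial>lborel) \<le> C"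
    "\<And>j u. u \<in> Xs (\<gamma> j) \<Longrightarrow> hj j u \<le> M \<Longrightarrow> nw u \<le> C"
proof -
  have "\<forall>j. \<exists>C. \<forall>u :: real^'d \<Rightarrow> complex. u \<in> Xs (\<gamma> j) \<longrightarrow> hj j u \<le> M \<longrightarrow>
    u \<in> Lp (p j) \<and> (\<integral>x. cmod (u x) powr p j \<partial>lborel) \<le> C"
    by (intro allI Xs_Lp_bound[OF adm s_pos])
  from choice[OF this] obtain C0 where C0': "\<forall>j. \<forall>u :: real^'d \<Rightarrow> complex. u \<in> Xs (\<gamma> j) \<longrightarrow> hj j u \<le> M \<longrightarrow>
    u \<in> Lp (p j) \<and> (\<integral>x. cmod (u x) powr p j \<partial>lborel) \<le> C0 j" by (rule exE)
  note C0 = C0'[rule_format]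
  define W where "W = (\<integral>x. wt x \<partial>(lborel :: (real^'d) measure))"
  have W: "0 \<le> W" unfolding W_def by (intro integral_nonneg_AE) (auto simp: wt_pos less_imp_le)
  define C where "C = W + (\<Sum>j\<in>UNIV. \<bar>C0 j\<bar>)"
  have le: "W + C0 j \<le> C" for j
  proof -
    have "\<bar>C0 j\<bar> \<le> (\<Sum>j\<in>UNIV. \<bar>C0 j\<bar>)" by (rule member_le_sum) auto
    then show ?thesis unfolding C_def by linarith
  qed
  show thesis
  proof (rule that[of C])
    show "0 \<le> C" unfolding C_def using W by (intro add_nonneg_nonneg sum_nonneg) auto
    show "(\<integral>x. cmod (u x) powr p j \<partial>lborel) \<le> C" if "u \<in> Xs (\<gamma> j)" "hj j u \<le> M" for j u
      using C0[OF that] le[of j] W by linarith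
    show "nw u \<le> C" if "u \<in> Xs (\<gamma> j)" "hj j u \<le> M" for j u
    proof -
      have "nw u \<le> W + (\<integral>x. cmod (u x) powr p j \<partial>lborel)"
        unfolding W_def by (rule Lp_L2w(2)) (use C0[OF that] p2[of j] in auto)
      then show ?thesis using C0[OF that] le[of j] by linarith
    qed
  qed
qed

text \<open>A bound on the unit ball of H extends by homogeneity, H having degree 2 and N degree 3.
  For H = 0 scaling stays in the ball while N grows without bound, so N = 0.\<close>

lemma N_bound: obtains C where "0 \<le> C" "\<And>\<Psi>. \<Psi> \<in> X \<Longrightarrow> (N \<Psi>)\<^sup>2 \<le> C * (H \<Psi>) ^ 3"
proof -
  obtain C where C: "0 \<le> C" "\<And>j u. u \<in> Xs (\<gamma> j) \<Longrightarrow> hj j u \<le> 1 \<Longrightarrow> (\<integral>x. cmod (u x) powr p j \<partial>lborel) \<le> C"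
    by (rule Lp_uniform[of 1]) (rule that)
  have unit: "\<bar>N \<Psi>\<bar> \<le> 3 * C" if "\<Psi> \<in> X" "H \<Psi> \<le> 1" for \<Psi>
  proof -
    have "\<bar>N \<Psi>\<bar> \<le> (\<integral>x. cmod (\<Psi> x $ 1) * cmod (\<Psi> x $ 2) * cmod (\<Psi> x $ 3) \<partial>lborel)"
      by (rule N_le_triple[OF that(1)]) simp
    also have "\<dots> \<le> (\<integral>x. cmod (\<Psi> x $ 1) powr p 1 \<partial>lborel) + (\<integral>x. cmod (\<Psi> x $ 2) powr p 2 \<partial>lborel)
      + (\<integral>x. cmod (\<Psi> x $ 3) powr p 3 \<partial>lborel)"
      using triple_integrable(2)[OF X_Lp X_Lp X_Lp p0 p0 p0 pq, of \<Psi> \<Psi> \<Psi> 1] that by simp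
    also have "\<dots> \<le> C + C + C"
      by (intro add_mono C XD that order_trans[OF hj_le_H that(2)])
    finally show ?thesis by simp
  qed
  have "(N \<Psi>)\<^sup>2 \<le> (3 * C)\<^sup>2 * (H \<Psi>) ^ 3" if \<Psi>: "\<Psi> \<in> X" for \<Psi>
  proof (cases "H \<Psi> = 0")
    case True
    have "N \<Psi> = 0"
    proof (rule ccontr)
      assume nz: "N \<Psi> \<noteq> 0"
      define t where "t = 3 * C / \<bar>N \<Psi>\<bar> + 1"
      have t: "t \<ge> 1" using C nz by (simp add: t_def)
      have "\<bar>N (\<lambda>x. of_real t *s \<Psi> x)\<bar> \<le> 3 * C"
        by (rule unit[OF X_scale[OF \<Psi>]]) (simp add: H_scale[OF \<Psi>] True)
      then have "t ^ 3 * \<bar>N \<Psi>\<bar> \<le> 3 * C"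
        using t by (simp add: N_scale[OF \<Psi>] abs_mult)
      moreover have "t * \<bar>N \<Psi>\<bar> \<le> t ^ 3 * \<bar>N \<Psi>\<bar>"
        using power_increasing[of 1 3 t] t by (intro mult_right_mono) auto
      moreover have "t * \<bar>N \<Psi>\<bar> = 3 * C + \<bar>N \<Psi>\<bar>" using nz by (simp add: t_def distrib_right)
      ultimately show False using nz by simp
    qed
    then show ?thesis using True by simp
  next
    case False
    then have Hp: "H \<Psi> > 0" using H_nonneg[of \<Psi>] by simp
    define t where "t = 1 / sqrt (H \<Psi>)"
    have t: "t > 0" "t\<^sup>2 * H \<Psi> = 1" using Hp by (auto simp: t_def power_divide)
    have "\<bar>N (\<lambda>x. of_real t *s \<Psi> x)\<bar> \<le> 3 * C"
      by (rule unit[OF X_scale[OF \<Psi>]]) (simp add: H_scale[OF \<Psi>] t)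
    then have "\<bar>t ^ 3 * N \<Psi>\<bar> \<le> 3 * C" by (simp add: N_scale[OF \<Psi>])
    then have "(t ^ 3 * N \<Psi>)\<^sup>2 \<le> (3 * C)\<^sup>2" by (metis abs_ge_zero power2_abs power_mono)
    then have "(t\<^sup>2) ^ 3 * (N \<Psi>)\<^sup>2 * (H \<Psi>) ^ 3 \<le> (3 * C)\<^sup>2 * (H \<Psi>) ^ 3"
      using Hp by (intro mult_right_mono) (simp_all add: power_mult_distrib power_mult[symmetric])
    moreover have "(t\<^sup>2) ^ 3 * (N \<Psi>)\<^sup>2 * (H \<Psi>) ^ 3 = (t\<^sup>2 * H \<Psi>) ^ 3 * (N \<Psi>)\<^sup>2"
      by (simp only: power_mult_distrib mult_ac)
    ultimately show ?thesis by (simp only: t(2) power_one mult_1_left)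
  qed
  then show thesis by (intro that[of "(3 * C)\<^sup>2"]) auto
qed

section \<open>The Nehari set and the sharp inequality\<close>

definition A :: "(real^'d \<Rightarrow> complex^3) set" where
  "A = {\<Psi> \<in> X. nonzero \<Psi> \<and> K_til \<sigma> c \<omega> \<Psi> = 0}"

abbreviation m :: real where "m \<equiv> m_til \<sigma> c \<omega>"

lemma A_D: assumes "\<Psi> \<in> A" shows "\<Psi> \<in> X" "nonzero \<Psi>" "3 * N \<Psi> = - H \<Psi>" "S_til \<sigma> c \<omega> \<Psi> = H \<Psi> / 6"
  using assms by (auto simp: A_def K_til_def S_til_def)

lemma H_pos:
  assumes "\<Psi> \<in> X" "nonzero \<Psi>"
  shows "H \<Psi> > 0"
proof (rule ccontr)
  assume "\<not> ?thesis"
  then have "H \<Psi> = 0" using H_nonneg[of \<Psi>] by simp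
  then have "hj j (\<lambda>x. \<Psi> x $ j) = 0" for j
    using hj_le_H[of j \<Psi>] hj_nonneg[of j "\<lambda>x. \<Psi> x $ j"] by linarith
  then have "AE x in lborel. \<Psi> x $ j = 0" for j
    by (rule hs_zero[OF adm s_pos XD[OF assms(1)]])
  then have "AE x in lborel. \<forall>j\<in>UNIV. \<Psi> x $ j = 0"
    by (intro AE_finite_allI) auto
  then have "AE x in lborel. \<Psi> x = 0" by (simp add: vec_eq_iff)
  then show False using assms(2) by (simp add: nonzero_def)
qed

text \<open>Along the ray through \<Psi> the functional K equals t^2 (H + 3 t N), whose only nonzero
  root is this t.\<close>

lemma scale_in_A:
  assumes \<Psi>: "\<Psi> \<in> X" and N0: "N \<Psi> \<noteq> 0"
  defines "t \<equiv> - H \<Psi> / (3 * N \<Psi>)"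
  shows "(\<lambda>x. of_real t *s \<Psi> x) \<in> A" "H (\<lambda>x. of_real t *s \<Psi> x) = (H \<Psi>) ^ 3 / (9 * (N \<Psi>)\<^sup>2)"
proof -
  have nz: "nonzero \<Psi>"
  proof (rule ccontr)
    assume "\<not> nonzero \<Psi>"
    then have ae: "AE x in lborel. \<Psi> x = 0" by (simp add: nonzero_def)
    have [measurable]: "(\<lambda>x. \<Psi> x $ j) \<in> borel_measurable borel" for j by (rule X_borel[OF \<Psi>])
    have "(\<integral>x. th x * \<Psi> x $ 1 * \<Psi> x $ 2 * cnj (\<Psi> x $ 3) \<partial>lborel) = (\<integral>x. 0 \<partial>(lborel :: (real^'d) measure))"
      by (rule integral_cong_AE) (use ae in \<open>auto elim!: eventually_mono\<close>)
    then show False using N0 by (simp add: N_eq)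
  qed
  have Hp: "H \<Psi> > 0" by (rule H_pos[OF \<Psi> nz])
  have t: "t \<noteq> 0" using Hp N0 by (simp add: t_def)
  have "AE x in lborel. \<Psi> x = 0" if "AE x in lborel. of_real t *s \<Psi> x = 0"
    using that by eventually_elim (use t in \<open>simp add: vec_eq_iff\<close>)
  then have "nonzero (\<lambda>x. of_real t *s \<Psi> x)" using nz by (auto simp: nonzero_def)
  moreover have "K_til \<sigma> c \<omega> (\<lambda>x. of_real t *s \<Psi> x) = t\<^sup>2 * (H \<Psi> + 3 * t * N \<Psi>)"
    by (simp add: K_til_def H_scale[OF \<Psi>] N_scale[OF \<Psi>] power2_eq_square power3_eq_cube algebra_simps)
  moreover have "H \<Psi> + 3 * t * N \<Psi> = 0" using N0 by (simp add: t_def)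
  ultimately show "(\<lambda>x. of_real t *s \<Psi> x) \<in> A" using X_scale[OF \<Psi>] by (simp add: A_def)
  show "H (\<lambda>x. of_real t *s \<Psi> x) = (H \<Psi>) ^ 3 / (9 * (N \<Psi>)\<^sup>2)"
    unfolding H_scale[OF \<Psi>] t_def by (simp add: power_divide power_mult_distrib power2_eq_square power3_eq_cube)
qed

text \<open>The oscillating phase could make the integral cancel. A bump supported close to the
  origin, where the cosine stays positive, avoids this.\<close>

lemma exists_N_nonzero: "\<exists>\<Psi>\<in>X. N \<Psi> \<noteq> 0"
proof -
  define \<kappa> where "\<kappa> = (\<sigma> $ 1 + \<sigma> $ 2 - \<sigma> $ 3) / 2"
  \<comment> \<open>The half side is so small that the phase stays within [-1, 1] on the box, inside
    (-\<pi>/2, \<pi>/2); the summand 1 covers c = 0 and \<kappa> = 0.\<close>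
  define \<epsilon> where "\<epsilon> = 1 / ((\<bar>\<kappa>\<bar> * norm c + 1) * real CARD('d))"
  have d: "0 < real CARD('d)" by (simp add: zero_less_card_finite)
  have \<epsilon>: "\<epsilon> > 0" using d by (simp add: \<epsilon>_def add_nonneg_pos)
  define a where "a = (\<chi> i. - \<epsilon> :: real^'d)"
  define b where "b = (\<chi> i. \<epsilon> :: real^'d)"
  define \<phi> where "\<phi> x = (\<Prod>i\<in>UNIV. cut 1 (a $ i) (b $ i) (x $ i))" for x :: "real^'d"
  have test: "(\<lambda>x. complex_of_real (\<phi> x)) \<in> test_functions"
    using cut_test_function[of 1 a b] by (simp add: \<phi>_def)
  define \<Psi> where "\<Psi> x = (\<chi> j::3. complex_of_real (\<phi> x))" for x
  have \<Psi>: "\<Psi> \<in> X"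
    using test_function_Xs[OF adm test] by (simp add: X_iff \<Psi>_def)
  have \<phi>0: "0 \<le> \<phi> x" for x unfolding \<phi>_def by (intro prod_nonneg cut_bounds)
  have \<phi>box: "\<phi> x > 0 \<longleftrightarrow> x \<in> box a b" for x
  proof
    assume "\<phi> x > 0"
    then have "cut 1 (a $ i) (b $ i) (x $ i) \<noteq> 0" for i unfolding \<phi>_def by (auto simp: less_le)
    then show "x \<in> box a b" using cut_eq_0 unfolding mem_box_cart by (metis not_le)
  qed (auto simp: \<phi>_def mem_box_cart intro!: prod_pos cut_pos)
  have cospos: "cos (\<kappa> * (c \<bullet> x)) > 0" if "x \<in> box a b" for x
  proof -
    have "norm x \<le> (\<Sum>i\<in>UNIV. \<bar>x $ i\<bar>)" by (rule norm_le_l1_cart)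
    also have "\<dots> \<le> (\<Sum>i\<in>(UNIV :: 'd set). \<epsilon>)"
      using that by (intro sum_mono) (auto simp: mem_box_cart a_def b_def abs_le_iff less_imp_le minus_le_iff)
    finally have nx: "norm x \<le> real CARD('d) * \<epsilon>" by simp
    have "\<bar>\<kappa> * (c \<bullet> x)\<bar> \<le> \<bar>\<kappa>\<bar> * (norm c * norm x)"
      unfolding abs_mult by (intro mult_left_mono Cauchy_Schwarz_ineq2) auto
    also have "\<dots> \<le> \<bar>\<kappa>\<bar> * (norm c * (real CARD('d) * \<epsilon>))"
      using nx by (intro mult_left_mono) auto
    also have "\<dots> = \<bar>\<kappa>\<bar> * norm c / (\<bar>\<kappa>\<bar> * norm c + 1)"
      using d by (simp add: \<epsilon>_def)
    also have "\<dots> \<le> 1" by (simp add: divide_le_eq add_nonneg_pos)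
    finally have "\<bar>\<kappa> * (c \<bullet> x)\<bar> \<le> 1" .
    then have "\<bar>\<kappa> * (c \<bullet> x)\<bar> < pi / 2" using pi_gt3 by linarith
    then show ?thesis using cos_gt_zero_pi[of "\<kappa> * (c \<bullet> x)"] by (simp add: abs_less_iff)
  qed
  define F where "F x = cos (\<kappa> * (c \<bullet> x)) * (\<phi> x) ^ 3" for x
  have ReF: "Re (th x * \<Psi> x $ 1 * \<Psi> x $ 2 * cnj (\<Psi> x $ 3)) = F x" for x
    by (simp add: th_def \<Psi>_def F_def \<kappa>_def power3_eq_cube)
  have int: "integrable lborel (\<lambda>x. th x * \<Psi> x $ 1 * \<Psi> x $ 2 * cnj (\<Psi> x $ 3))"
    by (rule triple_int(1)) (intro X_Lp \<Psi>)+
  have Fint: "integrable lborel F" using integrable_Re[OF int] by (simp only: ReF)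
  have NF: "N \<Psi> = - (\<integral>x. F x \<partial>lborel)"
    unfolding N_eq integral_Re[OF int, symmetric] ReF ..
  have F0: "0 \<le> F x" for x
  proof (cases "x \<in> box a b")
    case True
    then show ?thesis using cospos[OF True] \<phi>0[of x] by (simp add: F_def)
  next
    case False
    then have "\<phi> x = 0" using \<phi>box[of x] \<phi>0[of x] by (simp add: less_le)
    then show ?thesis by (simp add: F_def)
  qed
  have "N \<Psi> \<noteq> 0"
  proof
    assume "N \<Psi> = 0"
    then have "(\<integral>x. F x \<partial>lborel) = 0" using NF by simp
    then have "AE x in lborel. F x = 0"
      by (subst (asm) integral_nonneg_eq_0_iff_AE) (use Fint F0 in auto)
    then have "AE x in lborel. x \<notin> box a b"
    proof eventually_elim
      case (elim x)
      then show ?case using cospos[of x] \<phi>box[of x] by (auto simp: F_def)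
    qed
    then have "emeasure lborel (box a b) = 0"
      by (subst (asm) AE_iff_measurable[of "box a b"]) auto
    moreover have "emeasure lborel (box a b) = ennreal (\<Prod>i\<in>Basis. (b - a) \<bullet> i)"
      by (rule emeasure_lborel_box) (use \<epsilon> in \<open>auto simp: Basis_vec_def inner_axis a_def b_def\<close>)
    moreover have "(\<Prod>i\<in>Basis. (b - a) \<bullet> i) > 0"
      by (rule prod_pos) (use \<epsilon> in \<open>auto simp: Basis_vec_def inner_axis a_def b_def\<close>)
    ultimately show False by (simp add: ennreal_eq_0_iff)
  qed
  with \<Psi> show ?thesis by blast
qed

lemma A_nonempty: "A \<noteq> {}"
  using exists_N_nonzero scale_in_A(1) by blast

lemma m_Inf: "m = Inf (S_til \<sigma> c \<omega> ` A)"
  by (simp add: m_til_def A_def)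

lemma S_nonneg: "\<Psi> \<in> A \<Longrightarrow> 0 \<le> S_til \<sigma> c \<omega> \<Psi>"
  using A_D(4)[of \<Psi>] H_nonneg[of \<Psi>] by simp

lemma m_le: "\<Psi> \<in> A \<Longrightarrow> m \<le> S_til \<sigma> c \<omega> \<Psi>"
  unfolding m_Inf by (intro cInf_lower bdd_belowI[of _ 0]) (auto intro: S_nonneg)

lemma m_le_H: "\<Psi> \<in> A \<Longrightarrow> 6 * m \<le> H \<Psi>"
  using m_le[of \<Psi>] A_D(4)[of \<Psi>] by simp

text \<open>On the Nehari set H = -3N, so H^2 = 9 N^2 \<le> 9 C H^3 keeps H away from 0. C + 1
  instead of C avoids division by zero.\<close>

lemma m_pos: "0 < m"
proof -
  obtain C where C: "0 \<le> C" "\<And>\<Psi>. \<Psi> \<in> X \<Longrightarrow> (N \<Psi>)\<^sup>2 \<le> C * (H \<Psi>) ^ 3"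
    by (rule N_bound) (rule that; blast)
  define \<delta> where "\<delta> = 1 / (54 * (C + 1))"
  have \<delta>: "\<delta> > 0" using C by (simp add: \<delta>_def)
  have "\<delta> \<le> S_til \<sigma> c \<omega> \<Psi>" if "\<Psi> \<in> A" for \<Psi>
  proof -
    note D = A_D[OF that]
    have Hp: "H \<Psi> > 0" by (rule H_pos[OF D(1,2)])
    have "H \<Psi> = - 3 * N \<Psi>" using D(3) by simp
    then have "(H \<Psi>)\<^sup>2 = 9 * (N \<Psi>)\<^sup>2" by (simp add: power_mult_distrib)
    also have "\<dots> \<le> 9 * (C * (H \<Psi>) ^ 3)" using C(2)[OF D(1)] by simp
    also have "\<dots> \<le> 9 * ((C + 1) * (H \<Psi>) ^ 3)" using Hp by (intro mult_left_mono mult_right_mono) auto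
    also have "\<dots> = (H \<Psi>)\<^sup>2 * (9 * (C + 1) * H \<Psi>)" by (simp add: power2_eq_square power3_eq_cube)
    finally have "1 \<le> 9 * (C + 1) * H \<Psi>" using Hp by simp
    then have "1 / (9 * (C + 1)) \<le> H \<Psi>" using C by (simp add: field_simps)
    then show ?thesis unfolding D(4) \<delta>_def using C by (simp add: field_simps)
  qed
  then have "\<delta> \<le> m" unfolding m_Inf using A_nonempty by (intro cInf_greatest) auto
  then show ?thesis using \<delta> by simp
qed

text \<open>Rescaled to the Nehari set, \<Psi> has H^3/(9 N^2) in place of H, which is at least 6m;
  54 is 6 times 9. Minimisers attain equality.\<close>

lemma sharp_bound:
  assumes "\<Psi> \<in> X"
  shows "54 * m * (N \<Psi>)\<^sup>2 \<le> (H \<Psi>) ^ 3"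
proof (cases "N \<Psi> = 0")
  case False
  from m_le_H[OF scale_in_A(1)[OF assms False]]
  have "6 * m \<le> (H \<Psi>) ^ 3 / (9 * (N \<Psi>)\<^sup>2)" unfolding scale_in_A(2)[OF assms False] .
  then show ?thesis using False by (simp add: field_simps)
qed (simp add: H_nonneg)

end

section \<open>Existence of a minimiser\<close>

lemma permute_3_distinct:
  fixes j k :: 3
  assumes "j \<noteq> k"
  shows "\<exists>l. (\<forall>f :: 3 \<Rightarrow> real. f 1 * f 2 * f 3 = f j * f k * f l \<and> f 1 + f 2 + f 3 = f j + f k + f l)"
proof -
  have "j = 1 \<or> j = 2 \<or> j = 3" "k = 1 \<or> k = 2 \<or> k = 3" using exhaust_3 by auto
  then consider "j = 1" "k = 2" | "j = 1" "k = 3" | "j = 2" "k = 1" | "j = 2" "k = 3" | "j = 3" "k = 1" | "j = 3" "k = 2"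
    using assms by blast
  then show ?thesis
  proof cases
    case 1 then show ?thesis by (intro exI[of _ 3]) (simp add: ac_simps)
  next
    case 2 then show ?thesis by (intro exI[of _ 2]) (simp add: ac_simps)
  next
    case 3 then show ?thesis by (intro exI[of _ 3]) (simp add: ac_simps)
  next
    case 4 then show ?thesis by (intro exI[of _ 1]) (simp add: ac_simps)
  next
    case 5 then show ?thesis by (intro exI[of _ 2]) (simp add: ac_simps)
  next
    case 6 then show ?thesis by (intro exI[of _ 1]) (simp add: ac_simps)
  qed
qed

text \<open>Normalised, y^2 \<le> x^3 and (1-y)^2 \<le> (1-x)^3. For 0 < x < 1 a cube is smaller
  than the square, so y < x and 1 - y < 1 - x, which is absurd: energy cannot be shared between
  limit and remainder.\<close>

lemma cube_split:
  fixes m h \<nu> :: real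
  assumes m: "0 < m" and h: "0 < h" "h \<le> 6 * m"
    and 1: "54 * m * (2 * m + \<nu>)\<^sup>2 \<le> (6 * m - h) ^ 3" and 2: "54 * m * \<nu>\<^sup>2 \<le> h ^ 3"
  shows "h = 6 * m" "\<nu> = - 2 * m"
proof -
  define x where "x = h / (6 * m)"
  define y where "y = - \<nu> / (2 * m)"
  have hx: "h = 6 * m * x" "\<nu> = - 2 * m * y" using m by (auto simp: x_def y_def)
  have "216 * m ^ 3 * (1 - y)\<^sup>2 \<le> 216 * m ^ 3 * (1 - x) ^ 3"
    using 1 unfolding hx by (simp add: power2_eq_square power3_eq_cube algebra_simps)
  then have y1: "(1 - y)\<^sup>2 \<le> (1 - x) ^ 3" using m by simp
  have "216 * m ^ 3 * y\<^sup>2 \<le> 216 * m ^ 3 * x ^ 3"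
    using 2 unfolding hx by (simp add: power2_eq_square power3_eq_cube algebra_simps)
  then have y2: "y\<^sup>2 \<le> x ^ 3" using m by simp
  have x: "0 < x" "x \<le> 1" using h m by (auto simp: x_def)
  have "x = 1"
  proof (rule ccontr)
    assume "x \<noteq> 1"
    then have x1: "x < 1" using x by simp
    have "z ^ 3 < z\<^sup>2" if "0 < z" "z < 1" for z :: real
      using power_strict_decreasing[of 2 3 z] that by simp
    then have "y\<^sup>2 < x\<^sup>2" "(1 - y)\<^sup>2 < (1 - x)\<^sup>2"
      using x x1 by (auto intro: order_le_less_trans[OF y1] order_le_less_trans[OF y2])
    then have "y < x" "1 - y < 1 - x"
      using power_less_imp_less_base[of y 2 x] power_less_imp_less_base[of "1 - y" 2 "1 - x"] x by auto
    then show False by simp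
  qed
  moreover from this have "y = 1" using y1 by simp
  ultimately show "h = 6 * m" "\<nu> = - 2 * m" using hx by auto
qed

context triple_setup
begin

definition T :: "(real^'d \<Rightarrow> complex) \<Rightarrow> (real^'d \<Rightarrow> complex) \<Rightarrow> (real^'d \<Rightarrow> complex) \<Rightarrow> complex" where
  "T u v w = (\<integral>x. th x * u x * v x * cnj (w x) \<partial>lborel)"

lemma N_T: "N \<Psi> = - Re (T (\<lambda>x. \<Psi> x $ 1) (\<lambda>x. \<Psi> x $ 2) (\<lambda>x. \<Psi> x $ 3))"
  by (simp add: N_eq T_def)

lemma T_expand:
  assumes u: "u \<in> Lp (p 1)" "u' \<in> Lp (p 1)" and v: "v \<in> Lp (p 2)" "v' \<in> Lp (p 2)" and w: "w \<in> Lp (p 3)" "w' \<in> Lp (p 3)"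
  shows "T (\<lambda>x. u x + u' x) (\<lambda>x. v x + v' x) (\<lambda>x. w x + w' x)
    = T u v w + T u v w' + T u v' w + T u v' w' + T u' v w + T u' v w' + T u' v' w + T u' v' w'"
proof -
  note i = triple_int(1)[OF u(1) v(1) w(1)] triple_int(1)[OF u(1) v(1) w(2)]
    triple_int(1)[OF u(1) v(2) w(1)] triple_int(1)[OF u(1) v(2) w(2)]
    triple_int(1)[OF u(2) v(1) w(1)] triple_int(1)[OF u(2) v(1) w(2)]
    triple_int(1)[OF u(2) v(2) w(1)] triple_int(1)[OF u(2) v(2) w(2)]
  have "T (\<lambda>x. u x + u' x) (\<lambda>x. v x + v' x) (\<lambda>x. w x + w' x) =
    (\<integral>x. th x * u x * v x * cnj (w x) + th x * u x * v x * cnj (w' x) + th x * u x * v' x * cnj (w x)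
      + th x * u x * v' x * cnj (w' x) + th x * u' x * v x * cnj (w x) + th x * u' x * v x * cnj (w' x)
      + th x * u' x * v' x * cnj (w x) + th x * u' x * v' x * cnj (w' x) \<partial>lborel)"
    unfolding T_def by (rule Bochner_Integration.integral_cong) (simp_all add: algebra_simps)
  also have "\<dots> = T u v w + T u v w' + T u v' w + T u v' w' + T u' v w + T u' v w' + T u' v' w + T u' v' w'"
    unfolding T_def by (simp only: Bochner_Integration.integral_add Bochner_Integration.integrable_add i)
  finally show ?thesis .
qed

text \<open>One slot j is constant in n, one slot k tends to zero locally, the third is only
  bounded: the situation of the truncation argument, whatever the positions.\<close>

lemma T_tendsto_0:
  fixes u :: "nat \<Rightarrow> 3 \<Rightarrow> real^'d \<Rightarrow> complex"
  assumes u: "\<And>n i. u n i \<in> Xs (\<gamma> i)" "\<And>n i. hj i (u n i) \<le> M"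
    and j: "\<And>n. u n j = a" and k: "j \<noteq> k" "(\<lambda>n. nw (u n k)) \<longlonglongrightarrow> 0"
  shows "(\<lambda>n. T (u n 1) (u n 2) (u n 3)) \<longlonglongrightarrow> 0"
proof -
  obtain l where l: "\<And>f :: 3 \<Rightarrow> real. f 1 * f 2 * f 3 = f j * f k * f l" "\<And>f :: 3 \<Rightarrow> real. f 1 + f 2 + f 3 = f j + f k + f l"
    using permute_3_distinct[OF k(1)] by blast
  obtain C where C: "0 \<le> C" "\<And>i v. v \<in> Xs (\<gamma> i) \<Longrightarrow> hj i v \<le> M \<Longrightarrow> (\<integral>x. cmod (v x) powr p i \<partial>lborel) \<le> C"
    "\<And>i v. v \<in> Xs (\<gamma> i) \<Longrightarrow> hj i v \<le> M \<Longrightarrow> nw v \<le> C"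
    by (rule Lp_uniform[of M]) (rule that; blast)
  have uLp: "u n i \<in> Lp (p i)" and uL: "u n i \<in> L2w" for n i
    using Xs_Lp[OF adm u(1)] Xs_L2w[OF adm u(1)] by auto
  have "(\<lambda>n. \<integral>x. cmod (a x) * cmod (u n k x) * cmod (u n l x) \<partial>lborel) \<longlonglongrightarrow> 0"
  proof (rule triple_tendsto_0[where p = "p j" and q = "p k" and r = "p l" and C = C])
    show "a \<in> Lp (p j)" using uLp[of 0 j] j by simp
    show "1 / p j + 1 / p k + 1 / p l = 1" using l(2)[of "\<lambda>i. 1 / p i"] pq by simp
  qed (rule uLp uL p0 C(2,3) u k(2))+
  moreover have "norm (T (u n 1) (u n 2) (u n 3)) \<le> (\<integral>x. cmod (a x) * cmod (u n k x) * cmod (u n l x) \<partial>lborel)" for n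
  proof -
    have "norm (T (u n 1) (u n 2) (u n 3)) \<le> (\<integral>x. cmod (u n 1 x) * cmod (u n 2 x) * cmod (u n 3 x) \<partial>lborel)"
      unfolding T_def by (rule triple_int(2)) (rule uLp)+
    also have "\<dots> = (\<integral>x. cmod (a x) * cmod (u n k x) * cmod (u n l x) \<partial>lborel)"
      using l(1)[of "\<lambda>i. cmod (u n i _)"] j by simp
    finally show ?thesis .
  qed
  ultimately show ?thesis by (rule Lim_null_comparison[OF eventuallyI, rotated])
qed

text \<open>Expanding f = g + \<psi> gives eight terms. The two pure ones are N of the remainder and
  of the limit; the other six are mixed and vanish.\<close>

lemma N_brezis_lieb:
  assumes f: "\<And>n. f n \<in> X" "\<And>n. H (f n) \<le> M" and \<psi>: "\<psi> \<in> X"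
    and lim: "\<And>j. (\<lambda>n. nw (\<lambda>x. f n x $ j - \<psi> x $ j)) \<longlonglongrightarrow> 0"
  shows "(\<lambda>n. N (f n) - N (\<lambda>x. f n x - \<psi> x) - N \<psi>) \<longlonglongrightarrow> 0"
proof -
  define g where "g n j x = f n x $ j - \<psi> x $ j" for n j x
  define \<psi>' where "\<psi>' j x = \<psi> x $ j" for j x
  define M' where "M' = 2 * M + 2 * H \<psi>"
  have gX: "g n j \<in> Xs (\<gamma> j)" for n j
    unfolding g_def by (rule Xs_diff[OF adm XD[OF f(1)] XD[OF \<psi>]])
  have \<psi>X: "\<psi>' j \<in> Xs (\<gamma> j)" for j unfolding \<psi>'_def by (rule XD[OF \<psi>])
  have M0: "0 \<le> M" using order_trans[OF H_nonneg f(2)] .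
  have gM: "hj j (g n j) \<le> M'" for n j
  proof -
    have "hj j (\<lambda>x. f n x $ j + (- 1) * \<psi> x $ j) \<le> hj j (\<lambda>x. f n x $ j) / (1 - 1/2) + hj j (\<lambda>x. (- 1) * \<psi> x $ j) / (1/2)"
      by (rule hs_triangle[OF adm XD[OF f(1)] Xs_cmult[OF XD[OF \<psi>]]]) (use s_pos[of j] in auto)
    moreover have "hj j (\<lambda>x. (- 1) * \<psi> x $ j) = hj j (\<lambda>x. \<psi> x $ j)"
      using hs_cmult_real[OF adm XD[OF \<psi>], where s = "1 / \<sigma> $ j" and a = "- 1"] by simp
    moreover have "(\<lambda>x. f n x $ j + (- 1) * \<psi> x $ j) = g n j" by (simp add: g_def[abs_def])
    ultimately have "hj j (g n j) \<le> 2 * hj j (\<lambda>x. f n x $ j) + 2 * hj j (\<lambda>x. \<psi> x $ j)"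
      by simp
    also have "\<dots> \<le> M'" unfolding M'_def
      using order_trans[OF hj_le_H f(2)] hj_le_H by (intro add_mono mult_left_mono) auto
    finally show ?thesis .
  qed
  have \<psi>M: "hj j (\<psi>' j) \<le> M'" for j
    unfolding \<psi>'_def M'_def using hj_le_H[of j \<psi>] H_nonneg[of \<psi>] M0 by linarith
  have glim: "(\<lambda>n. nw (g n j)) \<longlonglongrightarrow> 0" for j
    using lim[of j] by (simp add: g_def[abs_def])
  \<comment> \<open>S is the set of slots filled by the fixed \<psi>; a mixed term is one where S is
    neither empty nor everything.\<close>
  have part: "(\<lambda>n. T (if 1 \<in> S then \<psi>' 1 else g n 1) (if 2 \<in> S then \<psi>' 2 else g n 2) (if 3 \<in> S then \<psi>' 3 else g n 3)) \<longlonglongrightarrow> 0"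
    if S: "j \<in> S" "k \<notin> S" for S :: "3 set" and j k
    by (rule T_tendsto_0[where u = "\<lambda>n i. if i \<in> S then \<psi>' i else g n i" and M = M' and j = j and a = "\<psi>' j" and k = k])
      (use S in \<open>auto simp: gX \<psi>X gM \<psi>M glim\<close>)
  note p = part[of 1 "{1}" 2, simplified] part[of 2 "{2}" 1, simplified] part[of 3 "{3}" 1, simplified]
    part[of 1 "{1,2}" 3, simplified] part[of 1 "{1,3}" 2, simplified] part[of 2 "{2,3}" 1, simplified]
  have gL: "g n j \<in> Lp (p j)" and \<psi>L: "\<psi>' j \<in> Lp (p j)" for n j
    using Xs_Lp[OF adm] gX \<psi>X by auto
  have "(\<lambda>n. - Re (T (g n 1) (g n 2) (\<psi>' 3) + T (g n 1) (\<psi>' 2) (g n 3) + T (g n 1) (\<psi>' 2) (\<psi>' 3)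
      + T (\<psi>' 1) (g n 2) (g n 3) + T (\<psi>' 1) (g n 2) (\<psi>' 3) + T (\<psi>' 1) (\<psi>' 2) (g n 3))) \<longlonglongrightarrow> - Re (0 + 0 + 0 + 0 + 0 + 0)"
    by (intro tendsto_minus tendsto_Re tendsto_add p)
  moreover have "N (f n) - N (\<lambda>x. f n x - \<psi> x) - N \<psi> = - Re (T (g n 1) (g n 2) (\<psi>' 3) + T (g n 1) (\<psi>' 2) (g n 3) + T (g n 1) (\<psi>' 2) (\<psi>' 3)
      + T (\<psi>' 1) (g n 2) (g n 3) + T (\<psi>' 1) (g n 2) (\<psi>' 3) + T (\<psi>' 1) (\<psi>' 2) (g n 3))" for n
  proof -
    have 1: "N (f n) = - Re (T (\<lambda>x. g n 1 x + \<psi>' 1 x) (\<lambda>x. g n 2 x + \<psi>' 2 x) (\<lambda>x. g n 3 x + \<psi>' 3 x))"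
      by (simp add: N_T g_def \<psi>'_def)
    have 2: "N (\<lambda>x. f n x - \<psi> x) = - Re (T (g n 1) (g n 2) (g n 3))"
      by (simp add: N_T g_def[abs_def])
    have 3: "N \<psi> = - Re (T (\<psi>' 1) (\<psi>' 2) (\<psi>' 3))" by (simp add: N_T \<psi>'_def[abs_def])
    show ?thesis unfolding 1 2 3 T_expand[OF gL \<psi>L gL \<psi>L gL \<psi>L] by simp
  qed
  ultimately show ?thesis by simp
qed

text \<open>The phase is multiplicative, \<open>th (x + y)\<close> = \<open>th x\<close> *
  \<open>th y\<close>, so a plain shift would leave a factor behind. The third component enters N
  conjugated, and its constant phase restores exactly that factor.\<close>

lemma translate:
  fixes y :: "real^'d"
  assumes \<Psi>: "\<Psi> \<in> X"
  defines "\<Phi> \<equiv> \<lambda>x. \<chi> j. (if j = 3 then cnj (th y) else 1) * \<Psi> (x + y) $ j"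
  shows "\<Phi> \<in> X" "H \<Phi> = H \<Psi>" "N \<Phi> = N \<Psi>"
proof -
  have \<Phi>j: "(\<lambda>x. \<Phi> x $ j) = (\<lambda>x. (if j = 3 then cnj (th y) else 1) * \<Psi> (x + y) $ j)" for j
    by (simp add: \<Phi>_def)
  have a: "cmod (if j = 3 then cnj (th y) else 1) = 1" for j :: 3 by simp
  show "\<Phi> \<in> X" unfolding X_iff \<Phi>j by (intro allI Xs_shift(1)[OF XD[OF \<Psi>] a])
  show "H \<Phi> = H \<Psi>" unfolding H_sum \<Phi>j Xs_shift(2)[OF XD[OF \<Psi>] a] ..
  have [measurable]: "(\<lambda>x. \<Psi> x $ j) \<in> borel_measurable borel" for j by (rule X_borel[OF \<Psi>])
  have "th (x + y) = th x * th y" for x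
    by (simp add: th_def cis_mult inner_add_right distrib_left)
  moreover have "(3::3) \<noteq> 1" "(3::3) \<noteq> 2" by simp_all
  ultimately have "th x * \<Phi> x $ 1 * \<Phi> x $ 2 * cnj (\<Phi> x $ 3) = th (x + y) * \<Psi> (x + y) $ 1 * \<Psi> (x + y) $ 2 * cnj (\<Psi> (x + y) $ 3)" for x
    unfolding \<Phi>_def by simp
  then have "(\<integral>x. th x * \<Phi> x $ 1 * \<Phi> x $ 2 * cnj (\<Phi> x $ 3) \<partial>lborel) = (\<integral>x. th x * \<Psi> x $ 1 * \<Psi> x $ 2 * cnj (\<Psi> x $ 3) \<partial>lborel)"
    using lborel_shift(2)[of "\<lambda>x. th x * \<Psi> x $ 1 * \<Psi> x $ 2 * cnj (\<Psi> x $ 3)" y] by simp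
  then show "N \<Phi> = N \<Psi>" by (simp add: N_eq)
qed

text \<open>The energies must converge component by component, not only in sum, because the
  splitting lemma is applied to each component.\<close>

lemma weak_compactness:
  assumes f: "\<And>n. f n \<in> X" "\<And>n. H (f n) \<le> M"
  obtains r :: "nat \<Rightarrow> nat" and u :: "3 \<Rightarrow> real^'d \<Rightarrow> complex" and l :: "real^3" where "strict_mono r"
    "\<And>j. u j \<in> L2w" "\<And>j. (\<lambda>n. nw (\<lambda>x. f (r n) x $ j - u j x)) \<longlonglongrightarrow> 0"
    "\<And>j. (\<lambda>n. hj j (\<lambda>x. f (r n) x $ j)) \<longlonglongrightarrow> l $ j"
proof -
  have bd: "hj j (\<lambda>x. f n x $ j) \<le> M" for n j using order_trans[OF hj_le_H f(2)] .
  have sub: "(\<lambda>n. nw (\<lambda>x. g (q n) x - u x)) \<longlonglongrightarrow> 0" if "(\<lambda>n. nw (\<lambda>x. g n x - u x)) \<longlonglongrightarrow> 0" "strict_mono q"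
    for g :: "nat \<Rightarrow> real^'d \<Rightarrow> complex" and u and q :: "nat \<Rightarrow> nat"
    using LIMSEQ_subseq_LIMSEQ[OF that] by (simp add: o_def)
  obtain r1 u1 where r1: "strict_mono r1" "u1 \<in> L2w" "(\<lambda>n. nw (\<lambda>x. f (r1 n) x $ 1 - u1 x)) \<longlonglongrightarrow> 0"
    by (rule rellich[OF adm s_pos, of "\<lambda>n x. f n x $ 1" 1 1 M]) (use XD[OF f(1)] bd in auto)
  obtain r2 u2 where r2: "strict_mono r2" "u2 \<in> L2w" "(\<lambda>n. nw (\<lambda>x. f (r1 (r2 n)) x $ 2 - u2 x)) \<longlonglongrightarrow> 0"
    by (rule rellich[OF adm s_pos, of "\<lambda>n x. f (r1 n) x $ 2" 2 2 M]) (use XD[OF f(1)] bd in auto)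
  obtain r3 u3 where r3: "strict_mono r3" "u3 \<in> L2w" "(\<lambda>n. nw (\<lambda>x. f (r1 (r2 (r3 n))) x $ 3 - u3 x)) \<longlonglongrightarrow> 0"
    by (rule rellich[OF adm s_pos, of "\<lambda>n x. f (r1 (r2 n)) x $ 3" 3 3 M]) (use XD[OF f(1)] bd in auto)
  \<comment> \<open>Collected in a vector, the three energies need a single application of
    Bolzano--Weierstrass.\<close>
  define a where "a n = (\<chi> j. hj j (\<lambda>x. f (r1 (r2 (r3 n))) x $ j) :: real^3)" for n
  have "norm (a n) \<le> 3 * M" for n
  proof -
    have "norm (a n) \<le> (\<Sum>j\<in>UNIV. \<bar>a n $ j\<bar>)" by (rule norm_le_l1_cart)
    also have "\<dots> \<le> (\<Sum>j\<in>(UNIV :: 3 set). M)"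
      by (intro sum_mono) (simp add: a_def bd abs_of_nonneg[OF hj_nonneg])
    finally show ?thesis by simp
  qed
  then have "bounded (range a)" by (auto simp: bounded_iff)
  then obtain l r4 where r4: "strict_mono (r4 :: nat \<Rightarrow> nat)" "(a \<circ> r4) \<longlonglongrightarrow> l"
    using bounded_imp_convergent_subsequence by blast
  define r where "r n = r1 (r2 (r3 (r4 n)))" for n
  define u where "u j = (if j = 1 then u1 else if j = 2 then u2 else u3)" for j :: 3
  have "strict_mono r" using r1(1) r2(1) r3(1) r4(1) by (simp add: r_def strict_mono_def)
  moreover have "u j \<in> L2w" for j by (simp add: u_def r1 r2 r3)
  moreover have "(\<lambda>n. nw (\<lambda>x. f (r n) x $ j - u j x)) \<longlonglongrightarrow> 0" for j
  proof -
    have 34: "strict_mono (\<lambda>n. r3 (r4 n))" "strict_mono (\<lambda>n. r2 (r3 (r4 n)))"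
      using r2(1) r3(1) r4(1) by (auto simp: strict_mono_def)
    have "(\<lambda>n. nw (\<lambda>x. f (r n) x $ 1 - u1 x)) \<longlonglongrightarrow> 0" "(\<lambda>n. nw (\<lambda>x. f (r n) x $ 2 - u2 x)) \<longlonglongrightarrow> 0"
      "(\<lambda>n. nw (\<lambda>x. f (r n) x $ 3 - u3 x)) \<longlonglongrightarrow> 0"
      using sub[OF r1(3) 34(2)] sub[OF r2(3) 34(1)] sub[OF r3(3) r4(1)] by (simp_all add: r_def)
    moreover have "j = 1 \<or> j = 2 \<or> j = 3" by (rule exhaust_3)
    ultimately show ?thesis by (auto simp: u_def)
  qed
  moreover have "(\<lambda>n. hj j (\<lambda>x. f (r n) x $ j)) \<longlonglongrightarrow> l $ j" for j
    using tendsto_vec_nth[OF r4(2), of j] by (simp add: a_def r_def)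
  ultimately show thesis by (rule that)
qed

lemma minimizing_sequence:
  obtains f :: "nat \<Rightarrow> real^'d \<Rightarrow> complex^3" and j L \<epsilon>
  where "\<And>n. f n \<in> X" "\<And>n. H (f n) \<le> 6 * m + 6" "(\<lambda>n. H (f n)) \<longlonglongrightarrow> 6 * m" "\<And>n. 3 * N (f n) = - H (f n)"
    "\<epsilon> > 0" "\<And>n. \<epsilon> < cmod (av L (\<lambda>x. f n x $ j) 0)"
proof -
  have "\<forall>n. \<exists>\<Psi>. \<Psi> \<in> A \<and> S_til \<sigma> c \<omega> \<Psi> < m + 1 / real (Suc n)"
  proof
    fix n
    have "Inf (S_til \<sigma> c \<omega> ` A) < m + 1 / real (Suc n)" unfolding m_Inf[symmetric] by simp
    then show "\<exists>\<Psi>. \<Psi> \<in> A \<and> S_til \<sigma> c \<omega> \<Psi> < m + 1 / real (Suc n)"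
      using cInf_lessD[of "S_til \<sigma> c \<omega> ` A"] A_nonempty by blast
  qed
  from choice[OF this] obtain P where P': "\<forall>n. P n \<in> A \<and> S_til \<sigma> c \<omega> (P n) < m + 1 / real (Suc n)" ..
  then have P: "P n \<in> A" "S_til \<sigma> c \<omega> (P n) < m + 1 / real (Suc n)" for n by auto
  note PD = A_D[OF P(1)]
  have Hlow: "6 * m \<le> H (P n)" for n by (rule m_le_H[OF P(1)])
  have Hup: "H (P n) \<le> 6 * m + 6 * (1 / real (Suc n))" for n
    using P(2)[of n] PD(4)[of n] by linarith
  have HM: "H (P n) \<le> 6 * m + 6" for n
  proof -
    have "1 / real (Suc n) \<le> 1" by simp
    then show ?thesis using Hup[of n] by linarith
  qed
  have Hlim: "(\<lambda>n. H (P n)) \<longlonglongrightarrow> 6 * m"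
  proof (rule tendsto_sandwich[OF _ _ tendsto_const])
    show "(\<lambda>n. 6 * m + 6 * (1 / real (Suc n))) \<longlonglongrightarrow> 6 * m" by real_asymp
    show "\<forall>\<^sub>F n in sequentially. 6 * m \<le> H (P n)"
      "\<forall>\<^sub>F n in sequentially. H (P n) \<le> 6 * m + 6 * (1 / real (Suc n))"
      by (intro always_eventually allI Hlow Hup)+
  qed
  \<comment> \<open>A component with positive \<gamma> has a subcritical exponent, and only such a
    component can be kept from vanishing.\<close>
  obtain j where j: "\<gamma> j > 0" using pos by blast
  obtain k l where kl: "\<And>f :: 3 \<Rightarrow> real. f 1 * f 2 * f 3 = f j * f k * f l" "\<And>f :: 3 \<Rightarrow> real. f 1 + f 2 + f 3 = f j + f k + f l"
    by (rule permute_3[of j]) (rule that)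
  obtain C where C: "0 \<le> C" "\<And>i v. v \<in> Xs (\<gamma> i) \<Longrightarrow> hj i v \<le> 6 * m + 6 \<Longrightarrow> (\<integral>x. cmod (v x) powr p i \<partial>lborel) \<le> C"
    by (rule Lp_uniform[of "6 * m + 6"]) (rule that; blast)
  \<comment> \<open>The other two components take at most m of the total \<bar>N\<bar> \<ge> 2m, so
    at least m is left for component j; this determines the threshold \<delta>.\<close>
  obtain \<eta> where \<eta>: "0 < \<eta>" "\<eta> powr p k * C + \<eta> powr p l * C < m"
    by (rule small_powers[OF p0 p0 m_pos])
  define \<delta> where "\<delta> = m / \<eta> powr (- 2 * p j)"
  have \<delta>: "\<delta> > 0" using m_pos \<eta> by (simp add: \<delta>_def)
  have big: "\<delta> \<le> (\<integral>x. cmod (P n x $ j) powr p j \<partial>lborel)" for n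
  proof -
    have "2 * m \<le> \<bar>N (P n)\<bar>" using PD(3)[of n] Hlow[of n] by linarith
    also have "\<dots> \<le> (\<integral>x. cmod (P n x $ j) * cmod (P n x $ k) * cmod (P n x $ l) \<partial>lborel)"
      by (rule N_le_triple[OF PD(1) kl(1)])
    also have "\<dots> \<le> \<eta> powr (- 2 * p j) * (\<integral>x. cmod (P n x $ j) powr p j \<partial>lborel)
        + \<eta> powr p k * (\<integral>x. cmod (P n x $ k) powr p k \<partial>lborel) + \<eta> powr p l * (\<integral>x. cmod (P n x $ l) powr p l \<partial>lborel)"
      by (rule triple_integrable(2)[OF X_Lp X_Lp X_Lp p0 p0 p0]) (use PD(1) \<eta> kl(2)[of "\<lambda>i. 1 / p i"] pq in auto)
    also have "\<dots> \<le> \<eta> powr (- 2 * p j) * (\<integral>x. cmod (P n x $ j) powr p j \<partial>lborel) + \<eta> powr p k * C + \<eta> powr p l * C"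
      by (intro add_mono mult_left_mono C(2) XD PD(1) order_trans[OF hj_le_H HM]) auto
    finally have "m \<le> \<eta> powr (- 2 * p j) * (\<integral>x. cmod (P n x $ j) powr p j \<partial>lborel)"
      using \<eta>(2) by linarith
    then show ?thesis using \<eta>(1) by (simp add: \<delta>_def pos_divide_le_eq mult.commute)
  qed
  have M6: "0 < 6 * m + 6" using m_pos by simp
  obtain L \<epsilon> where \<epsilon>: "\<epsilon> > 0" "\<And>u :: real^'d \<Rightarrow> complex. u \<in> Xs (\<gamma> j) \<Longrightarrow> hj j u \<le> 6 * m + 6 \<Longrightarrow>
      \<delta> \<le> (\<integral>x. cmod (u x) powr p j \<partial>lborel) \<Longrightarrow> \<exists>x. \<epsilon> < cmod (av L u x)"
    by (rule nonvanishing[OF adm s_pos j \<delta> M6]) (rule that; blast)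
  have "\<forall>n. \<exists>x. \<epsilon> < cmod (av L (\<lambda>x. P n x $ j) x)"
    by (intro allI \<epsilon>(2) XD PD(1) big order_trans[OF hj_le_H HM])
  from choice[OF this] obtain z where z: "\<forall>n. \<epsilon> < cmod (av L (\<lambda>x. P n x $ j) (z n))" ..
  \<comment> \<open>The corner of the box around \<open>z n\<close>: after this translation the
    large average sits in the box at the origin, independently of n.\<close>
  define y where "y n = lo L (z n)" for n
  define f where "f n x = (\<chi> i. (if i = 3 then cnj (th (y n)) else 1) * P n (x + y n) $ i)" for n x
  show thesis
  proof (rule that[of f \<epsilon> L j])
    show "f n \<in> X" for n using translate(1)[OF PD(1)[of n], where y = "y n"] by (simp add: f_def[abs_def])
    have Hf: "H (f n) = H (P n)" for n using translate(2)[OF PD(1)[of n], where y = "y n"] by (simp add: f_def[abs_def])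
    have Nf: "N (f n) = N (P n)" for n using translate(3)[OF PD(1)[of n], where y = "y n"] by (simp add: f_def[abs_def])
    show "H (f n) \<le> 6 * m + 6" "3 * N (f n) = - H (f n)" for n using Hf Nf HM PD(3) by auto
    show "(\<lambda>n. H (f n)) \<longlonglongrightarrow> 6 * m" using Hlim by (simp add: Hf)
    show "\<epsilon> > 0" by fact
    show "\<epsilon> < cmod (av L (\<lambda>x. f n x $ j) 0)" for n
      using z av_shift_lo[OF X_borel[OF PD(1)[of n], of j], where N = L and a = "if j = 3 then cnj (th (y n)) else 1" and x = "z n"]
      by (auto simp: f_def y_def norm_mult)
  qed
qed

lemma minimizer_exists: "\<exists>\<Psi>\<in>A. S_til \<sigma> c \<omega> \<Psi> = m"
proof -
  obtain f0 :: "nat \<Rightarrow> real^'d \<Rightarrow> complex^3" and j0 L \<epsilon> where f0: "\<And>n. f0 n \<in> X" "\<And>n. H (f0 n) \<le> 6 * m + 6"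
    "(\<lambda>n. H (f0 n)) \<longlonglongrightarrow> 6 * m" "\<And>n. 3 * N (f0 n) = - H (f0 n)"
    and \<epsilon>: "\<epsilon> > 0" "\<And>n. \<epsilon> < cmod (av L (\<lambda>x. f0 n x $ j0) 0)"
    by (rule minimizing_sequence) (rule that)
  obtain r u l where r: "strict_mono (r :: nat \<Rightarrow> nat)"
    and u: "\<And>j. u j \<in> L2w" "\<And>j. (\<lambda>n. nw (\<lambda>x. f0 (r n) x $ j - u j x)) \<longlonglongrightarrow> 0"
    and l: "\<And>j. (\<lambda>n. hj j (\<lambda>x. f0 (r n) x $ j)) \<longlonglongrightarrow> l $ j"
    by (rule weak_compactness[OF f0(1,2)]) (rule that)
  define f where "f n = f0 (r n)" for n
  define \<psi> where "\<psi> x = (\<chi> j. u j x)" for x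
  have f: "f n \<in> X" "H (f n) \<le> 6 * m + 6" "3 * N (f n) = - H (f n)" "\<epsilon> < cmod (av L (\<lambda>x. f n x $ j0) 0)" for n
    using f0 \<epsilon> by (auto simp: f_def)
  have Hf: "(\<lambda>n. H (f n)) \<longlonglongrightarrow> 6 * m"
    using LIMSEQ_subseq_LIMSEQ[OF f0(3) r] by (simp add: o_def f_def)
  have \<psi>j: "(\<lambda>x. \<psi> x $ j) = u j" for j by (simp add: \<psi>_def)
  note split = hs_split[OF adm s_pos XD[OF f(1)] l[folded f_def] u(1) u(2)[folded f_def]]
  have \<psi>: "\<psi> \<in> X" unfolding X_iff \<psi>j by (intro allI split(1))
  \<comment> \<open>Averages over a fixed box are continuous for local convergence, and those of
    component \<open>j0\<close> at the origin stay above \<epsilon>.\<close>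
  have "nonzero \<psi>"
  proof (rule ccontr)
    assume "\<not> nonzero \<psi>"
    then have "AE x in lborel. \<psi> x = 0" by (simp add: nonzero_def)
    then have "AE x in lborel. u j0 x = 0"
      by eventually_elim (simp add: \<psi>_def vec_eq_iff)
    then have "av L (u j0) 0 = 0"
      unfolding av_def set_lebesgue_integral_def
      by (subst integral_eq_zero_AE) (auto elim!: eventually_mono)
    moreover have "(\<lambda>n. av L (\<lambda>x. f n x $ j0) 0) \<longlonglongrightarrow> av L (u j0) 0"
      by (rule L2w_av_tendsto) (use u f_def Xs_L2w[OF adm XD[OF f(1)]] in auto)
    ultimately have "(\<lambda>n. cmod (av L (\<lambda>x. f n x $ j0) 0)) \<longlonglongrightarrow> 0"
      using tendsto_norm_zero by simp
    then have "\<epsilon> \<le> 0" by (rule tendsto_lowerbound) (use f(4) less_imp_le in \<open>auto intro!: always_eventually\<close>)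
    then show False using \<epsilon>(1) by simp
  qed
  then have hp: "H \<psi> > 0" by (rule H_pos[OF \<psi>])
  have "(\<lambda>n. \<Sum>j\<in>UNIV. hj j (\<lambda>x. f n x $ j)) \<longlonglongrightarrow> (\<Sum>j\<in>UNIV. l $ j)"
    unfolding f_def by (intro tendsto_sum l)
  then have suml: "(\<Sum>j\<in>UNIV. l $ j) = 6 * m"
    using Hf LIMSEQ_unique unfolding H_sum by blast
  \<comment> \<open>Summing the three splittings with the same e; the limits \<open>l $ j\<close>
    add up to 6m.\<close>
  have remainder: "\<forall>\<^sub>F n in sequentially. H (\<lambda>x. f n x - \<psi> x) \<le> 6 * m - H \<psi> + 3 * e" if "e > 0" for e
  proof -
    have "\<forall>\<^sub>F n in sequentially. \<forall>j\<in>UNIV. hj j (\<lambda>x. f n x $ j - u j x) \<le> l $ j - hj j (u j) + e"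
      by (intro eventually_ball_finite finite ballI split(2) that)
    then show ?thesis
    proof eventually_elim
      case (elim n)
      have "H (\<lambda>x. f n x - \<psi> x) = (\<Sum>j\<in>UNIV. hj j (\<lambda>x. f n x $ j - u j x))"
        unfolding H_sum by (simp add: \<psi>_def)
      also have "\<dots> \<le> (\<Sum>j\<in>UNIV. l $ j - hj j (u j) + e)" using elim by (intro sum_mono) auto
      also have "\<dots> = (\<Sum>j\<in>UNIV. l $ j) - H \<psi> + 3 * e"
        unfolding H_sum \<psi>j by (simp add: sum.distrib sum_subtractf)
      finally show ?case unfolding suml .
    qed
  qed
  have nonneg: "0 \<le> 6 * m - H \<psi> + 3 * e" if "e > 0" for e
    using eventually_happens'[OF sequentially_bot remainder[OF that]] H_nonneg order_trans by blast
  have h6: "H \<psi> \<le> 6 * m"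
  proof (rule field_le_epsilon)
    fix e :: real assume "e > 0"
    then show "H \<psi> \<le> 6 * m + e" using nonneg[of "e / 3"] by simp
  qed
  have "(\<lambda>n. N (f n) - N (\<lambda>x. f n x - \<psi> x) - N \<psi>) \<longlonglongrightarrow> 0"
    by (rule N_brezis_lieb[OF f(1,2) \<psi>]) (use u(2) in \<open>simp add: f_def \<psi>_def\<close>)
  moreover have "(\<lambda>n. N (f n)) \<longlonglongrightarrow> - 2 * m"
  proof -
    have "(\<lambda>n. - H (f n) / 3) \<longlonglongrightarrow> - (6 * m) / 3" by (intro tendsto_intros Hf) simp
    moreover have "- H (f n) / 3 = N (f n)" for n using f(3)[of n] by linarith
    ultimately show ?thesis by simp
  qed
  ultimately have "(\<lambda>n. N (f n) - (N (f n) - N (\<lambda>x. f n x - \<psi> x) - N \<psi>) - N \<psi>) \<longlonglongrightarrow> - 2 * m - 0 - N \<psi>"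
    by (intro tendsto_diff tendsto_const)
  then have Nlim: "(\<lambda>n. N (\<lambda>x. f n x - \<psi> x)) \<longlonglongrightarrow> - 2 * m - N \<psi>" by simp
  \<comment> \<open>The sharp inequality for the remainder in the limit n to infinity. Its energy is
    only bounded above by the splitting, which is the direction needed here; then e tends to
    0.\<close>
  have cube: "54 * m * (- 2 * m - N \<psi>)\<^sup>2 \<le> (6 * m - H \<psi> + 3 * e) ^ 3" if "e > 0" for e
  proof (rule tendsto_upperbound)
    show "(\<lambda>n. 54 * m * (N (\<lambda>x. f n x - \<psi> x))\<^sup>2) \<longlonglongrightarrow> 54 * m * (- 2 * m - N \<psi>)\<^sup>2"
      by (intro tendsto_mult tendsto_const tendsto_power Nlim)
    show "\<forall>\<^sub>F n in sequentially. 54 * m * (N (\<lambda>x. f n x - \<psi> x))\<^sup>2 \<le> (6 * m - H \<psi> + 3 * e) ^ 3"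
      using remainder[OF that]
    proof eventually_elim
      case (elim n)
      have "54 * m * (N (\<lambda>x. f n x - \<psi> x))\<^sup>2 \<le> H (\<lambda>x. f n x - \<psi> x) ^ 3" by (rule sharp_bound[OF X_diff[OF f(1) \<psi>]])
      also have "\<dots> \<le> (6 * m - H \<psi> + 3 * e) ^ 3" by (intro power_mono elim H_nonneg)
      finally show ?case .
    qed
  qed simp
  have "54 * m * (- 2 * m - N \<psi>)\<^sup>2 \<le> (6 * m - H \<psi>) ^ 3"
  proof (rule tendsto_lowerbound)
    have "((\<lambda>e. (6 * m - H \<psi> + 3 * e) ^ 3) \<longlongrightarrow> (6 * m - H \<psi> + 3 * 0) ^ 3) (at_right 0)"
      by (intro tendsto_intros)
    then show "((\<lambda>e. (6 * m - H \<psi> + 3 * e) ^ 3) \<longlongrightarrow> (6 * m - H \<psi>) ^ 3) (at_right 0)" by simp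
    show "\<forall>\<^sub>F e in at_right 0. 54 * m * (- 2 * m - N \<psi>)\<^sup>2 \<le> (6 * m - H \<psi> + 3 * e) ^ 3"
      using eventually_at_right_less by eventually_elim (rule cube)
  qed (rule trivial_limit_at_right_real)
  moreover have "(- 2 * m - N \<psi>)\<^sup>2 = (2 * m + N \<psi>)\<^sup>2" by (simp add: power2_eq_square algebra_simps)
  ultimately have 1: "54 * m * (2 * m + N \<psi>)\<^sup>2 \<le> (6 * m - H \<psi>) ^ 3" by simp
  \<comment> \<open>The limit takes the whole energy 6m and the whole value -2m of N, so it
    satisfies the constraint exactly and no strong convergence has to be shown.\<close>
  note c = cube_split[OF m_pos hp h6 1 sharp_bound[OF \<psi>]]
  then have "K_til \<sigma> c \<omega> \<psi> = 0" "S_til \<sigma> c \<omega> \<psi> = m" by (simp_all add: K_til_def S_til_def)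
  then show ?thesis using \<psi> \<open>nonzero \<psi>\<close> by (auto simp: A_def)
qed

end

section \<open>The Euler--Lagrange equations\<close>

lemma L2_inner_i: "L2_inner f (\<lambda>x. \<i> * g x) = - \<i> * L2_inner f g"
proof -
  have "(\<lambda>x. f x * cnj (\<i> * g x)) = (\<lambda>x. - \<i> * (f x * cnj (g x)))" by (simp add: fun_eq_iff)
  then show ?thesis unfolding L2_inner_def by (simp only: integral_mult_right_zero)
qed

lemma L2_inner_self: "L2_inner f f = of_real (L2_normsq f)"
  unfolding L2_inner_def L2_normsq_def by (simp add: complex_norm_square[symmetric] flip: of_real_power)

lemma grad_inner_i:
  assumes u: "u \<in> Xs \<gamma>" and v: "v \<in> Xs \<gamma>'"
  shows "grad_inner u (\<lambda>x. \<i> * v x) = - \<i> * grad_inner u v"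
proof -
  note w = sob_weak_grad[OF sob_cmult[OF Xs_sob[OF v], of \<i>]]
  have "L2_inner (\<lambda>x. weak_grad u x $ k) (\<lambda>x. weak_grad (\<lambda>x. \<i> * v x) x $ k)
    = L2_inner (\<lambda>x. weak_grad u x $ k) (\<lambda>x. \<i> * weak_grad v x $ k)" for k
  proof -
    have [measurable]: "(\<lambda>x. weak_grad u x $ k) \<in> borel_measurable borel" "(\<lambda>x. weak_grad v x $ k) \<in> borel_measurable borel"
      "(\<lambda>x. weak_grad (\<lambda>x. \<i> * v x) x $ k) \<in> borel_measurable borel"
      using sob_borel(2)[OF Xs_sob[OF u]] sob_borel(2)[OF Xs_sob[OF v]] sob_borel(2)[OF w(1)] by auto
    show ?thesis unfolding L2_inner_def
      by (rule integral_cong_AE) (use w(2) in \<open>auto elim!: eventually_mono\<close>)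
  qed
  then show ?thesis unfolding grad_inner_def L2_inner_i by (simp add: sum_distrib_left)
qed

lemma bs_self: "bs s \<gamma> u u = hs s \<gamma> u"
  by (simp add: bs_def hs_def grad_inner_def grad_normsq_def L2_inner_self)

context triple_setup
begin

text \<open>The equations are tested one component at a time. Each component occurs once in the
  trilinear term, so N is affine along a real variation of component j.\<close>

definition subst :: "3 \<Rightarrow> (real^'d \<Rightarrow> complex) \<Rightarrow> (real^'d \<Rightarrow> complex^3) \<Rightarrow> real^'d \<Rightarrow> complex^3" where
  "subst j \<theta> \<Psi> x = (\<chi> i. if i = j then \<theta> x else \<Psi> x $ i)"

lemma subst_nth: "(\<lambda>x. subst j \<theta> \<Psi> x $ i) = (if i = j then \<theta> else (\<lambda>x. \<Psi> x $ i))"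
  by (simp add: subst_def fun_eq_iff)

lemma subst_self: "subst j (\<lambda>x. \<Psi> x $ j) \<Psi> = \<Psi>"
  by (simp add: subst_def fun_eq_iff vec_eq_iff)

lemma subst_X: "\<Psi> \<in> X \<Longrightarrow> \<theta> \<in> Xs (\<gamma> j) \<Longrightarrow> subst j \<theta> \<Psi> \<in> X"
  by (simp add: X_iff subst_nth)

lemma triple_int_X:
  assumes "\<Psi> \<in> X"
  shows "integrable lborel (\<lambda>x. th x * \<Psi> x $ 1 * \<Psi> x $ 2 * cnj (\<Psi> x $ 3))"
  by (rule triple_int(1)[OF X_Lp[OF assms] X_Lp[OF assms] X_Lp[OF assms]])

lemma N_subst:
  assumes \<Psi>: "\<Psi> \<in> X" and \<theta>: "\<theta> \<in> Xs (\<gamma> j)"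
  shows "N (subst j (\<lambda>x. \<Psi> x $ j + of_real t * \<theta> x) \<Psi>) = N \<Psi> + t * N (subst j \<theta> \<Psi>)"
proof -
  define Q where "Q V x = th x * V x $ 1 * V x $ 2 * cnj (V x $ 3)" for V :: "real^'d \<Rightarrow> complex^3" and x
  have N: "N V = - Re (\<integral>x. Q V x \<partial>lborel)" for V by (simp add: N_eq Q_def)
  have i: "integrable lborel (Q \<Psi>)" "integrable lborel (\<lambda>x. of_real t * Q (subst j \<theta> \<Psi>) x)"
    unfolding Q_def[abs_def] by (intro triple_int_X \<Psi> subst_X \<theta> integrable_mult_right)+
  have "j = 1 \<or> j = 2 \<or> j = 3" by (rule exhaust_3)
  then have "Q (subst j (\<lambda>x. \<Psi> x $ j + of_real t * \<theta> x) \<Psi>) x = Q \<Psi> x + of_real t * Q (subst j \<theta> \<Psi>) x" for x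
    by (auto simp: Q_def subst_def algebra_simps)
  then have eq: "Q (subst j (\<lambda>x. \<Psi> x $ j + of_real t * \<theta> x) \<Psi>) = (\<lambda>x. Q \<Psi> x + of_real t * Q (subst j \<theta> \<Psi>) x)"
    by (rule ext)
  show ?thesis unfolding N eq Bochner_Integration.integral_add[OF i] by (simp add: algebra_simps)
qed

lemma H_subst:
  assumes \<Psi>: "\<Psi> \<in> X" and \<theta>: "\<theta> \<in> Xs (\<gamma> j)"
  shows "H (subst j (\<lambda>x. \<Psi> x $ j + of_real t * \<theta> x) \<Psi>) = H \<Psi> + 2 * t * bs (1 / \<sigma> $ j) (\<gamma> j) (\<lambda>x. \<Psi> x $ j) \<theta> + t\<^sup>2 * hj j \<theta>"
proof -
  have s: "H V = hj j (\<lambda>x. V x $ j) + (\<Sum>i\<in>UNIV - {j}. hj i (\<lambda>x. V x $ i))" for V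
    unfolding H_sum by (rule sum.remove) auto
  have "(\<Sum>i\<in>UNIV - {j}. hj i (\<lambda>x. subst j \<theta>' \<Psi> x $ i)) = (\<Sum>i\<in>UNIV - {j}. hj i (\<lambda>x. \<Psi> x $ i))" for \<theta>'
    by (rule sum.cong) (auto simp: subst_nth)
  then show ?thesis
    unfolding s[of "subst _ _ _"] s[of \<Psi>] by (simp add: subst_nth hs_expand[OF \<gamma>_nonneg XD[OF \<Psi>] \<theta>])
qed

text \<open>H^3 - 54 m N^2 is nonnegative along the variation and zero at t = 0, so its derivative
  216 m^2 (b + n) vanishes there. Working with the sharp inequality avoids a Lagrange
  multiplier.\<close>

lemma minimizer_stationary:
  assumes \<Psi>: "\<Psi> \<in> X" and HN: "H \<Psi> = 6 * m" "N \<Psi> = - 2 * m" and \<theta>: "\<theta> \<in> Xs (\<gamma> j)"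
  shows "bs (1 / \<sigma> $ j) (\<gamma> j) (\<lambda>x. \<Psi> x $ j) \<theta> + N (subst j \<theta> \<Psi>) = 0"
proof -
  define b where "b = bs (1 / \<sigma> $ j) (\<gamma> j) (\<lambda>x. \<Psi> x $ j) \<theta>"
  define n where "n = N (subst j \<theta> \<Psi>)"
  define h where "h = hj j \<theta>"
  define f where "f t = (6 * m + 2 * t * b + t\<^sup>2 * h) ^ 3 - 54 * m * (- 2 * m + t * n)\<^sup>2" for t
  have f_nonneg: "0 \<le> f t" for t
  proof -
    have "subst j (\<lambda>x. \<Psi> x $ j + of_real t * \<theta> x) \<Psi> \<in> X"
      by (intro subst_X \<Psi> Xs_add[OF adm XD[OF \<Psi>]] Xs_cmult \<theta>)
    from sharp_bound[OF this] show ?thesis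
      unfolding N_subst[OF \<Psi> \<theta>] H_subst[OF \<Psi> \<theta>] HN f_def b_def n_def h_def by simp
  qed
  have f0: "f 0 = 0" by (simp add: f_def power2_eq_square power3_eq_cube)
  have "(f has_real_derivative (216 * m\<^sup>2 * b + 216 * m\<^sup>2 * n)) (at 0)"
    unfolding f_def by (auto intro!: derivative_eq_intros simp: power2_eq_square power3_eq_cube algebra_simps)
  then have "216 * m\<^sup>2 * b + 216 * m\<^sup>2 * n = 0"
    by (rule DERIV_local_min[of _ _ _ 1]) (use f0 f_nonneg in auto)
  then have "216 * m\<^sup>2 * (b + n) = 0" by (simp add: algebra_simps)
  then show ?thesis using m_pos by (simp add: b_def n_def)
qed

text \<open>The phases combine to \<open>th\<close>. In the pairing \<theta> is conjugated, whereas
  in N only the third slot is; for j = 1 and j = 2 the integrand of N therefore appears conjugated,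
  which its real part does not see.\<close>

lemma G_nl_pairing:
  "G_nl \<sigma> c \<Psi> x $ j * cnj (\<theta> x) =
    - (let z = th x * subst j \<theta> \<Psi> x $ 1 * subst j \<theta> \<Psi> x $ 2 * cnj (subst j \<theta> \<Psi> x $ 3) in if j = 3 then z else cnj z)"
proof -
  define e where "e i = cis (\<sigma> $ i / 2 * (c \<bullet> x))" for i
  have th: "th x = e 1 * e 2 * cnj (e 3)"
    by (simp add: th_def e_def cis_mult cis_cnj) (simp add: algebra_simps add_divide_distrib diff_divide_distrib)
  have "G_nl \<sigma> c \<Psi> x $ j = cnj (e j) * F (Lam \<sigma> c \<Psi> x) $ j"
    by (simp add: G_nl_def e_def cis_cnj)
  moreover have L: "Lam \<sigma> c \<Psi> x $ i = e i * \<Psi> x $ i" for i by (simp add: Lam_def e_def)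
  moreover have "j = 1 \<or> j = 2 \<or> j = 3" by (rule exhaust_3)
  ultimately show ?thesis
    by (auto simp: F_def L th subst_def Let_def vector_3)
qed

definition weak_form :: "(real^'d \<Rightarrow> complex^3) \<Rightarrow> 3 \<Rightarrow> (real^'d \<Rightarrow> complex) \<Rightarrow> complex" where
  "weak_form \<Psi> j \<theta> = complex_of_real (1 / \<sigma> $ j) * grad_inner (\<lambda>x. \<Psi> x $ j) \<theta>
     + L2_inner (\<lambda>x. complex_of_real (\<gamma> j) * \<Psi> x $ j + G_nl \<sigma> c \<Psi> x $ j) \<theta>"

text \<open>The real part of the weak form is the derivative of the action in direction \<theta> of
  component j.\<close>

lemma Re_weak_form:
  assumes \<Psi>: "\<Psi> \<in> X" and \<theta>: "\<theta> \<in> Xs (\<gamma> j)"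
  shows "Re (weak_form \<Psi> j \<theta>) = bs (1 / \<sigma> $ j) (\<gamma> j) (\<lambda>x. \<Psi> x $ j) \<theta> + N (subst j \<theta> \<Psi>)"
proof -
  define z where "z x = th x * subst j \<theta> \<Psi> x $ 1 * subst j \<theta> \<Psi> x $ 2 * cnj (subst j \<theta> \<Psi> x $ 3)" for x
  have z: "integrable lborel z" unfolding z_def[abs_def] by (rule triple_int_X[OF subst_X[OF \<Psi> \<theta>]])
  have G: "(\<lambda>x. G_nl \<sigma> c \<Psi> x $ j * cnj (\<theta> x)) = (\<lambda>x. - (if j = 3 then z x else cnj (z x)))"
    by (simp add: G_nl_pairing Let_def z_def fun_eq_iff)
  have Gi: "integrable lborel (\<lambda>x. G_nl \<sigma> c \<Psi> x $ j * cnj (\<theta> x))"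
    unfolding G using z by (cases "j = 3") auto
  have N: "N (subst j \<theta> \<Psi>) = - Re (\<integral>x. z x \<partial>lborel)" by (simp add: N_eq z_def)
  have GN: "Re (L2_inner (\<lambda>x. G_nl \<sigma> c \<Psi> x $ j) \<theta>) = N (subst j \<theta> \<Psi>)"
    unfolding L2_inner_def G N by (cases "j = 3") auto
  \<comment> \<open>For \<gamma> = 0 the product of the two components need not be integrable, so
    the factor is kept inside and the integrand is then zero.\<close>
  have \<gamma>i: "integrable lborel (\<lambda>x. of_real (\<gamma> j) * (\<Psi> x $ j * cnj (\<theta> x)))"
  proof (cases "\<gamma> j = 0")
    case False
    then have "0 < \<gamma> j" using \<gamma>_nonneg[of j] by simp
    then have "(\<lambda>x. \<Psi> x $ j) \<in> Lp 2" "\<theta> \<in> Lp 2"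
      using XD[OF \<Psi>, of j] \<theta> by (auto simp: Xs_iff qexp_def)
    from Lp2_mult_integrable[OF this] show ?thesis by (rule integrable_mult_right)
  qed simp
  have "L2_inner (\<lambda>x. complex_of_real (\<gamma> j) * \<Psi> x $ j + G_nl \<sigma> c \<Psi> x $ j) \<theta>
    = (\<integral>x. of_real (\<gamma> j) * (\<Psi> x $ j * cnj (\<theta> x)) + G_nl \<sigma> c \<Psi> x $ j * cnj (\<theta> x) \<partial>lborel)"
    unfolding L2_inner_def by (rule Bochner_Integration.integral_cong) (simp_all add: algebra_simps)
  also have "\<dots> = of_real (\<gamma> j) * L2_inner (\<lambda>x. \<Psi> x $ j) \<theta> + L2_inner (\<lambda>x. G_nl \<sigma> c \<Psi> x $ j) \<theta>"
    unfolding Bochner_Integration.integral_add[OF \<gamma>i Gi] integral_mult_right_zero L2_inner_def ..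
  finally show ?thesis unfolding weak_form_def by (simp add: bs_def GN)
qed

lemma weak_sol_til_iff: "weak_sol_til \<sigma> c \<omega> \<Psi> \<longleftrightarrow> (\<forall>\<Theta>\<in>X. \<forall>j. weak_form \<Psi> j (\<lambda>x. \<Theta> x $ j) = 0)"
  unfolding weak_sol_til_def weak_form_def ..

lemma minimizer_weak_sol:
  assumes \<Psi>: "\<Psi> \<in> X" and HN: "H \<Psi> = 6 * m" "N \<Psi> = - 2 * m"
  shows "weak_sol_til \<sigma> c \<omega> \<Psi>"
proof -
  have "weak_form \<Psi> j \<theta> = 0" if \<theta>: "\<theta> \<in> Xs (\<gamma> j)" for j \<theta>
  proof -
    have i\<theta>: "(\<lambda>x. \<i> * \<theta> x) \<in> Xs (\<gamma> j)" by (rule Xs_cmult[OF \<theta>])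
    \<comment> \<open>The form is conjugate-linear in \<theta>, so its real part at i\<theta> is its
      imaginary part at \<theta>.\<close>
    have "weak_form \<Psi> j (\<lambda>x. \<i> * \<theta> x) = - \<i> * weak_form \<Psi> j \<theta>"
      unfolding weak_form_def grad_inner_i[OF XD[OF \<Psi>] \<theta>] L2_inner_i by (simp add: algebra_simps)
    moreover have "Re (weak_form \<Psi> j \<theta>) = 0" "Re (weak_form \<Psi> j (\<lambda>x. \<i> * \<theta> x)) = 0"
      unfolding Re_weak_form[OF \<Psi> \<theta>] Re_weak_form[OF \<Psi> i\<theta>] by (intro minimizer_stationary \<Psi> HN \<theta> i\<theta>)+
    ultimately show ?thesis by (simp add: complex_eq_iff)
  qed
  then show ?thesis unfolding weak_sol_til_iff using XD by blast
qed

text \<open>Testing equation j with component j gives the energy of that component plus N, and the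
  three equations add up to H + 3N.\<close>

lemma weak_sol_K_zero:
  assumes \<Psi>: "\<Psi> \<in> X" and sol: "weak_sol_til \<sigma> c \<omega> \<Psi>"
  shows "K_til \<sigma> c \<omega> \<Psi> = 0"
proof -
  have "hj j (\<lambda>x. \<Psi> x $ j) + N \<Psi> = 0" for j
    using Re_weak_form[OF \<Psi> XD[OF \<Psi>], of j] sol \<Psi> by (simp add: weak_sol_til_iff bs_self subst_self)
  then have "(\<Sum>j\<in>(UNIV :: 3 set). hj j (\<lambda>x. \<Psi> x $ j) + N \<Psi>) = 0" by simp
  then show ?thesis by (simp add: K_til_def H_sum sum.distrib)
qed

text \<open>Minimisers are solutions and solutions lie in the Nehari set. The infimum over the
  larger set is attained in the smaller one, so the two minimisation problems have the same value
  and the same minimisers.\<close>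

theorem ground_states: "G_til \<sigma> c \<omega> = M_til \<sigma> c \<omega>" "M_til \<sigma> c \<omega> \<noteq> {}"
proof -
  have M: "M_til \<sigma> c \<omega> = {\<Psi> \<in> A. S_til \<sigma> c \<omega> \<Psi> = m}" by (auto simp: M_til_def A_def)
  show ne: "M_til \<sigma> c \<omega> \<noteq> {}" using minimizer_exists by (auto simp: M)
  have E: "E_til \<sigma> c \<omega> \<subseteq> A" using weak_sol_K_zero by (auto simp: E_til_def A_def)
  have ME: "M_til \<sigma> c \<omega> \<subseteq> E_til \<sigma> c \<omega>"
  proof
    fix \<Psi> assume "\<Psi> \<in> M_til \<sigma> c \<omega>"
    then have \<Psi>: "\<Psi> \<in> A" "S_til \<sigma> c \<omega> \<Psi> = m" by (auto simp: M)
    note D = A_D[OF \<Psi>(1)]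
    have "H \<Psi> = 6 * m" "N \<Psi> = - 2 * m" using D(3,4) \<Psi>(2) by linarith+
    then have "weak_sol_til \<sigma> c \<omega> \<Psi>" by (rule minimizer_weak_sol[OF D(1)])
    then show "\<Psi> \<in> E_til \<sigma> c \<omega>" using D by (simp add: E_til_def)
  qed
  show "G_til \<sigma> c \<omega> = M_til \<sigma> c \<omega>"
  proof
    show "M_til \<sigma> c \<omega> \<subseteq> G_til \<sigma> c \<omega>"
    proof
      fix \<Psi> assume \<Psi>: "\<Psi> \<in> M_til \<sigma> c \<omega>"
      then have "S_til \<sigma> c \<omega> \<Psi> = m" by (simp add: M)
      then show "\<Psi> \<in> G_til \<sigma> c \<omega>" using \<Psi> ME E m_le by (auto simp: G_til_def)
    qed
    show "G_til \<sigma> c \<omega> \<subseteq> M_til \<sigma> c \<omega>"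
    proof
      fix \<Psi> assume "\<Psi> \<in> G_til \<sigma> c \<omega>"
      then have \<Psi>: "\<Psi> \<in> A" "\<And>\<Theta>. \<Theta> \<in> E_til \<sigma> c \<omega> \<Longrightarrow> S_til \<sigma> c \<omega> \<Psi> \<le> S_til \<sigma> c \<omega> \<Theta>"
        using E by (auto simp: G_til_def)
      obtain \<Theta> where \<Theta>: "\<Theta> \<in> M_til \<sigma> c \<omega>" using ne by blast
      then have "S_til \<sigma> c \<omega> \<Psi> \<le> m" using \<Psi>(2)[of \<Theta>] ME by (auto simp: M)
      then show "\<Psi> \<in> M_til \<sigma> c \<omega>" using \<Psi>(1) m_le[OF \<Psi>(1)] by (simp add: M)
    qed
  qed
qed

end

section \<open>Gauge invariance and exponents\<close>

lemma Lam_minus [simp]: "Lam \<sigma> (- c) (Lam \<sigma> c \<Psi>) = \<Psi>"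
proof -
  have "cis (- t) * (cis t * z) = z" for t z
    by (simp add: cis_mult mult.assoc[symmetric])
  then show ?thesis by (simp add: Lam_def fun_eq_iff vec_eq_iff)
qed

lemma nonzero_Lam [simp]: "nonzero (Lam \<sigma> c \<Psi>) \<longleftrightarrow> nonzero \<Psi>"
proof -
  have "Lam \<sigma> c \<Psi> x = 0 \<longleftrightarrow> \<Psi> x = 0" for x by (simp add: Lam_def vec_eq_iff)
  then show ?thesis by (simp add: nonzero_def)
qed

lemma S_c_Lam [simp]: "S_c \<sigma> c \<omega> (Lam \<sigma> c \<Psi>) = S_til \<sigma> c \<omega> \<Psi>"
  and K_c_Lam [simp]: "K_c \<sigma> c \<omega> (Lam \<sigma> c \<Psi>) = K_til \<sigma> c \<omega> \<Psi>"
  by (simp_all add: S_c_def K_c_def)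

text \<open>The phase of \<Phi> meets the conjugate phase of \<Theta> in the L^2 term, while the
  gradient term removes both phases explicitly; the two weak formulations therefore agree term by
  term.\<close>

lemma weak_sol_c_Lam: "weak_sol_c \<sigma> c \<omega> (Lam \<sigma> c \<Psi>) \<longleftrightarrow> weak_sol_til \<sigma> c \<omega> \<Psi>"
proof -
  have undo: "cis (- (\<sigma> $ j / 2 * (c \<bullet> x))) * Lam \<sigma> c \<Theta> x $ j = \<Theta> x $ j" for \<Theta> j x
    by (simp add: Lam_def cis_mult mult.assoc[symmetric])
  have "(of_real (gam \<sigma> c \<omega> j) * Lam \<sigma> c \<Psi> x $ j + F (Lam \<sigma> c \<Psi> x) $ j) * cnj (Lam \<sigma> c \<Theta> x $ j)
      = (of_real (gam \<sigma> c \<omega> j) * \<Psi> x $ j + G_nl \<sigma> c \<Psi> x $ j) * cnj (\<Theta> x $ j)" for \<Theta> x j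
  proof -
    define e where "e = cis (\<sigma> $ j / 2 * (c \<bullet> x))"
    have ee: "e * cnj e = 1" unfolding e_def cis_cnj by (simp add: cis_mult)
    have L: "Lam \<sigma> c \<Xi> x $ j = e * \<Xi> x $ j" for \<Xi> by (simp add: Lam_def e_def)
    have G: "G_nl \<sigma> c \<Psi> x $ j = cnj e * F (Lam \<sigma> c \<Psi> x) $ j" by (simp add: G_nl_def e_def cis_cnj)
    have "(g * (e * u) + w) * cnj (e * v) = (g * u + cnj e * w) * cnj v" for g u w v
    proof -
      have "(g * (e * u) + w) * cnj (e * v) = (e * cnj e) * (g * u * cnj v) + cnj e * w * cnj v"
        by (simp add: algebra_simps)
      then show ?thesis unfolding ee by (simp add: algebra_simps)
    qed
    then show ?thesis unfolding L G .
  qed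
  then show ?thesis
    unfolding weak_sol_c_def weak_sol_til_def X_c_def L2_inner_def by (simp only: ball_simps undo)
qed

text \<open>The gauge transformation preserves action, constraint, solutions and nontriviality, so
  every set of the moving frame is an image.\<close>

lemma untilded_sets:
  shows "E_c \<sigma> c \<omega> = Lam \<sigma> c ` E_til \<sigma> c \<omega>" "G_c \<sigma> c \<omega> = Lam \<sigma> c ` G_til \<sigma> c \<omega>" "M_c \<sigma> c \<omega> = Lam \<sigma> c ` M_til \<sigma> c \<omega>"
proof -
  show E: "E_c \<sigma> c \<omega> = Lam \<sigma> c ` E_til \<sigma> c \<omega>"
    by (auto simp: E_c_def E_til_def X_c_def weak_sol_c_Lam)
  show "G_c \<sigma> c \<omega> = Lam \<sigma> c ` G_til \<sigma> c \<omega>"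
    unfolding G_c_def G_til_def E by auto
  have "{\<Phi> \<in> X_c \<sigma> c \<omega>. nonzero \<Phi> \<and> K_c \<sigma> c \<omega> \<Phi> = 0} = Lam \<sigma> c ` {\<Psi> \<in> X_til \<sigma> c \<omega>. nonzero \<Psi> \<and> K_til \<sigma> c \<omega> \<Psi> = 0}"
    by (auto simp: X_c_def)
  then have "m_c \<sigma> c \<omega> = m_til \<sigma> c \<omega>"
    by (simp add: m_c_def m_til_def image_image)
  then show "M_c \<sigma> c \<omega> = Lam \<sigma> c ` M_til \<sigma> c \<omega>"
    by (auto simp: M_c_def M_til_def X_c_def)
qed

section \<open>Signs of the gammas and choice of the exponents\<close>

lemma gam_eq:
  "gam \<sigma> c (\<omega>1, \<omega>2) 1 = \<omega>1 - \<sigma> $ 1 / 4 * (norm c)\<^sup>2"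
  "gam \<sigma> c (\<omega>1, \<omega>2) 2 = \<omega>2 - \<sigma> $ 2 / 4 * (norm c)\<^sup>2"
  "gam \<sigma> c (\<omega>1, \<omega>2) 3 = \<omega>1 + \<omega>2 - \<sigma> $ 3 / 4 * (norm c)\<^sup>2"
  by (simp_all add: gam_def freq_def crit_def)

lemma gam_pos_Omega: "(\<omega>1, \<omega>2) \<in> Omega \<sigma> c \<Longrightarrow> gam \<sigma> c (\<omega>1, \<omega>2) j > 0"
  using exhaust_3[of j] by (auto simp: Omega_def gam_eq)

lemma gam_nonneg_frontier:
  assumes "(\<omega>1, \<omega>2) \<in> frontier (Omega \<sigma> c)"
  shows "gam \<sigma> c (\<omega>1, \<omega>2) j \<ge> 0"
proof -
  let ?S = "{w :: real \<times> real. \<sigma> $ 1 / 4 * (norm c)\<^sup>2 \<le> fst w} \<inter> {w. \<sigma> $ 2 / 4 * (norm c)\<^sup>2 \<le> snd w}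
    \<inter> {w. \<sigma> $ 3 / 4 * (norm c)\<^sup>2 \<le> fst w + snd w}"
  have "closed ?S" by (intro closed_Int closed_Collect_le continuous_intros)
  moreover have "Omega \<sigma> c \<subseteq> ?S" by (auto simp: Omega_def)
  ultimately have "closure (Omega \<sigma> c) \<subseteq> ?S" by (rule closure_minimal[rotated])
  then have "(\<omega>1, \<omega>2) \<in> ?S" using assms by (auto simp: frontier_def)
  then show ?thesis using exhaust_3[of j] by (auto simp: gam_eq)
qed



text \<open>The exponents are \<open>3, 3, 3\<close> if no \<open>gam\<close> vanishes; \<open>2d/(d-2)\<close> and twice \<open>4d/(d+2)\<close> if one does; and
  \<open>5/2\<close> and twice \<open>10/3\<close> if two do (\<open>d = 5\<close>).\<close>

lemma admissible_exponents:
  fixes \<sigma> :: "real^3" and c :: "real^'d::finite"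
  assumes "(CARD('d) \<le> 5 \<and> (\<forall>j. gam \<sigma> c \<omega> j > 0))
    \<or> (3 \<le> CARD('d) \<and> CARD('d) \<le> 5 \<and> (\<forall>j. gam \<sigma> c \<omega> j \<ge> 0) \<and> (\<forall>i j. i \<noteq> j \<longrightarrow> gam \<sigma> c \<omega> i > 0 \<or> gam \<sigma> c \<omega> j > 0))
    \<or> (CARD('d) = 5 \<and> (\<forall>j. gam \<sigma> c \<omega> j \<ge> 0) \<and> (\<exists>j. gam \<sigma> c \<omega> j > 0))"
  shows "\<exists>p. (\<forall>j. adm TYPE('d) (gam \<sigma> c \<omega> j) (p j)) \<and> 1 / p 1 + 1 / p 2 + 1 / p 3 = 1"
proof -
  define g where "g = gam \<sigma> c \<omega>"
  define d where "d = real CARD('d)"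
  have adm_iff: "adm TYPE('d) \<gamma> p \<longleftrightarrow> 2 < p \<and> 0 \<le> \<gamma> \<and> (if \<gamma> > 0 then p * (d - 2) < 2 * d else 3 \<le> d \<and> p = 2 * d / (d - 2))" for \<gamma> p
    by (simp add: adm_def d_def)
  have one_zero: ?thesis if d: "3 \<le> d" "d \<le> 5" and z: "g i = 0" "\<And>j. j \<noteq> i \<Longrightarrow> g j > 0" for i
  proof (intro exI[of _ "\<lambda>j. if j = i then 2 * d / (d - 2) else 4 * d / (d + 2)"] conjI allI)
    fix j
    have "2 < 2 * d / (d - 2)" "2 < 4 * d / (d + 2)" using d by (simp_all add: field_simps)
    \<comment> \<open>Amounts to 2(d - 2) < d + 2, that is, to d < 6.\<close>
    moreover have "4 * d / (d + 2) * (d - 2) < 2 * d" using d by (simp add: field_simps)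
    ultimately show "adm TYPE('d) (gam \<sigma> c \<omega> j) (if j = i then 2 * d / (d - 2) else 4 * d / (d + 2))"
      using z(1) z(2)[of j] d by (auto simp: adm_iff g_def)
  next
    \<comment> \<open>The critical exponent leaves (d + 2)/(2d) of the total 1, shared equally by
      the other two components.\<close>
    have "(d - 2) / (2 * d) + (d + 2) / (4 * d) + (d + 2) / (4 * d) = 1" using d by (simp add: field_simps)
    then show "1 / (if 1 = i then 2 * d / (d - 2) else 4 * d / (d + 2)) + 1 / (if 2 = i then 2 * d / (d - 2) else 4 * d / (d + 2))
       + 1 / (if 3 = i then 2 * d / (d - 2) else 4 * d / (d + 2)) = 1"
      using exhaust_3[of i] by (auto simp: ac_simps)
  qed
  have all_pos: ?thesis if d: "d \<le> 5" and z: "\<And>j. g j > 0"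
  proof (intro exI[of _ "\<lambda>j. 3"] conjI allI)
    \<comment> \<open>Here too 3(d - 2) < 2d says d < 6.\<close>
    show "adm TYPE('d) (gam \<sigma> c \<omega> j) 3" for j
      using z[of j] d by (auto simp: adm_iff g_def)
  qed simp
  have one_pos: ?thesis if d: "d = 5" and z: "g i > 0" "\<And>j. j \<noteq> i \<Longrightarrow> g j = 0" for i
  proof (intro exI[of _ "\<lambda>j. if j = i then 5 / 2 else 10 / 3"] conjI allI)
    \<comment> \<open>For d = 5 the critical exponent is 10/3; two of them leave 1 - 6/10 = 2/5, and
      5/2 is subcritical as well as above 2.\<close>
    show "adm TYPE('d) (gam \<sigma> c \<omega> j) (if j = i then 5 / 2 else 10 / 3)" for j
      using z(1) z(2)[of j] d by (auto simp: adm_iff g_def)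
    show "1 / (if 1 = i then 5 / 2 else 10 / 3) + 1 / (if 2 = i then 5 / 2 else 10 / 3)
       + 1 / (if 3 = i then 5 / 2 else 10 / (3::real)) = 1"
      using exhaust_3[of i] by auto
  qed
  have nonneg: "g j \<ge> 0" for j using assms unfolding g_def by (auto intro: less_imp_le)
  have d5: "d \<le> 5" using assms by (auto simp: d_def)
  have "3 \<le> d" if "g i = 0" for i using assms that by (auto simp: d_def g_def dest: spec[of _ i])
  note zero = one_zero[OF this d5]
  show ?thesis
  proof (cases "\<exists>i j. i \<noteq> j \<and> g i = 0 \<and> g j = 0")
    case False
    show ?thesis
    proof (cases "\<exists>i. g i = 0")
      case True
      then obtain i where i: "g i = 0" by blast
      show ?thesis by (rule zero[OF i i]) (use False i nonneg in \<open>metis less_eq_real_def\<close>)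
    next
      case False
      then show ?thesis using nonneg by (intro all_pos[OF d5]) (metis less_eq_real_def)
    qed
  next
    case True
    then obtain i j where ij: "i \<noteq> j" "g i = 0" "g j = 0" by blast
    \<comment> \<open>Two zeros contradict the first two alternatives of the hypothesis, so the
      third one holds.\<close>
    then have d: "d = 5" and ex: "\<exists>k. g k > 0"
      using assms unfolding d_def g_def by (metis less_irrefl of_nat_numeral)+
    then obtain k where k: "g k > 0" by blast
    have "l = i \<or> l = j" if "l \<noteq> k" for l
    proof -
      have "i \<noteq> k" "j \<noteq> k" using k ij by auto
      then show ?thesis using that ij(1) exhaust_3[of i] exhaust_3[of j] exhaust_3[of k] exhaust_3[of l] by auto
    qed
    then show ?thesis using ij by (intro one_pos[OF d k]) auto
  qed
qed

theorem theorem1p4: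
  fixes \<sigma> :: "real^3" and c :: "real^'d::finite" and \<omega>\<^sub>1 \<omega>\<^sub>2 :: real
  assumes "\<forall>j. \<sigma> $ j > 0"
    and "(1 \<le> CARD('d) \<and> CARD('d) \<le> 5 \<and> (\<omega>\<^sub>1, \<omega>\<^sub>2) \<in> Omega \<sigma> c)
       \<or> (3 \<le> CARD('d) \<and> CARD('d) \<le> 5 \<and> (\<omega>\<^sub>1, \<omega>\<^sub>2) \<in> frontier (Omega \<sigma> c)
           \<and> (\<forall>i j. i \<noteq> j \<longrightarrow>
                (freq (\<omega>\<^sub>1, \<omega>\<^sub>2) $ i, freq (\<omega>\<^sub>1, \<omega>\<^sub>2) $ j) \<noteq> (crit \<sigma> c $ i, crit \<sigma> c $ j)))
       \<or> (CARD('d) = 5 \<and> c \<noteq> 0 \<and> (\<omega>\<^sub>1, \<omega>\<^sub>2) \<in> frontier (Omega \<sigma> c)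
           \<and> (\<exists>i j. i \<noteq> j \<and>
                (freq (\<omega>\<^sub>1, \<omega>\<^sub>2) $ i, freq (\<omega>\<^sub>1, \<omega>\<^sub>2) $ j) = (crit \<sigma> c $ i, crit \<sigma> c $ j))
           \<and> freq (\<omega>\<^sub>1, \<omega>\<^sub>2) \<noteq> crit \<sigma> c)"
  shows "G_til \<sigma> c (\<omega>\<^sub>1, \<omega>\<^sub>2) = M_til \<sigma> c (\<omega>\<^sub>1, \<omega>\<^sub>2) \<and> M_til \<sigma> c (\<omega>\<^sub>1, \<omega>\<^sub>2) \<noteq> {}
       \<and> G_c \<sigma> c (\<omega>\<^sub>1, \<omega>\<^sub>2) = M_c \<sigma> c (\<omega>\<^sub>1, \<omega>\<^sub>2) \<and> M_c \<sigma> c (\<omega>\<^sub>1, \<omega>\<^sub>2) \<noteq> {}"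
proof -
  let ?g = "gam \<sigma> c (\<omega>\<^sub>1, \<omega>\<^sub>2)"
  have nonneg: "?g j \<ge> 0" for j
    using assms(2) gam_pos_Omega[of \<omega>\<^sub>1 \<omega>\<^sub>2 \<sigma> c j] gam_nonneg_frontier[of \<omega>\<^sub>1 \<omega>\<^sub>2 \<sigma> c j] by auto
  have pos_iff: "?g j > 0 \<longleftrightarrow> freq (\<omega>\<^sub>1, \<omega>\<^sub>2) $ j \<noteq> crit \<sigma> c $ j" for j
    using nonneg[of j] by (auto simp: gam_def)
  \<comment> \<open>In terms of signs, (B) says that no two of the gammas vanish and (C) that not
    all three do.\<close>
  have cases: "(CARD('d) \<le> 5 \<and> (\<forall>j. ?g j > 0))
    \<or> (3 \<le> CARD('d) \<and> CARD('d) \<le> 5 \<and> (\<forall>j. ?g j \<ge> 0) \<and> (\<forall>i j. i \<noteq> j \<longrightarrow> ?g i > 0 \<or> ?g j > 0))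
    \<or> (CARD('d) = 5 \<and> (\<forall>j. ?g j \<ge> 0) \<and> (\<exists>j. ?g j > 0))"
    using assms(2)
  proof (elim disjE conjE)
    assume "(\<omega>\<^sub>1, \<omega>\<^sub>2) \<in> Omega \<sigma> c" "CARD('d) \<le> 5"
    then show ?thesis using gam_pos_Omega[of \<omega>\<^sub>1 \<omega>\<^sub>2 \<sigma> c] by simp
  next
    assume "3 \<le> CARD('d)" "CARD('d) \<le> 5"
      "\<forall>i j. i \<noteq> j \<longrightarrow> (freq (\<omega>\<^sub>1, \<omega>\<^sub>2) $ i, freq (\<omega>\<^sub>1, \<omega>\<^sub>2) $ j) \<noteq> (crit \<sigma> c $ i, crit \<sigma> c $ j)"
    then show ?thesis using nonneg unfolding pos_iff by (intro disjI2 disjI1) auto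
  next
    assume "CARD('d) = 5" "freq (\<omega>\<^sub>1, \<omega>\<^sub>2) \<noteq> crit \<sigma> c"
    then show ?thesis using nonneg unfolding pos_iff by (intro disjI2) (auto simp: vec_eq_iff)
  qed
  obtain p where p: "\<And>j. adm TYPE('d) (?g j) (p j)" "1 / p 1 + 1 / p 2 + 1 / p 3 = 1"
    using admissible_exponents[OF cases] by blast
  have "\<exists>j. ?g j > 0"
  proof -
    have "?g 1 > 0 \<or> ?g 2 > 0" if "\<forall>i j. i \<noteq> j \<longrightarrow> ?g i > 0 \<or> ?g j > 0"
      using that[rule_format, of 1 2] by simp
    then show ?thesis using cases by metis
  qed
  then interpret triple_setup \<sigma> c "(\<omega>\<^sub>1, \<omega>\<^sub>2)" p
    using assms(1) p by unfold_locales auto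
  show ?thesis
    using ground_states unfolding untilded_sets(2,3) by simp
qed

end
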